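(* Let $s\in(\frac12,1)\cup(1,\frac32)$ and $$\Theta(s,\lambda):=\big(\lambda^{1-\frac1s}\,s\,\sin(\tfrac\pi s)\big)^{-1},\qquad\lambda>0,\qquad\qquad \theta_s:=\begin{cases}0&\text{if }s<1\\1&\text{if }s>1.\end{cases}$$ (i) The self-adjoint extensions in $L^2(\mathbb{R})$ of the operator $\mathring{\mathsf{k}}^{(s/2)}$ form the family $(\mathsf{k}^{(s/2)}_\alpha)_{\alpha\in\mathbb{R}\cup\{\infty\}}$, where for arbitrary $\lambda>0$ $$\mathcal{D}(\mathsf{k}^{(s/2)}_\alpha)=\Big\{g=F^\lambda+\frac{F^\lambda(0)}{\alpha-\Theta(s,\lambda)}\,\mathsf{G}_{s,\lambda}\,\Big|\,F^\lambda\in H^s(\mathbb{R})\Big\},\qquad(\mathsf{k}^{(s/2)}_\alpha+\lambda)\,g=((-\Delta)^{s/2}+\lambda)F^\lambda$$ (where, if $\alpha=\Theta(s,\lambda)$, the domain is to be read as $\{F^\lambda+c\,\mathsf{G}_{s,\lambda}\mid F^\lambda\in H^s(\mathbb{R}),\ F^\lambda(0)=0,\ c\in\mathbb{C}\}$). The Friedrichs extension $\mathsf{k}^{(s/2)}_F$ corresponds to $\alpha=\infty$ when $s\in(\frac12,1)$ and to $\alpha=0$ when $s\in(1,\frac32)$. For every $s$ in the considered range, the extension with $\alpha=\infty$ is the ordinary self-adjoint fractional Laplacian $(-\Delta)^{s/2}$ on $L^2(\mathbb{R})$. (ii) For each $\alpha\in\mathbb{R}$ (with $\alpha\neq0$ if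 $s\in(1,\frac32)$) the quadratic form of the extension $\mathsf{k}^{(s/2)}_\alpha$ is given by $$\mathcal{D}[\mathsf{k}^{(s/2)}_\alpha]=\begin{cases}H^{s/2}(\mathbb{R})\dotplus\mathrm{span}\{\mathsf{G}_{s,\lambda}\}&\text{if }s\in(\frac12,1)\\ H^{s/2}_0(\mathbb{R}\setminus\{0\})\dotplus\mathrm{span}\{\mathsf{G}_{s,\lambda}\}&\text{if }s\in(1,\frac32)\text{ and }\alpha\neq0\end{cases}$$ $$\mathsf{k}^{(s/2)}_\alpha[F^\lambda+\kappa_\lambda\mathsf{G}_{s,\lambda}]=\||\nabla|^{\frac s2}F^\lambda\|_{L^2}^2-\lambda\|F^\lambda+\kappa_\lambda\mathsf{G}_{s,\lambda}\|_{L^2}^2+\lambda\|F^\lambda\|_{L^2}^2+\Big(\frac{\theta_s}{\Theta(s,\lambda)}+\frac{1}{\alpha-\Theta(s,\lambda)}\Big)^{-1}|\kappa_\lambda|^2$$ for arbitrary $\lambda>0$, $F^\lambda\in\mathcal{D}[\mathsf{k}^{(s/2)}_F]$, $\kappa_\lambda\in\mathbb{C}$ (where the coefficient of $|\kappa_\lambda|^2$ is read as $0$ if $\alpha=\Theta(s,\lambda)$). (iii) For $\alpha\in\mathbb{R}$, the resolvent of $\mathsf{k}^{(s/2)}_\alpha$ is given by $$(\mathsf{k}^{(s/2)}_\alpha+\lambda\mathbf{1})^{-1}=((-\Delta)^{s/2}+\lambda\mathbf{1})^{-1}+\big(\alpha-\Theta(s,\lambda)\big)^{-1}|\mathsf{G}_{s,\lambda}\rangle\langle\mathsf{G}_{s,\lambda}|$$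 for arbitrary $\lambda>0$ with $\alpha\neq\Theta(s,\lambda)$. (iv) For each $\alpha\in\mathbb{R}$ the extension $\mathsf{k}^{(s/2)}_\alpha$ is semi-bounded from below, and $$\sigma_{\mathrm{ess}}(\mathsf{k}^{(s/2)}_\alpha)=\sigma_{\mathrm{ac}}(\mathsf{k}^{(s/2)}_\alpha)=[0,+\infty),\qquad\sigma_{\mathrm{sc}}(\mathsf{k}^{(s/2)}_\alpha)=\emptyset,$$ $$\sigma_{\mathrm{disc}}(\mathsf{k}^{(s/2)}_\alpha)=\begin{cases}\emptyset&\text{if }(s-1)\alpha\leqslant0\\ \{-E_\alpha^{(s)}\}&\text{if }(s-1)\alpha>0,\end{cases}$$ where the eigenvalue $-E_\alpha^{(s)}$ is non-degenerate and is given by $$E_\alpha^{(s)}=\big(\alpha\,s\,\sin(\tfrac\pi s)\big)^{\frac{s}{1-s}},$$ the (non-normalised) eigenfunction being $\mathsf{G}_{s,\lambda}$ with $\lambda=|E_\alpha^{(s)}|$.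
   Context: Dimension $d=1$. Fourier transform: $\widehat f(p)=(2\pi)^{-1/2}\int_{\mathbb{R}}e^{-ipx}f(x)\,dx$, with inverse ${}^\vee$. $(-\Delta)^{s/2}$ is the Fourier multiplier by $|p|^s$ (self-adjoint on $H^s(\mathbb{R})$) and $|\nabla|^{a}$ the Fourier multiplier by $|p|^a$. Scalar products are antilinear in the first entry; $|\mathsf{G}\rangle\langle\mathsf{G}|$ is the operator $h\mapsto\langle\mathsf{G},h\rangle_{L^2}\mathsf{G}$. For $\lambda>0$, $\mathsf{G}_{s,\lambda}(x):=(2\pi)^{-1/2}\big(\frac{1}{|p|^s+\lambda}\big)^\vee(x)$. $\mathring{\mathsf{k}}^{(s/2)}:=\overline{(-\Delta)^{s/2}\upharpoonright C_0^\infty(\mathbb{R}\setminus\{0\})}$ (operator closure in $L^2(\mathbb{R})$). For $r\geqslant0$, $H^r_0(\mathbb{R}\setminus\{0\})$ is the closure of $C_0^\infty(\mathbb{R}\setminus\{0\})$ in the $H^r(\mathbb{R})$-norm. The Friedrichs extension $\mathsf{k}^{(s/2)}_F$ of $\mathring{\mathsf{k}}^{(s/2)}$ has form domain $\mathcal{D}[\mathsf{k}^{(s/2)}_F]=H^{s/2}(\mathbb{R})$ if $s\in(\frac12,1)$ and $H^{s/2}_0(\mathbb{R}\setminus\{0\})$ if $s\in(1,\frac32)$, with form $\langle|\nabla|^{s/2}f,|\nabla|^{s/2}g\rangle$. For $s\in(\frac12,1)$ it is $(-\Delta)^{s/2}$ with domain $H^s(\mathbb{R})$; for $s\in(1,\frac32)$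 its domain is $\{f=\phi-\frac{\phi(0)}{\mathsf{G}_{s,\lambda}(0)}\mathsf{G}_{s,\lambda}\mid\phi\in H^s(\mathbb{R})\}$, with $(\mathsf{k}^{(s/2)}_F+\lambda\mathbf{1})f=((-\Delta)^{s/2}+\lambda)\phi$. $F^\lambda(0)$ for $F^\lambda\in H^s(\mathbb{R})$ is the value at $0$ of the continuous representative. In (i), for $\alpha=\infty$ the coefficient $1/(\alpha-\Theta(s,\lambda))$ is $0$. For a lower semi-bounded self-adjoint operator $T$, $\mathcal{D}[T]$ and $T[\cdot]$ denote its (closed) quadratic form domain and quadratic form. $\dotplus$ denotes direct algebraic sum. $\sigma_{\mathrm{ess}},\sigma_{\mathrm{ac}},\sigma_{\mathrm{sc}},\sigma_{\mathrm{disc}}$ are the essential, absolutely continuous, singular continuous, discrete spectra. *)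

theory Defs
  imports "HOL-Analysis.Analysis"
begin

section \<open>The complex Hilbert space of square-integrable functions on the line\<close>

definition square_integrable :: "(real \<Rightarrow> complex) \<Rightarrow> bool" where
  "square_integrable f \<longleftrightarrow>
     f \<in> borel_measurable lborel \<and> integrable lborel (\<lambda>x. (cmod (f x))\<^sup>2)"

definition L2_rel :: "(real \<Rightarrow> complex) \<Rightarrow> (real \<Rightarrow> complex) \<Rightarrow> bool" where
  "L2_rel f g \<longleftrightarrow> square_integrable f \<and> square_integrable g \<and> (AE x in lborel. f x = g x)"

lemma square_integrable_zero [simp]: "square_integrable (\<lambda>x. 0)"
  by (simp add: square_integrable_def)

lemma square_integrable_scale:
  assumes "square_integrable f" shows "square_integrable (\<lambda>x. c * f x)"
  using assms by (auto simp: square_integrable_def norm_mult power_mult_distrib)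

lemma square_integrable_add:
  assumes "square_integrable f" "square_integrable g"
  shows "square_integrable (\<lambda>x. f x + g x)"
proof -
  have "integrable lborel (\<lambda>x. (cmod (f x + g x))\<^sup>2)"
  proof (rule Bochner_Integration.integrable_bound)
    show "integrable lborel (\<lambda>x. 2 * (cmod (f x))\<^sup>2 + 2 * (cmod (g x))\<^sup>2)"
      using assms by (auto simp: square_integrable_def)
    show "(\<lambda>x. (cmod (f x + g x))\<^sup>2) \<in> borel_measurable lborel"
      using assms by (auto simp: square_integrable_def)
    show "AE x in lborel. norm ((cmod (f x + g x))\<^sup>2)
            \<le> norm (2 * (cmod (f x))\<^sup>2 + 2 * (cmod (g x))\<^sup>2)"
    proof (rule AE_I2)
      fix x
      have "(cmod (f x + g x))\<^sup>2 \<le> (cmod (f x) + cmod (g x))\<^sup>2"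
        by (intro power_mono norm_triangle_ineq) auto
      also have "\<dots> \<le> 2 * (cmod (f x))\<^sup>2 + 2 * (cmod (g x))\<^sup>2"
        using sum_squares_bound[of "cmod (f x)" "cmod (g x)"] by (simp add: power2_sum)
      finally show "norm ((cmod (f x + g x))\<^sup>2)
            \<le> norm (2 * (cmod (f x))\<^sup>2 + 2 * (cmod (g x))\<^sup>2)" by simp
    qed
  qed
  then show ?thesis using assms by (auto simp: square_integrable_def)
qed

lemma integrable_cnj_mult:
  assumes "square_integrable f" "square_integrable g"
  shows "integrable lborel (\<lambda>x. cnj (f x) * g x)"
proof (rule Bochner_Integration.integrable_bound)
  show "integrable lborel (\<lambda>x. (cmod (f x))\<^sup>2 + (cmod (g x))\<^sup>2)"
    using assms by (auto simp: square_integrable_def)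
  have "(\<lambda>x. cnj (f x)) \<in> borel_measurable lborel"
    using assms by (auto simp: square_integrable_def
        intro!: borel_measurable_continuous_on[where f = cnj] continuous_intros)
  then show "(\<lambda>x. cnj (f x) * g x) \<in> borel_measurable lborel"
    using assms by (auto simp: square_integrable_def)
  show "AE x in lborel. norm (cnj (f x) * g x) \<le> norm ((cmod (f x))\<^sup>2 + (cmod (g x))\<^sup>2)"
  proof (rule AE_I2)
    fix x
    have "2 * (cmod (f x) * cmod (g x)) \<le> (cmod (f x))\<^sup>2 + (cmod (g x))\<^sup>2"
      using sum_squares_bound[of "cmod (f x)" "cmod (g x)"] by simp
    moreover have "0 \<le> cmod (f x) * cmod (g x)" by simp
    ultimately have "cmod (f x) * cmod (g x) \<le> (cmod (f x))\<^sup>2 + (cmod (g x))\<^sup>2"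
      by linarith
    then show "norm (cnj (f x) * g x) \<le> norm ((cmod (f x))\<^sup>2 + (cmod (g x))\<^sup>2)"
      by (simp add: norm_mult)
  qed
qed

quotient_type L2 = "real \<Rightarrow> complex" / partial: L2_rel
proof (rule part_equivpI)
  show "\<exists>f. L2_rel f f" by (rule exI[of _ "\<lambda>x. 0"]) (simp add: L2_rel_def)
  show "symp L2_rel" by (auto simp: symp_def L2_rel_def)
  show "transp L2_rel" by (auto simp: transp_def L2_rel_def)
qed

instantiation L2 :: "{zero, plus, uminus, minus}"
begin
lift_definition zero_L2 :: L2 is "\<lambda>x. 0" by (simp add: L2_rel_def)
lift_definition plus_L2 :: "L2 \<Rightarrow> L2 \<Rightarrow> L2" is "\<lambda>f g x. f x + g x"
  by (auto simp: L2_rel_def square_integrable_add)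
lift_definition uminus_L2 :: "L2 \<Rightarrow> L2" is "\<lambda>f x. - f x"
  using square_integrable_scale[where c = "-1"] by (auto simp: L2_rel_def)
definition minus_L2 :: "L2 \<Rightarrow> L2 \<Rightarrow> L2" where "minus_L2 u v = u + (- v)"
instance ..
end

lift_definition scaleC :: "complex \<Rightarrow> L2 \<Rightarrow> L2"  (infixr "*\<^sub>C" 75) is "\<lambda>c f x. c * f x"
  by (auto simp: L2_rel_def square_integrable_scale)

lift_definition cinner :: "L2 \<Rightarrow> L2 \<Rightarrow> complex" is
  "\<lambda>f g. integral\<^sup>L lborel (\<lambda>x. cnj (f x) * g x)"
proof -
  fix f f' g g' assume *: "L2_rel f f'" "L2_rel g g'"
  have 1: "(\<lambda>x. cnj (f x) * g x) \<in> borel_measurable lborel"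
    using * integrable_cnj_mult[of f g] by (auto simp: L2_rel_def)
  have 2: "(\<lambda>x. cnj (f' x) * g' x) \<in> borel_measurable lborel"
    using * integrable_cnj_mult[of f' g'] by (auto simp: L2_rel_def)
  show "integral\<^sup>L lborel (\<lambda>x. cnj (f x) * g x) = integral\<^sup>L lborel (\<lambda>x. cnj (f' x) * g' x)"
    by (rule integral_cong_AE[OF 1 2]) (use * in \<open>auto simp: L2_rel_def\<close>)
qed

instance L2 :: ab_group_add
proof
  fix a b c :: L2
  show "a + b + c = a + (b + c)"
    by transfer (auto simp: L2_rel_def add.assoc intro!: square_integrable_add)
  show "a + b = b + a"
    by transfer (auto simp: L2_rel_def add.commute intro!: square_integrable_add)
  show "0 + a = a" by transfer (auto simp: L2_rel_def)
  show "- a + a = 0"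
    by transfer (use square_integrable_scale[where c = "-1"] in \<open>auto simp: L2_rel_def\<close>)
  show "a - b = a + - b" by (simp add: minus_L2_def)
qed

interpretation L2C: vector_space scaleC
proof
  fix a b :: complex and x y :: L2
  show "a *\<^sub>C (x + y) = a *\<^sub>C x + a *\<^sub>C y"
    by transfer (auto simp: L2_rel_def distrib_left
        intro!: square_integrable_add square_integrable_scale)
  show "(a + b) *\<^sub>C x = a *\<^sub>C x + b *\<^sub>C x"
    by transfer (auto simp: L2_rel_def distrib_right
        intro!: square_integrable_add square_integrable_scale)
  show "a *\<^sub>C b *\<^sub>C x = (a * b) *\<^sub>C x"
    by transfer (auto simp: L2_rel_def mult.assoc intro!: square_integrable_scale)
  show "1 *\<^sub>C x = x" by transfer (auto simp: L2_rel_def)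
qed

lemma cinner_commute: "cinner x y = cnj (cinner y x)"
proof transfer
  fix f g assume "L2_rel f f" "L2_rel g g"
  show "integral\<^sup>L lborel (\<lambda>x. cnj (f x) * g x) = cnj (integral\<^sup>L lborel (\<lambda>x. cnj (g x) * f x))"
    by (subst Bochner_Integration.integral_cnj[symmetric]) (simp add: mult.commute)
qed

lemma cinner_add_left: "cinner (x + y) z = cinner x z + cinner y z"
proof transfer
  fix f g h assume "L2_rel f f" "L2_rel g g" "L2_rel h h"
  then show "integral\<^sup>L lborel (\<lambda>x. cnj (f x + g x) * h x)
    = integral\<^sup>L lborel (\<lambda>x. cnj (f x) * h x) + integral\<^sup>L lborel (\<lambda>x. cnj (g x) * h x)"
    by (simp add: L2_rel_def distrib_right integrable_cnj_mult)
qed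

lemma cinner_scaleC_left: "cinner (c *\<^sub>C x) y = cnj c * cinner x y"
  by transfer (simp add: mult.assoc)

lemma cinner_self: "Im (cinner x x) = 0" "0 \<le> Re (cinner x x)" "cinner x x = 0 \<longleftrightarrow> x = 0"
proof -
  have *: "integral\<^sup>L lborel (\<lambda>x. cnj (f x) * f x)
      = complex_of_real (integral\<^sup>L lborel (\<lambda>x. (cmod (f x))\<^sup>2))" for f :: "real \<Rightarrow> complex"
    by (subst integral_complex_of_real[symmetric], rule Bochner_Integration.integral_cong)
       (auto simp: complex_norm_square mult.commute simp del: of_real_power)
  show "Im (cinner x x) = 0" by transfer (simp only: * Im_complex_of_real)
  show "0 \<le> Re (cinner x x)" by transfer (simp only: * Re_complex_of_real, simp)
  show "cinner x x = 0 \<longleftrightarrow> x = 0"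
  proof transfer
    fix f assume f: "L2_rel f f"
    then have "integral\<^sup>L lborel (\<lambda>x. (cmod (f x))\<^sup>2) = 0 \<longleftrightarrow> (AE x in lborel. (cmod (f x))\<^sup>2 = 0)"
      by (intro integral_nonneg_eq_0_iff_AE) (auto simp: L2_rel_def square_integrable_def)
    with f show "integral\<^sup>L lborel (\<lambda>x. cnj (f x) * f x) = 0 \<longleftrightarrow> L2_rel f (\<lambda>x. 0)"
      unfolding * by (simp add: L2_rel_def)
  qed
qed

instantiation L2 :: real_inner
begin
definition scaleR_L2 :: "real \<Rightarrow> L2 \<Rightarrow> L2" where "scaleR_L2 r x = complex_of_real r *\<^sub>C x"
definition inner_L2 :: "L2 \<Rightarrow> L2 \<Rightarrow> real" where "inner_L2 x y = Re (cinner x y)"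
definition norm_L2 :: "L2 \<Rightarrow> real" where "norm_L2 x = sqrt (Re (cinner x x))"
definition dist_L2 :: "L2 \<Rightarrow> L2 \<Rightarrow> real" where "dist_L2 x y = norm (x - y)"
definition sgn_L2 :: "L2 \<Rightarrow> L2" where "sgn_L2 x = inverse (norm x) *\<^sub>R x"
definition uniformity_L2 :: "(L2 \<times> L2) filter" where
  "uniformity_L2 = (INF e\<in>{0 <..}. principal {(x, y). dist x y < e})"
definition open_L2 :: "L2 set \<Rightarrow> bool" where
  "open_L2 U \<longleftrightarrow> (\<forall>x\<in>U. eventually (\<lambda>(x', y). x' = x \<longrightarrow> y \<in> U) uniformity)"
instance
proof
  fix a b :: real and x y z :: L2 and U :: "L2 set"
  show "a *\<^sub>R (x + y) = a *\<^sub>R x + a *\<^sub>R y"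
    by (simp add: scaleR_L2_def L2C.scale_right_distrib)
  show "(a + b) *\<^sub>R x = a *\<^sub>R x + b *\<^sub>R x"
    by (simp add: scaleR_L2_def L2C.scale_left_distrib)
  show "a *\<^sub>R b *\<^sub>R x = (a * b) *\<^sub>R x" by (simp add: scaleR_L2_def)
  show "1 *\<^sub>R x = x" by (simp add: scaleR_L2_def)
  show "dist x y = norm (x - y)" by (rule dist_L2_def)
  show "sgn x = inverse (norm x) *\<^sub>R x" by (rule sgn_L2_def)
  show "(uniformity :: (L2 \<times> L2) filter) = (INF e\<in>{0 <..}. principal {(x, y). dist x y < e})"
    by (rule uniformity_L2_def)
  show "open U \<longleftrightarrow> (\<forall>x\<in>U. eventually (\<lambda>(x', y). x' = x \<longrightarrow> y \<in> U) uniformity)"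
    by (rule open_L2_def)
  show "inner x y = inner y x"
    by (subst (2) inner_L2_def, subst cinner_commute) (simp add: inner_L2_def)
  show "inner (x + y) z = inner x z + inner y z" by (simp add: inner_L2_def cinner_add_left)
  show "inner (a *\<^sub>R x) y = a * inner x y"
    by (simp add: inner_L2_def scaleR_L2_def cinner_scaleC_left)
  show "0 \<le> inner x x" by (simp add: inner_L2_def cinner_self)
  show "inner x x = 0 \<longleftrightarrow> x = 0"
    using cinner_self[of x] by (simp add: inner_L2_def complex_eq_iff)
  show "norm x = sqrt (inner x x)" by (simp add: inner_L2_def norm_L2_def)
qed
end

definition to_L2 :: "(real \<Rightarrow> complex) \<Rightarrow> L2" where
  "to_L2 f = (if square_integrable f then abs_L2 f else 0)"

text \<open>\<^const>\<open>rep_L2\<close> picks some representative of a class; below it only occurs inside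
  integrals and almost-everywhere statements.\<close>

section \<open>Operators in the Hilbert space, identified with their graphs\<close>

type_synonym L2_op = "(L2 \<times> L2) set"

definition app :: "L2_op \<Rightarrow> L2 \<Rightarrow> L2" where
  "app A x = (THE y. (x, y) \<in> A)"

definition linear_operator :: "L2_op \<Rightarrow> bool" where
  "linear_operator A \<longleftrightarrow> single_valued A \<and> (0, 0) \<in> A \<and>
     (\<forall>(x, y)\<in>A. \<forall>(x', y')\<in>A. (x + x', y + y') \<in> A) \<and>
     (\<forall>c. \<forall>(x, y)\<in>A. (c *\<^sub>C x, c *\<^sub>C y) \<in> A)"

definition op_add :: "L2_op \<Rightarrow> L2_op \<Rightarrow> L2_op" where
  "op_add A B = {(x, y + z) | x y z. (x, y) \<in> A \<and> (x, z) \<in> B}"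

definition op_scale :: "complex \<Rightarrow> L2_op \<Rightarrow> L2_op" where
  "op_scale c A = {(x, c *\<^sub>C y) | x y. (x, y) \<in> A}"

definition op_one :: L2_op where
  "op_one = {(x, x) | x. True}"

abbreviation op_shift :: "L2_op \<Rightarrow> real \<Rightarrow> L2_op" where
  "op_shift A l \<equiv> op_add A (op_scale (complex_of_real l) op_one)"

definition ket_bra :: "L2 \<Rightarrow> L2_op" where
  "ket_bra g = {(h, cinner g h *\<^sub>C g) | h. True}"

definition adjoint_op :: "L2_op \<Rightarrow> L2_op" where
  "adjoint_op A = {(x, y). \<forall>(u, v)\<in>A. cinner x v = cinner y u}"

definition self_adjoint :: "L2_op \<Rightarrow> bool" where
  "self_adjoint A \<longleftrightarrow> linear_operator A \<and> closure (Domain A) = UNIV \<and> adjoint_op A = A"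

definition self_adjoint_extension :: "L2_op \<Rightarrow> L2_op \<Rightarrow> bool" where
  "self_adjoint_extension S A \<longleftrightarrow> self_adjoint A \<and> S \<subseteq> A"

definition semibounded_below :: "L2_op \<Rightarrow> bool" where
  "semibounded_below A \<longleftrightarrow> (\<exists>m::real. \<forall>(x, y)\<in>A. m * (norm x)\<^sup>2 \<le> Re (cinner x y))"

text \<open>The quadratic form of a symmetric, lower semi-bounded operator \<open>A\<close> is the closure of
  \<open>x \<mapsto> \<langle>x, A x\<rangle>\<close> on the operator domain. Since the approximating sequences converge in norm,
  being Cauchy for \<open>\<langle>x, A x\<rangle>\<close> is the same as being Cauchy for the norm
  \<open>\<langle>x, A x\<rangle> + (1 - m) \<parallel>x\<parallel>\<^sup>2\<close>, where \<open>m\<close> is a lower bound of \<open>A\<close>.\<close>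

definition form_approx :: "L2_op \<Rightarrow> L2 \<Rightarrow> (nat \<Rightarrow> L2) \<Rightarrow> bool" where
  "form_approx A x X \<longleftrightarrow> (\<forall>n. X n \<in> Domain A) \<and> X \<longlonglongrightarrow> x \<and>
     (\<forall>e>0. \<exists>N. \<forall>m\<ge>N. \<forall>n\<ge>N. cmod (cinner (X m - X n) (app A (X m - X n))) < e)"

definition form_domain :: "L2_op \<Rightarrow> L2 set" where
  "form_domain A = {x. \<exists>X. form_approx A x X}"

definition form_value :: "L2_op \<Rightarrow> L2 \<Rightarrow> real" where
  "form_value A x = (THE r. \<forall>X. form_approx A x X \<longrightarrow>
     (\<lambda>n. Re (cinner (X n) (app A (X n)))) \<longlonglongrightarrow> r)"

definition friedrichs_extension :: "L2_op \<Rightarrow> L2_op" where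
  "friedrichs_extension S = {(x, y) \<in> adjoint_op S. x \<in> form_domain S}"

section \<open>Spectra\<close>

text \<open>The parameter \<open>M\<close> is a closed subspace, so that the spectrum of the part of an operator
  in a reducing subspace can be formed; \<open>(x, y + z *\<^sub>C x) \<in> A\<close> says \<open>(A - z) x = y\<close>.\<close>

definition resolvent_set_on :: "L2 set \<Rightarrow> L2_op \<Rightarrow> complex set" where
  "resolvent_set_on M A = {z. (\<forall>y\<in>M. \<exists>!x. x \<in> M \<and> (x, y + z *\<^sub>C x) \<in> A) \<and>
     (\<exists>C. \<forall>x\<in>M. \<forall>y\<in>M. (x, y + z *\<^sub>C x) \<in> A \<longrightarrow> norm x \<le> C * norm y)}"

definition spectrum_on :: "L2 set \<Rightarrow> L2_op \<Rightarrow> complex set" where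
  "spectrum_on M A = - resolvent_set_on M A"

abbreviation resolvent_set :: "L2_op \<Rightarrow> complex set" where
  "resolvent_set \<equiv> resolvent_set_on UNIV"

abbreviation spectrum :: "L2_op \<Rightarrow> complex set" where
  "spectrum \<equiv> spectrum_on UNIV"

definition eigenspace :: "L2_op \<Rightarrow> complex \<Rightarrow> L2 set" where
  "eigenspace A z = {x. (x, z *\<^sub>C x) \<in> A}"

definition discrete_spectrum :: "L2_op \<Rightarrow> complex set" where
  "discrete_spectrum A = {z. z isolated_in spectrum A \<and> eigenspace A z \<noteq> {0} \<and>
     (\<exists>B. finite B \<and> eigenspace A z \<subseteq> L2C.span B)}"

definition essential_spectrum :: "L2_op \<Rightarrow> complex set" where
  "essential_spectrum A = spectrum A - discrete_spectrum A"

definition orth_projection :: "(L2 \<Rightarrow> L2) \<Rightarrow> bool" where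
  "orth_projection P \<longleftrightarrow> (\<forall>x y. cinner (P x) y = cinner x (P y)) \<and> (\<forall>x. P (P x) = P x)"

text \<open>For a projection-valued measure \<open>E\<close>: the measure \<open>B \<mapsto> \<langle>x, E B x\<rangle> = \<parallel>E B x\<parallel>\<^sup>2\<close>.\<close>

definition scalar_spectral_measure :: "(real set \<Rightarrow> L2 \<Rightarrow> L2) \<Rightarrow> L2 \<Rightarrow> real measure" where
  "scalar_spectral_measure E x =
     measure_of UNIV (sets borel) (\<lambda>B. ennreal ((norm (E B x))\<^sup>2))"

text \<open>\<open>A = \<integral> t dE(t)\<close>, with \<open>E\<close> a projection-valued measure on the Borel sets of the line.\<close>

definition spectral_resolution :: "L2_op \<Rightarrow> (real set \<Rightarrow> L2 \<Rightarrow> L2) \<Rightarrow> bool" where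
  "spectral_resolution A E \<longleftrightarrow>
     (\<forall>B\<in>sets borel. orth_projection (E B)) \<and>
     E UNIV = id \<and>
     (\<forall>B\<in>sets borel. \<forall>C\<in>sets borel. E (B \<inter> C) = E B \<circ> E C) \<and>
     (\<forall>B::nat \<Rightarrow> real set. range B \<subseteq> sets borel \<and> disjoint_family B \<longrightarrow>
        (\<forall>x. (\<lambda>i. E (B i) x) sums E (\<Union>i. B i) x)) \<and>
     Domain A = {x. integrable (scalar_spectral_measure E x) (\<lambda>t. t\<^sup>2)} \<and>
     (\<forall>(x, y)\<in>A. cinner x y = complex_of_real (integral\<^sup>L (scalar_spectral_measure E x) (\<lambda>t. t)))"

definition spectral_measure :: "L2_op \<Rightarrow> L2 \<Rightarrow> real measure" where
  "spectral_measure A = scalar_spectral_measure (SOME E. spectral_resolution A E)"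

definition ac_subspace :: "L2_op \<Rightarrow> L2 set" where
  "ac_subspace A = {x. absolutely_continuous lborel (spectral_measure A x)}"

definition sc_subspace :: "L2_op \<Rightarrow> L2 set" where
  "sc_subspace A = {x. (\<forall>t. emeasure (spectral_measure A x) {t} = 0) \<and>
     (\<exists>N\<in>null_sets lborel. emeasure (spectral_measure A x) (- N) = 0)}"

definition ac_spectrum :: "L2_op \<Rightarrow> complex set" where
  "ac_spectrum A = spectrum_on (ac_subspace A) (A \<inter> ac_subspace A \<times> ac_subspace A)"

definition sc_spectrum :: "L2_op \<Rightarrow> complex set" where
  "sc_spectrum A = spectrum_on (sc_subspace A) (A \<inter> sc_subspace A \<times> sc_subspace A)"

section \<open>Fourier transform, multipliers and Sobolev spaces\<close>

text \<open>The unitary Fourier transform on \<open>L\<^sup>2\<close>, as the limit in the mean of truncated integrals.\<close>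

definition fourier :: "L2 \<Rightarrow> L2" where
  "fourier f = lim (\<lambda>n::nat. to_L2 (\<lambda>p. complex_of_real (1 / sqrt (2 * pi)) *
     (CLINT x:{- real n..real n}|lborel. exp (- \<i> * complex_of_real (p * x)) * rep_L2 f x)))"

definition fourier_multiplier :: "(real \<Rightarrow> real) \<Rightarrow> L2_op" where
  "fourier_multiplier m =
     {(f, g). AE p in lborel. rep_L2 (fourier g) p = complex_of_real (m p) * rep_L2 (fourier f) p}"

text \<open>\<open>|\<nabla>|\<^sup>a\<close>, and \<open>(-\<Delta>)\<^sup>r\<close>, the multiplier by \<open>|p|\<^sup>2\<^sup>r\<close>.\<close>

definition abs_nabla :: "real \<Rightarrow> L2_op" where
  "abs_nabla a = fourier_multiplier (\<lambda>p. \<bar>p\<bar> powr a)"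

definition frac_laplacian :: "real \<Rightarrow> L2_op" where
  "frac_laplacian r = fourier_multiplier (\<lambda>p. \<bar>p\<bar> powr (2 * r))"

definition sobolev_weight :: "real \<Rightarrow> L2 \<Rightarrow> real \<Rightarrow> complex" where
  "sobolev_weight r f p = complex_of_real ((1 + p\<^sup>2) powr (r / 2)) * rep_L2 (fourier f) p"

definition sobolev :: "real \<Rightarrow> L2 set" where
  "sobolev r = {f. square_integrable (sobolev_weight r f)}"

definition sobolev_norm :: "real \<Rightarrow> L2 \<Rightarrow> real" where
  "sobolev_norm r f = norm (to_L2 (sobolev_weight r f))"

definition smooth :: "(real \<Rightarrow> complex) \<Rightarrow> bool" where
  "smooth \<phi> \<longleftrightarrow> (\<exists>D. D 0 = \<phi> \<and>
     (\<forall>n::nat. \<forall>x. (D n has_vector_derivative D (Suc n) x) (at x)))"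

text \<open>\<open>C\<^sub>0\<^sup>\<infinity>(\<real> - {0})\<close>\<close>

definition test_functions :: "L2 set" where
  "test_functions = {to_L2 \<phi> | \<phi>. smooth \<phi> \<and>
     compact (closure {x. \<phi> x \<noteq> 0}) \<and> 0 \<notin> closure {x. \<phi> x \<noteq> 0}}"

text \<open>\<open>H\<^sup>r\<^sub>0(\<real> - {0})\<close>: the closure of the test functions in \<open>H\<^sup>r(\<real>)\<close>.\<close>

definition sobolev0 :: "real \<Rightarrow> L2 set" where
  "sobolev0 r = {f \<in> sobolev r. \<forall>e>0. \<exists>\<phi>\<in>test_functions. sobolev_norm r (f - \<phi>) < e}"

text \<open>Point value of the continuous representative (for classes that have one).\<close>

definition point_value :: "L2 \<Rightarrow> real \<Rightarrow> complex" where
  "point_value F = (THE f. continuous_on UNIV f \<and> (AE x in lborel. f x = rep_L2 F x))"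

section \<open>The point-perturbed fractional Laplacian\<close>

definition G :: "real \<Rightarrow> real \<Rightarrow> L2" where
  "G s l = complex_of_real (1 / sqrt (2 * pi)) *\<^sub>C
     inv fourier (to_L2 (\<lambda>p. complex_of_real (1 / (\<bar>p\<bar> powr s + l))))"

definition k_ring :: "real \<Rightarrow> L2_op" where
  "k_ring s = closure {(f, g) \<in> frac_laplacian (s / 2). f \<in> test_functions}"

definition Theta :: "real \<Rightarrow> real \<Rightarrow> real" where
  "Theta s l = inverse (l powr (1 - 1 / s) * s * sin (pi / s))"

definition theta :: "real \<Rightarrow> real" where
  "theta s = (if s < 1 then 0 else 1)"

text \<open>The pairs \<open>(F, c)\<close> for which \<open>F + c G\<close> belongs to the domain of the extension with
  parameter \<open>\<alpha> \<in> \<real> \<union> {\<infinity>}\<close>. The value \<open>-\<infinity>\<close> of \<^typ>\<open>ereal\<close> is not a parameter.\<close>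

definition boundary_pairs :: "real \<Rightarrow> ereal \<Rightarrow> real \<Rightarrow> (L2 \<times> complex) set" where
  "boundary_pairs s \<alpha> l = {(F, c). F \<in> sobolev s \<and>
     (case \<alpha> of
        ereal a \<Rightarrow> if a = Theta s l then point_value F 0 = 0
                   else c = point_value F 0 / complex_of_real (a - Theta s l)
      | _ \<Rightarrow> c = 0)}"

definition form_coeff :: "real \<Rightarrow> real \<Rightarrow> real \<Rightarrow> real" where
  "form_coeff s a l = (if a = Theta s l then 0
     else inverse (theta s / Theta s l + 1 / (a - Theta s l)))"

definition direct_sum :: "L2 set \<Rightarrow> L2 set \<Rightarrow> L2 set \<Rightarrow> bool" where
  "direct_sum D V W \<longleftrightarrow> D = {v + w | v w. v \<in> V \<and> w \<in> W} \<and> V \<inter> W = {0}"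

definition eigenvalue_E :: "real \<Rightarrow> real \<Rightarrow> real" where
  "eigenvalue_E s a = (a * s * sin (pi / s)) powr (s / (1 - s))"

end

theory Submission
  imports Defs "HOL-Probability.Probability" "HOL-Complex_Analysis.Complex_Analysis" "HOL-Real_Asymp.Real_Asymp"
begin

text \<open>Every \<open>x\<close> in the domain of the adjoint of \<^term>\<open>k_ring s\<close> is a function in \<open>H\<^sup>s\<close> plus \<open>c G\<close>. If \<open>d\<close> is the
 renormalised value at \<open>0\<close> of the regular part, Green's formula \<open>\<langle>x, A x'\<rangle> - \<langle>A x, x'\<rangle> = cnj c d' - c' cnj d\<close> shows
 that the self-adjoint extensions are the lines \<open>d = \<alpha> c\<close>. Their forms are closures, computed in the coordinates
 given by \<open>((-\<Delta>)\<^sup>s\<^sup>/\<^sup>2 + \<lambda>)\<^sup>-\<^sup>1\<^sup>/\<^sup>2\<close>. For the spectrum, integrating \<open>e\<^sup>w / ((\<alpha> - \<Theta>(s, e\<^sup>w)) (e\<^sup>w - a) (e\<^sup>w - b))\<close> around a strip of height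
 \<open>2 \<pi>\<close> shows that suitable multiples of the \<open>G\<^sub>a\<close>, projected away from the bound state, have the Gram matrix
 of \<open>w(p) / (|p|\<^sup>s + a)\<close> for an explicit weight \<open>w\<close>; so away from the bound state the extension is
 unitarily equivalent to multiplication by \<open>|p|\<^sup>s\<close>.\<close>

text \<open>For s < 3/2 an element of H^(-s) supported at the origin is a multiple of the Dirac
  measure, without derivatives, so only one function G is added to H^s. For s > 1/2 this G is square
  integrable, and \<Theta> = const l^b with b = 1/s - 1 has |b| < 1, which makes the contour
  integrals converge. At s = 1 the sign of b changes: G lies in H^(s/2) exactly for s > 1, hence the
  two descriptions of the Friedrichs extension and of the form domains. On the edges Im w = -pi and
  Im w = pi the number e^w is negative, so e^w - a turns into -(|p|^s + a), and the jump of 1 /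
  (\<alpha> - \<Theta>) turns into the weight. The poles at ln a and ln b supply the resolvent
  entries, the zero of \<alpha> - \<Theta> the projection onto the bound state. All this concerns
  even functions; odd ones are orthogonal to G and are treated by the inverse Fourier transform. The
  absolutely and singularly continuous subspaces are defined through a spectral resolution picked by
  \<open>SOME\<close>, so the scalar measures must be shown to be the same for all resolutions
  before one can be computed.\<close>

abbreviation (input) cor :: "real \<Rightarrow> complex" where "cor \<equiv> complex_of_real"

section \<open>The Hilbert space\<close>

lemma square_integrable_rep [simp]: "square_integrable (rep_L2 x)"
 using Quotient3_rep_reflp[OF Quotient3_L2, of x] by (simp add: L2_rel_def)

lemma rep_L2_measurable [measurable]: "rep_L2 x \<in> borel_measurable borel"
 using square_integrable_rep[of x] by (simp add: square_integrable_def)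

lemma square_integrable_measurable: "square_integrable f \<Longrightarrow> f \<in> borel_measurable borel"
 by (simp add: square_integrable_def)

lemma to_L2_rep [simp]: "to_L2 (rep_L2 x) = x"
 by (simp add: to_L2_def Quotient3_abs_rep[OF Quotient3_L2])

lemma rep_to_L2: "square_integrable f \<Longrightarrow> AE t in lborel. rep_L2 (to_L2 f) t = f t"
 using Quotient3_rel_rep[OF Quotient3_L2, of "abs_L2 f" "abs_L2 f"]
  rep_abs_rsp[OF Quotient3_L2, of f f]
 by (auto simp: to_L2_def L2_rel_def AE_conj_iff elim: AE_mp)

text \<open>Functions that agree almost everywhere are square integrable together; if they are not,
  both sides are the default value 0.\<close>

lemma to_L2_cong:
 assumes "AE t in lborel. f t = g t" "f \<in> borel_measurable borel" "g \<in> borel_measurable borel"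
 shows "to_L2 f = to_L2 g"
proof -
 have sq: "square_integrable f \<longleftrightarrow> square_integrable g"
 proof -
  have "integrable lborel (\<lambda>x. (cmod (f x))\<^sup>2) \<longleftrightarrow> integrable lborel (\<lambda>x. (cmod (g x))\<^sup>2)"
   by (rule integrable_cong_AE) (use assms in auto)
  thus ?thesis using assms by (auto simp: square_integrable_def)
 qed
 show ?thesis
 proof (cases "square_integrable f")
  case True
  hence "L2_rel f g" using sq assms by (simp add: L2_rel_def)
  thus ?thesis using Quotient3_rel_abs[OF Quotient3_L2] True sq by (simp add: to_L2_def)
 qed (use sq in \<open>simp add: to_L2_def\<close>)
qed

lemma L2_eq_iff: "x = y \<longleftrightarrow> (AE t in lborel. rep_L2 x t = rep_L2 y t)"
proof
 assume "AE t in lborel. rep_L2 x t = rep_L2 y t"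
 hence "to_L2 (rep_L2 x) = to_L2 (rep_L2 y)" by (rule to_L2_cong) auto
 thus "x = y" by simp
qed auto

lemma L2_rel_refl: "L2_rel f f \<longleftrightarrow> square_integrable f"
 by (auto simp: L2_rel_def)

lemma rep_zero: "AE t in lborel. rep_L2 0 t = 0"
 using rep_to_L2[of "\<lambda>_. 0"] by (simp add: zero_L2_def to_L2_def)

lemma to_L2_add:
 assumes "square_integrable f" "square_integrable g"
 shows "to_L2 (\<lambda>t. f t + g t) = to_L2 f + to_L2 g"
 using assms by (simp add: to_L2_def plus_L2.abs_eq L2_rel_refl square_integrable_add)

lemma to_L2_scale:
 assumes "square_integrable f"
 shows "to_L2 (\<lambda>t. c * f t) = c *\<^sub>C to_L2 f"
 using assms by (simp add: to_L2_def scaleC.abs_eq L2_rel_refl square_integrable_scale)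

lemma to_L2_zero: "to_L2 (\<lambda>t. 0) = 0"
 by (simp add: zero_L2_def to_L2_def)

lemma rep_add: "AE t in lborel. rep_L2 (x + y) t = rep_L2 x t + rep_L2 y t"
 using rep_to_L2[of "\<lambda>t. rep_L2 x t + rep_L2 y t"]
 by (simp add: to_L2_add square_integrable_add)

lemma rep_scaleC: "AE t in lborel. rep_L2 (c *\<^sub>C x) t = c * rep_L2 x t"
 using rep_to_L2[of "\<lambda>t. c * rep_L2 x t"]
 by (simp add: to_L2_scale square_integrable_scale)

lemma uminus_L2_eq: "- x = (-1) *\<^sub>C (x::L2)"
 using L2C.scale_minus_left[of 1 x] by simp

lemma rep_diff: "AE t in lborel. rep_L2 (x - y) t = rep_L2 x t - rep_L2 y t"
proof -
 have "x - y = x + (-1) *\<^sub>C y" by (simp only: uminus_L2_eq[symmetric]) simp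
 thus ?thesis using rep_add[of x "(-1) *\<^sub>C y"] rep_scaleC[of "-1" y] by auto
qed

lemma square_integrable_diff:
 assumes "square_integrable f" "square_integrable g"
 shows "square_integrable (\<lambda>t. f t - g t)"
 using square_integrable_add[OF assms(1) square_integrable_scale[OF assms(2), of "-1"]] by simp

lemma to_L2_diff:
 assumes "square_integrable f" "square_integrable g"
 shows "to_L2 (\<lambda>t. f t - g t) = to_L2 f - to_L2 g"
proof -
 have "to_L2 (\<lambda>t. f t + (-1) * g t) = to_L2 f + to_L2 (\<lambda>t. (-1) * g t)"
  using assms by (intro to_L2_add square_integrable_scale)
 also have "to_L2 (\<lambda>t. (-1) * g t) = - to_L2 g"
  using to_L2_scale[OF assms(2), of "-1"] by (simp only: uminus_L2_eq)
 finally show ?thesis by simp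
qed

lemma square_integrable_bound:
 assumes "square_integrable f" "g \<in> borel_measurable borel"
  and "AE t in lborel. cmod (g t) \<le> C * cmod (f t)"
 shows "square_integrable g"
 unfolding square_integrable_def
proof
 show "g \<in> borel_measurable lborel" using assms(2) by simp
 show "integrable lborel (\<lambda>x. (cmod (g x))\<^sup>2)"
 proof (rule Bochner_Integration.integrable_bound)
  show "integrable lborel (\<lambda>x. C\<^sup>2 * (cmod (f x))\<^sup>2)"
   using assms(1) by (auto simp: square_integrable_def)
  show "(\<lambda>x. (cmod (g x))\<^sup>2) \<in> borel_measurable lborel" using assms(2) by simp
  show "AE x in lborel. norm ((cmod (g x))\<^sup>2) \<le> norm (C\<^sup>2 * (cmod (f x))\<^sup>2)"
   using assms(3)
  proof eventually_elim
   case (elim x)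
   hence "(cmod (g x))\<^sup>2 \<le> (C * cmod (f x))\<^sup>2" by (intro power_mono) auto
   thus ?case by (simp only: power_mult_distrib real_norm_def abs_mult abs_power2)
  qed
 qed
qed

lemma cinner_to_L2:
 assumes "square_integrable f" "square_integrable g"
 shows "cinner (to_L2 f) (to_L2 g) = (LBINT t. cnj (f t) * g t)"
 using assms by (simp add: to_L2_def cinner.abs_eq L2_rel_refl)

lemma cinner_rep: "cinner x y = (LBINT t. cnj (rep_L2 x t) * rep_L2 y t)"
 using cinner_to_L2[of "rep_L2 x" "rep_L2 y"] by simp

lemma cinner_add_right: "cinner x (y + z) = cinner x y + cinner x z"
 by (metis cinner_commute cinner_add_left complex_cnj_add)

lemma cinner_scaleC_right: "cinner x (c *\<^sub>C y) = c * cinner x y"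
 by (metis cinner_commute cinner_scaleC_left complex_cnj_cnj complex_cnj_mult)

lemma cinner_zero [simp]: "cinner 0 x = 0" "cinner x 0 = 0"
 using cinner_scaleC_left[of 0 0 x] cinner_scaleC_right[of x 0 0] by auto

lemma cinner_minus [simp]: "cinner (- x) y = - cinner x y" "cinner x (- y) = - cinner x y"
 by (simp_all only: uminus_L2_eq cinner_scaleC_left cinner_scaleC_right) simp_all

lemma cinner_diff: "cinner (x - y) z = cinner x z - cinner y z"
  "cinner z (x - y) = cinner z x - cinner z y"
 using cinner_add_left[of x "-y" z] cinner_add_right[of z x "-y"] by auto

lemma cinner_norm: "cinner x x = cor ((norm x)\<^sup>2)"
 using cinner_self[of x] by (simp add: norm_L2_def complex_eq_iff)

lemma Re_cinner_norm: "Re (cinner x x) = (norm x)\<^sup>2"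
 by (simp add: cinner_norm)

lemma norm_scaleC: "norm (c *\<^sub>C x) = cmod c * norm x"
proof -
 have "cor ((norm (c *\<^sub>C x))\<^sup>2) = cor ((cmod c * norm x)\<^sup>2)"
  by (simp only: cinner_norm[symmetric] cinner_scaleC_left cinner_scaleC_right
     power_mult_distrib of_real_mult complex_norm_square) (simp add: mult_ac complex_norm_square[symmetric] cinner_norm)
 hence "(norm (c *\<^sub>C x))\<^sup>2 = (cmod c * norm x)\<^sup>2" by (simp only: of_real_eq_iff)
 thus ?thesis by (simp add: power2_eq_iff_nonneg)
qed

lemma norm_to_L2_sq:
 assumes "square_integrable f"
 shows "(norm (to_L2 f))\<^sup>2 = (LBINT t. (cmod (f t))\<^sup>2)"
proof -
 have "cor ((norm (to_L2 f))\<^sup>2) = cor (LBINT t. (cmod (f t))\<^sup>2)"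
  unfolding cinner_norm[symmetric] cinner_to_L2[OF assms assms] integral_complex_of_real[symmetric]
  by (rule Bochner_Integration.integral_cong) (auto simp: complex_norm_square mult.commute simp del: of_real_power)
 thus ?thesis by (simp only: of_real_eq_iff)
qed

lemma norm_L2_sq: "(norm x)\<^sup>2 = (LBINT t. (cmod (rep_L2 x t))\<^sup>2)"
 using norm_to_L2_sq[of "rep_L2 x"] by simp

lemma norm_to_L2_le:
 assumes "square_integrable f" "square_integrable g" "C \<ge> 0" "\<And>p. cmod (f p) \<le> C * cmod (g p)"
 shows "norm (to_L2 f) \<le> C * norm (to_L2 g)"
proof (rule power2_le_imp_le)
 have "(norm (to_L2 f))\<^sup>2 \<le> (LBINT p. C\<^sup>2 * (cmod (g p))\<^sup>2)"
  unfolding norm_to_L2_sq[OF assms(1)]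
  by (rule integral_mono) (use assms(1,2) power_mono[OF assms(4), of _ 2] in \<open>auto simp: square_integrable_def power_mult_distrib\<close>)
 also have "... = (C * norm (to_L2 g))\<^sup>2" by (simp add: norm_to_L2_sq[OF assms(2)] power_mult_distrib)
 finally show "(norm (to_L2 f))\<^sup>2 \<le> (C * norm (to_L2 g))\<^sup>2" .
qed (use assms(3) in simp)

lemma cinner_bound: "cmod (cinner x y) \<le> norm x * norm y"
proof -
 \<comment> \<open>A unimodular factor turns the complex product into its modulus, so the
   Cauchy-Schwarz inequality of the real inner product space applies.\<close>
 obtain u where u: "cmod u = 1" "u * cinner x y = cor (cmod (cinner x y))"
 proof (cases "cinner x y = 0")
  case False
  thus ?thesis
   by (intro that[of "cnj (cinner x y) / cmod (cinner x y)"])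
     (auto simp: norm_divide complex_norm_square[symmetric] mult.commute power2_eq_square)
 qed (auto intro: that[of 1])
 have "cmod (cinner x y) = Re (cinner x (u *\<^sub>C y))"
  by (simp add: cinner_scaleC_right u)
 also have "... = inner x (u *\<^sub>C y)" by (simp add: inner_L2_def)
 also have "... \<le> norm x * norm (u *\<^sub>C y)" by (rule norm_cauchy_schwarz)
 finally show ?thesis by (simp add: norm_scaleC u)
qed

lemma tendsto_cinner [tendsto_intros]:
 assumes "(f \<longlongrightarrow> a) F" "(g \<longlongrightarrow> b) F"
 shows "((\<lambda>n. cinner (f n) (g n)) \<longlongrightarrow> cinner a b) F"
proof -
 have "bounded_bilinear cinner"
 proof
  fix r :: real and a b :: L2
  show "cinner (r *\<^sub>R a) b = r *\<^sub>R cinner a b" "cinner a (r *\<^sub>R b) = r *\<^sub>R cinner a b"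
   by (simp_all add: scaleR_L2_def cinner_scaleC_left cinner_scaleC_right scaleR_conv_of_real)
  show "\<exists>K. \<forall>a b. norm (cinner a b) \<le> norm a * norm b * K"
   by (rule exI[of _ 1]) (simp add: cinner_bound)
 qed (auto simp: cinner_add_left cinner_add_right)
 thus ?thesis using assms by (rule bounded_bilinear.tendsto)
qed

lemma tendsto_scaleC [tendsto_intros]:
 assumes "(f \<longlongrightarrow> a) F" "(g \<longlongrightarrow> b) F"
 shows "((\<lambda>n. f n *\<^sub>C g n) \<longlongrightarrow> a *\<^sub>C b) F"
proof -
 have "bounded_bilinear scaleC"
 proof
  fix r :: real and a :: complex and b :: L2
  show "(r *\<^sub>R a) *\<^sub>C b = r *\<^sub>R (a *\<^sub>C b)" "a *\<^sub>C (r *\<^sub>R b) = r *\<^sub>R (a *\<^sub>C b)"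
   by (simp_all add: scaleR_L2_def scaleR_conv_of_real mult.commute)
  show "\<exists>K. \<forall>a b. norm (a *\<^sub>C b) \<le> norm a * norm b * K"
   by (rule exI[of _ 1]) (simp add: norm_scaleC)
 qed (auto simp: L2C.scale_left_distrib L2C.scale_right_distrib)
 thus ?thesis using assms by (rule bounded_bilinear.tendsto)
qed

section \<open>Completeness\<close>

lemma square_integrable_nn:
 "square_integrable f \<longleftrightarrow> f \<in> borel_measurable borel \<and>
   (\<integral>\<^sup>+t. ennreal ((cmod (f t))\<^sup>2) \<partial>lborel) < \<infinity>"
 by (auto simp: square_integrable_def integrable_iff_bounded)

lemma norm_to_L2_nn:
 assumes "square_integrable f"
 shows "ennreal ((norm (to_L2 f))\<^sup>2) = (\<integral>\<^sup>+t. ennreal ((cmod (f t))\<^sup>2) \<partial>lborel)"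
 using assms by (subst nn_integral_eq_integral) (auto simp: square_integrable_def norm_to_L2_sq)

lemma norm_L2_nn: "ennreal ((norm x)\<^sup>2) = (\<integral>\<^sup>+t. ennreal ((cmod (rep_L2 x t))\<^sup>2) \<partial>lborel)"
 using norm_to_L2_nn[of "rep_L2 x"] by simp

text \<open>Riesz--Fischer: along a subsequence \<open>\<Sum>\<^sub>n 2\<^sup>n \<parallel>x\<^sub>n\<^sub>+\<^sub>1 - x\<^sub>n\<parallel>\<^sup>2 < \<infinity>\<close>, which forces the
 increments to be pointwise summable almost everywhere.\<close>

lemma summable_of_weighted_squares:
 fixes d :: "nat \<Rightarrow> complex"
 assumes "summable (\<lambda>n. 2 ^ n * (cmod (d n))\<^sup>2)"
 shows "summable d"
proof (rule summable_norm_cancel, rule summable_comparison_test')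
 have "summable (\<lambda>n. (1/2::real) ^ n)" by (rule summable_geometric) simp
 thus "summable (\<lambda>n. (1/2) ^ n + 2 ^ n * (cmod (d n))\<^sup>2)"
  using assms by (rule summable_add)
 show "norm (norm (d n)) \<le> (1/2) ^ n + 2 ^ n * (cmod (d n))\<^sup>2" if "n \<ge> 0" for n
 proof -
  \<comment> \<open>Twice the product of 1/a and a |d_n| is at most the sum of their squares: one
    term is geometric, the other is summable by assumption.\<close>
  define a where "a = sqrt (2 ^ n)"
  have a: "a > 0" "a\<^sup>2 = 2 ^ n" by (auto simp: a_def)
  have "2 * (1 / a * (a * cmod (d n))) \<le> (1 / a)\<^sup>2 + (a * cmod (d n))\<^sup>2"
   using sum_squares_bound[of "1 / a" "a * cmod (d n)"] by (simp only: mult.assoc)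
  hence "2 * cmod (d n) \<le> 1 / 2 ^ n + 2 ^ n * (cmod (d n))\<^sup>2"
   using a by (simp add: power_divide power_mult_distrib)
  thus ?thesis by (simp add: power_divide) (smt (verit) norm_ge_zero)
 qed
qed

instance L2 :: banach
proof
 fix X :: "nat \<Rightarrow> L2" assume C: "Cauchy X"
 have "\<exists>N. \<forall>m\<ge>N. \<forall>k\<ge>N. norm (X m - X k) < (1/2) ^ n" for n
  using C unfolding Cauchy_iff by (metis zero_less_power half_gt_zero zero_less_one)
 then obtain N where N: "\<And>n m k. m \<ge> N n \<Longrightarrow> k \<ge> N n \<Longrightarrow> norm (X m - X k) < (1/2) ^ n" by metis
 \<comment> \<open>Summing makes \<open>r\<close> strictly increasing and at the same time at least
   \<open>N n\<close>.\<close>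
 define r where "r n = (\<Sum>k\<le>n. Suc (N k))" for n
 have r: "strict_mono r" by (rule strict_monoI_Suc) (simp add: r_def)
 define Y where "Y n = X (r n)" for n
 have Y: "norm (Y m - Y n) \<le> (1/2) ^ n" if "n \<le> m" for m n
 proof -
  have "N n \<le> r n" by (cases n) (auto simp: r_def)
  moreover have "r n \<le> r m" using r that by (simp add: strict_mono_less_eq)
  ultimately show ?thesis using N[of n "r m" "r n"] by (simp add: Y_def)
 qed
 have diff: "(\<integral>\<^sup>+t. ennreal ((cmod (rep_L2 x t - rep_L2 y t))\<^sup>2) \<partial>lborel) = ennreal ((norm (x - y))\<^sup>2)" for x y
  unfolding norm_L2_nn by (rule nn_integral_cong_AE) (use rep_diff[of x y] in auto)
 define d where "d n t = rep_L2 (Y (Suc n)) t - rep_L2 (Y n) t" for n t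
 have dm [measurable]: "d n \<in> borel_measurable borel" for n unfolding d_def by measurable
 have "(\<integral>\<^sup>+t. (\<Sum>n. ennreal (2 ^ n * (cmod (d n t))\<^sup>2)) \<partial>lborel)
   = (\<Sum>n. \<integral>\<^sup>+t. ennreal (2 ^ n * (cmod (d n t))\<^sup>2) \<partial>lborel)"
  by (rule nn_integral_suminf) simp
 also have "... \<le> (\<Sum>n. ennreal ((1/2) ^ n))"
 proof (rule suminf_le)
  fix n
  have "(\<integral>\<^sup>+t. ennreal (2 ^ n * (cmod (d n t))\<^sup>2) \<partial>lborel) = ennreal (2 ^ n) * ennreal ((norm (Y (Suc n) - Y n))\<^sup>2)"
   unfolding diff[symmetric] by (subst nn_integral_cmult[symmetric]) (auto simp: ennreal_mult' d_def)
  also have "... \<le> ennreal (2 ^ n) * ennreal (((1/2) ^ n)\<^sup>2)" by (intro mult_left_mono ennreal_leI power_mono Y) auto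
  also have "... = ennreal ((1/2) ^ n)" by (simp add: ennreal_mult'[symmetric] power2_eq_square flip: power_mult_distrib)
  finally show "(\<integral>\<^sup>+t. ennreal (2 ^ n * (cmod (d n t))\<^sup>2) \<partial>lborel) \<le> ennreal ((1/2) ^ n)" .
 qed auto
 also have "... = ennreal (\<Sum>n. (1/2) ^ n)"
  by (rule suminf_ennreal2) (auto intro: summable_geometric)
 finally have "(\<integral>\<^sup>+t. (\<Sum>n. ennreal (2 ^ n * (cmod (d n t))\<^sup>2)) \<partial>lborel) < \<infinity>"
  by (simp add: le_less_trans[OF _ ennreal_less_top])
 hence conv: "AE t in lborel. (\<Sum>n. ennreal (2 ^ n * (cmod (d n t))\<^sup>2)) \<noteq> \<infinity>"
  by (intro nn_integral_PInf_AE) auto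
 define f where "f t = lim (\<lambda>n. rep_L2 (Y n) t)" for t
 have tel: "rep_L2 (Y n) t = rep_L2 (Y 0) t + (\<Sum>k<n. d k t)" for n t
  by (induction n) (auto simp: d_def)
 from conv have lim: "AE t in lborel. (\<lambda>n. rep_L2 (Y n) t) \<longlonglongrightarrow> f t"
 proof eventually_elim
  case (elim t)
  have "summable (\<lambda>n. d n t)" by (rule summable_of_weighted_squares, rule summable_suminf_not_top) (use elim in auto)
  hence "(\<lambda>n. rep_L2 (Y 0) t + (\<Sum>k<n. d k t)) \<longlonglongrightarrow> rep_L2 (Y 0) t + (\<Sum>k. d k t)"
   by (intro tendsto_add tendsto_const summable_LIMSEQ)
  thus ?case unfolding f_def tel[symmetric] by (metis limI)
 qed
 have [measurable]: "f \<in> borel_measurable borel" unfolding f_def[abs_def] by (rule borel_measurable_lim_metric) auto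
 \<comment> \<open>Fatou's lemma bounds the distance to the pointwise limit by the distances within
   the sequence.\<close>
 have bd: "(\<integral>\<^sup>+t. ennreal ((cmod (f t - rep_L2 (Y n) t))\<^sup>2) \<partial>lborel) \<le> ennreal (((1/2) ^ n)\<^sup>2)" for n
 proof -
  have "(\<integral>\<^sup>+t. ennreal ((cmod (f t - rep_L2 (Y n) t))\<^sup>2) \<partial>lborel)
    = (\<integral>\<^sup>+t. liminf (\<lambda>k. ennreal ((cmod (rep_L2 (Y k) t - rep_L2 (Y n) t))\<^sup>2)) \<partial>lborel)"
  proof (rule nn_integral_cong_AE, use lim in eventually_elim)
   case (elim t)
   thus ?case by (intro lim_imp_Liminf[symmetric] tendsto_ennrealI tendsto_intros) auto
  qed
  also have "... \<le> liminf (\<lambda>k. ennreal ((norm (Y k - Y n))\<^sup>2))"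
   unfolding diff[symmetric] by (rule nn_integral_liminf) auto
  also have "... \<le> ennreal (((1/2) ^ n)\<^sup>2)"
   by (rule Liminf_le) (auto simp: eventually_sequentially intro!: exI[of _ n] ennreal_leI power_mono Y)
  finally show ?thesis .
 qed
 have sq: "square_integrable (\<lambda>t. f t - rep_L2 (Y n) t)" for n
  using le_less_trans[OF bd[of n] ennreal_less_top] by (simp add: square_integrable_nn)
 have sf: "square_integrable f" using square_integrable_add[OF sq[of 0], of "rep_L2 (Y 0)"] by simp
 have "norm (to_L2 f - Y n) \<le> (1/2) ^ n" for n
  by (rule power2_le_imp_le) (use bd[of n, folded norm_to_L2_nn[OF sq]] sf in \<open>simp_all add: to_L2_diff\<close>)
 hence "(\<lambda>n. Y n - to_L2 f) \<longlonglongrightarrow> 0"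
  by (intro Lim_null_comparison[OF always_eventually LIMSEQ_power_zero[of "1/2"]]) (simp_all add: norm_minus_commute)
 hence "Y \<longlonglongrightarrow> to_L2 f" by (rule LIM_zero_cancel)
 thus "convergent X" using Cauchy_converges_subseq[OF C r] by (auto simp: convergent_def o_def Y_def[abs_def])
qed

section \<open>Best approximation, orthogonality and density\<close>

lemma Inf_distance_minimizer:
 assumes S: "L2C.subspace S"
 obtains p where "p \<in> closure S" "\<And>x. x \<in> S \<Longrightarrow> norm (y - p) \<le> norm (y - p - x)"
proof -
 define D where "D = Inf ((\<lambda>x. (norm (y - x))\<^sup>2) ` S)"
 have ne: "S \<noteq> {}" using L2C.subspace_0[OF S] by blast
 have bdd: "bdd_below ((\<lambda>x. (norm (y - x))\<^sup>2) ` S)" by (rule bdd_belowI2[of _ 0]) simp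
 have D: "D \<le> (norm (y - x))\<^sup>2" if "x \<in> S" for x
  unfolding D_def by (rule cInf_lower[OF _ bdd]) (use that in auto)
 have "\<exists>x\<in>S. (norm (y - x))\<^sup>2 < D + inverse (Suc n)" for n
  using cInf_less_iff[OF _ bdd, of "D + inverse (Suc n)"] ne by (auto simp: D_def)
 then obtain X where X: "\<And>n. X n \<in> S" "\<And>n. (norm (y - X n))\<^sup>2 < D + inverse (Suc n)" by metis
 have parallelogram: "(norm (a + b))\<^sup>2 + (norm (a - b))\<^sup>2 = 2 * (norm a)\<^sup>2 + 2 * (norm b)\<^sup>2" for a b :: L2
  by (simp add: power2_norm_eq_inner inner_add_left inner_add_right inner_diff_left inner_diff_right inner_commute)
 \<comment> \<open>The midpoint of two members of S lies in S, so its squared distance to y is at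
   least D; the parallelogram law then makes a minimising sequence Cauchy.\<close>
 have par: "(norm (X m - X n))\<^sup>2 \<le> 2 * inverse (Suc m) + 2 * inverse (Suc n)" for m n
 proof -
  let ?a = "y - X m" and ?b = "y - X n" and ?h = "(1/2) *\<^sub>C (X m + X n)"
  have "2 *\<^sub>R ?h = X m + X n" by (simp add: scaleR_L2_def)
  hence "?a + ?b = 2 *\<^sub>R (y - ?h)" by (simp add: scaleR_diff_right scaleR_2)
  hence "(norm (?a + ?b))\<^sup>2 = 4 * (norm (y - ?h))\<^sup>2" by (simp add: power_mult_distrib)
  moreover have "(norm (?a + ?b))\<^sup>2 + (norm (?a - ?b))\<^sup>2 = 2 * (norm ?a)\<^sup>2 + 2 * (norm ?b)\<^sup>2"
   by (rule parallelogram)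
  moreover have "D \<le> (norm (y - ?h))\<^sup>2" by (intro D L2C.subspace_scale[OF S] L2C.subspace_add[OF S] X)
  moreover have "norm (?a - ?b) = norm (X m - X n)" by (simp add: norm_minus_commute)
  ultimately show ?thesis using X(2)[of m] X(2)[of n] by simp
 qed
 have "Cauchy X"
 proof (rule CauchyI)
  fix e :: real assume e: "0 < e"
  then obtain N where N: "inverse (real (Suc N)) < e\<^sup>2 / 4" using reals_Archimedean[of "e\<^sup>2 / 4"] by auto
  have "norm (X m - X n) < e" if "m \<ge> N" "n \<ge> N" for m n
  proof (rule power_less_imp_less_base)
   have "inverse (real (Suc k)) \<le> inverse (real (Suc N))" if "k \<ge> N" for k using that by (intro le_imp_inverse_le) auto
   from this[OF \<open>m \<ge> N\<close>] this[OF \<open>n \<ge> N\<close>] show "(norm (X m - X n))\<^sup>2 < e\<^sup>2" using par[of m n] N by linarith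
  qed (use e in simp)
  thus "\<exists>M. \<forall>m\<ge>M. \<forall>n\<ge>M. norm (X m - X n) < e" by blast
 qed
 then obtain p where p: "X \<longlonglongrightarrow> p" by (auto simp: convergent_eq_Cauchy[symmetric])
 have "(norm (y - p))\<^sup>2 \<le> D"
 proof (rule LIMSEQ_le)
  show "(\<lambda>n. (norm (y - X n))\<^sup>2) \<longlonglongrightarrow> (norm (y - p))\<^sup>2" by (intro tendsto_intros p)
  show "(\<lambda>n. D + inverse (real (Suc n))) \<longlonglongrightarrow> D"
   using tendsto_add[OF tendsto_const[of D] LIMSEQ_inverse_real_of_nat] by simp
 qed (use X(2) less_imp_le in blast)
 moreover have "D \<le> (norm (y - p - x))\<^sup>2" if x: "x \<in> S" for x
 proof (rule LIMSEQ_le_const)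
  show "(\<lambda>n. (norm (y - X n - x))\<^sup>2) \<longlonglongrightarrow> (norm (y - p - x))\<^sup>2" by (intro tendsto_intros p)
  show "\<exists>N. \<forall>n\<ge>N. D \<le> (norm (y - X n - x))\<^sup>2"
   using D[OF L2C.subspace_add[OF S X(1) x]] by (auto simp: diff_diff_eq)
 qed
 ultimately have "norm (y - p) \<le> norm (y - p - x)" if "x \<in> S" for x
  using that by (meson order_trans norm_ge_zero power2_le_imp_le)
 thus ?thesis using p X(1) by (intro that[of p]) (auto simp: closure_sequential)
qed

text \<open>The residual z of the best approximation p works: varying p along real multiples of x
  and of \<i> x shows that z is orthogonal to S, and by continuity to p, so that its product with y
  is its own squared norm.\<close>

lemma orthogonal_separation:
 assumes S: "L2C.subspace S" and y: "y \<notin> closure S"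
 obtains z where "\<And>x. x \<in> S \<Longrightarrow> cinner x z = 0" "cinner z y \<noteq> 0"
proof -
 obtain p where p: "p \<in> closure S" "\<And>x. x \<in> S \<Longrightarrow> norm (y - p) \<le> norm (y - p - x)"
  using Inf_distance_minimizer[OF S] by blast
 define z where "z = y - p"
 have z0: "z \<noteq> 0" using p y by (auto simp: z_def)
 have inn: "inner z x = 0" if x: "x \<in> S" for x
 proof (rule ccontr)
  assume nz: "inner z x \<noteq> 0"
  hence x0: "x \<noteq> 0" by auto
  define t where "t = inner z x / (norm x)\<^sup>2"
  have "t *\<^sub>R x \<in> S" unfolding scaleR_L2_def by (rule L2C.subspace_scale[OF S x])
  hence "(norm z)\<^sup>2 \<le> (norm (z - t *\<^sub>R x))\<^sup>2"
   using p(2) by (intro power_mono) (auto simp: z_def)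
  also have "... = (norm z)\<^sup>2 - 2 * t * inner z x + t\<^sup>2 * (norm x)\<^sup>2"
   by (simp only: power2_norm_eq_inner inner_diff_left inner_diff_right inner_scaleR_left
     inner_scaleR_right inner_commute[of x z]) (simp add: algebra_simps power2_eq_square)
  also have "... = (norm z)\<^sup>2 - (inner z x)\<^sup>2 / (norm x)\<^sup>2"
   using x0 by (simp add: t_def power2_eq_square field_simps)
  finally have "(inner z x)\<^sup>2 / (norm x)\<^sup>2 \<le> 0" by simp
  moreover have "(inner z x)\<^sup>2 / (norm x)\<^sup>2 > 0" using nz x0 by simp
  ultimately show False by simp
 qed
 have orth: "cinner x z = 0" if x: "x \<in> S" for x
 proof -
  have "Re (cinner z x) = 0" using inn[OF x] by (simp add: inner_L2_def)
  moreover have "Re (cinner z (\<i> *\<^sub>C x)) = 0"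
   using inn[OF L2C.subspace_scale[OF S x, of \<i>]] by (simp add: inner_L2_def)
  ultimately have "cinner z x = 0" by (simp add: cinner_scaleC_right complex_eq_iff)
  thus ?thesis by (subst cinner_commute) simp
 qed
 have "cinner z p = 0"
 proof -
  obtain X where X: "\<And>n. X n \<in> S" "X \<longlonglongrightarrow> p" using p(1) by (auto simp: closure_sequential)
  have "(\<lambda>n. cinner z (X n)) \<longlonglongrightarrow> cinner z p" by (intro tendsto_intros X)
  moreover have "cinner z (X n) = 0" for n using orth[OF X(1)] by (subst cinner_commute) simp
  ultimately show ?thesis using LIMSEQ_unique[OF _ tendsto_const[of 0]] by auto
 qed
 hence "cinner z y = cinner z z" unfolding z_def by (simp add: cinner_diff(2))
 hence "cinner z y \<noteq> 0" using z0 cinner_self(3) by simp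
 with orth show ?thesis using that by blast
qed

lemma dense_subspace:
 assumes "L2C.subspace S" "\<And>y. (\<And>x. x \<in> S \<Longrightarrow> cinner x y = 0) \<Longrightarrow> y = 0"
 shows "closure S = UNIV"
 using orthogonal_separation[OF assms(1)] assms(2) by (metis UNIV_eq_I cinner_zero(1))

section \<open>Isometries determined by Gram matrices\<close>

definition clinear_map :: "(L2 \<Rightarrow> L2) \<Rightarrow> bool" where
 "clinear_map Y \<longleftrightarrow> (\<forall>x y. Y (x + y) = Y x + Y y) \<and> (\<forall>c x. Y (c *\<^sub>C x) = c *\<^sub>C Y x)"

lemma clinear_mapD:
 assumes "clinear_map Y"
 shows "Y (x + y) = Y x + Y y" "Y (c *\<^sub>C x) = c *\<^sub>C Y x" "Y 0 = 0" "Y (- x) = - Y x" "Y (x - y) = Y x - Y y"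
proof -
 show add: "Y (x + y) = Y x + Y y" and sc: "Y (c *\<^sub>C x) = c *\<^sub>C Y x" for x y c
  using assms by (auto simp: clinear_map_def)
 show "Y 0 = 0" using add[of 0 0] by simp
 show neg: "Y (- x) = - Y x" for x using sc[of "-1" x] by (simp only: uminus_L2_eq)
 show "Y (x - y) = Y x - Y y" using add[of x "-y"] neg[of y] by simp
qed

text \<open>The defect of linearity is a combination of values of Y and is orthogonal to every value
  of Y, hence to itself.\<close>

lemma inner_preserving_linear:
 assumes Y: "\<And>x y. cinner (Y x) (Y y) = cinner x y"
 shows "clinear_map Y"
proof -
 have "Y (c *\<^sub>C x + d *\<^sub>C y) = c *\<^sub>C Y x + d *\<^sub>C Y y" (is "?l = ?r") for c d x y
 proof -
  have z: "cinner (?l - ?r) (Y z) = 0" for z by (simp add: cinner_diff cinner_add_left cinner_scaleC_left Y)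
  have "cinner (?l - ?r) (?l - ?r) = 0"
   unfolding cinner_diff(2)[of "?l - ?r"] by (simp add: cinner_add_right cinner_scaleC_right z)
  thus ?thesis by (simp add: cinner_self)
 qed
 from this[of 1 _ 1] this[of _ _ 0] show ?thesis by (simp add: clinear_map_def)
qed

text \<open>The linear relation spanned by the pairs. Taking combinations in both components at once
  postpones the question whether u determines v.\<close>

inductive_set gram_span :: "(L2 \<times> L2) set \<Rightarrow> (L2 \<times> L2) set" for P where
 gram_span_0: "(0, 0) \<in> gram_span P"
| gram_span_add: "(x, y) \<in> gram_span P \<Longrightarrow> (u, v) \<in> P \<Longrightarrow> (x + c *\<^sub>C u, y + c *\<^sub>C v) \<in> gram_span P"

lemma gram_span_plus:
 "(x', y') \<in> gram_span P \<Longrightarrow> (x, y) \<in> gram_span P \<Longrightarrow> (x + x', y + y') \<in> gram_span P"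
 by (induction rule: gram_span.induct) (auto simp: add.assoc[symmetric] intro: gram_span_add)

lemma gram_span_scale:
 "(x, y) \<in> gram_span P \<Longrightarrow> (c *\<^sub>C x, c *\<^sub>C y) \<in> gram_span P"
 by (induction rule: gram_span.induct)
   (auto simp: L2C.scale_right_distrib intro: gram_span_0 gram_span_add)

lemma gram_span_base: "(u, v) \<in> P \<Longrightarrow> (u, v) \<in> gram_span P"
 using gram_span_add[OF gram_span_0, of u v P 1] by simp

text \<open>Equal Gram matrices make the spanned relation isometric, totality makes its domain
  dense, and completeness extends it to the whole space. Both the Fourier transform and the unitary
  equivalence with a multiplication operator are obtained in this way.\<close>

lemma gram_extension:
 assumes gram: "\<And>u v u' v'. (u, v) \<in> P \<Longrightarrow> (u', v') \<in> P \<Longrightarrow> cinner u u' = cinner v v'"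
  and total: "\<And>y. (\<And>u v. (u, v) \<in> P \<Longrightarrow> cinner u y = 0) \<Longrightarrow> y = 0"
 obtains Y where "clinear_map Y" "\<And>x y. cinner (Y x) (Y y) = cinner x y" "\<And>u v. (u, v) \<in> P \<Longrightarrow> Y u = v"
proof -
 let ?G = "gram_span P"
 have g1: "cinner x u = cinner y v" if "(x, y) \<in> ?G" "(u, v) \<in> P" for x y u v
  using that by (induction rule: gram_span.induct)
   (auto simp: cinner_add_left cinner_scaleC_left gram)
 have g2: "cinner x' x = cinner y' y" if "(x, y) \<in> ?G" "(x', y') \<in> ?G" for x y x' y'
  using that by (induction rule: gram_span.induct)
   (auto simp: cinner_add_right cinner_scaleC_right g1)
 have dense: "closure (Domain ?G) = UNIV"
 proof (rule dense_subspace)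
  show "L2C.subspace (Domain ?G)"
   unfolding L2C.subspace_def by (auto intro: gram_span_0 gram_span_plus gram_span_scale Domain.intros)
  fix y assume y: "\<And>x. x \<in> Domain ?G \<Longrightarrow> cinner x y = 0"
  show "y = 0"
  proof (rule total)
   fix u v assume "(u, v) \<in> P"
   thus "cinner u y = 0" using y gram_span_base by blast
  qed
 qed
 have "\<exists>X Z. (\<forall>n. (X n, Z n) \<in> ?G) \<and> X \<longlonglongrightarrow> x \<and> convergent Z" for x
 proof -
  have "x \<in> closure (Domain ?G)" using dense by simp
  then obtain X where X: "\<And>n. X n \<in> Domain ?G" "X \<longlonglongrightarrow> x" by (auto simp: closure_sequential)
  then obtain Z where Z: "\<And>n. (X n, Z n) \<in> ?G" unfolding Domain_iff by metis
  have nd: "norm (Z m - Z n) = norm (X m - X n)" for m n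
  proof -
   have "(X m + (-1) *\<^sub>C X n, Z m + (-1) *\<^sub>C Z n) \<in> ?G" by (intro gram_span_plus gram_span_scale Z)
   hence *: "(X m - X n, Z m - Z n) \<in> ?G" by (simp add: uminus_L2_eq[symmetric])
   from g2[OF this this] show ?thesis by (simp add: norm_L2_def)
  qed
  have "Cauchy X" using X(2) by (rule LIMSEQ_imp_Cauchy)
  hence "Cauchy Z" unfolding Cauchy_iff nd .
  thus ?thesis using X Z Cauchy_convergent by blast
 qed
 then obtain X Z where X: "\<And>x n. (X x n, Z x n) \<in> ?G" "\<And>x. X x \<longlonglongrightarrow> x" "\<And>x. convergent (Z x)" by metis
 define Y where "Y x = lim (Z x)" for x
 have Z: "Z x \<longlonglongrightarrow> Y x" for x unfolding Y_def using X(3) by (simp add: convergent_LIMSEQ_iff)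
 \<comment> \<open>Identities of inner products that hold along the chosen sequences pass to the
   limit, so the arbitrary choice of the sequences does no harm; linearity follows afterwards from
   isometry.\<close>
 have lim: "cinner z (Y x) = cinner u x" if g: "\<And>n. cinner z (Z x n) = cinner u (X x n)" for z u x
  using LIMSEQ_unique[OF tendsto_cinner[OF tendsto_const[of z] Z[of x]]] tendsto_cinner[OF tendsto_const[of u] X(2)[of x]] by (simp add: g)
 have iso: "cinner (Y x) (Y y) = cinner x y" for x y
 proof (rule lim)
  show "cinner (Y x) (Z y n) = cinner x (X y n)" for n
   using lim[OF g2[OF X(1) X(1), symmetric], of y n x] cinner_commute[of "Y x"] cinner_commute[of x] by metis
 qed
 have base: "Y u = v" if "(u, v) \<in> P" for u v
 proof -
  note g = gram_span_base[OF that]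
  have "cinner v (Y u) = cinner u u" by (rule lim) (rule g2[OF X(1) g, symmetric])
  hence "cinner (Y u - v) (Y u - v) = 0"
   using g2[OF g g] cinner_commute[of "Y u" v] cinner_commute[of u u] by (simp add: cinner_diff iso)
  thus ?thesis by (simp add: cinner_self)
 qed
 show ?thesis by (rule that[OF inner_preserving_linear[OF iso] iso base])
qed

lemma isometry_norm:
 assumes "\<And>x y. cinner (Y x) (Y y) = cinner x y"
 shows "norm (Y x) = norm x"
 unfolding norm_L2_def assms ..

lemma clinear_map_bounded_continuous:
 assumes Y: "clinear_map Y" and b: "\<And>x. norm (Y x) \<le> C * norm x" and X: "(X \<longlongrightarrow> x) F"
 shows "((\<lambda>n. Y (X n)) \<longlongrightarrow> Y x) F"
proof -
 have "((\<lambda>n. C * norm (X n - x)) \<longlongrightarrow> C * norm (x - x)) F" by (intro tendsto_intros X)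
 hence "((\<lambda>n. C * norm (X n - x)) \<longlongrightarrow> 0) F" by simp
 hence "((\<lambda>n. Y (X n) - Y x) \<longlongrightarrow> 0) F"
  by (rule Lim_null_comparison[rotated]) (simp add: clinear_mapD[OF Y, symmetric] b)
 thus ?thesis by (simp add: LIM_zero_iff)
qed

lemma isometry_continuous:
 assumes "clinear_map Y" "\<And>x y. cinner (Y x) (Y y) = cinner x y" "(X \<longlongrightarrow> x) F"
 shows "((\<lambda>n. Y (X n)) \<longlongrightarrow> Y x) F"
 using clinear_map_bounded_continuous[OF assms(1) _ assms(3), of 1] isometry_norm[OF assms(2)] by simp

text \<open>The range of an isometry is closed, so it contains every vector that is orthogonal to
  its orthogonal complement.\<close>

lemma isometry_range:
 assumes Y: "clinear_map Y" "\<And>x y. cinner (Y x) (Y y) = cinner x y"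
  and x: "\<And>z. (\<And>f. cinner (Y f) z = 0) \<Longrightarrow> cinner z x = 0"
 shows "x \<in> range Y"
proof -
 have S: "L2C.subspace (range Y)"
  unfolding L2C.subspace_def using clinear_mapD[OF Y(1), symmetric] by (auto intro: rangeI)
 have "x \<in> closure (range Y)"
 proof (rule ccontr)
  assume "x \<notin> closure (range Y)"
  then obtain z where "\<And>u. u \<in> range Y \<Longrightarrow> cinner u z = 0" "cinner z x \<noteq> 0"
   using orthogonal_separation[OF S] by blast
  thus False using x[of z] by blast
 qed
 then obtain X where X: "\<And>n. X n \<in> range Y" "X \<longlonglongrightarrow> x" by (auto simp: closure_sequential)
 then obtain Z where Z: "\<And>n. X n = Y (Z n)" unfolding image_iff by metis
 have "norm (X m - X n) = norm (Z m - Z n)" for m n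
  unfolding Z clinear_mapD(5)[OF Y(1), symmetric] by (rule isometry_norm[OF Y(2)])
 moreover have "Cauchy X" using X(2) by (rule LIMSEQ_imp_Cauchy)
 ultimately have "Cauchy Z" unfolding Cauchy_iff by simp
 then obtain z where z: "Z \<longlonglongrightarrow> z" by (auto simp: convergent_eq_Cauchy[symmetric])
 have "X \<longlonglongrightarrow> Y z" using isometry_continuous[OF Y z] by (simp only: Z[symmetric])
 thus ?thesis using LIMSEQ_unique[OF X(2)] by auto
qed

lemma L2_dominated_convergence:
 assumes g: "square_integrable g" and m [measurable]: "\<And>n::nat. f n \<in> borel_measurable borel" "h \<in> borel_measurable borel"
  and conv: "AE t in lborel. (\<lambda>n. f n t) \<longlonglongrightarrow> h t"
  and bound: "\<And>n. AE t in lborel. cmod (f n t) \<le> cmod (g t)"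
 shows "square_integrable (f n)" "square_integrable h" "(\<lambda>n. to_L2 (f n)) \<longlonglongrightarrow> to_L2 h"
proof -
 show sf: "square_integrable (f n)" for n
  by (rule square_integrable_bound[OF g m(1), of _ 1]) (use bound[of n] in simp)
 have "AE t in lborel. \<forall>n. cmod (f n t) \<le> cmod (g t)" using bound by (simp add: AE_all_countable)
 with conv have hb: "AE t in lborel. cmod (h t) \<le> cmod (g t)"
 proof eventually_elim
  case (elim t)
  show ?case by (rule LIMSEQ_le_const2[OF tendsto_norm[OF elim(1)]]) (use elim in auto)
 qed
 show sh: "square_integrable h"
  by (rule square_integrable_bound[OF g m(2), of 1]) (use hb in simp)
 have "(\<lambda>n. \<integral>t. (cmod (f n t - h t))\<^sup>2 \<partial>lborel) \<longlonglongrightarrow> (\<integral>t. (0::real) \<partial>(lborel::real measure))"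
 proof (rule integral_dominated_convergence[where w = "\<lambda>t. 4 * (cmod (g t))\<^sup>2"])
  show "integrable lborel (\<lambda>t. 4 * (cmod (g t))\<^sup>2)" using g by (auto simp: square_integrable_def)
  show "AE t in lborel. (\<lambda>n. (cmod (f n t - h t))\<^sup>2) \<longlonglongrightarrow> 0"
   using conv
  proof eventually_elim
   case (elim t)
   have "(\<lambda>n. (cmod (f n t - h t))\<^sup>2) \<longlonglongrightarrow> (cmod (h t - h t))\<^sup>2" by (intro tendsto_intros elim)
   thus ?case by simp
  qed
  show "AE t in lborel. norm ((cmod (f n t - h t))\<^sup>2) \<le> 4 * (cmod (g t))\<^sup>2" for n
   using bound[of n] hb
  proof eventually_elim
   case (elim t)
   have "cmod (f n t - h t) \<le> 2 * cmod (g t)" using norm_triangle_ineq4[of "f n t" "h t"] elim by simp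
   hence "(cmod (f n t - h t))\<^sup>2 \<le> (2 * cmod (g t))\<^sup>2" by (intro power_mono) auto
   thus ?case by (simp add: power_mult_distrib)
  qed
 qed auto
 moreover have "(LBINT t. (cmod (f n t - h t))\<^sup>2) = (norm (to_L2 (f n) - to_L2 h))\<^sup>2" for n
  using norm_to_L2_sq[OF square_integrable_diff[OF sf sh]] by (simp add: to_L2_diff sf sh)
 ultimately have "(\<lambda>n. (norm (to_L2 (f n) - to_L2 h))\<^sup>2) \<longlonglongrightarrow> 0" by simp
 hence "(\<lambda>n. sqrt ((norm (to_L2 (f n) - to_L2 h))\<^sup>2)) \<longlonglongrightarrow> sqrt 0" by (rule tendsto_real_sqrt)
 hence "(\<lambda>n. to_L2 (f n) - to_L2 h) \<longlonglongrightarrow> 0" by (simp add: tendsto_norm_zero_iff)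
 thus "(\<lambda>n. to_L2 (f n)) \<longlonglongrightarrow> to_L2 h" by (simp add: LIM_zero_iff)
qed

section \<open>Bounded multiplication operators\<close>

definition mulop :: "(real \<Rightarrow> complex) \<Rightarrow> L2 \<Rightarrow> L2" where
 "mulop \<phi> x = to_L2 (\<lambda>p. \<phi> p * rep_L2 x p)"

definition bounded_borel :: "(real \<Rightarrow> complex) \<Rightarrow> bool" where
 "bounded_borel \<phi> \<longleftrightarrow> \<phi> \<in> borel_measurable borel \<and> (\<exists>C. \<forall>p. cmod (\<phi> p) \<le> C)"

lemma bounded_borelI: "\<phi> \<in> borel_measurable borel \<Longrightarrow> (\<And>p. cmod (\<phi> p) \<le> C) \<Longrightarrow> bounded_borel \<phi>"
 by (auto simp: bounded_borel_def)

lemma bounded_borel_measurable: "bounded_borel \<phi> \<Longrightarrow> \<phi> \<in> borel_measurable borel"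
 by (simp add: bounded_borel_def)

lemma bounded_borel_indicator [simp]: "B \<in> sets borel \<Longrightarrow> bounded_borel (\<lambda>p. indicator B p)"
 by (rule bounded_borelI[of _ 1]) (auto simp: indicator_def)

lemma square_integrable_mult:
 assumes "bounded_borel \<phi>" "square_integrable f" shows "square_integrable (\<lambda>p. \<phi> p * f p)"
proof -
 obtain C where "\<And>p. cmod (\<phi> p) \<le> C" using assms by (auto simp: bounded_borel_def)
 thus ?thesis using assms square_integrable_measurable[OF assms(2)]
  by (intro square_integrable_bound[OF assms(2), of _ C])
    (auto simp: norm_mult bounded_borel_def intro!: mult_right_mono AE_I2 borel_measurable_times)
qed

lemma mulop_to_L2:
 assumes "bounded_borel \<phi>" "square_integrable f"
 shows "mulop \<phi> (to_L2 f) = to_L2 (\<lambda>p. \<phi> p * f p)"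
 unfolding mulop_def
proof (rule to_L2_cong)
 show "AE p in lborel. \<phi> p * rep_L2 (to_L2 f) p = \<phi> p * f p" using rep_to_L2[OF assms(2)] by eventually_elim simp
qed (use assms square_integrable_measurable[OF assms(2)] in \<open>auto simp: bounded_borel_def intro!: borel_measurable_times\<close>)

lemma rep_mulop:
 assumes "bounded_borel \<phi>" shows "AE p in lborel. rep_L2 (mulop \<phi> x) p = \<phi> p * rep_L2 x p"
 unfolding mulop_def by (rule rep_to_L2) (simp add: assms square_integrable_mult)

lemma mulop_linear: assumes "bounded_borel \<phi>" shows "clinear_map (mulop \<phi>)"
 unfolding clinear_map_def
proof (intro conjI allI)
 fix x y c
 have b: "square_integrable (\<lambda>p. \<phi> p * rep_L2 x p)" for x by (simp add: assms square_integrable_mult)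
 have "mulop \<phi> (x + y) = mulop \<phi> (to_L2 (\<lambda>p. rep_L2 x p + rep_L2 y p))" by (simp add: to_L2_add)
 also have "... = to_L2 (\<lambda>p. \<phi> p * rep_L2 x p + \<phi> p * rep_L2 y p)"
  by (simp only: mulop_to_L2[OF assms square_integrable_add[OF square_integrable_rep square_integrable_rep]] distrib_left)
 finally show "mulop \<phi> (x + y) = mulop \<phi> x + mulop \<phi> y"
  by (simp only: to_L2_add[OF b b] mulop_def[of _ x] mulop_def[of _ y])
 have "mulop \<phi> (c *\<^sub>C x) = mulop \<phi> (to_L2 (\<lambda>p. c * rep_L2 x p))" by (simp add: to_L2_scale)
 also have "... = to_L2 (\<lambda>p. c * (\<phi> p * rep_L2 x p))"
  by (simp only: mulop_to_L2[OF assms square_integrable_scale[OF square_integrable_rep]] mult.left_commute)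
 finally show "mulop \<phi> (c *\<^sub>C x) = c *\<^sub>C mulop \<phi> x"
  by (simp only: to_L2_scale[OF b] mulop_def[of _ x])
qed

lemma mulop_mulop:
 assumes "bounded_borel \<phi>" "bounded_borel \<psi>"
 shows "mulop \<phi> (mulop \<psi> x) = mulop (\<lambda>p. \<phi> p * \<psi> p) x"
 unfolding mulop_def[of \<psi> x]
 by (subst mulop_to_L2[OF assms(1)]) (auto simp: assms square_integrable_mult mulop_def mult.assoc)

lemma mulop_norm:
 assumes "\<phi> \<in> borel_measurable borel" "\<And>p. cmod (\<phi> p) \<le> C"
 shows "norm (mulop \<phi> x) \<le> C * norm x"
proof -
 have "square_integrable (\<lambda>p. \<phi> p * rep_L2 x p)" using bounded_borelI[OF assms] by (simp add: square_integrable_mult)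
 moreover have "0 \<le> C" using assms(2)[of 0] norm_ge_zero order_trans by blast
 ultimately show ?thesis
  using norm_to_L2_le[of "\<lambda>p. \<phi> p * rep_L2 x p" "rep_L2 x" C] assms(2) by (simp add: mulop_def norm_mult mult_right_mono)
qed

lemma mulop_adjoint:
 assumes "bounded_borel \<phi>" "bounded_borel (\<lambda>p. cnj (\<phi> p))"
 shows "cinner (mulop \<phi> x) y = cinner x (mulop (\<lambda>p. cnj (\<phi> p)) y)"
proof -
 have "cinner (mulop \<phi> x) (to_L2 (rep_L2 y)) = (LBINT t. cnj (\<phi> t * rep_L2 x t) * rep_L2 y t)"
  unfolding mulop_def by (rule cinner_to_L2) (auto simp: assms square_integrable_mult)
 moreover have "cinner (to_L2 (rep_L2 x)) (mulop (\<lambda>p. cnj (\<phi> p)) y) = (LBINT t. cnj (rep_L2 x t) * (cnj (\<phi> t) * rep_L2 y t))"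
  unfolding mulop_def by (rule cinner_to_L2) (auto simp: assms square_integrable_mult)
 ultimately show ?thesis by (simp add: mult_ac)
qed

section \<open>The Fourier transform\<close>

definition ft :: "(real \<Rightarrow> complex) \<Rightarrow> real \<Rightarrow> complex" where
 "ft h p = cor (1 / sqrt (2 * pi)) * (LBINT x. exp (- \<i> * cor (p * x)) * h x)"

lemma borel_measurable_cnj [measurable (raw)]:
 "f \<in> borel_measurable M \<Longrightarrow> (\<lambda>x. cnj (f x)) \<in> borel_measurable M"
 by (rule borel_measurable_continuous_on[where f = cnj]) (auto intro: continuous_intros)

lemma cmod_exp_ii [simp]: "cmod (exp (- (\<i> * cor r))) = 1" "cmod (exp (\<i> * cor r)) = 1"
 "cmod (exp (- (\<i> * (cor a * cor b)))) = 1" "cmod (exp (\<i> * (cor a * cor b))) = 1"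
 by (simp_all add: norm_exp_eq_Re)

lemma integrable_exp_mult:
 assumes "integrable lborel h"
 shows "integrable lborel (\<lambda>x. exp (- \<i> * cor (p * x)) * h x)"
 by (rule Bochner_Integration.integrable_bound[OF assms]) (use assms in \<open>auto simp: norm_mult\<close>)

lemma ft_measurable [measurable]:
 assumes [measurable]: "h \<in> borel_measurable borel"
 shows "ft h \<in> borel_measurable borel"
 unfolding ft_def by measurable

lemma ft_bound:
 assumes "integrable lborel h"
 shows "cmod (ft h p) \<le> 1 / sqrt (2 * pi) * (LBINT x. cmod (h x))"
proof -
 have "cmod (LBINT x. exp (- \<i> * cor (p * x)) * h x)
   \<le> (LBINT x. cmod (exp (- \<i> * cor (p * x)) * h x))"
  by (rule integral_norm_bound)
 also have "... = (LBINT x. cmod (h x))" by (simp add: norm_mult)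
 finally show ?thesis by (simp add: ft_def norm_mult divide_right_mono norm_divide)
qed

lemma ft_scale: "ft (\<lambda>x. c * h x) p = c * ft h p"
 unfolding ft_def by (subst mult.left_commute, subst integral_mult_right_zero) (simp add: mult_ac)

lemma Fubini_bounded_kernel:
 fixes f g :: "real \<Rightarrow> complex" and k :: "real \<Rightarrow> real \<Rightarrow> complex"
 assumes f: "integrable lborel f" and g: "integrable lborel g"
  and k: "case_prod k \<in> borel_measurable (borel \<Otimes>\<^sub>M borel)" "\<And>p x. cmod (k p x) \<le> 1"
 shows "(LBINT p. f p * (LBINT x. k p x * g x)) = (LBINT x. g x * (LBINT p. k p x * f p))"
proof -
 have [measurable]: "f \<in> borel_measurable borel" "g \<in> borel_measurable borel" using f g by auto
 have k' [measurable]: "case_prod k \<in> borel_measurable (lborel \<Otimes>\<^sub>M lborel)"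
  using k(1) by (simp cong: measurable_cong_sets)
 have gk: "integrable lborel (\<lambda>x. k p x * g x)" for p
 proof (rule Bochner_Integration.integrable_bound[OF g])
  show "(\<lambda>x. k p x * g x) \<in> borel_measurable lborel"
   using measurable_compose[OF measurable_Pair1' k', of p] by (simp add: o_def)
  show "AE x in lborel. norm (k p x * g x) \<le> norm (g x)"
   by (auto simp: norm_mult intro!: AE_I2 mult_left_le_one_le k(2))
 qed
 have int: "integrable (lborel \<Otimes>\<^sub>M lborel) (\<lambda>(p, x). f p * (k p x * g x))"
 proof (rule lborel_pair.Fubini_integrable)
  show "(\<lambda>(p, x). f p * (k p x * g x)) \<in> borel_measurable (lborel \<Otimes>\<^sub>M lborel)" by measurable
  show "integrable lborel (\<lambda>p. \<integral>x. norm (case (p, x) of (p, x) \<Rightarrow> f p * (k p x * g x)) \<partial>lborel)"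
  proof (rule Bochner_Integration.integrable_bound)
   show "integrable lborel (\<lambda>p. cmod (f p) * (LBINT x. cmod (g x)))" using f by simp
   show "(\<lambda>p. \<integral>x. norm (case (p, x) of (p, x) \<Rightarrow> f p * (k p x * g x)) \<partial>lborel) \<in> borel_measurable lborel"
    by measurable
   show "AE p in lborel. norm (LBINT x. norm (case (p, x) of (p, x) \<Rightarrow> f p * (k p x * g x)))
     \<le> norm (cmod (f p) * (LBINT x. cmod (g x)))"
   proof (rule AE_I2)
    fix p
    have "(LBINT x. cmod (k p x * g x)) \<le> (LBINT x. cmod (g x))"
     using integrable_norm[OF gk[of p]] integrable_norm[OF g]
     by (rule integral_mono) (auto simp: norm_mult intro!: mult_left_le_one_le k(2))
    thus "norm (LBINT x. norm (case (p, x) of (p, x) \<Rightarrow> f p * (k p x * g x)))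
     \<le> norm (cmod (f p) * (LBINT x. cmod (g x)))"
     by (simp add: norm_mult abs_mult mult_left_mono)
   qed
  qed
  show "AE p in lborel. integrable lborel (\<lambda>x. case (p, x) of (p, x) \<Rightarrow> f p * (k p x * g x))"
   using gk by simp
 qed
 have "(LBINT p. f p * (LBINT x. k p x * g x)) = (LBINT p. (LBINT x. f p * (k p x * g x)))" by simp
 also have "... = (LBINT x. (LBINT p. f p * (k p x * g x)))"
  by (rule lborel_pair.Fubini_integral[OF int, symmetric])
 also have "... = (LBINT x. g x * (LBINT p. k p x * f p))"
  by (subst integral_mult_right_zero[symmetric]) (simp add: mult_ac)
 finally show ?thesis .
qed

text \<open>The positive and negative parts of u have the same Fourier transform and so the same
  mass c. Divided by c they are probability densities with equal characteristic functions, which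
  Levy's theorem identifies.\<close>

lemma L1_Fourier_uniqueness_real:
 fixes u :: "real \<Rightarrow> real"
 assumes u: "integrable lborel u"
  and z: "\<And>t. (LBINT x. exp (\<i> * cor (t * x)) * cor (u x)) = 0"
 shows "AE x in lborel. u x = 0"
proof -
 have [measurable]: "u \<in> borel_measurable borel" using u by auto
 define up where "up = (\<lambda>x. max 0 (u x))"
 define um where "um = (\<lambda>x. max 0 (- u x))"
 have [measurable]: "up \<in> borel_measurable borel" "um \<in> borel_measurable borel" unfolding up_def um_def by auto
 have ui: "integrable lborel up" "integrable lborel um" unfolding up_def um_def using u by auto
 have dec: "u x = up x - um x" for x by (simp add: up_def um_def)
 have nn: "0 \<le> up x" "0 \<le> um x" for x by (auto simp: up_def um_def)
 have ei: "integrable lborel (\<lambda>x. exp (\<i> * cor (t * x)) * cor (v x))"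
  if v: "integrable lborel v" for v t
  by (rule Bochner_Integration.integrable_bound[OF v]) (use v in \<open>auto simp: norm_mult\<close>)
 have eq: "(LBINT x. exp (\<i> * cor (t * x)) * cor (up x))
   = (LBINT x. exp (\<i> * cor (t * x)) * cor (um x))" for t
  using z[of t] ei[OF ui(1), of t] ei[OF ui(2), of t] by (simp add: dec right_diff_distrib)
 define c where "c = (LBINT x. up x)"
 have c': "c = (LBINT x. um x)" using eq[of 0] by (simp add: c_def)
 have c0: "c \<ge> 0" unfolding c_def by (rule integral_nonneg_AE) (simp add: nn)
 show ?thesis
 proof (cases "c = 0")
  case True
  hence "AE x in lborel. up x = 0" "AE x in lborel. um x = 0"
   using integral_nonneg_eq_0_iff_AE[OF ui(1)] integral_nonneg_eq_0_iff_AE[OF ui(2)] c' nn by (auto simp: c_def)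
  thus ?thesis by eventually_elim (simp add: dec)
 next
  case False
  with c0 have c: "c > 0" by simp
  define M where "M v = density lborel (\<lambda>x. ennreal (v x / c))" for v :: "real \<Rightarrow> real"
  have rd: "real_distribution (M v)" if v: "integrable lborel v" "\<And>x. 0 \<le> v x" "(LBINT x. v x) = c" for v
  proof -
   have [measurable]: "v \<in> borel_measurable borel" using v(1) by auto
   have "emeasure (M v) (space (M v)) = (\<integral>\<^sup>+x. ennreal (v x / c) \<partial>lborel)"
    by (simp add: M_def emeasure_density)
   also have "... = ennreal (LBINT x. v x / c)"
    by (rule nn_integral_eq_integral) (use v c in auto)
   also have "... = 1" using v c by simp
   finally have "prob_space (M v)" by (rule prob_spaceI)
   thus ?thesis by (simp add: real_distribution_def real_distribution_axioms_def M_def)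
  qed
  have ch: "char (M v) t = (LBINT x. exp (\<i> * cor (t * x)) * cor (v x)) / c"
   if v: "integrable lborel v" "\<And>x. 0 \<le> v x" for v t
  proof -
   have [measurable]: "v \<in> borel_measurable borel" using v(1) by auto
   have "char (M v) t = (LBINT x. (v x / c) *\<^sub>R exp (\<i> * cor (t * x)))"
    unfolding char_def M_def by (rule integral_density) (use v c in auto)
   also have "... = (LBINT x. (exp (\<i> * cor (t * x)) * cor (v x)) / c)"
    by (simp add: scaleR_conv_of_real mult_ac)
   finally show ?thesis by simp
  qed
  have "char (M up) = char (M um)" by (rule ext) (simp only: ch[OF ui(1) nn(1)] ch[OF ui(2) nn(2)] eq)
  hence "M up = M um" by (intro Levy_uniqueness rd ui nn) (simp_all add: c_def c'[symmetric])
  hence "AE x in lborel. ennreal (up x / c) = ennreal (um x / c)"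
   unfolding M_def by (subst (asm) sigma_finite_measure.density_unique_iff[OF lborel.sigma_finite_measure_axioms]) auto
  thus ?thesis
   by eventually_elim (use c nn in \<open>simp add: dec\<close>)
 qed
qed

text \<open>The real part of \<open>c * h\<close> is half of \<open>c * h\<close> plus its
  conjugate, and the transform of the conjugate at t is conjugate to that of \<open>c * h\<close> at
  -t. The factors 1 and \<i> recover h.\<close>

lemma L1_Fourier_uniqueness:
 fixes h :: "real \<Rightarrow> complex"
 assumes h: "integrable lborel h"
  and z: "\<And>t. (LBINT x. exp (\<i> * cor (t * x)) * h x) = 0"
 shows "AE x in lborel. h x = 0"
proof -
 let ?e = "\<lambda>t x. exp (\<i> * cor (t * x))"
 have Re0: "AE x in lborel. Re (c * h x) = 0" for c
 proof (rule L1_Fourier_uniqueness_real)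
  show "integrable lborel (\<lambda>x. Re (c * h x))" using h by simp
  fix t
  have ei: "integrable lborel (\<lambda>x. ?e t x * h x)" for t using integrable_exp_mult[OF h, of "- t"] by simp
  have r: "cor (Re w) = (w + cnj w) / 2" for w by (simp add: complex_add_cnj)
  have e: "?e t x * cor (Re (c * h x)) = (c / 2) * (?e t x * h x) + cnj ((c / 2) * (?e (- t) x * h x))" for x
   unfolding r by (simp add: exp_cnj distrib_left add_divide_distrib mult_ac)
  show "(LBINT x. ?e t x * cor (Re (c * h x))) = 0"
   unfolding e using ei[of t] ei[of "- t"] z[of t] z[of "- t"]
   by (subst Bochner_Integration.integral_add) (simp_all only: integrable_mult_right integrable_cnj Bochner_Integration.integral_cnj integral_mult_right_zero, simp)
 qed
 show ?thesis using Re0[of 1] Re0[of "\<i>"] by eventually_elim (simp add: complex_eq_iff)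
qed

section \<open>Truncation and reflection\<close>

definition truncate :: "nat \<Rightarrow> L2 \<Rightarrow> real \<Rightarrow> complex" where
 "truncate n x t = indicator {- real n..real n} t * rep_L2 x t"

lemma truncate_square_integrable: "square_integrable (truncate n x)"
 unfolding truncate_def by (intro square_integrable_mult) auto

lemma square_integrable_imp_integrable_on:
 assumes f: "square_integrable f" and A: "A \<in> sets borel" "emeasure lborel A < \<infinity>"
  and out: "\<And>t. t \<notin> A \<Longrightarrow> f t = 0"
 shows "integrable lborel f"
proof (rule Bochner_Integration.integrable_bound)
 show "integrable lborel (\<lambda>t. indicator A t + (cmod (f t))\<^sup>2)"
  using f A by (intro Bochner_Integration.integrable_add) (auto simp: square_integrable_def)
 show "f \<in> borel_measurable lborel" using f by (simp add: square_integrable_def)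
 show "AE t in lborel. norm (f t) \<le> norm (indicator A t + (cmod (f t))\<^sup>2)"
 proof (rule AE_I2)
  fix t
  have "cmod (f t) \<le> 1 + (cmod (f t))\<^sup>2"
   using sum_squares_bound[of 1 "cmod (f t)"] by (simp add: power2_eq_square) (smt (verit) norm_ge_zero)
  thus "norm (f t) \<le> norm (indicator A t + (cmod (f t))\<^sup>2)"
   by (cases "t \<in> A") (auto simp: out)
 qed
qed

lemma truncate_integrable: "integrable lborel (truncate n x)"
 by (rule square_integrable_imp_integrable_on[OF truncate_square_integrable, of "{- real n..real n}"])
   (auto simp: truncate_def)

lemma truncate_limit: "(\<lambda>n. to_L2 (truncate n x)) \<longlonglongrightarrow> x"
proof -
 have "(\<lambda>n. to_L2 (truncate n x)) \<longlonglongrightarrow> to_L2 (rep_L2 x)"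
 proof (rule L2_dominated_convergence(3)[OF square_integrable_rep[of x]])
  show "AE t in lborel. (\<lambda>n. truncate n x t) \<longlonglongrightarrow> rep_L2 x t"
  proof (rule AE_I2)
   fix t
   obtain N :: nat where "\<bar>t\<bar> \<le> real N" using real_arch_simple by blast
   hence "\<forall>\<^sub>F n in sequentially. truncate n x t = rep_L2 x t"
    by (intro eventually_sequentiallyI[of N]) (auto simp: truncate_def indicator_def)
   thus "(\<lambda>n. truncate n x t) \<longlonglongrightarrow> rep_L2 x t" by (rule tendsto_eventually)
  qed
 qed (auto simp: truncate_def[abs_def] indicator_def)
 thus ?thesis by simp
qed

lemma fourier_eq_lim: "fourier x = lim (\<lambda>n. to_L2 (ft (truncate n x)))"
proof -
 have "(CLINT t:{- real n..real n}|lborel. exp (- \<i> * cor (p * t)) * rep_L2 x t)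
   = (LBINT t. exp (- \<i> * cor (p * t)) * truncate n x t)" for n p
  unfolding set_lebesgue_integral_def truncate_def
  by (rule Bochner_Integration.integral_cong) (auto simp: indicator_def)
 thus ?thesis unfolding fourier_def ft_def by simp
qed

definition refl_L2 :: "L2 \<Rightarrow> L2" where
 "refl_L2 x = to_L2 (\<lambda>t. rep_L2 x (- t))"

lemma AE_lborel_uminus:
 assumes "AE t in lborel. P t" shows "AE t in lborel. P (- t :: real)"
proof -
 obtain N where N: "{t. \<not> P t} \<subseteq> N" "N \<in> null_sets lborel" using assms by (auto elim!: AE_E simp: null_sets_def)
 have "emeasure lborel (uminus -` N) = emeasure (distr lborel borel uminus) N"
  using N(2) by (subst emeasure_distr) auto
 also have "... = 0" using N(2) by (simp add: lborel_distr_uminus null_sets_def)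
 finally have "uminus -` N \<in> null_sets lborel"
  using N(2) measurable_sets_borel[of "uminus :: real \<Rightarrow> real" borel N] by (auto simp: null_sets_def)
 thus ?thesis by (rule AE_I') (use N(1) in auto)
qed

lemma integral_lborel_uminus:
 fixes f :: "real \<Rightarrow> 'a :: {banach, second_countable_topology}"
 shows "(LBINT x. f (- x)) = (LBINT x. f x)"
 using lborel_integral_real_affine[of "-1" f 0] by simp

lemma integrable_lborel_uminus:
 fixes f :: "real \<Rightarrow> 'a :: {banach, second_countable_topology}"
 assumes "integrable lborel f" shows "integrable lborel (\<lambda>x. f (- x))"
 using lborel_integrable_real_affine[OF assms, of "-1" 0] by simp

lemma square_integrable_uminus:
 assumes "square_integrable f" shows "square_integrable (\<lambda>t. f (- t))"
 using assms integrable_lborel_uminus[of "\<lambda>x. (cmod (f x))\<^sup>2"]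
 by (auto simp: square_integrable_def intro: measurable_compose[of uminus borel borel f borel])

lemma refl_to_L2:
 assumes "square_integrable f" shows "refl_L2 (to_L2 f) = to_L2 (\<lambda>t. f (- t))"
 unfolding refl_L2_def
proof (rule to_L2_cong)
 show "AE t in lborel. rep_L2 (to_L2 f) (- t) = f (- t)" by (rule AE_lborel_uminus[OF rep_to_L2[OF assms]])
 show "(\<lambda>t. f (- t)) \<in> borel_measurable borel"
  using square_integrable_uminus[OF assms] by (simp add: square_integrable_def)
qed auto

lemma rep_refl: "AE t in lborel. rep_L2 (refl_L2 x) t = rep_L2 x (- t)"
 unfolding refl_L2_def by (rule rep_to_L2) (simp add: square_integrable_uminus)

lemma refl_refl [simp]: "refl_L2 (refl_L2 x) = x"
 unfolding refl_L2_def[of x] by (subst refl_to_L2) (auto simp: square_integrable_uminus)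

lemma refl_cinner: "cinner (refl_L2 x) (refl_L2 y) = cinner x y"
 unfolding refl_L2_def
 by (subst cinner_to_L2) (auto simp: square_integrable_uminus cinner_rep
   intro: integral_lborel_uminus[of "\<lambda>t. cnj (rep_L2 x t) * rep_L2 y t"])

lemma refl_linear: "clinear_map refl_L2"
 unfolding clinear_map_def
proof (intro conjI allI)
 fix x y c
 have "refl_L2 (x + y) = refl_L2 (to_L2 (\<lambda>t. rep_L2 x t + rep_L2 y t))" by (simp add: to_L2_add)
 also have "... = to_L2 (\<lambda>t. rep_L2 x (- t) + rep_L2 y (- t))"
  by (rule refl_to_L2) (simp add: square_integrable_add)
 also have "... = refl_L2 x + refl_L2 y"
  unfolding refl_L2_def by (rule to_L2_add) (simp_all add: square_integrable_uminus)
 finally show "refl_L2 (x + y) = refl_L2 x + refl_L2 y" .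
 have "refl_L2 (c *\<^sub>C x) = refl_L2 (to_L2 (\<lambda>t. c * rep_L2 x t))" by (simp add: to_L2_scale)
 also have "... = to_L2 (\<lambda>t. c * rep_L2 x (- t))"
  by (rule refl_to_L2) (simp add: square_integrable_scale)
 also have "... = c *\<^sub>C refl_L2 x"
  unfolding refl_L2_def by (rule to_L2_scale) (simp add: square_integrable_uminus)
 finally show "refl_L2 (c *\<^sub>C x) = c *\<^sub>C refl_L2 x" .
qed

lemma refl_continuous: "(X \<longlongrightarrow> x) F \<Longrightarrow> ((\<lambda>n. refl_L2 (X n)) \<longlongrightarrow> refl_L2 x) F"
 by (rule isometry_continuous[OF refl_linear refl_cinner])

text \<open>An induction principle: a property that defines a closed subspace holds for every vector
  once it holds on a total set. Identities between bounded operators are checked with it on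
  generators only.\<close>

lemma closed_subspace_dense_UNIV:
 assumes S: "L2C.subspace S" and T: "T \<subseteq> S"
  and cl: "\<And>X x. (\<And>n. X n \<in> S) \<Longrightarrow> X \<longlonglongrightarrow> x \<Longrightarrow> x \<in> S"
  and total: "\<And>y. (\<And>x. x \<in> T \<Longrightarrow> cinner x y = 0) \<Longrightarrow> y = 0"
 shows "x \<in> S"
proof -
 have "closure S = UNIV" using total T by (intro dense_subspace[OF S]) blast
 then obtain X where "\<And>n. X n \<in> S" "X \<longlonglongrightarrow> x" by (metis UNIV_I closure_sequential)
 thus ?thesis by (rule cl)
qed

lemma square_integrable_mult_integrable:
 assumes "square_integrable f" "square_integrable g"
 shows "integrable lborel (\<lambda>x. f x * g x)"
proof -
 have "square_integrable (\<lambda>x. cnj (f x))"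
  using assms(1) by (auto simp: square_integrable_def)
 from integrable_cnj_mult[OF this assms(2)] show ?thesis by simp
qed


text \<open>The Fourier transform is built as the isometric extension of its restriction to these
 packets, whose span it preserves.\<close>

definition packet :: "real \<Rightarrow> real \<Rightarrow> real \<Rightarrow> complex" where
 "packet a b x = exp (\<i> * cor (a * x)) * cor (exp (- (x - b)\<^sup>2 / 2))"

lemma packet_integrable: "integrable lborel (packet a b)" "square_integrable (packet a b)"
proof -
 have [measurable]: "packet a b \<in> borel_measurable borel" unfolding packet_def[abs_def] by measurable
 have n: "cmod (packet a b x) = exp (- (x - b)\<^sup>2 / 2)" for x by (simp add: packet_def norm_mult)
 have e: "exp (- (x - b)\<^sup>2 / 2) = sqrt (2 * pi) * normal_density b 1 x" for x by (simp add: normal_density_def)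
 have i: "integrable lborel (\<lambda>x. exp (- (x - b)\<^sup>2 / 2))" unfolding e by (intro integrable_mult_right integrable_normal_density) simp
 thus "integrable lborel (packet a b)" by (rule Bochner_Integration.integrable_bound) (auto simp: n)
 have "integrable lborel (\<lambda>x. (cmod (packet a b x))\<^sup>2)"
  by (rule Bochner_Integration.integrable_bound[OF i]) (auto simp: n power2_eq_square simp flip: exp_add)
 thus "square_integrable (packet a b)" by (simp add: square_integrable_def)
qed

text \<open>This is the characteristic function of the standard normal law at -t.\<close>

lemma gaussian_integral:
 "(LBINT x. exp (- \<i> * cor (t * x)) * cor (exp (- x\<^sup>2 / 2))) = cor (sqrt (2 * pi) * exp (- t\<^sup>2 / 2))" (is "?I = _")
proof -
 have "char std_normal_distribution (- t) = (LBINT x. cor (1 / sqrt (2 * pi)) * (exp (- \<i> * cor (t * x)) * cor (exp (- x\<^sup>2 / 2))))"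
  unfolding char_def by (subst integral_density) (auto simp: std_normal_density_def scaleR_conv_of_real mult_ac)
 hence "cor (sqrt (2 * pi)) * (cor (1 / sqrt (2 * pi)) * ?I) = cor (sqrt (2 * pi)) * cor (exp (- t\<^sup>2 / 2))"
  by (simp only: char_std_normal_distribution integral_mult_right_zero) simp
 moreover have "cor (sqrt (2 * pi)) * cor (1 / sqrt (2 * pi)) = 1" by (simp flip: of_real_mult)
 ultimately show ?thesis by (simp only: mult.assoc[symmetric] mult_1 of_real_mult)
qed

lemma ft_packet: "ft (packet a b) p = exp (\<i> * cor (a * b)) * packet (- b) a p"
proof -
 have "(LBINT x. exp (- \<i> * cor (p * x)) * packet a b x) = (LBINT x. exp (- \<i> * cor (p * (b + 1 * x))) * packet a b (b + 1 * x))"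
  using lborel_integral_real_affine[of 1 "\<lambda>x. exp (- \<i> * cor (p * x)) * packet a b x" b] by (simp del: of_real_mult of_real_add)
 also have "... = (LBINT x. exp (\<i> * cor ((a - p) * b)) * (exp (- \<i> * cor ((p - a) * x)) * cor (exp (- x\<^sup>2 / 2))))"
  unfolding packet_def by (simp only: mult.assoc[symmetric] exp_add[symmetric]) (simp add: algebra_simps)
 also have "... = exp (\<i> * cor ((a - p) * b)) * cor (sqrt (2 * pi) * exp (- (p - a)\<^sup>2 / 2))"
  by (simp only: integral_mult_right_zero gaussian_integral)
 also have "cor (1 / sqrt (2 * pi)) * \<dots> = exp (\<i> * cor ((a - p) * b)) * cor (exp (- (p - a)\<^sup>2 / 2))" by simp
 also have "exp (\<i> * cor ((a - p) * b)) = exp (\<i> * cor (a * b)) * exp (\<i> * cor (- b * p))"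
  by (simp only: exp_add[symmetric]) (simp add: algebra_simps)
 finally show ?thesis by (simp only: ft_def packet_def mult.assoc)
qed

lemma ft_ft_packet: "ft (ft (packet a b)) p = packet a b (- p)"
proof -
 have "ft (ft (packet a b)) p = exp (\<i> * cor (a * b)) * (exp (\<i> * cor (- b * a)) * packet (- a) (- b) p)"
  unfolding ft_packet[abs_def, of a b] ft_scale ft_packet ..
 also have "... = (exp (\<i> * cor (a * b)) * exp (\<i> * cor (- b * a))) * packet (- a) (- b) p" by (rule mult.assoc[symmetric])
 also have "exp (\<i> * cor (a * b)) * exp (\<i> * cor (- b * a)) = 1" by (simp only: exp_add[symmetric]) (simp add: mult.commute)
 also have "1 * packet (- a) (- b) p = packet a b (- p)" by (simp add: packet_def power2_eq_square algebra_simps)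
 finally show ?thesis .
qed

lemma ft_packet_integrable: "integrable lborel (ft (packet a b))" "square_integrable (ft (packet a b))"
 unfolding ft_packet[abs_def] by (intro integrable_mult_right square_integrable_scale packet_integrable)+

text \<open>Pairing with modulated Gaussians is the Fourier transform of v times a Gaussian. The
  Gaussian makes this integrable for square integrable as well as for bounded v; a difference of the
  two kinds occurs in \<open>fourier_isometry\<close>.\<close>

lemma packets_null:
 assumes v: "integrable lborel (\<lambda>x. cor (exp (- x\<^sup>2 / 2)) * v x)" and z: "\<And>a. (LBINT x. cnj (v x) * packet a 0 x) = 0"
 shows "AE x in lborel. v x = 0"
proof -
 have "AE x in lborel. cor (exp (- x\<^sup>2 / 2)) * v x = 0"
 proof (rule L1_Fourier_uniqueness[OF v])
  fix t
  have "(LBINT x. exp (\<i> * cor (t * x)) * (cor (exp (- x\<^sup>2 / 2)) * v x)) = (LBINT x. cnj (cnj (v x) * packet (- t) 0 x))"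
   by (simp add: packet_def exp_cnj mult_ac)
  thus "(LBINT x. exp (\<i> * cor (t * x)) * (cor (exp (- x\<^sup>2 / 2)) * v x)) = 0" using z[of "- t"] by (simp only: Bochner_Integration.integral_cnj) simp
 qed
 thus ?thesis by eventually_elim simp
qed

lemma packets_total: assumes "\<And>a. cinner (to_L2 (packet a 0)) y = 0" shows "y = 0"
proof -
 have "AE x in lborel. rep_L2 y x = 0"
 proof (rule packets_null)
  show "integrable lborel (\<lambda>x. cor (exp (- x\<^sup>2 / 2)) * rep_L2 y x)"
   using square_integrable_mult_integrable[OF packet_integrable(2)[of 0 0] square_integrable_rep[of y]] by (simp add: packet_def)
  show "(LBINT x. cnj (rep_L2 y x) * packet a 0 x) = 0" for a
   using cinner_to_L2[OF square_integrable_rep[of y] packet_integrable(2)[of a 0]] assms[of a] cinner_commute[of y "to_L2 (packet a 0)"] by simp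
 qed
 thus ?thesis unfolding L2_eq_iff using rep_zero by eventually_elim simp
qed

lemma ft_adjoint:
 assumes f: "integrable lborel f" and g: "integrable lborel g"
 shows "(LBINT p. cnj (ft f p) * g p) = (LBINT x. cnj (f x) * ft g (- x))"
proof -
 have c: "cnj (ft f p) = cor (1 / sqrt (2 * pi)) * (LBINT x. exp (\<i> * cor (p * x)) * cnj (f x))" for p
  unfolding ft_def complex_cnj_mult Bochner_Integration.integral_cnj[symmetric] by (simp add: exp_cnj)
 have "(LBINT p. g p * (LBINT x. exp (\<i> * cor (p * x)) * cnj (f x))) = (LBINT x. cnj (f x) * (LBINT p. exp (\<i> * cor (p * x)) * g p))"
  by (rule Fubini_bounded_kernel[OF g]) (use f in \<open>auto simp: norm_exp_eq_Re\<close>)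
 hence "(LBINT p. cor (1 / sqrt (2 * pi)) * (g p * (LBINT x. exp (\<i> * cor (p * x)) * cnj (f x))))
   = (LBINT x. cor (1 / sqrt (2 * pi)) * (cnj (f x) * (LBINT p. exp (\<i> * cor (p * x)) * g p)))" by (simp only: integral_mult_right_zero)
 moreover have "exp (- \<i> * cor (- x * p)) = exp (\<i> * cor (p * x))" for x p by (simp add: mult.commute)
 ultimately show ?thesis unfolding c unfolding ft_def by (simp only: mult_ac)
qed

text \<open>The packets and their transforms have the same Gram matrix by \<open>ft_adjoint\<close>
  and \<open>ft_ft_packet\<close>, which yields an isometry F. For integrable h, \<open>F h\<close>
  and \<open>ft h\<close> have equal pairings with all packets and thus coincide; applied to
  truncations, this shows that F is the limit in the mean that defines
  \<open>fourier\<close>.\<close>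

lemma fourier_isometry:
 "clinear_map fourier" "cinner (fourier x) (fourier y) = cinner x y"
 "integrable lborel h \<Longrightarrow> square_integrable h \<Longrightarrow> square_integrable (ft h) \<and> fourier (to_L2 h) = to_L2 (ft h)"
proof -
 define P where "P = {(to_L2 (packet a b), to_L2 (ft (packet a b))) | a b. True}"
 have gram: "cinner u u' = cinner v v'" if uv: "(u, v) \<in> P" "(u', v') \<in> P" for u v u' v'
 proof -
  obtain a b a' b' where "u = to_L2 (packet a b)" "v = to_L2 (ft (packet a b))" "u' = to_L2 (packet a' b')" "v' = to_L2 (ft (packet a' b'))"
   using uv unfolding P_def by blast
  thus ?thesis using ft_adjoint[OF packet_integrable(1)[of a b] ft_packet_integrable(1)[of a' b']]
   by (simp add: cinner_to_L2 packet_integrable ft_packet_integrable ft_ft_packet)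
 qed
 have total: "y = 0" if "\<And>u v. (u, v) \<in> P \<Longrightarrow> cinner u y = 0" for y
  by (rule packets_total, rule that) (auto simp: P_def)
 obtain F where F: "clinear_map F" "\<And>x y. cinner (F x) (F y) = cinner x y" "\<And>u v. (u, v) \<in> P \<Longrightarrow> F u = v"
  by (rule gram_extension[OF gram total]) auto
 have Fh: "square_integrable (ft h) \<and> F (to_L2 h) = to_L2 (ft h)" if h: "integrable lborel h" "square_integrable h" for h
 proof -
  have [measurable]: "h \<in> borel_measurable borel" using h(1) by auto
  let ?v = "\<lambda>p. rep_L2 (F (to_L2 h)) p - ft h p"
  have i: "integrable lborel (\<lambda>p. packet a 0 p * rep_L2 (F (to_L2 h)) p)" "integrable lborel (\<lambda>p. packet a 0 p * ft h p)" for a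
  proof -
   show "integrable lborel (\<lambda>p. packet a 0 p * rep_L2 (F (to_L2 h)) p)" by (intro square_integrable_mult_integrable packet_integrable square_integrable_rep)
   let ?C = "1 / sqrt (2 * pi) * (LBINT x. cmod (h x))"
   show "integrable lborel (\<lambda>p. packet a 0 p * ft h p)"
   proof (rule Bochner_Integration.integrable_bound[OF integrable_mult_left[OF packet_integrable(1)[of a 0], of "cor ?C"]])
    have "0 \<le> ?C" by (simp add: integral_nonneg_AE)
    thus "AE p in lborel. norm (packet a 0 p * ft h p) \<le> norm (packet a 0 p * cor ?C)"
     unfolding norm_mult norm_of_real using ft_bound[OF h(1)] by (intro AE_I2 mult_left_mono) (auto intro: order_trans[OF _ abs_ge_self])
   qed (use packet_integrable(1)[of a 0] in auto)
  qed
  have "AE p in lborel. ?v p = 0"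
  proof (rule packets_null)
   show "integrable lborel (\<lambda>p. cor (exp (- p\<^sup>2 / 2)) * ?v p)"
    using Bochner_Integration.integrable_diff[OF i[of 0]] by (simp add: packet_def right_diff_distrib)
   fix a
   have ii: "integrable lborel (\<lambda>p. cnj (rep_L2 (F (to_L2 h)) p) * packet a 0 p)" "integrable lborel (\<lambda>p. cnj (ft h p) * packet a 0 p)"
    using integrable_cnj_mult[OF square_integrable_rep[of "F (to_L2 h)"] packet_integrable(2)[of a 0]] i(2)[of "- a", THEN integrable_cnj]
    by (auto simp: packet_def exp_cnj mult_ac)
   have pk: "packet a 0 = ft (packet 0 (- a))" by (rule ext) (simp add: ft_packet)
   have "(to_L2 (packet 0 (- a)), to_L2 (packet a 0)) \<in> P" unfolding P_def pk by blast
   hence "(LBINT p. cnj (rep_L2 (F (to_L2 h)) p) * packet a 0 p) = cinner (F (to_L2 h)) (F (to_L2 (packet 0 (- a))))"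
    using cinner_to_L2[OF square_integrable_rep[of "F (to_L2 h)"] packet_integrable(2)[of a 0]] F(3) by simp
   also have "... = (LBINT x. cnj (h x) * packet 0 (- a) x)" unfolding F(2) by (rule cinner_to_L2[OF h(2) packet_integrable(2)])
   also have "... = (LBINT p. cnj (ft h p) * packet a 0 p)"
    unfolding pk ft_adjoint[OF h(1) ft_packet_integrable(1)] ft_ft_packet by simp
   finally show "(LBINT p. cnj (?v p) * packet a 0 p) = 0"
    by (simp only: complex_cnj_diff left_diff_distrib Bochner_Integration.integral_diff[OF ii]) simp
  qed
  hence ae: "AE p in lborel. rep_L2 (F (to_L2 h)) p = ft h p" by eventually_elim simp
  have "square_integrable (ft h)"
   by (rule square_integrable_bound[OF square_integrable_rep[of "F (to_L2 h)"], of _ 1]) (use ae in \<open>auto elim: eventually_mono\<close>)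
  moreover have "to_L2 (rep_L2 (F (to_L2 h))) = to_L2 (ft h)" by (rule to_L2_cong[OF ae]) auto
  ultimately show ?thesis by simp
 qed
 have "fourier = F"
 proof
  fix x
  have "(\<lambda>n. to_L2 (ft (truncate n x))) \<longlonglongrightarrow> F x"
   using isometry_continuous[OF F(1,2) truncate_limit[of x]] Fh[OF truncate_integrable truncate_square_integrable] by simp
  thus "fourier x = F x" unfolding fourier_eq_lim by (rule limI)
 qed
 thus "clinear_map fourier" "cinner (fourier x) (fourier y) = cinner x y"
  "integrable lborel h \<Longrightarrow> square_integrable h \<Longrightarrow> square_integrable (ft h) \<and> fourier (to_L2 h) = to_L2 (ft h)"
  using F Fh by auto
qed

lemmas fourier_linear = fourier_isometry(1)
lemmas fourier_cinner = fourier_isometry(2)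
lemmas fourier_norm = isometry_norm[OF fourier_cinner]

lemma ft_contraction: "integrable lborel h \<Longrightarrow> square_integrable h \<Longrightarrow> square_integrable (ft h)"
 and fourier_to_L2: "integrable lborel h \<Longrightarrow> square_integrable h \<Longrightarrow> fourier (to_L2 h) = to_L2 (ft h)"
 by (simp_all add: fourier_isometry(3))

theorem fourier_fourier: "fourier (fourier x) = refl_L2 x"
proof -
 note lin = clinear_mapD[OF fourier_linear] clinear_mapD[OF refl_linear]
 have "x \<in> {x. fourier (fourier x) = refl_L2 x}"
 proof (rule closed_subspace_dense_UNIV[where T = "range (\<lambda>a. to_L2 (packet a 0))"])
  show "L2C.subspace {x. fourier (fourier x) = refl_L2 x}" by (simp add: L2C.subspace_def lin)
  show "range (\<lambda>a. to_L2 (packet a 0)) \<subseteq> {x. fourier (fourier x) = refl_L2 x}"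
   by (auto simp: fourier_to_L2 packet_integrable ft_packet_integrable refl_to_L2 ft_ft_packet[abs_def])
  show "x \<in> {x. fourier (fourier x) = refl_L2 x}" if X: "\<And>n. X n \<in> {x. fourier (fourier x) = refl_L2 x}" "X \<longlonglongrightarrow> x" for X x
   using LIMSEQ_unique[OF isometry_continuous[OF fourier_isometry(1,2) isometry_continuous[OF fourier_isometry(1,2) X(2)]], of "refl_L2 x"]
    refl_continuous[OF X(2)] X(1) by simp
  show "y = 0" if "\<And>x. x \<in> range (\<lambda>a. to_L2 (packet a 0)) \<Longrightarrow> cinner x y = 0" for y
   by (rule packets_total) (use that in blast)
 qed
 thus ?thesis by simp
qed

lemma inj_fourier: "inj fourier"
proof (rule injI)
 fix x y assume "fourier x = fourier y"
 hence "refl_L2 (fourier (fourier x)) = refl_L2 (fourier (fourier y))" by simp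
 thus "x = y" by (simp add: fourier_fourier)
qed

lemma fourier_refl: "fourier (refl_L2 x) = refl_L2 (fourier x)"
 by (simp add: fourier_fourier[symmetric])

section \<open>The inverse transform and point values\<close>

definition ifourier :: "L2 \<Rightarrow> L2" where
 "ifourier y = refl_L2 (fourier y)"

lemma fourier_ifourier [simp]: "fourier (ifourier y) = y"
 by (simp add: ifourier_def fourier_refl fourier_fourier)

lemma ifourier_fourier [simp]: "ifourier (fourier x) = x"
 by (simp add: ifourier_def fourier_fourier)

lemma inv_fourier: "inv fourier = ifourier"
 by (rule ext) (metis fourier_ifourier inj_fourier inv_f_f)

lemma ifourier_linear: "clinear_map ifourier"
 unfolding clinear_map_def ifourier_def by (simp add: clinear_mapD[OF fourier_linear] clinear_mapD[OF refl_linear])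

lemma ifourier_cinner: "cinner (ifourier x) (ifourier y) = cinner x y"
 unfolding ifourier_def refl_cinner fourier_cinner ..

lemma cinner_ifourier: "cinner (ifourier x) y = cinner x (fourier y)"
 using ifourier_cinner[of x "fourier y"] by simp

lemma ifourier_to_L2:
 assumes "integrable lborel h" "square_integrable h"
 shows "ifourier (to_L2 h) = to_L2 (\<lambda>x. ft h (- x))"
 unfolding ifourier_def by (simp add: fourier_to_L2 refl_to_L2 ft_contraction assms)

lemma ft_continuous:
 assumes h: "integrable lborel h"
 shows "continuous_on UNIV (ft h)"
proof (rule continuous_on_sequentiallyI)
 fix X :: "nat \<Rightarrow> real" and p assume X: "X \<longlonglongrightarrow> p"
 have [measurable]: "h \<in> borel_measurable borel" using h by auto
 have "(\<lambda>n. \<integral>x. exp (- \<i> * cor (X n * x)) * h x \<partial>lborel) \<longlonglongrightarrow> (LBINT x. exp (- \<i> * cor (p * x)) * h x)"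
 proof (rule integral_dominated_convergence[where w = "\<lambda>x. cmod (h x)"])
  show "integrable lborel (\<lambda>x. cmod (h x))" using h by simp
  show "AE x in lborel. (\<lambda>n. exp (- \<i> * cor (X n * x)) * h x) \<longlonglongrightarrow> exp (- \<i> * cor (p * x)) * h x"
   by (intro AE_I2 tendsto_intros X)
 qed (auto simp: norm_mult)
 thus "(\<lambda>n. ft h (X n)) \<longlonglongrightarrow> ft h p" unfolding ft_def by (intro tendsto_intros)
qed

lemma continuous_AE_eq:
 fixes f g :: "real \<Rightarrow> complex"
 assumes "continuous_on UNIV f" "continuous_on UNIV g" "AE x in lborel. f x = g x"
 shows "f = g"
proof (rule ccontr)
 assume "f \<noteq> g"
 have op: "open {x. f x \<noteq> g x}" by (intro open_Collect_neq assms)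
 have "{x. f x \<noteq> g x} \<noteq> {}" using \<open>f \<noteq> g\<close> by auto
 hence "\<not> negligible {x. f x \<noteq> g x}" using open_not_negligible[OF op] by blast
 moreover have "{x. f x \<noteq> g x} \<in> null_sets lborel"
  using assms(3) op by (subst AE_iff_null_sets) auto
 ultimately show False by (simp add: negligible_iff_null_sets null_sets_completionI)
qed

text \<open>Fourier inversion: an integrable transform gives F a continuous representative, and
  there is only one because nonempty open sets have positive measure.\<close>

lemma point_value_eq:
 assumes "integrable lborel (rep_L2 (fourier F))"
 shows "point_value F x = ft (rep_L2 (fourier F)) (- x)"
proof -
 let ?f = "\<lambda>x. ft (rep_L2 (fourier F)) (- x)"
 have F: "F = to_L2 ?f"
  using ifourier_to_L2[OF assms square_integrable_rep] by simp
 have s: "square_integrable ?f"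
  by (intro square_integrable_uminus ft_contraction assms square_integrable_rep)
 have ae: "AE x in lborel. ?f x = rep_L2 F x"
  using rep_to_L2[OF s] unfolding F[symmetric] by eventually_elim simp
 have c: "continuous_on UNIV ?f"
  using continuous_on_compose2[OF ft_continuous[OF assms], of UNIV uminus] by (simp add: continuous_on_minus)
 have "point_value F = ?f"
  unfolding point_value_def
 proof (rule the_equality)
  show "continuous_on UNIV ?f \<and> (AE x in lborel. ?f x = rep_L2 F x)" using c ae by blast
  fix f assume f: "continuous_on UNIV f \<and> (AE x in lborel. f x = rep_L2 F x)"
  hence "AE x in lborel. f x = rep_L2 F x" by blast
  with ae have "AE x in lborel. f x = ?f x" by eventually_elim simp
  thus "f = ?f" using f c by (intro continuous_AE_eq) auto
 qed
 thus ?thesis by simp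
qed

section \<open>Test functions\<close>

text \<open>The functions R(1/x) e^(-1/x), continued by 0 to the left, form a family closed under
  differentiation. Smoothness then needs no formula for higher derivatives.\<close>

definition bump_side :: "real poly \<Rightarrow> real \<Rightarrow> real" where
 "bump_side R x = (if x > 0 then poly R (1 / x) * exp (- (1 / x)) else 0)"

lemma bump_side_limit: "((\<lambda>h. bump_side R h / h) \<longlongrightarrow> 0) (at 0)"
proof -
 \<comment> \<open>With t = 1/h the difference quotient at 0 becomes t R(t) / e^t.\<close>
 have "((\<lambda>t. poly (pCons 0 R) t / exp t) \<longlongrightarrow> 0) at_top"
  unfolding poly_altdef sum_divide_distrib times_divide_eq_right[symmetric]
  by (intro tendsto_null_sum tendsto_mult_right_zero tendsto_power_div_exp_0)
 from filterlim_compose[OF this filterlim_inverse_at_top_right]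
 have "((\<lambda>h. bump_side R h / h) \<longlongrightarrow> 0) (at_right 0)"
  by (rule Lim_transform_eventually)
    (auto simp: bump_side_def exp_minus field_simps intro!: eventually_at_right_less[THEN eventually_mono])
 moreover have "((\<lambda>h. bump_side R h / h) \<longlongrightarrow> 0) (at_left 0)"
  by (rule tendsto_eventually) (auto simp: bump_side_def eventually_at_filter)
 ultimately show ?thesis by (rule filterlim_split_at[rotated])
qed

lemma bump_side_derivative:
 "(bump_side R has_real_derivative bump_side ([:0, 0, 1:] * (R - pderiv R)) x) (at x)"
proof (cases x "0 :: real" rule: linorder_cases)
 case less
 hence "((\<lambda>z. 0) has_real_derivative bump_side ([:0, 0, 1:] * (R - pderiv R)) x) (at x)" by (simp add: bump_side_def)
 thus ?thesis
  by (rule has_field_derivative_transform_within_open[of _ _ _ "{..<0}"]) (use less in \<open>auto simp: bump_side_def\<close>)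
next
 case equal
 thus ?thesis using bump_side_limit[of R] by (simp add: DERIV_def bump_side_def)
next
 case greater
 have "((\<lambda>x. poly R (1 / x) * exp (- (1 / x))) has_real_derivative bump_side ([:0, 0, 1:] * (R - pderiv R)) x) (at x)"
  using greater by (auto intro!: derivative_eq_intros DERIV_chain2[OF poly_DERIV] simp: bump_side_def field_simps power2_eq_square)
 thus ?thesis
  by (rule has_field_derivative_transform_within_open[of _ _ _ "{0<..}"]) (use greater in \<open>auto simp: bump_side_def\<close>)
qed

text \<open>The argument 1 - x^2 moves the support to the unit interval. Sums are included because
  the derivative of one product has two terms.\<close>

inductive bump_like :: "(real \<Rightarrow> real) \<Rightarrow> bool" where
 bump_like_base: "bump_like (\<lambda>x. poly Q x * bump_side R (1 - x\<^sup>2))"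
| bump_like_add: "bump_like f \<Longrightarrow> bump_like g \<Longrightarrow> bump_like (\<lambda>x. f x + g x)"

lemma bump_like_derivative: "bump_like f \<Longrightarrow> \<exists>g. bump_like g \<and> (\<forall>x. (f has_real_derivative g x) (at x))"
proof (induction rule: bump_like.induct)
 case (bump_like_base Q R)
 let ?S = "[:0, 0, 1:] * (R - pderiv R)"
 have "((\<lambda>x. poly Q x * bump_side R (1 - x\<^sup>2)) has_real_derivative
   poly (pderiv Q) x * bump_side R (1 - x\<^sup>2) + poly ([:0, - 2:] * Q) x * bump_side ?S (1 - x\<^sup>2)) (at x)" for x
  by (rule DERIV_cong, rule DERIV_mult[OF poly_DERIV DERIV_chain2[OF bump_side_derivative]])
    (auto intro!: derivative_eq_intros)
 from allI[OF this] show ?case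
  by (intro exI) (rule conjI[OF bump_like.bump_like_add[OF bump_like.bump_like_base[of "pderiv Q"] bump_like.bump_like_base[of "[:0, - 2:] * Q"]]])
next
 case (bump_like_add f g)
 then obtain f' g' where "bump_like f'" "bump_like g'"
  "\<And>x. (f has_real_derivative f' x) (at x)" "\<And>x. (g has_real_derivative g' x) (at x)" by blast
 thus ?case by (intro exI[of _ "\<lambda>x. f' x + g' x"]) (simp add: bump_like.bump_like_add DERIV_add)
qed

lemma bump_exists:
 obtains D :: "nat \<Rightarrow> real \<Rightarrow> real" where
  "\<And>n x. (D n has_real_derivative D (Suc n) x) (at x)"
  "\<And>n x. \<bar>x\<bar> \<ge> 1 \<Longrightarrow> D n x = 0" "\<And>x. D 0 x \<ge> 0" "D 0 0 > 0"
proof -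
 obtain G where G: "\<And>f. bump_like f \<Longrightarrow> bump_like (G f) \<and> (\<forall>x. (f has_real_derivative G f x) (at x))"
  using bump_like_derivative by metis
 let ?f = "\<lambda>x. bump_side [:1:] (1 - x\<^sup>2)"
 define D where "D n = (G ^^ n) ?f" for n
 have b: "bump_like (D n)" for n by (induction n) (use G bump_like_base[of "[:1:]" "[:1:]"] in \<open>auto simp: D_def\<close>)
 have z: "f x = 0" if "bump_like f" "1 \<le> \<bar>x\<bar>" for f x
  using that by (induction) (auto simp: bump_side_def abs_square_less_1)
 show ?thesis
  by (rule that[of D]) (use G[OF b] z[OF b] in \<open>auto simp: D_def bump_side_def\<close>)
qed

lemma compact_support_integrable:
 fixes f :: "real \<Rightarrow> complex"
 assumes "continuous_on UNIV f" "\<And>x. x \<notin> {a..b} \<Longrightarrow> f x = 0"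
 shows "integrable lborel f" "square_integrable f"
proof -
 have i: "integrable lborel (\<lambda>x. indicator {a..b} x *\<^sub>R g x)" if "continuous_on UNIV g" for g :: "real \<Rightarrow> 'b::{banach, second_countable_topology}"
  by (rule borel_integrable_compact) (auto intro: continuous_on_subset[OF that])
 have "(\<lambda>x. indicator {a..b} x *\<^sub>R f x) = f" using assms(2) by (force simp: indicator_def)
 with i[OF assms(1)] show "integrable lborel f" by simp
 have "(\<lambda>x. indicator {a..b} x *\<^sub>R (cmod (f x))\<^sup>2) = (\<lambda>x. (cmod (f x))\<^sup>2)" using assms(2) by (force simp: indicator_def)
 moreover have "continuous_on UNIV (\<lambda>x. (cmod (f x))\<^sup>2)" by (intro continuous_intros assms)
 ultimately show "square_integrable f"
  using i[of "\<lambda>x. (cmod (f x))\<^sup>2"] assms(1) by (simp add: square_integrable_def borel_measurable_continuous_onI)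
qed

lemma exp_has_vector_derivative:
 "((\<lambda>x. exp (- \<i> * cor (p * x))) has_vector_derivative (- \<i> * cor p) * exp (- \<i> * cor (p * x))) (at x within A)"
proof -
 have "((\<lambda>z. exp (- \<i> * (cor p * z))) has_field_derivative exp (- \<i> * (cor p * cor x)) * (- \<i> * cor p)) (at (cor x))"
  by (auto intro!: derivative_eq_intros)
 from has_vector_derivative_real_field[OF this, of A] show ?thesis by (simp add: o_def mult_ac)
qed

lemma ft_derivative:
 fixes f f' :: "real \<Rightarrow> complex"
 assumes d: "\<And>x. (f has_vector_derivative f' x) (at x)" and c: "continuous_on UNIV f'"
  and s: "\<And>x. x \<notin> {a<..<b} \<Longrightarrow> f x = 0" "\<And>x. x \<notin> {a<..<b} \<Longrightarrow> f' x = 0" and ab: "a \<le> b"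
 shows "ft f' p = \<i> * cor p * ft f p"
proof -
 let ?e = "\<lambda>x. exp (- \<i> * cor (p * x))"
 have cf: "continuous_on UNIV f"
  using d by (meson continuous_at_imp_continuous_on has_vector_derivative_continuous)
 have i: "integrable lborel f" by (rule compact_support_integrable[OF cf, of a b]) (use s(1) in auto)
 have i': "integrable lborel f'" by (rule compact_support_integrable[OF c, of a b]) (use s(2) in auto)
 have g: "((\<lambda>x. ?e x * f x) has_vector_derivative ?e x * f' x + (- \<i> * cor p) * (?e x * f x)) (at x within {a..b})" for x
  by (rule has_vector_derivative_eq_rhs[OF has_vector_derivative_mult[OF exp_has_vector_derivative has_vector_derivative_at_within[OF d]]])
    (simp add: mult_ac)
 have "(LBINT x. indicator {a..b} x *\<^sub>R (?e x * f' x + (- \<i> * cor p) * (?e x * f x))) = ?e b * f b - ?e a * f a"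
  by (rule integral_FTC_atLeastAtMost[OF ab g])
    (auto intro!: continuous_intros intro: continuous_on_subset[OF c] continuous_on_subset[OF cf])
 also have "... = 0" using s(1) by simp
 also have "(\<lambda>x. indicator {a..b} x *\<^sub>R (?e x * f' x + (- \<i> * cor p) * (?e x * f x)))
   = (\<lambda>x. ?e x * f' x + (- \<i> * cor p) * (?e x * f x))"
  using s by (fastforce simp: indicator_def)
 finally have "(LBINT x. ?e x * f' x) + (- \<i> * cor p) * (LBINT x. ?e x * f x) = 0"
  using integrable_exp_mult[OF i, of p] integrable_exp_mult[OF i', of p] by simp
 hence "(LBINT x. ?e x * f' x) = \<i> * cor p * (LBINT x. ?e x * f x)" by (simp add: add_eq_0_iff)
 thus ?thesis unfolding ft_def by (simp only: mult_ac)
qed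

lemma ft_affine:
 assumes "\<delta> > 0"
 shows "ft (\<lambda>x. f ((x - a) / \<delta>)) p = \<delta> * exp (- \<i> * cor (p * a)) * ft f (\<delta> * p)"
proof -
 have "(LBINT x. exp (- \<i> * cor (p * x)) * f ((x - a) / \<delta>))
   = \<bar>\<delta>\<bar> *\<^sub>R (LBINT x. exp (- \<i> * cor (p * (a + \<delta> * x))) * f ((a + \<delta> * x - a) / \<delta>))"
  by (rule lborel_integral_real_affine) (use assms in simp)
 also have "(LBINT x. exp (- \<i> * cor (p * (a + \<delta> * x))) * f ((a + \<delta> * x - a) / \<delta>))
   = (LBINT x. exp (- \<i> * cor (p * a)) * (exp (- \<i> * cor (\<delta> * p * x)) * f x))"
 proof (rule Bochner_Integration.integral_cong[OF refl])
  fix x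
  have "exp (- \<i> * cor (p * (a + \<delta> * x))) = exp (- \<i> * cor (p * a)) * exp (- \<i> * cor (\<delta> * p * x))"
   by (simp only: exp_add[symmetric]) (simp add: algebra_simps)
  thus "exp (- \<i> * cor (p * (a + \<delta> * x))) * f ((a + \<delta> * x - a) / \<delta>)
   = exp (- \<i> * cor (p * a)) * (exp (- \<i> * cor (\<delta> * p * x)) * f x)"
   using assms by (simp add: mult.assoc)
 qed
 also have "... = exp (- \<i> * cor (p * a)) * (LBINT x. exp (- \<i> * cor (\<delta> * p * x)) * f x)"
  by (rule integral_mult_right_zero)
 finally show ?thesis unfolding ft_def using assms by (simp add: scaleR_conv_of_real mult_ac)
qed

definition test_function :: "(real \<Rightarrow> complex) \<Rightarrow> bool" where
 "test_function \<phi> \<longleftrightarrow> smooth \<phi> \<and> compact (closure {x. \<phi> x \<noteq> 0}) \<and> 0 \<notin> closure {x. \<phi> x \<noteq> 0}"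

lemma test_functions_eq: "test_functions = to_L2 ` {\<phi>. test_function \<phi>}"
 by (auto simp: test_functions_def test_function_def)

lemma smooth_derivatives:
 assumes "smooth \<phi>"
 obtains \<phi>' \<phi>'' where "\<And>x. (\<phi> has_vector_derivative \<phi>' x) (at x)" "\<And>x. (\<phi>' has_vector_derivative \<phi>'' x) (at x)"
  "continuous_on UNIV \<phi>" "continuous_on UNIV \<phi>'" "continuous_on UNIV \<phi>''"
proof -
 obtain D where D: "D 0 = \<phi>" "\<And>n x. (D n has_vector_derivative D (Suc n) x) (at x)"
  using assms by (auto simp: smooth_def)
 have c: "continuous_on UNIV (D n)" for n
  using D(2) by (meson continuous_at_imp_continuous_on has_vector_derivative_continuous)
 show ?thesis by (rule that[of "D 1" "D 2"]) (use D c in \<open>auto simp: numeral_2_eq_2\<close>)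
qed

lemma zero_derivative_outside:
 fixes f f' :: "real \<Rightarrow> complex"
 assumes "\<And>x. (f has_vector_derivative f' x) (at x)" "open S" "x \<in> S" "\<And>z. z \<in> S \<Longrightarrow> f z = 0"
 shows "f' x = 0"
proof -
 have "((\<lambda>z. 0) has_vector_derivative f' x) (at x)"
  by (rule has_vector_derivative_transform_within_open[OF assms(1) assms(2,3)]) (use assms(4) in simp)
 moreover have "((\<lambda>z. 0 :: complex) has_vector_derivative 0) (at x)" by simp
 ultimately show ?thesis by (metis vector_derivative_unique_at)
qed

lemma test_function_support:
 assumes "test_function \<phi>" obtains R where "R > 0" "\<And>x. \<bar>x\<bar> \<ge> R \<Longrightarrow> \<phi> x = 0" "\<phi> 0 = 0"
proof -
 have "bounded (closure {x. \<phi> x \<noteq> 0})" using assms compact_imp_bounded by (auto simp: test_function_def)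
 then obtain R where R: "\<And>x. x \<in> closure {x. \<phi> x \<noteq> 0} \<Longrightarrow> \<bar>x\<bar> \<le> R" by (auto simp: bounded_iff)
 have "\<phi> x = 0" if "\<bar>x\<bar> \<ge> \<bar>R\<bar> + 1" for x
  using R[of x] closure_subset[of "{x. \<phi> x \<noteq> 0}"] that by force
 moreover have "\<phi> 0 = 0" using assms closure_subset[of "{x. \<phi> x \<noteq> 0}"] by (auto simp: test_function_def)
 ultimately show ?thesis by (intro that[of "\<bar>R\<bar> + 1"]) auto
qed

text \<open>The weighted transform is that of \<phi> minus its second derivative, which is again
  continuous with compact support. The weight 1 + p^2 dominates every Sobolev weight that occurs,
  since s < 2.\<close>

lemma test_function_facts:
 assumes t: "test_function \<phi>"
 shows "integrable lborel \<phi>" "square_integrable \<phi>" "square_integrable (\<lambda>p. cor (1 + p\<^sup>2) * ft \<phi> p)"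
  "continuous_on UNIV \<phi>" "\<phi> 0 = 0"
proof -
 obtain \<phi>' \<phi>'' where d: "\<And>x. (\<phi> has_vector_derivative \<phi>' x) (at x)" "\<And>x. (\<phi>' has_vector_derivative \<phi>'' x) (at x)"
  "continuous_on UNIV \<phi>" "continuous_on UNIV \<phi>'" "continuous_on UNIV \<phi>''"
  using smooth_derivatives[of \<phi>] t by (auto simp: test_function_def)
 obtain R where R: "R > 0" "\<And>x. \<bar>x\<bar> \<ge> R \<Longrightarrow> \<phi> x = 0" "\<phi> 0 = 0" using test_function_support[OF t] by blast
 have op: "open {x::real. R < \<bar>x\<bar>}" by (intro open_Collect_less continuous_intros)
 have z1: "\<phi>' x = 0" if "R < \<bar>x\<bar>" for x
  by (rule zero_derivative_outside[OF d(1) op]) (use that R in auto)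
 have z2: "\<phi>'' x = 0" if "R < \<bar>x\<bar>" for x
  by (rule zero_derivative_outside[OF d(2) op]) (use that z1 in auto)
 let ?a = "- R - 1" and ?b = "R + 1"
 have out: "x \<notin> {?a<..<?b} \<Longrightarrow> R < \<bar>x\<bar>" "x \<notin> {?a..?b} \<Longrightarrow> R < \<bar>x\<bar>" for x by auto
 show i: "integrable lborel \<phi>" "square_integrable \<phi>"
  by (rule compact_support_integrable[OF d(3), of ?a ?b]; use R out(2) in force)+
 have i2: "integrable lborel \<phi>''" "square_integrable \<phi>''"
  by (rule compact_support_integrable[OF d(5), of ?a ?b]; use z2 out(2) in force)+
 have "ft \<phi>' p = \<i> * cor p * ft \<phi> p" for p
  by (rule ft_derivative[OF d(1,4), of ?a ?b]) (use R z1 out(1) in force)+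
 moreover have "ft \<phi>'' p = \<i> * cor p * ft \<phi>' p" for p
  by (rule ft_derivative[OF d(2,5), of ?a ?b]) (use R z1 z2 out(1) in force)+
 ultimately have "ft \<phi>'' p = - (cor (p\<^sup>2) * ft \<phi> p)" for p
  by (simp add: power2_eq_square algebra_simps)
 hence "(\<lambda>p. cor (1 + p\<^sup>2) * ft \<phi> p) = (\<lambda>p. ft \<phi> p - ft \<phi>'' p)" by (auto simp: distrib_right)
 thus "square_integrable (\<lambda>p. cor (1 + p\<^sup>2) * ft \<phi> p)"
  using ft_contraction[OF i] ft_contraction[OF i2] by (simp add: square_integrable_diff)
qed (use assms test_function_support[OF t] smooth_derivatives in \<open>auto simp: test_function_def\<close>)

lemma cmod_exp_diff_le:
 "cmod (exp (- \<i> * cor (p * x)) - exp (- \<i> * cor (q * x))) \<le> \<bar>p - q\<bar> * \<bar>x\<bar>"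
proof -
 have "exp (- \<i> * cor (p * x)) - exp (- \<i> * cor (q * x))
   = exp (- \<i> * cor (q * x)) * (exp (\<i> * cor ((q - p) * x)) - 1)"
 proof -
  have "- \<i> * cor (p * x) = - \<i> * cor (q * x) + \<i> * cor ((q - p) * x)"
   by (simp add: complex_eq_iff left_diff_distrib)
  hence "exp (- \<i> * cor (p * x)) = exp (- \<i> * cor (q * x)) * exp (\<i> * cor ((q - p) * x))"
   by (simp only: exp_add)
  thus ?thesis by (simp only: right_diff_distrib mult_1_right)
 qed
 hence "cmod (exp (- \<i> * cor (p * x)) - exp (- \<i> * cor (q * x))) = 2 * \<bar>sin ((q - p) * x / 2)\<bar>"
  by (simp only: norm_mult dist_exp_i_1) simp
 also have "... \<le> 2 * \<bar>(q - p) * x / 2\<bar>" using abs_sin_x_le_abs_x[of "(q - p) * x / 2"] by simp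
 also have "... = \<bar>p - q\<bar> * \<bar>x\<bar>" by (simp add: abs_mult abs_minus_commute[of p q])
 finally show ?thesis .
qed

text \<open>Translated and rescaled copies of one bump: a copy of radius \<delta> around y stays
  away from the origin when \<delta> < |y|. All transforms come from a single k, so pairing with the
  copies evaluates a mollified distribution at y. The decay of k stems from the second derivative of
  the bump.\<close>

lemma test_bumps:
 obtains k :: "real \<Rightarrow> complex" and C where "continuous_on UNIV k" "k 0 \<noteq> 0" "C > 0" "\<And>q. cmod (k q) * (1 + q\<^sup>2) \<le> C"
  "\<And>y \<delta>. 0 < \<delta> \<Longrightarrow> \<delta> < \<bar>y\<bar> \<Longrightarrow> \<exists>\<phi>. test_function \<phi> \<and> (\<forall>p. ft \<phi> p = \<delta> * exp (- \<i> * cor (p * y)) * k (\<delta> * p))"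
proof -
 obtain D :: "nat \<Rightarrow> real \<Rightarrow> real" where D: "\<And>n x. (D n has_real_derivative D (Suc n) x) (at x)"
  "\<And>n x. \<bar>x\<bar> \<ge> 1 \<Longrightarrow> D n x = 0" "\<And>x. D 0 x \<ge> 0" "D 0 0 > 0" using bump_exists by blast
 define c where "c n x = cor (D n x)" for n x
 have dc: "(c n has_vector_derivative c (Suc n) x) (at x)" for n x
  unfolding c_def has_vector_derivative_complex_iff
  using D(1)[of n x] by (simp add: has_real_derivative_iff_has_vector_derivative)
 have cc: "continuous_on UNIV (c n)" for n
  using dc by (meson continuous_at_imp_continuous_on has_vector_derivative_continuous)
 have c0: "c n x = 0" if "\<bar>x\<bar> \<ge> 1" for n x using D(2)[OF that] by (simp add: c_def)
 have ic: "integrable lborel (c n)" for n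
  by (rule compact_support_integrable[OF cc, of "-1" 1]) (use c0 in force)
 have fd: "ft (c (Suc n)) p = \<i> * cor p * ft (c n) p" for n p
  by (rule ft_derivative[OF dc cc, of "-1" 1]) (use c0 in force)+
 show ?thesis
 proof (rule that[of "ft (c 0)"])
  show "ft (c 0) 0 \<noteq> 0"
  proof
   assume "ft (c 0) 0 = 0"
   hence "(LBINT x. D 0 x) = 0" by (simp add: ft_def c_def)
   moreover have "integrable lborel (D 0)" using integrable_Re[OF ic[of 0]] by (simp add: c_def)
   ultimately have "AE x in lborel. c 0 x = 0" using D(3) by (simp add: integral_nonneg_eq_0_iff_AE c_def)
   hence "c 0 = (\<lambda>x. 0)" by (intro continuous_AE_eq cc) auto
   thus False using D(4) by (metis c_def less_irrefl of_real_eq_0_iff)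
  qed
  define B where "B n = 1 / sqrt (2 * pi) * (LBINT x. cmod (c n x))" for n
  have B: "cmod (ft (c n) q) \<le> B n" for n q unfolding B_def by (rule ft_bound[OF ic])
  have "ft (c 2) q = (\<i> * cor q)\<^sup>2 * ft (c 0) q" for q
   using fd[of 1 q] fd[of 0 q] by (simp add: numeral_2_eq_2 power2_eq_square)
  hence "cmod (ft (c 2) q) = q\<^sup>2 * cmod (ft (c 0) q)" for q by (simp add: norm_mult norm_power)
  thus "cmod (ft (c 0) q) * (1 + q\<^sup>2) \<le> \<bar>B 0\<bar> + \<bar>B 2\<bar> + 1" for q
   using B[of 0 q] B[of 2 q] by (simp add: algebra_simps)
  show "0 < \<bar>B 0\<bar> + \<bar>B 2\<bar> + 1" by (rule add_nonneg_pos) auto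
  fix y \<delta> :: real assume h: "0 < \<delta>" "\<delta> < \<bar>y\<bar>"
  let ?\<phi> = "\<lambda>n x. cor ((1 / \<delta>) ^ n) * c n ((x - y) / \<delta>)"
  have "(?\<phi> n has_vector_derivative ?\<phi> (Suc n) x) (at x)" for n x
  proof -
   have "((\<lambda>x. (x - y) / \<delta>) has_real_derivative 1 / \<delta>) (at x)" using h by (auto intro!: derivative_eq_intros)
   from vector_diff_chain_at[OF this[unfolded has_real_derivative_iff_has_vector_derivative] dc, unfolded o_def]
   show ?thesis by (rule has_vector_derivative_eq_rhs[OF has_vector_derivative_mult_right]) (simp add: scaleR_conv_of_real mult_ac)
  qed
  hence sm: "smooth (?\<phi> 0)" unfolding smooth_def by (intro exI[of _ ?\<phi>]) blast
  have "c 0 ((x - y) / \<delta>) = 0" if "x \<notin> cball y \<delta>" for x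
   using that h by (intro c0) (simp add: dist_real_def abs_minus_commute le_divide_eq)
  hence "closure {x. ?\<phi> 0 x \<noteq> 0} \<subseteq> cball y \<delta>" by (intro closure_minimal subsetI) fastforce+
  moreover have "0 \<notin> cball y \<delta>" using h by simp
  ultimately have "test_function (?\<phi> 0)"
   unfolding test_function_def compact_eq_bounded_closed using sm bounded_subset[OF bounded_cball] by blast
  thus "\<exists>\<phi>. test_function \<phi> \<and> (\<forall>p. ft \<phi> p = \<delta> * exp (- \<i> * cor (p * y)) * ft (c 0) (\<delta> * p))"
   by (rule exI[of _ "?\<phi> 0", OF conjI]) (simp add: ft_affine[OF h(1)])
 qed (auto intro: ft_continuous ic)
qed

text \<open>A distribution of negative Sobolev order greater than \<open>-3/2\<close> that vanishes on all test functions
 supported away from the origin is a multiple of the Dirac measure, that is, its Fourier transform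
 is constant. Its mollifications \<open>w\<close> at scale \<open>\<delta>\<close> live in \<open>[-\<delta>, \<delta>]\<close> and have \<open>L\<^sup>2\<close>-norm
 \<open>O(\<delta>\<^sup>-\<^sup>r)\<close>, so the increments of their Fourier transforms are \<open>O(\<delta>\<^sup>3\<^sup>/\<^sup>2\<^sup>-\<^sup>r)\<close>.\<close>

lemma annihilator_of_test_functions:
 fixes u :: "real \<Rightarrow> complex"
 assumes um: "u \<in> borel_measurable borel"
  and r: "0 \<le> r" "r < 3/2"
  and U: "square_integrable (\<lambda>p. cor ((1 + p\<^sup>2) powr (- r / 2)) * u p)"
  and an: "\<And>\<phi>. test_function \<phi> \<Longrightarrow> (LBINT p. cnj (u p) * ft \<phi> p) = 0"
 shows "\<exists>c. AE p in lborel. u p = c"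
proof -
 note [measurable] = um
 obtain k C where k: "continuous_on UNIV k" "k 0 \<noteq> 0" "C > 0" "\<And>q. cmod (k q) * (1 + q\<^sup>2) \<le> C"
  and bump: "\<And>y \<delta>. 0 < \<delta> \<Longrightarrow> \<delta> < \<bar>y\<bar> \<Longrightarrow> \<exists>\<phi>. test_function \<phi> \<and> (\<forall>p. ft \<phi> p = cor \<delta> * exp (- \<i> * cor (p * y)) * k (\<delta> * p))"
  by (rule test_bumps) blast
 have [measurable]: "k \<in> borel_measurable borel" by (rule borel_measurable_continuous_onI[OF k(1)])
 define V where "V = (\<lambda>p. cor ((1 + p\<^sup>2) powr (- r / 2)) * u p)"
 have V: "square_integrable V" using U by (simp add: V_def)
 define \<delta> where "\<delta> n = 1 / real (Suc n)" for n
 have d: "0 < \<delta> n" "\<delta> n \<le> 1" for n by (auto simp: \<delta>_def)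
 have \<delta>0: "\<delta> \<longlonglongrightarrow> 0" unfolding \<delta>_def by (rule LIMSEQ_Suc[OF lim_1_over_n])
 define w where "w n p = u p * cnj (k (\<delta> n * p))" for n p
 have wm [measurable]: "w n \<in> borel_measurable borel" for n unfolding w_def by measurable
 have uV: "cmod (u p) = (1 + p\<^sup>2) powr (r / 2) * cmod (V p)" for p
 proof -
  have "(1 + p\<^sup>2) powr (r / 2) * (1 + p\<^sup>2) powr - (r / 2) = 1"
   by (subst powr_add[symmetric]) (auto simp: add_pos_nonneg less_imp_neq[symmetric])
  thus ?thesis unfolding V_def norm_mult by (simp add: mult.assoc[symmetric])
 qed
 \<comment> \<open>For \<delta> at most 1 the number \<delta>^2 (1 + p^2) is at most 1 + (\<delta>
   p)^2. The power r/2 is at most 1, so the decay of k absorbs the weight at the cost of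
   \<delta>^(-r).\<close>
 have kb: "(1 + p\<^sup>2) powr (r / 2) * cmod (k (\<delta> n * p)) \<le> \<delta> n powr (- r) * C" for n p
 proof -
  have pos: "0 < 1 + p\<^sup>2" "0 < 1 + (\<delta> n * p)\<^sup>2" by (auto simp: add_pos_nonneg)
  have "(\<delta> n)\<^sup>2 * (1 + p\<^sup>2) \<le> 1 + (\<delta> n * p)\<^sup>2"
   using d[of n] by (simp add: power_mult_distrib distrib_left power_le_one less_imp_le)
  hence "((\<delta> n)\<^sup>2 * (1 + p\<^sup>2)) powr (r / 2) \<le> (1 + (\<delta> n * p)\<^sup>2) powr (r / 2)"
   using pos r by (intro powr_mono2) auto
  also have "... \<le> (1 + (\<delta> n * p)\<^sup>2) powr 1" using r by (intro powr_mono) auto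
  finally have "\<delta> n powr r * (1 + p\<^sup>2) powr (r / 2) * cmod (k (\<delta> n * p)) \<le> (1 + (\<delta> n * p)\<^sup>2) * cmod (k (\<delta> n * p))"
   using pos d[of n] by (intro mult_right_mono) (simp_all add: powr_mult powr_powr powr_numeral[symmetric] del: powr_numeral)
  also have "... \<le> C" using k(4)[of "\<delta> n * p"] by (simp add: mult.commute)
  finally show ?thesis using d[of n] by (simp add: powr_minus field_simps)
 qed
 have wb: "cmod (w n p) \<le> \<delta> n powr (- r) * C * cmod (V p)" for n p
  using mult_right_mono[OF kb[of p n], of "cmod (V p)"] by (simp add: w_def norm_mult uV mult_ac)
 have ws: "square_integrable (w n)" for n
  by (rule square_integrable_bound[OF V wm]) (use wb in blast)
 have wn: "norm (to_L2 (w n)) \<le> \<delta> n powr (- r) * C * norm (to_L2 V)" for n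
  by (rule norm_to_L2_le[OF ws V]) (use k(3) wb in auto)
 have wi: "integrable lborel (w n)" for n
 proof -
  \<comment> \<open>The centre 2 is arbitrary beyond the largest radius 1; the bump only serves to
    bound k(\<delta> p) by the decay of its transform.\<close>
  obtain \<phi> where t: "test_function \<phi>" and ph: "\<And>p. ft \<phi> p = cor (\<delta> n) * exp (- \<i> * cor (p * 2)) * k (\<delta> n * p)"
   using bump[of "\<delta> n" 2] d[of n] by auto
  have "integrable lborel (\<lambda>p. V p * (cor (1 + p\<^sup>2) * ft \<phi> p))"
   by (intro square_integrable_mult_integrable V test_function_facts t)
  from integrable_mult_right[OF this, of "cor (1 / \<delta> n)"] show ?thesis
  proof (rule Bochner_Integration.integrable_bound)
   have "(1 + p\<^sup>2) powr (r / 2) \<le> 1 + p\<^sup>2" for p :: real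
    using powr_mono[of "r / 2" 1 "1 + p\<^sup>2"] r by (simp add: add_pos_nonneg)
   thus "AE p in lborel. cmod (w n p) \<le> cmod (cor (1 / \<delta> n) * (V p * (cor (1 + p\<^sup>2) * ft \<phi> p)))"
    using d[of n] by (intro AE_I2) (auto simp: w_def norm_mult norm_divide uV ph mult_ac simp del: of_real_add intro!: mult_right_mono mult_left_mono)
  qed simp
 qed
 define v where "v n = ft (w n)" for n
 have vz: "v n y = 0" if "y \<notin> {- \<delta> n..\<delta> n}" for n y
 proof -
  have "\<delta> n < \<bar>- y\<bar>" using that by auto
  from bump[OF d(1) this] obtain \<phi> where t: "test_function \<phi>"
   and ph: "\<And>p. ft \<phi> p = cor (\<delta> n) * exp (- \<i> * cor (p * - y)) * k (\<delta> n * p)" by auto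
  \<comment> \<open>Up to conjugation and constant factors, the value of \<open>v n\<close> at y is
    the pairing of u with the bump around -y, which vanishes by hypothesis.\<close>
  have "cnj (\<delta> n * (LBINT p. exp (- \<i> * cor (y * p)) * w n p)) = (LBINT p. cnj (u p) * ft \<phi> p)"
   unfolding integral_mult_right_zero[symmetric] Bochner_Integration.integral_cnj[symmetric]
   by (rule Bochner_Integration.integral_cong) (simp_all add: w_def ph exp_cnj mult_ac)
  thus ?thesis using an[OF t] d(1)[of n] by (simp add: v_def ft_def)
 qed
 have vs: "square_integrable (v n)" for n unfolding v_def by (intro ft_contraction wi ws)
 have vi: "integrable lborel (v n)" for n
  by (rule square_integrable_imp_integrable_on[OF vs, of "{- \<delta> n..\<delta> n}"]) (auto simp: vz emeasure_lborel_Icc_eq)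
 have fw: "fourier (to_L2 (w n)) = to_L2 (v n)" for n unfolding v_def by (intro fourier_to_L2 wi ws)
 have wf: "AE p in lborel. w n p = ft (v n) (- p)" for n
 proof -
  have "to_L2 (w n) = to_L2 (\<lambda>p. ft (v n) (- p))"
   using ifourier_fourier[of "to_L2 (w n)"] ifourier_to_L2[OF vi vs, of n] by (simp add: fw)
  hence "AE p in lborel. rep_L2 (to_L2 (w n)) p = rep_L2 (to_L2 (\<lambda>p. ft (v n) (- p))) p" by simp
  thus ?thesis
   using rep_to_L2[OF ws[of n]] rep_to_L2[OF square_integrable_uminus[OF ft_contraction[OF vi vs, of n]]] by eventually_elim simp
 qed
 \<comment> \<open>On the support of \<open>v n\<close> the two exponentials differ by at most |p -
   q| \<delta>, and the indicator of the support has norm sqrt (2 \<delta>); Cauchy-Schwarz does the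
   rest.\<close>
 have diff: "cmod (ft (v n) p - ft (v n) q) \<le> \<bar>p - q\<bar> * \<delta> n * sqrt (2 * \<delta> n) * norm (to_L2 (w n))" for n p q
 proof -
  let ?E = "\<lambda>p x. exp (- \<i> * cor (p * x))" and ?i = "\<lambda>x. cor (indicator {- \<delta> n..\<delta> n} x)"
  let ?g = "\<lambda>x. cnj ((?E p x - ?E q x) * ?i x)"
  have gb: "cmod (?g x) \<le> \<bar>p - q\<bar> * \<delta> n * cmod (?i x)" for x
   using order_trans[OF cmod_exp_diff_le[of p x q] mult_left_mono[of "\<bar>x\<bar>" "\<delta> n" "\<bar>p - q\<bar>"]]
   unfolding complex_mod_cnj norm_mult by (auto simp: indicator_def)
  have i1: "integrable lborel (\<lambda>x. indicator {- \<delta> n..\<delta> n} x *\<^sub>R (1::real))" by (rule borel_integrable_compact) auto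
  have i: "(\<lambda>x. (cmod (?i x))\<^sup>2) = (\<lambda>x. indicator {- \<delta> n..\<delta> n} x *\<^sub>R 1)" by (auto simp: indicator_def)
  have sq: "square_integrable ?i" using i1 unfolding square_integrable_def i by simp
  have gs: "square_integrable ?g" by (rule square_integrable_bound[OF sq _ AE_I2[OF gb]]) measurable
  have "(norm (to_L2 ?i))\<^sup>2 = 2 * \<delta> n" unfolding norm_to_L2_sq[OF sq] i using d(1)[of n] by simp
  hence ni: "norm (to_L2 ?i) = sqrt (2 * \<delta> n)" by (metis norm_ge_zero real_sqrt_unique)
  have "cinner (to_L2 ?g) (to_L2 (v n)) = (LBINT x. ?E p x * v n x - ?E q x * v n x)"
   unfolding cinner_to_L2[OF gs vs]
   by (rule Bochner_Integration.integral_cong) (use vz in \<open>auto simp: indicator_def left_diff_distrib\<close>)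
  hence "ft (v n) p - ft (v n) q = cor (1 / sqrt (2 * pi)) * cinner (to_L2 ?g) (to_L2 (v n))"
   by (simp add: ft_def right_diff_distrib integrable_exp_mult[OF vi, simplified])
  hence "cmod (ft (v n) p - ft (v n) q) = 1 / sqrt (2 * pi) * cmod (cinner (to_L2 ?g) (to_L2 (v n)))" by (simp add: norm_mult norm_divide)
  also have "... \<le> 1 * (norm (to_L2 ?g) * norm (to_L2 (v n)))"
   using pi_ge_two by (intro mult_mono cinner_bound) (auto simp: divide_le_eq)
  also have "norm (to_L2 (v n)) = norm (to_L2 (w n))" by (metis fw fourier_norm)
  also have "norm (to_L2 ?g) \<le> \<bar>p - q\<bar> * \<delta> n * sqrt (2 * \<delta> n)"
   using norm_to_L2_le[OF gs sq _ gb] d(1)[of n] ni by simp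
  finally show ?thesis by (simp add: mult_right_mono)
 qed
 \<comment> \<open>The exponents add up to 1 + 1/2 - r, where 1 comes from the exponentials, 1/2
   from the length of the support and -r from the norm of \<open>w n\<close>.\<close>
 have lim0: "(\<lambda>n. ft (v n) p - ft (v n) q) \<longlonglongrightarrow> 0" for p q
 proof (rule Lim_null_comparison)
  let ?K = "\<bar>p - q\<bar> * sqrt 2 * C * norm (to_L2 V)"
  have "cmod (ft (v n) p - ft (v n) q) \<le> ?K * \<delta> n powr (3/2 - r)" for n
  proof -
   have "cmod (ft (v n) p - ft (v n) q) \<le> \<bar>p - q\<bar> * \<delta> n * sqrt (2 * \<delta> n) * (\<delta> n powr (- r) * C * norm (to_L2 V))"
    by (intro order_trans[OF diff] mult_left_mono wn) (use d(1)[of n] in auto)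
   also have "... = ?K * (\<delta> n powr 1 * \<delta> n powr (1/2) * \<delta> n powr (- r))"
    using d(1)[of n] by (simp add: powr_half_sqrt less_imp_le real_sqrt_mult mult_ac)
   also have "... = ?K * \<delta> n powr (3/2 - r)" by (simp only: powr_add[symmetric]) simp
   finally show ?thesis .
  qed
  thus "\<forall>\<^sub>F n in sequentially. cmod (ft (v n) p - ft (v n) q) \<le> ?K * \<delta> n powr (3/2 - r)" by simp
  have "(\<lambda>n. \<delta> n powr (3/2 - r)) \<longlonglongrightarrow> 0 powr (3/2 - r)"
   by (rule tendsto_powr2[OF \<delta>0 tendsto_const]) (use r d(1) in \<open>auto intro!: always_eventually less_imp_le\<close>)
  thus "(\<lambda>n. ?K * \<delta> n powr (3/2 - r)) \<longlonglongrightarrow> 0" using r by (intro tendsto_mult_right_zero) simp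
 qed
 have wlim: "(\<lambda>n. w n p) \<longlonglongrightarrow> u p * cnj (k 0)" for p
 proof -
  have "(\<lambda>n. k (\<delta> n * p)) \<longlonglongrightarrow> k 0"
   using k(1) by (intro isCont_tendsto_compose[of 0 k] tendsto_mult_left_zero \<delta>0) (auto simp: continuous_on_eq_continuous_at)
  thus ?thesis unfolding w_def by (intro tendsto_intros)
 qed
 \<comment> \<open>Where \<open>w n\<close> agrees for all n with the transform of
   \<open>v n\<close>, its limit \<open>u p * cnj (k 0)\<close> does not depend on p, and
   \<open>k 0\<close> is not 0.\<close>
 let ?good = "\<lambda>p. \<forall>n. w n p = ft (v n) (- p)"
 have ae: "AE p in lborel. ?good p" using wf by (simp add: AE_all_countable)
 have eq: "u p = u q" if "?good p" "?good q" for p q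
 proof -
  have "(\<lambda>n. w n p - w n q) \<longlonglongrightarrow> 0" using lim0[of "- p" "- q"] that by simp
  from LIMSEQ_unique[OF tendsto_diff[OF wlim[of p] wlim[of q]] this] show ?thesis using k(2) by simp
 qed
 obtain q where q: "?good q" using eventually_happens[OF ae] by (auto simp: ae_filter_eq_bot_iff)
 have "AE p in lborel. u p = u q" using ae by eventually_elim (rule eq[OF _ q])
 thus ?thesis by blast
qed

section \<open>The contour integral\<close>

lemma contour_integral_linepath_horizontal:
 assumes "x < y"
 shows "contour_integral (linepath (Complex x c) (Complex y c)) f = integral {x..y} (\<lambda>t. f (Complex t c))"
proof -
 have sh: "Complex t c = cor t + Complex 0 c" for t by (simp add: complex_eq_iff)
 have "linepath (Complex x c) (Complex y c) t = linepath (cor x) (cor y) t + Complex 0 c" for t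
  unfolding linepath_def sh[of x] sh[of y] by (simp add: algebra_simps)
 hence "contour_integral (linepath (Complex x c) (Complex y c)) f
   = contour_integral (linepath (cor x) (cor y)) (\<lambda>w. f (w + Complex 0 c))"
  unfolding contour_integral_integral by (simp add: sh[of x] sh[of y])
 also have "... = integral {x..y} (\<lambda>t. f (cor t + Complex 0 c))"
  using contour_integral_linepath_Reals_eq[of "cor x" "cor y" "\<lambda>w. f (w + Complex 0 c)"] assms by simp
 finally show ?thesis by (simp add: sh[symmetric])
qed

lemma exp_eq_of_real_strip:
 assumes "exp w = cor r" "r > 0" "\<bar>Im w\<bar> < 2 * pi"
 shows "w = cor (ln r)"
proof -
 have "exp w = exp (cor (ln r))" using assms by (simp add: exp_of_real)
 then obtain n where n: "w = cor (ln r) + (of_int (2 * n) * pi) * \<i>" by (auto simp: exp_eq)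
 hence "Im w = of_int (2 * n) * pi" by simp
 hence "\<bar>of_int (2 * n)\<bar> * pi < 2 * pi" using assms(3) by (simp add: abs_mult)
 hence "\<bar>of_int (2 * n) :: real\<bar> < 2" by simp
 hence "n = 0" by linarith
 with n show ?thesis by simp
qed

text \<open>Used twice: with q = 1 / \<Theta>, which gives the inner products of the G, and with q =
  \<alpha> - \<Theta>, which gives the Gram matrix of the spectral model. The condition \<eta> < 1
  keeps the strip inside |Im w| < 2 pi, where a positive value of exp is taken only on the real
  axis. The condition \<gamma> < 1 is what the decay e^(-|Re w|) of the other factors can
  compensate.\<close>

locale strip_contour =
 fixes a b \<eta> \<gamma> C L0 :: real and q :: "complex \<Rightarrow> complex" and Z :: "complex set"
 assumes ab: "0 < a" "0 < b" "a \<noteq> b" and eta: "0 < \<eta>" "\<eta> < 1"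
  and q: "q holomorphic_on {w. \<bar>Im w\<bar> < pi + \<eta>}"
  and Z: "finite Z" "\<And>w. \<bar>Im w\<bar> < pi + \<eta> \<Longrightarrow> q w = 0 \<longleftrightarrow> w \<in> Z" "\<And>z. z \<in> Z \<Longrightarrow> Im z = 0"
   "\<And>z. z \<in> Z \<Longrightarrow> deriv q z \<noteq> 0" "\<And>z. z \<in> Z \<Longrightarrow> exp z \<noteq> cor a \<and> exp z \<noteq> cor b"
  and growth: "\<gamma> < 1" "\<And>w. \<bar>Im w\<bar> < pi + \<eta> \<Longrightarrow> \<bar>Re w\<bar> \<ge> L0 \<Longrightarrow> cmod (1 / q w) \<le> C * exp (\<gamma> * \<bar>Re w\<bar>)"
begin

definition "S = {w::complex. \<bar>Im w\<bar> < pi + \<eta>}"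
text \<open>With this numerator the quotient by the two exponential factors is a / (e^w - a) - b /
  (e^w - b), whose residues at ln a and ln b are 1 and -1.\<close>

definition "num w = cor (a - b) * exp w" for w
definition "den w = q w * (exp w - cor a) * (exp w - cor b)" for w
definition "f w = num w / den w" for w
definition "la = cor (ln a)"
definition "lb = cor (ln b)"
definition "pts = insert la (insert lb Z)"

lemma S_open: "open S" unfolding S_def by (intro open_Collect_less continuous_intros)

lemma S_convex: "convex S"
proof -
 have "S = {w. Im w < pi + \<eta>} \<inter> {w. Im w > - (pi + \<eta>)}" by (auto simp: S_def abs_less_iff)
 thus ?thesis by (simp add: convex_Int convex_halfspace_Im_lt convex_halfspace_Im_gt)
qed

lemma exps: "exp la = cor a" "exp lb = cor b"
 using ab by (simp_all add: la_def lb_def exp_of_real)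

lemma pts_S: "z \<in> pts \<Longrightarrow> Im z = 0" "z \<in> pts \<Longrightarrow> z \<in> S"
 using Z(3) eta pi_gt_zero by (auto simp: pts_def la_def lb_def S_def add_pos_pos)

lemma distinct: "la \<noteq> lb" "la \<notin> Z" "lb \<notin> Z"
 using exps Z(5) ab by auto

lemma den_zero: "w \<in> S \<Longrightarrow> den w = 0 \<longleftrightarrow> w \<in> pts"
proof -
 assume w: "w \<in> S"
 have i: "\<bar>Im w\<bar> < 2 * pi" using w eta pi_gt3 by (simp add: S_def)
 have "exp w = cor a \<longleftrightarrow> w = la" "exp w = cor b \<longleftrightarrow> w = lb"
  using exp_eq_of_real_strip[OF _ ab(1) i] exp_eq_of_real_strip[OF _ ab(2) i] exps by (auto simp: la_def lb_def)
 thus ?thesis using Z(2)[of w] w by (auto simp: den_def pts_def S_def)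
qed

lemma holo: "num holomorphic_on S" "den holomorphic_on S" "f holomorphic_on S - pts"
proof -
 show 1: "num holomorphic_on S" unfolding num_def by (intro holomorphic_intros)
 show 2: "den holomorphic_on S" unfolding den_def by (intro holomorphic_intros q[folded S_def])
 show "f holomorphic_on S - pts" unfolding f_def
  by (intro holomorphic_intros holomorphic_on_subset[OF 1] holomorphic_on_subset[OF 2]) (auto simp: den_zero)
qed

lemma residues:
 "residue f la = 1 / q la" "residue f lb = - 1 / q lb"
 "z \<in> Z \<Longrightarrow> residue f z = cor (a - b) * exp z / (deriv q z * (exp z - cor a) * (exp z - cor b))"
proof -
 have res: "residue f z = num z / D" if "z \<in> S" "den z = 0" "(den has_field_derivative D) (at z)" "D \<noteq> 0" for z D
  unfolding f_def
  by (rule residue_simple_pole_deriv[OF holo(1,2) S_open convex_connected[OF S_convex] that(1) that(3) _ that(2,4)])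
    (use ab in \<open>simp add: num_def\<close>)
 have dq: "(q has_field_derivative deriv q z) (at z)" if "z \<in> S" for z
  using holomorphic_derivI[OF q[folded S_def] S_open that] .
 have dd: "(den has_field_derivative (deriv q z * (exp z - cor a) + exp z * q z) * (exp z - cor b)
   + exp z * (q z * (exp z - cor a))) (at z)" if "z \<in> S" for z
  unfolding den_def[abs_def]
  by (rule DERIV_cong[OF DERIV_mult[OF DERIV_mult[OF dq[OF that] DERIV_diff[OF DERIV_exp DERIV_const]] DERIV_diff[OF DERIV_exp DERIV_const]]])
    (simp add: algebra_simps)
 have qn: "q la \<noteq> 0" "q lb \<noteq> 0"
  using Z(2)[of la] Z(2)[of lb] distinct pts_S(2)[of la] pts_S(2)[of lb] by (auto simp: S_def pts_def)
 have nz: "cor a - cor b \<noteq> 0" "cor a \<noteq> 0" "cor b \<noteq> 0" using ab by auto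
 have la: "la \<in> S" "den la = 0" and lb: "lb \<in> S" "den lb = 0" using pts_S(2) den_zero by (auto simp: pts_def)
 have "residue f la = num la / (cor a * q la * (cor a - cor b))"
  by (rule res[OF la]) (use dd[OF la(1)] qn nz in \<open>auto simp: exps\<close>)
 thus "residue f la = 1 / q la" using nz qn by (simp add: num_def exps)
 have "residue f lb = num lb / (cor b * (q lb * (cor b - cor a)))"
  by (rule res[OF lb]) (use dd[OF lb(1)] qn nz in \<open>auto simp: exps\<close>)
 also have "... = - 1 / q lb"
 proof -
  have "cor b - cor a = - (cor a - cor b)" by simp
  thus ?thesis using nz qn by (simp add: num_def exps divide_simps)
 qed
 finally show "residue f lb = - 1 / q lb" .
 assume z: "z \<in> Z"
 hence zS: "z \<in> S" "den z = 0" using pts_S(2) den_zero by (auto simp: pts_def)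
 have q0: "q z = 0" using Z(2)[of z] zS z by (auto simp: S_def)
 have "residue f z = num z / (deriv q z * (exp z - cor a) * (exp z - cor b))"
  by (rule res[OF zS]) (use dd[OF zS(1)] q0 Z(4,5)[OF z] in auto)
 thus "residue f z = cor (a - b) * exp z / (deriv q z * (exp z - cor a) * (exp z - cor b))"
  by (simp add: num_def)
qed

definition "R = 1 / q la - 1 / q lb
 + (\<Sum>z\<in>Z. cor (a - b) * exp z / (deriv q z * (exp z - cor a) * (exp z - cor b)))"

lemma sum_residues: "(\<Sum>z\<in>pts. residue f z) = R"
 unfolding pts_def R_def using Z(1) distinct residues by (simp add: residues)

definition "side_bound L = \<bar>C\<bar> * \<bar>a - b\<bar> * (exp (\<gamma> * L) * (exp L / (\<bar>exp L - a\<bar> * \<bar>exp L - b\<bar>) + exp (- L) / (\<bar>exp (- L) - a\<bar> * \<bar>exp (- L) - b\<bar>)))"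

text \<open>The bracket multiplied by e^L tends to 1 + 1 / (a b), so the bound is of order
  e^((\<gamma> - 1) L).\<close>

lemma side_bound_limit: "(side_bound \<longlongrightarrow> 0) at_top"
proof -
 have 1: "((\<lambda>L. exp L * (exp L / (\<bar>exp L - a\<bar> * \<bar>exp L - b\<bar>) + exp (- L) / (\<bar>exp (- L) - a\<bar> * \<bar>exp (- L) - b\<bar>))) \<longlongrightarrow> 1 + inverse a * inverse b) at_top"
  using ab(1,2) by real_asymp
 have 2: "((\<lambda>L. exp ((\<gamma> - 1) * L)) \<longlongrightarrow> 0) at_top" using growth(1) by real_asymp
 have e: "exp ((\<gamma> - 1) * L) * (exp L * x) = exp (\<gamma> * L) * x" for L x
  by (simp add: mult.assoc[symmetric] exp_add[symmetric] left_diff_distrib)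
 show ?thesis unfolding side_bound_def[abs_def]
  by (rule tendsto_mult_right_zero) (use tendsto_mult[OF 2 1] in \<open>simp add: e\<close>)
qed

lemma vertical_bound:
 assumes L: "L \<ge> L0" "L \<ge> 0" "\<And>z. z \<in> pts \<Longrightarrow> \<bar>Re z\<bar> < L" and w: "w \<in> S" "\<bar>Re w\<bar> = L"
 shows "cmod (f w) \<le> side_bound L"
proof -
 let ?r = "exp (Re w)"
 have e: "cmod (exp w) = ?r" by (simp add: norm_exp_eq_Re)
 have g: "cmod (1 / q w) \<le> \<bar>C\<bar> * exp (\<gamma> * L)"
  using growth(2)[of w] w L by (auto simp: S_def intro: order_trans mult_right_mono)
 have lb: "\<bar>?r - c\<bar> \<le> cmod (exp w - cor c)" if "c > 0" for c
  using norm_triangle_ineq3[of "exp w" "cor c"] that by (simp add: e)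
 have "\<bar>ln a\<bar> < L" "\<bar>ln b\<bar> < L" using L(3)[of la] L(3)[of lb] by (auto simp: pts_def la_def lb_def)
 hence "?r \<noteq> a" "?r \<noteq> b" using w(2) by auto
 hence "?r / (cmod (exp w - cor a) * cmod (exp w - cor b)) \<le> ?r / (\<bar>?r - a\<bar> * \<bar>?r - b\<bar>)"
  using lb[OF ab(1)] lb[OF ab(2)] by (intro divide_left_mono mult_mono mult_pos_pos) auto
 also have "... \<le> exp L / (\<bar>exp L - a\<bar> * \<bar>exp L - b\<bar>) + exp (- L) / (\<bar>exp (- L) - a\<bar> * \<bar>exp (- L) - b\<bar>)"
  using w(2) by (auto simp: abs_if split: if_splits)
 finally have "cmod (1 / q w) * (\<bar>a - b\<bar> * (?r / (cmod (exp w - cor a) * cmod (exp w - cor b))))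
   \<le> (\<bar>C\<bar> * exp (\<gamma> * L)) * (\<bar>a - b\<bar> * \<dots>)"
  by (intro mult_mono g mult_left_mono) auto
 thus ?thesis by (simp add: f_def num_def den_def norm_mult norm_divide e side_bound_def mult_ac del: of_real_diff)
qed

lemma rectangle:
 assumes L: "L > 0" "\<And>z. z \<in> pts \<Longrightarrow> \<bar>Re z\<bar> < L"
 shows "integral {-L..L} (\<lambda>x. f (Complex x (- pi))) - integral {-L..L} (\<lambda>x. f (Complex x pi))
   + contour_integral (linepath (Complex L (- pi)) (Complex L pi)) f
   + contour_integral (linepath (Complex (- L) pi) (Complex (- L) (- pi))) f = 2 * pi * \<i> * R"
  "continuous_on (closed_segment (Complex L (- pi)) (Complex L pi)) f"
  "continuous_on (closed_segment (Complex (- L) pi) (Complex (- L) (- pi))) f"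
  "(\<lambda>x. f (Complex x (- pi))) integrable_on {-L..L}" "(\<lambda>x. f (Complex x pi)) integrable_on {-L..L}"
proof -
 let ?a1 = "Complex (- L) (- pi)" and ?a2 = "Complex L (- pi)" and ?a3 = "Complex L pi" and ?a4 = "Complex (- L) pi"
 let ?g = "rectpath ?a1 ?a3"
 have im: "path_image ?g \<subseteq> S - pts"
  using pts_S(1) L eta pi_gt_zero by (subst path_image_rectpath) (force simp: S_def)+
 have segs: "closed_segment ?a1 ?a2 \<subseteq> S - pts" "closed_segment ?a2 ?a3 \<subseteq> S - pts"
   "closed_segment ?a3 ?a4 \<subseteq> S - pts" "closed_segment ?a4 ?a1 \<subseteq> S - pts"
  using im unfolding rectpath_def Let_def by (auto simp: path_image_join)
 have cf: "continuous_on T f" if "T \<subseteq> S - pts" for T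
  using holomorphic_on_imp_continuous_on[OF holo(3)] continuous_on_subset that by blast
 note c = cf[OF segs(1)] cf[OF segs(2)] cf[OF segs(3)] cf[OF segs(4)]
 note i = contour_integrable_continuous_linepath[OF c(1)] contour_integrable_continuous_linepath[OF c(2)]
  contour_integrable_continuous_linepath[OF c(3)] contour_integrable_continuous_linepath[OF c(4)]
 have "contour_integral ?g f = 2 * pi * \<i> * (\<Sum>p\<in>pts. winding_number ?g p * residue f p)"
 proof (rule Residue_theorem[OF S_open convex_connected[OF S_convex] _ holo(3) _ _ im])
  show "finite pts" using Z(1) by (simp add: pts_def)
  show "\<forall>z. z \<notin> S \<longrightarrow> winding_number ?g z = 0"
   using L eta by (auto intro!: winding_number_rectpath_outside simp: in_cbox_complex_iff S_def)
 qed auto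
 also have "(\<Sum>p\<in>pts. winding_number ?g p * residue f p) = (\<Sum>p\<in>pts. residue f p)"
 proof (rule sum.cong[OF refl])
  fix z assume z: "z \<in> pts"
  have "z \<in> box ?a1 ?a3" using L(2)[OF z] pts_S(1)[OF z] by (auto simp: in_box_complex_iff)
  thus "winding_number ?g z * residue f z = residue f z" by (simp add: winding_number_rectpath)
 qed
 finally have "contour_integral ?g f = 2 * pi * \<i> * R" by (simp add: sum_residues)
 moreover have "contour_integral ?g f = contour_integral (linepath ?a1 ?a2) f + contour_integral (linepath ?a2 ?a3) f
   + contour_integral (linepath ?a3 ?a4) f + contour_integral (linepath ?a4 ?a1) f"
  unfolding rectpath_def Let_def using i by (simp add: valid_path_join)
 moreover have "contour_integral (linepath ?a1 ?a2) f = integral {-L..L} (\<lambda>x. f (Complex x (- pi)))"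
  using L by (intro contour_integral_linepath_horizontal) auto
 moreover have "contour_integral (linepath ?a3 ?a4) f = - integral {-L..L} (\<lambda>x. f (Complex x pi))"
  using contour_integral_linepath_horizontal[of "-L" L pi f] contour_integral_reversepath[of "linepath ?a4 ?a3" f] L by simp
 ultimately show "integral {-L..L} (\<lambda>x. f (Complex x (- pi))) - integral {-L..L} (\<lambda>x. f (Complex x pi))
   + contour_integral (linepath (Complex L (- pi)) (Complex L pi)) f
   + contour_integral (linepath (Complex (- L) pi) (Complex (- L) (- pi))) f = 2 * pi * \<i> * R"
  by (simp add: algebra_simps)
 show "continuous_on (closed_segment ?a2 ?a3) f" "continuous_on (closed_segment ?a4 ?a1) f" by (fact c)+
 have ch: "(\<lambda>x. f (Complex x d)) integrable_on {-L..L}" if "d = pi \<or> d = - pi" for d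
 proof -
  have "(\<lambda>x. Complex x d) ` {-L..L} \<subseteq> S - pts"
   using that pts_S(1) eta pi_gt_zero by (force simp: S_def)
  hence "continuous_on {-L..L} (\<lambda>x. f (Complex x d))"
   by (intro continuous_on_compose2[OF cf[OF subset_refl]]) (auto simp: Complex_eq intro!: continuous_intros)
  thus ?thesis by (rule integrable_continuous_interval)
 qed
 show "(\<lambda>x. f (Complex x (- pi))) integrable_on {-L..L}" "(\<lambda>x. f (Complex x pi)) integrable_on {-L..L}"
  using ch by auto
qed

lemma limit:
 "((\<lambda>L. integral {-L..L} (\<lambda>x. f (Complex x (- pi)) - f (Complex x pi))) \<longlongrightarrow> 2 * pi * \<i> * R) at_top"
proof -
 define V where "V L = contour_integral (linepath (Complex L (- pi)) (Complex L pi)) f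
   + contour_integral (linepath (Complex (- L) pi) (Complex (- L) (- pi))) f" for L
 have "finite pts" using Z(1) by (simp add: pts_def)
 hence big: "\<forall>\<^sub>F L in at_top. (\<forall>z\<in>pts. \<bar>Re z\<bar> < L) \<and> L > 0 \<and> L \<ge> L0"
  by (intro eventually_conj eventually_gt_at_top eventually_ge_at_top) (simp add: eventually_ball_finite eventually_gt_at_top)
 have V0: "(V \<longlongrightarrow> 0) at_top"
 proof (rule Lim_null_comparison)
  show "\<forall>\<^sub>F L in at_top. norm (V L) \<le> (4 * pi) * side_bound L"
   using big
  proof eventually_elim
   case (elim L)
   have B: "cmod (contour_integral (linepath (Complex r c) (Complex r (- c))) f) \<le> side_bound L * cmod (Complex r (- c) - Complex r c)"
    if r: "r = L \<or> r = - L" "c = pi \<or> c = - pi" "continuous_on (closed_segment (Complex r c) (Complex r (- c))) f" for r c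
   proof (rule contour_integral_bound_linepath[OF contour_integrable_continuous_linepath[OF r(3)]])
    show "0 \<le> side_bound L" by (simp add: side_bound_def)
    fix w assume "w \<in> closed_segment (Complex r c) (Complex r (- c))"
    moreover have "pi \<le> Im w \<Longrightarrow> Im w \<le> - pi \<Longrightarrow> \<bar>Im w\<bar> \<le> pi" using pi_gt_zero by linarith
    ultimately have "Re w = r" "\<bar>Im w\<bar> \<le> pi" using r
     by (auto simp: closed_segment_same_Re closed_segment_eq_real_ivl split: if_splits)
    thus "cmod (f w) \<le> side_bound L" using elim eta r(1) by (intro vertical_bound) (auto simp: S_def)
   qed
   have n: "cmod (Complex r (- c) - Complex r c) = 2 * pi" if "c = pi \<or> c = - pi" for r c
    using that by (auto simp: complex_diff complex_norm real_sqrt_mult)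
   have "norm (V L) \<le> side_bound L * (2 * pi) + side_bound L * (2 * pi)"
    unfolding V_def
    using B[of L "- pi"] B[of "- L" pi] rectangle(2,3)[of L] elim n[of "- pi" L] n[of pi "- L"]
    by (intro order_trans[OF norm_triangle_ineq add_mono]) auto
   thus ?case by (simp add: mult_ac)
  qed
  show "((\<lambda>L. 4 * pi * side_bound L) \<longlongrightarrow> 0) at_top" by (rule tendsto_mult_right_zero[OF side_bound_limit])
 qed
 have "((\<lambda>L. 2 * pi * \<i> * R - V L) \<longlongrightarrow> 2 * pi * \<i> * R - 0) at_top" by (intro tendsto_intros V0)
 moreover have "\<forall>\<^sub>F L in at_top. 2 * pi * \<i> * R - V L = integral {-L..L} (\<lambda>x. f (Complex x (- pi)) - f (Complex x pi))"
  using big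
 proof eventually_elim
  case (elim L)
  hence L: "L > 0" "\<And>z. z \<in> pts \<Longrightarrow> \<bar>Re z\<bar> < L" by auto
  show ?case
   using rectangle(1)[OF L] rectangle(4,5)[OF L] by (simp add: V_def Henstock_Kurzweil_Integration.integral_diff algebra_simps)
 qed
 ultimately show ?thesis by (simp add: tendsto_cong)
qed

end

text \<open>The residue theorem yields only a limit of integrals over growing intervals. Positivity
  turns it, by monotone convergence, into a Lebesgue integral.\<close>

lemma nonneg_truncated_limit:
 fixes h :: "real \<Rightarrow> real" and l u :: "nat \<Rightarrow> real"
 assumes [measurable]: "h \<in> borel_measurable borel"
  and nn: "\<And>p. p > 0 \<Longrightarrow> h p \<ge> 0" and c: "continuous_on {0<..} h"
  and lu: "decseq l" "incseq u" "\<And>n. 0 < l n" "l \<longlonglongrightarrow> 0" "filterlim u at_top sequentially"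
  and lim: "(\<lambda>n. integral {l n..u n} h) \<longlonglongrightarrow> I"
 shows "(\<integral>\<^sup>+p. ennreal (indicator {0<..} p * h p) \<partial>lborel) = ennreal I"
proof -
 let ?A = "\<lambda>n. {l n..u n}"
 have A: "(\<integral>\<^sup>+p. ennreal (indicator (?A n) p * h p) \<partial>lborel) = ennreal (integral (?A n) h)" for n
 proof -
  have ci: "continuous_on (?A n) h" by (rule continuous_on_subset[OF c]) (use lu(3)[of n] in auto)
  have "(h has_integral integral (?A n) h) (?A n)" by (intro integrable_integral integrable_continuous_interval ci)
  moreover have "h p \<ge> 0" if "p \<in> ?A n" for p using that lu(3)[of n] by (intro nn) auto
  ultimately have "(\<integral>\<^sup>+p. ennreal (h p) * indicator (?A n) p \<partial>lborel) = ennreal (integral (?A n) h)"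
   by (intro nn_integral_has_integral_lebesgue' ) auto
  moreover have "ennreal (h p) * indicator (?A n) p = ennreal (indicator (?A n) p * h p)" for p
   by (simp add: indicator_def)
  ultimately show ?thesis by simp
 qed
 show ?thesis
 proof (rule LIMSEQ_unique)
  show "(\<lambda>n. ennreal (integral (?A n) h)) \<longlonglongrightarrow> ennreal I" by (rule tendsto_ennrealI[OF lim])
  show "(\<lambda>n. ennreal (integral (?A n) h)) \<longlonglongrightarrow> (\<integral>\<^sup>+p. ennreal (indicator {0<..} p * h p) \<partial>lborel)"
   unfolding A[symmetric]
  proof (rule nn_integral_LIMSEQ)
   show "incseq (\<lambda>n p. ennreal (indicator (?A n) p * h p))"
   proof (rule incseq_SucI, rule le_funI)
    fix n p
    have "?A n \<subseteq> ?A (Suc n)" using decseq_SucD[OF lu(1), of n] incseq_SucD[OF lu(2), of n] by auto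
    thus "ennreal (indicator (?A n) p * h p) \<le> ennreal (indicator (?A (Suc n)) p * h p)"
     using nn[of p] lu(3)[of "Suc n"] by (intro ennreal_leI) (auto simp: indicator_def)
   qed
   show "(\<lambda>n. ennreal (indicator (?A n) p * h p)) \<longlonglongrightarrow> ennreal (indicator {0<..} p * h p)" for p
   proof (rule tendsto_eventually, cases "p > 0")
    case True
    have "\<forall>\<^sub>F n in sequentially. l n < p" "\<forall>\<^sub>F n in sequentially. p \<le> u n"
     using order_tendstoD(2)[OF lu(4) True] lu(5) by (auto simp: filterlim_at_top)
    thus "\<forall>\<^sub>F n in sequentially. ennreal (indicator (?A n) p * h p) = ennreal (indicator {0<..} p * h p)"
     by eventually_elim (use True in \<open>simp add: indicator_def\<close>)
   next
    case False
    hence "p \<notin> ?A n" for n using lu(3)[of n] by auto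
    thus "\<forall>\<^sub>F n in sequentially. ennreal (indicator (?A n) p * h p) = ennreal (indicator {0<..} p * h p)" using False by simp
   qed
  qed simp
 qed
qed

lemma even_integral:
 fixes h :: "real \<Rightarrow> real"
 assumes [measurable]: "h \<in> borel_measurable borel"
  and nn: "\<And>p. p > 0 \<Longrightarrow> h p \<ge> 0"
  and I: "(\<integral>\<^sup>+p. ennreal (indicator {0<..} p * h p) \<partial>lborel) = ennreal I" "I \<ge> 0"
 shows "integrable lborel (\<lambda>p. h \<bar>p\<bar>)" "(LBINT p. h \<bar>p\<bar>) = 2 * I"
proof -
 have "(\<integral>\<^sup>+p. ennreal (h \<bar>p\<bar>) \<partial>lborel)
   = (\<integral>\<^sup>+p. ennreal (indicator {0<..} p * h p) + ennreal (indicator {0<..} (- p) * h (- p)) \<partial>lborel)"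
 proof (rule nn_integral_cong_AE)
  show "AE p in lborel. ennreal (h \<bar>p\<bar>) = ennreal (indicator {0<..} p * h p) + ennreal (indicator {0<..} (- p) * h (- p))"
   using AE_lborel_singleton[of "0::real"] by eventually_elim (auto simp: indicator_def abs_if)
 qed
 also have "... = (\<integral>\<^sup>+p. ennreal (indicator {0<..} p * h p) \<partial>lborel)
   + (\<integral>\<^sup>+p. ennreal (indicator {0<..} (- p) * h (- p)) \<partial>lborel)"
  by (rule nn_integral_add) measurable
 also have "(\<integral>\<^sup>+p. ennreal (indicator {0<..} (- p) * h (- p)) \<partial>lborel) = (\<integral>\<^sup>+p. ennreal (indicator {0<..} p * h p) \<partial>lborel)"
  using nn_integral_real_affine[of "\<lambda>p. ennreal (indicator {0<..} p * h p)" "-1" 0] by simp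
 finally have E: "(\<integral>\<^sup>+p. ennreal (h \<bar>p\<bar>) \<partial>lborel) = ennreal (2 * I)"
  using I by (simp add: ennreal_plus[symmetric] del: ennreal_plus)
 have ae: "AE p in lborel. 0 \<le> h \<bar>p\<bar>"
  using AE_lborel_singleton[of "0::real"] by eventually_elim (use nn in auto)
 show "integrable lborel (\<lambda>p. h \<bar>p\<bar>)"
  by (rule integrableI_nn_integral_finite[OF _ ae E]) (use I in auto)
 show "(LBINT p. h \<bar>p\<bar>) = 2 * I"
  by (subst integral_eq_nn_integral) (use ae E I in auto)
qed

context strip_contour begin

text \<open>On both edges e^w = -e^x, so the factors e^w - a become -(e^x + a). Under p = e^(x/s)
  these are -(p^s + a), and the factor e^(\<beta> x) of the jump is exactly what completes e^x to
  e^(x/s), that is s times the Jacobian. The half line gives pi R / (b - a), and evenness doubles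
  it.\<close>

lemma even_kernel_integral:
 fixes s \<beta> :: real and \<kappa> :: "real \<Rightarrow> real"
 assumes s: "s > 0" "\<beta> = 1 / s - 1"
  and k: "\<kappa> \<in> borel_measurable borel" "\<And>p. p > 0 \<Longrightarrow> \<kappa> p \<ge> 0" "continuous_on {0<..} \<kappa>"
  and jump: "\<And>x. 1 / q (Complex x (- pi)) - 1 / q (Complex x pi) = cor (2 / s * exp (\<beta> * x) * \<kappa> (exp (x / s))) * \<i>"
 shows "integrable lborel (\<lambda>p. \<kappa> \<bar>p\<bar> / ((\<bar>p\<bar> powr s + a) * (\<bar>p\<bar> powr s + b)))" (is "integrable _ ?k")
  "cor (LBINT p. \<kappa> \<bar>p\<bar> / ((\<bar>p\<bar> powr s + a) * (\<bar>p\<bar> powr s + b))) = 2 * pi * R / cor (b - a)" (is ?eq)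
proof -
 note [measurable] = k(1)
 define h where "h p = \<kappa> p / ((p powr s + a) * (p powr s + b))" for p
 have hm [measurable]: "h \<in> borel_measurable borel" unfolding h_def by measurable
 have hnn: "h p \<ge> 0" if "p > 0" for p using k(2)[OF that] ab by (simp add: h_def add_nonneg_nonneg)
 have hc: "continuous_on {0<..} h" unfolding h_def
  using ab by (intro continuous_intros k(3)) (auto simp: add_pos_pos intro!: less_imp_neq[symmetric] add_nonneg_pos)
 have diff: "f (Complex x (- pi)) - f (Complex x pi) = cor (2 * (b - a)) * \<i> * cor ((exp (x / s) / s) * h (exp (x / s)))" for x
 proof -
  have e: "exp (Complex x (- pi)) = - cor (exp x)" "exp (Complex x pi) = - cor (exp x)"
   by (simp_all add: exp_eq_polar cis.ctr complex_eq_iff)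
  define D where "D = (cor (exp x) + cor a) * (cor (exp x) + cor b)"
  have dd: "(- cor (exp x) - cor a) * (- cor (exp x) - cor b) = D"
   by (simp add: D_def algebra_simps)
  have "f (Complex x (- pi)) - f (Complex x pi)
    = cor (b - a) * cor (exp x) / D * (1 / q (Complex x (- pi)) - 1 / q (Complex x pi))"
   unfolding f_def num_def den_def e mult.assoc dd by (simp add: diff_divide_distrib algebra_simps)
  also have "... = cor (b - a) * cor (exp x) / D * (cor (2 / s * exp (\<beta> * x) * \<kappa> (exp (x / s))) * \<i>)"
   unfolding jump ..
  also have "... = cor (2 * (b - a)) * \<i> * cor (exp x * exp (\<beta> * x) / s * \<kappa> (exp (x / s)) / ((exp x + a) * (exp x + b)))"
   unfolding of_real_mult[of 2 "b - a"] by (simp add: D_def mult_ac del: of_real_diff)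
  also have "exp x * exp (\<beta> * x) = exp (x / s)"
   unfolding exp_add[symmetric] s(2) by (simp add: left_diff_distrib)
  also have "exp x = exp (x / s) powr s" using s by (simp add: powr_def)
  finally show ?thesis by (simp add: h_def)
 qed
 have sub: "integral {-L..L} (\<lambda>x. (exp (x / s) / s) * h (exp (x / s))) = integral {exp (- L / s)..exp (L / s)} h"
  "(\<lambda>x. (exp (x / s) / s) * h (exp (x / s))) integrable_on {-L..L}" if L: "L \<ge> 0" for L
 proof -
  have "((\<lambda>x. (exp (x / s) / s) *\<^sub>R h (exp (x / s))) has_integral
    integral {exp (- L / s)..exp (L / s)} h) {-L..L}"
  proof (rule has_integral_substitution[of "- L" L "\<lambda>x. exp (x / s)"])
   show "(\<lambda>x. exp (x / s)) ` {- L..L} \<subseteq> {exp (- L / s)..exp (L / s)}" using s by (auto simp: field_simps)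
   show "continuous_on {exp (- L / s)..exp (L / s)} h" by (rule continuous_on_subset[OF hc]) (auto intro: less_le_trans[OF exp_gt_zero])
   show "((\<lambda>x. exp (x / s)) has_real_derivative exp (x / s) / s) (at x within {-L..L})" for x
    using s by (auto intro!: derivative_eq_intros)
  qed (use L s in auto)
  hence hi: "((\<lambda>x. (exp (x / s) / s) * h (exp (x / s))) has_integral
    integral {exp (- L / s)..exp (L / s)} h) {-L..L}" by (simp only: real_scaleR_def)
  show "integral {-L..L} (\<lambda>x. (exp (x / s) / s) * h (exp (x / s))) = integral {exp (- L / s)..exp (L / s)} h"
   by (rule integral_unique[OF hi])
  show "(\<lambda>x. (exp (x / s) / s) * h (exp (x / s))) integrable_on {-L..L}"
   by (rule has_integral_integrable[OF hi])
 qed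
 define I where "I n = integral {exp (- real n / s)..exp (real n / s)} h" for n
 have "(\<lambda>n. integral {- real n..real n} (\<lambda>x. f (Complex x (- pi)) - f (Complex x pi))) \<longlonglongrightarrow> 2 * pi * \<i> * R"
  using filterlim_compose[OF limit filterlim_real_sequentially] .
 also have "(\<lambda>n. integral {- real n..real n} (\<lambda>x. f (Complex x (- pi)) - f (Complex x pi))) = (\<lambda>n. cor (2 * (b - a)) * \<i> * cor (I n))"
 proof
  fix n
  have "((\<lambda>x. cor ((exp (x / s) / s) * h (exp (x / s)))) has_integral cor (I n)) {- real n..real n}"
   unfolding I_def using sub[of "real n"] by (intro has_integral_of_real) (simp add: has_integral_iff)
  thus "integral {- real n..real n} (\<lambda>x. f (Complex x (- pi)) - f (Complex x pi)) = cor (2 * (b - a)) * \<i> * cor (I n)"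
   unfolding diff by (intro integral_unique has_integral_mult_right)
 qed
 finally have "(\<lambda>n. cor (2 * (b - a)) * \<i> * cor (I n)) \<longlonglongrightarrow> 2 * pi * \<i> * R" .
 from tendsto_mult_left[OF this, of "1 / (cor (2 * (b - a)) * \<i>)"]
 have lim: "(\<lambda>n. cor (I n)) \<longlonglongrightarrow> pi * R / cor (b - a)"
  using ab unfolding of_real_mult[of 2 "b - a"] by (simp del: of_real_diff)
 define J where "J = Re (pi * R / cor (b - a))"
 have J: "I \<longlonglongrightarrow> J" using tendsto_Re[OF lim] by (simp add: J_def)
 hence Jc: "cor J = pi * R / cor (b - a)"
  using LIMSEQ_unique[OF tendsto_of_real lim] by blast
 have J0: "J \<ge> 0"
 proof (rule LIMSEQ_le_const[OF J], intro exI allI impI)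
  fix n show "0 \<le> I n" unfolding I_def
  proof (rule Henstock_Kurzweil_Integration.integral_nonneg)
   show "h integrable_on {exp (- real n / s)..exp (real n / s)}"
    by (intro integrable_continuous_interval continuous_on_subset[OF hc]) (auto intro: less_le_trans[OF exp_gt_zero])
  qed (auto intro!: hnn intro: less_le_trans[OF exp_gt_zero])
 qed
 have "(\<integral>\<^sup>+p. ennreal (indicator {0<..} p * h p) \<partial>lborel) = ennreal J"
 proof (rule nonneg_truncated_limit[OF hm hnn hc])
  show "decseq (\<lambda>n. exp (- real n / s))" "incseq (\<lambda>n. exp (real n / s))"
   using s by (auto simp: decseq_def incseq_def divide_right_mono)
  show "(\<lambda>n. exp (- real n / s)) \<longlonglongrightarrow> 0" "filterlim (\<lambda>n. exp (real n / s)) at_top sequentially"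
   using s by real_asymp+
 qed (use J in \<open>auto simp: I_def[abs_def]\<close>)
 note ev = even_integral[OF hm hnn this J0]
 show "integrable lborel ?k"
  using ev(1) by (simp add: h_def)
 show ?eq
  using ev(2) by (simp add: h_def Jc)
qed

end

section \<open>The function Theta and its boundary values on the cut\<close>

locale fractional_order =
 fixes s :: real
 assumes s_range: "s \<in> {1/2<..<1} \<union> {1<..<3/2}"
begin

definition "m p = \<bar>p\<bar> powr s" for p :: real
text \<open>With \<open>\<beta>\<close> and \<open>c0\<close>, \<open>Theta s l\<close> is
  \<open>c0 * l powr \<beta>\<close>, hence entire as a function of ln l.\<close>

definition "\<beta> = 1 / s - 1"
definition "c0 = 1 / (s * sin (pi / s))"

lemma s_bounds: "1/2 < s" "s < 3/2" "s \<noteq> 1" "0 < s"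
 using s_range by auto

lemma beta: "\<bar>\<beta>\<bar> < 1" "\<beta> \<noteq> 0" "s < 1 \<Longrightarrow> \<beta> > 0" "s > 1 \<Longrightarrow> \<beta> < 0"
proof -
 have "\<bar>\<beta>\<bar> < 1 \<longleftrightarrow> \<bar>1 - s\<bar> < s" using s_bounds by (simp add: \<beta>_def abs_if field_simps)
 thus "\<bar>\<beta>\<bar> < 1" using s_bounds by (auto simp: abs_if)
qed (use s_bounds in \<open>auto simp: \<beta>_def field_simps\<close>)

lemma sin_sign: "s < 1 \<Longrightarrow> sin (pi / s) < 0" "s > 1 \<Longrightarrow> sin (pi / s) > 0"
proof -
 have "sin (pi / s) = - sin (pi / s - pi)" by simp
 moreover have "pi / s - pi = \<beta> * pi" by (simp add: \<beta>_def algebra_simps)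
 ultimately have e: "sin (pi / s) = - sin (\<beta> * pi)" by simp
 show "sin (pi / s) < 0" if "s < 1"
  unfolding e using beta beta(3)[OF that] by (auto intro!: sin_gt_zero)
 show "sin (pi / s) > 0" if "s > 1"
  by (rule sin_gt_zero) (use that s_bounds in \<open>auto simp: divide_less_eq\<close>)
qed

lemma c0_sign: "s < 1 \<Longrightarrow> c0 < 0" "s > 1 \<Longrightarrow> c0 > 0" "c0 \<noteq> 0" "sin (pi / s) \<noteq> 0"
proof -
 show n: "sin (pi / s) \<noteq> 0" using sin_sign s_bounds(3) by (cases "s < 1") force+
 show "s < 1 \<Longrightarrow> c0 < 0" "s > 1 \<Longrightarrow> c0 > 0" "c0 \<noteq> 0"
  using sin_sign s_bounds n by (auto simp: c0_def divide_less_0_iff zero_less_mult_iff mult_less_0_iff)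
qed

lemma Theta_eq: "l > 0 \<Longrightarrow> Theta s l = c0 * l powr \<beta>"
 by (simp add: Theta_def c0_def \<beta>_def powr_minus[symmetric] divide_inverse mult_ac)

lemma Theta_exp: "l > 0 \<Longrightarrow> cor (Theta s l) = cor c0 * exp (cor \<beta> * cor (ln l))"
 by (simp add: Theta_eq powr_def exp_of_real[symmetric])

text \<open>The modulus of 1 / (\<alpha> - \<Theta>) continued to the argument e^(x - i pi), where p
  = e^(x/s) and so e^(\<beta> x) = p^(1 - s). Its square is the density that the jump across the
  strip produces.\<close>

definition "wt \<alpha> p = 1 / cmod (cor \<alpha> - cor c0 * cor (\<bar>p\<bar> powr (1 - s)) * cis (- (\<beta> * pi)))" for \<alpha> p :: real

lemma wt_measurable [measurable]: "wt \<alpha> \<in> borel_measurable borel"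
 unfolding wt_def by measurable

lemma sin_beta: "sin (\<beta> * pi) = - sin (pi / s)"
proof -
 have "\<beta> * pi = pi / s - pi" by (simp add: \<beta>_def algebra_simps)
 thus ?thesis by simp
qed

text \<open>Small enough that |Im (\<beta> w)| stays below pi on the enlarged strip; then e^(\<beta>
  w) determines \<beta> w.\<close>

definition "strip_width = (1 - \<bar>\<beta>\<bar>) / 2"

lemma strip_width: "0 < strip_width" "strip_width < 1" "\<bar>Im w\<bar> < pi + strip_width \<Longrightarrow> \<bar>Im (cor \<beta> * w)\<bar> < pi"
proof -
 show "0 < strip_width" "strip_width < 1" using beta(1) by (auto simp: strip_width_def)
 assume w: "\<bar>Im w\<bar> < pi + strip_width"
 have "\<bar>Im (cor \<beta> * w)\<bar> = \<bar>\<beta>\<bar> * \<bar>Im w\<bar>" by (simp add: abs_mult)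
 also have "... \<le> \<bar>\<beta>\<bar> * (pi + strip_width)" using w by (intro mult_left_mono) auto
 also have "... < pi"
 proof -
  have "\<bar>\<beta>\<bar> * strip_width \<le> 1 * strip_width" using beta(1) by (intro mult_right_mono) (auto simp: strip_width_def)
  also have "... < pi * (1 - \<bar>\<beta>\<bar>)"
   using mult_strict_right_mono[of "1/2" pi "1 - \<bar>\<beta>\<bar>"] beta(1) pi_gt3 by (simp add: strip_width_def)
  finally show ?thesis by (simp add: algebra_simps)
 qed
 finally show "\<bar>Im (cor \<beta> * w)\<bar> < pi" .
qed

text \<open>Here q is the reciprocal of \<Theta>, which has no zeros, so that only ln a and ln b
  contribute. The normalisation c0 sin (pi/s) = 1/s makes the kernel produced by the jump equal to
  1.\<close>

theorem Theta_integral: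
 assumes ab: "a > 0" "b > 0" "a \<noteq> b"
 shows "integrable lborel (\<lambda>p. 1 / ((m p + a) * (m p + b)))"
  "(LBINT p. 1 / ((m p + a) * (m p + b))) = 2 * pi * (Theta s a - Theta s b) / (b - a)"
proof -
 define q where "q w = exp (- (cor \<beta> * w)) / cor c0" for w
 interpret strip_contour a b strip_width "\<bar>\<beta>\<bar>" "\<bar>c0\<bar>" 0 q "{}"
 proof
  show "q holomorphic_on {w. \<bar>Im w\<bar> < pi + strip_width}" unfolding q_def by (intro holomorphic_intros) (use c0_sign in auto)
  show "q w = 0 \<longleftrightarrow> w \<in> {}" for w using c0_sign by (simp add: q_def)
  show "cmod (1 / q w) \<le> \<bar>c0\<bar> * exp (\<bar>\<beta>\<bar> * \<bar>Re w\<bar>)" for w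
  proof -
   have "cmod (1 / q w) = \<bar>c0\<bar> * exp (\<beta> * Re w)"
    by (simp add: q_def norm_divide norm_mult norm_exp_eq_Re exp_minus field_simps)
   also have "\<beta> * Re w \<le> \<bar>\<beta>\<bar> * \<bar>Re w\<bar>" unfolding abs_mult[symmetric] by simp
   finally show ?thesis by (simp add: mult_left_mono)
  qed
 qed (use ab strip_width beta in auto)
 have jump: "1 / q (Complex x (- pi)) - 1 / q (Complex x pi) = cor (2 / s * exp (\<beta> * x) * 1) * \<i>" for x
 proof -
  have e: "exp (cor \<beta> * Complex x y) = cor (exp (\<beta> * x)) * cis (\<beta> * y)" for y
   by (simp add: exp_eq_polar)
  have iq: "1 / q w = cor c0 * exp (cor \<beta> * w)" for w
   using c0_sign by (simp add: q_def exp_minus field_simps)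
  have "1 / q (Complex x (- pi)) - 1 / q (Complex x pi) = cor (c0 * exp (\<beta> * x)) * (cis (- (\<beta> * pi)) - cis (\<beta> * pi))"
   unfolding iq e by (simp add: algebra_simps)
  also have "cis (- (\<beta> * pi)) - cis (\<beta> * pi) = cor (2 * sin (pi / s)) * \<i>"
   by (simp add: complex_eq_iff sin_beta)
  also have "cor (c0 * exp (\<beta> * x)) * (cor (2 * sin (pi / s)) * \<i>) = cor (c0 * sin (pi / s) * 2 * exp (\<beta> * x)) * \<i>"
   by simp
  also have "c0 * sin (pi / s) = 1 / s" using c0_sign(4) by (simp add: c0_def)
  finally show ?thesis by simp
 qed
 note K = even_kernel_integral[OF s_bounds(4) \<beta>_def, of "\<lambda>_. 1", OF _ _ _ jump]
 show "integrable lborel (\<lambda>p. 1 / ((m p + a) * (m p + b)))" using K(1) by (simp add: m_def)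
 have R: "R = cor (Theta s a - Theta s b)"
  using c0_sign ab by (simp add: R_def la_def lb_def q_def Theta_exp exp_minus field_simps)
 have "cor (LBINT p. 1 / ((m p + a) * (m p + b))) = cor (2 * pi * (Theta s a - Theta s b) / (b - a))"
  using K(2) unfolding R by (simp add: m_def)
 thus "(LBINT p. 1 / ((m p + a) * (m p + b))) = 2 * pi * (Theta s a - Theta s b) / (b - a)"
  by (simp only: of_real_eq_iff)
qed

text \<open>For \<alpha> different from 0 the reciprocal is bounded far out. For \<alpha> = 0 it is
  a multiple of e^(-\<beta> w), which grows on one side; the exponential bound covers both
  cases.\<close>

lemma reciprocal_growth:
 "\<exists>C L0. \<forall>w. \<bar>Re w\<bar> \<ge> L0 \<longrightarrow> cmod (1 / (cor \<alpha> - cor c0 * exp (cor \<beta> * w))) \<le> C * exp (\<bar>\<beta>\<bar> * \<bar>Re w\<bar>)"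
proof -
 define A where "A = \<bar>c0\<bar>"
 have A: "A > 0" using c0_sign by (simp add: A_def)
 define C where "C = (if \<alpha> = 0 then 1 / A else 1)"
 have C: "C > 0" using A by (simp add: C_def)
 have "\<forall>\<^sub>F t in at_top. exp (- t) \<le> C * (A * exp t - \<bar>\<alpha>\<bar>)" using A C by real_asymp
 moreover have "\<forall>\<^sub>F t in at_top. exp (- t) \<le> C * \<bar>\<bar>\<alpha>\<bar> - A * exp (- t)\<bar>"
 proof (cases "\<alpha> = 0")
  case False
  hence "\<forall>\<^sub>F t in at_top. exp (- t) \<le> \<bar>\<alpha>\<bar> - A * exp (- t)" using A by real_asymp
  thus ?thesis by eventually_elim (simp add: C_def False)
 qed (use A in \<open>simp add: C_def\<close>)
 ultimately have "\<forall>\<^sub>F t in at_top. exp (- t) \<le> C * (A * exp t - \<bar>\<alpha>\<bar>) \<and> exp (- t) \<le> C * \<bar>\<bar>\<alpha>\<bar> - A * exp (- t)\<bar>"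
  by (rule eventually_conj)
 then obtain T where T: "\<And>t. t \<ge> T \<Longrightarrow> exp (- t) \<le> C * (A * exp t - \<bar>\<alpha>\<bar>)" "\<And>t. t \<ge> T \<Longrightarrow> exp (- t) \<le> C * \<bar>\<bar>\<alpha>\<bar> - A * exp (- t)\<bar>"
  by (auto simp: eventually_at_top_linorder)
 have bound: "exp (- \<bar>t\<bar>) \<le> C * \<bar>\<bar>\<alpha>\<bar> - A * exp t\<bar>" if "\<bar>t\<bar> \<ge> T" for t
 proof (cases "t \<ge> 0")
  case True
  have "C * (A * exp t - \<bar>\<alpha>\<bar>) \<le> C * \<bar>\<bar>\<alpha>\<bar> - A * exp t\<bar>" using C by (intro mult_left_mono) auto
  thus ?thesis using T(1)[of t] True that by simp
 qed (use T(2)[of "- t"] that in simp)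
 show ?thesis
 proof (intro exI allI impI)
  fix w assume w: "\<bar>Re w\<bar> \<ge> T / \<bar>\<beta>\<bar>"
  let ?q = "cor \<alpha> - cor c0 * exp (cor \<beta> * w)" and ?e = "exp (- \<bar>\<beta> * Re w\<bar>)"
  have "?e \<le> C * \<bar>\<bar>\<alpha>\<bar> - A * exp (\<beta> * Re w)\<bar>"
   using bound[of "\<beta> * Re w"] w beta(2) by (simp add: abs_mult divide_le_eq mult.commute)
  also have "... \<le> C * cmod ?q"
   using norm_triangle_ineq3[of "cor \<alpha>" "cor c0 * exp (cor \<beta> * w)"] C
   by (intro mult_left_mono) (auto simp: norm_mult norm_exp_eq_Re A_def)
  finally have e: "?e \<le> C * cmod ?q" .
  hence "?q \<noteq> 0" by (auto simp: not_le)
  with e show "cmod (1 / ?q) \<le> C * exp (\<bar>\<beta>\<bar> * \<bar>Re w\<bar>)"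
   by (simp add: norm_divide exp_minus abs_mult divide_simps mult_ac)
 qed
qed

text \<open>In the strip \<alpha> - \<Theta> vanishes only if \<alpha> and c0 have the same sign,
  and then only at the real point ln E, simply. The last term is the residue there; the hypothesis
  on E keeps this pole apart from ln a and ln b.\<close>

theorem reciprocal_integral:
 assumes ab: "a > 0" "b > 0" "a \<noteq> b"
  and E: "(s - 1) * \<alpha> > 0 \<Longrightarrow> eigenvalue_E s \<alpha> \<noteq> a \<and> eigenvalue_E s \<alpha> \<noteq> b"
 shows "integrable lborel (\<lambda>p. (wt \<alpha> p)\<^sup>2 / ((m p + a) * (m p + b)))"
  "(LBINT p. (wt \<alpha> p)\<^sup>2 / ((m p + a) * (m p + b))) = 2 * pi / (b - a) * (1 / (\<alpha> - Theta s a) - 1 / (\<alpha> - Theta s b)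
    + (if (s - 1) * \<alpha> > 0 then (b - a) * eigenvalue_E s \<alpha> / (\<beta> * \<alpha> * (eigenvalue_E s \<alpha> - a) * (eigenvalue_E s \<alpha> - b)) else 0))"
  (is "?I = 2 * pi / (b - a) * ?R")
proof -
 let ?E = "eigenvalue_E s \<alpha>"
 define q where "q w = cor \<alpha> - cor c0 * exp (cor \<beta> * w)" for w
 define Z where "Z = (if (s - 1) * \<alpha> > 0 then {cor (ln ?E)} else {})"
 have sgn: "(s - 1) * \<alpha> > 0 \<longleftrightarrow> \<alpha> / c0 > 0"
 proof (cases "s < 1")
  case True
  thus ?thesis using c0_sign(1)[OF True] by (auto simp: zero_less_mult_iff zero_less_divide_iff)
 next
  case False
  thus ?thesis using c0_sign(2) s_bounds(3) by (auto simp: zero_less_mult_iff zero_less_divide_iff)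
 qed
 have Epos: "?E > 0" "ln ?E = ln (\<alpha> / c0) / \<beta>" "exp (cor \<beta> * cor (ln ?E)) = cor (\<alpha> / c0)"
  if "(s - 1) * \<alpha> > 0"
 proof -
  have p: "\<alpha> / c0 > 0" using that sgn by simp
  have e: "?E = (\<alpha> / c0) powr (1 / \<beta>)"
  proof -
   have "s / (1 - s) = 1 / \<beta>" using s_bounds by (simp add: \<beta>_def field_simps)
   thus ?thesis by (simp add: eigenvalue_E_def c0_def mult.assoc)
  qed
  show "?E > 0" using p unfolding e by auto
  show l: "ln ?E = ln (\<alpha> / c0) / \<beta>" using p unfolding e by (auto simp: ln_powr)
  show "exp (cor \<beta> * cor (ln ?E)) = cor (\<alpha> / c0)"
   unfolding l of_real_mult[symmetric] using beta(2) p by (simp add: exp_of_real del: of_real_divide)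
 qed
 obtain C L0 where CL: "\<And>w. \<bar>Re w\<bar> \<ge> L0 \<Longrightarrow> cmod (1 / q w) \<le> C * exp (\<bar>\<beta>\<bar> * \<bar>Re w\<bar>)"
  using reciprocal_growth[of \<alpha>] unfolding q_def by blast
 have dq: "(q has_field_derivative - (cor (c0 * \<beta>) * exp (cor \<beta> * w))) (at w)" for w
  unfolding q_def[abs_def] by (auto intro!: derivative_eq_intros)
 have zero: "q w = 0 \<longleftrightarrow> w \<in> Z" if w: "\<bar>Im w\<bar> < pi + strip_width" for w
 proof -
  have q0: "q w = 0 \<longleftrightarrow> exp (cor \<beta> * w) = cor (\<alpha> / c0)"
   using c0_sign(3) by (auto simp: q_def field_simps)
  have iw: "\<bar>Im (cor \<beta> * w)\<bar> < pi" by (rule strip_width(3)[OF w])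
  show ?thesis
  proof (cases "\<alpha> / c0 > 0")
   case True
   have "exp (cor \<beta> * w) = cor (\<alpha> / c0) \<longleftrightarrow> cor \<beta> * w = cor (ln (\<alpha> / c0))"
    using exp_eq_of_real_strip[of "cor \<beta> * w" "\<alpha> / c0"] True iw by (auto simp: exp_of_real simp del: of_real_divide)
   also have "... \<longleftrightarrow> w = cor (ln ?E)"
   proof -
    have lnE: "ln (\<alpha> / c0) = \<beta> * ln ?E" using beta(2) Epos(2) True sgn by simp
    show ?thesis unfolding lnE of_real_mult using beta(2) by simp
   qed
   finally show ?thesis using q0 True sgn by (simp add: Z_def)
  next
   case False
   have "exp (cor \<beta> * w) \<noteq> cor (\<alpha> / c0)"
   proof
    assume ex: "exp (cor \<beta> * w) = cor (\<alpha> / c0)"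
    hence "\<alpha> / c0 \<noteq> 0" by (metis exp_not_eq_zero of_real_0)
    hence "\<alpha> / c0 < 0" using False by linarith
    \<comment> \<open>A negative value of e^(\<beta> w) would need imaginary part pi in \<beta> w,
      which the width of the strip excludes.\<close>
    hence "Im (Ln (cor (\<alpha> / c0))) = pi" by (subst Im_Ln_eq_pi) (simp_all del: of_real_divide, auto)
    moreover have "Ln (cor (\<alpha> / c0)) = cor \<beta> * w"
     unfolding ex[symmetric] using iw by (intro Ln_exp) auto
    ultimately show False using iw by simp
   qed
   thus ?thesis using q0 False sgn by (simp add: Z_def)
  qed
 qed
 interpret strip_contour a b strip_width "\<bar>\<beta>\<bar>" C L0 q Z
 proof
  show "q holomorphic_on {w. \<bar>Im w\<bar> < pi + strip_width}" unfolding q_def by (intro holomorphic_intros)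
  show "z \<in> Z \<Longrightarrow> deriv q z \<noteq> 0" for z using DERIV_imp_deriv[OF dq] c0_sign(3) beta(2) by simp
  show "exp z \<noteq> cor a \<and> exp z \<noteq> cor b" if "z \<in> Z" for z
   using that E Epos(1) by (auto simp: Z_def exp_of_real split: if_splits)
 qed (use ab strip_width beta zero CL in \<open>auto simp: Z_def split: if_splits\<close>)
 define \<kappa> where "\<kappa> p = (wt \<alpha> p)\<^sup>2" for p
 have qm: "q (Complex x (- pi)) = cor \<alpha> - cor c0 * cor (exp (\<beta> * x)) * cis (- (\<beta> * pi))"
   "q (Complex x pi) = cnj (q (Complex x (- pi)))" for x
  by (simp_all add: q_def exp_eq_polar cis_cnj)
 have kq: "\<kappa> (exp (x / s)) = 1 / (cmod (q (Complex x (- pi))))\<^sup>2" for x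
 proof -
  have "\<bar>exp (x / s)\<bar> powr (1 - s) = exp (\<beta> * x)" using s_bounds by (simp add: powr_def \<beta>_def field_simps)
  thus ?thesis by (simp add: \<kappa>_def wt_def qm(1) power_divide del: of_real_exp)
 qed
 have qnz: "q (Complex x (- pi)) \<noteq> 0" for x
  using zero[of "Complex x (- pi)"] strip_width(1) Z(3)[of "Complex x (- pi)"] by (auto simp: add_pos_pos)
 have jump: "1 / q (Complex x (- pi)) - 1 / q (Complex x pi) = cor (2 / s * exp (\<beta> * x) * \<kappa> (exp (x / s))) * \<i>" for x
 proof -
  \<comment> \<open>The values of q on the two edges are conjugate, so the jump of 1/q is -2 \<i> Im
    z / |z|^2, and Im z = -e^(\<beta> x) / s by the choice of \<open>c0\<close>.\<close>
  define z where "z = q (Complex x (- pi))"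
  have z0: "z \<noteq> 0" unfolding z_def by (rule qnz)
  have Iz: "Im z = - exp (\<beta> * x) / s"
  proof -
   have "Im z = c0 * exp (\<beta> * x) * sin (\<beta> * pi)" by (simp add: z_def qm(1) del: of_real_exp)
   thus ?thesis unfolding sin_beta using c0_sign(4) by (simp add: c0_def)
  qed
  have "1 / z - 1 / cnj z = (cnj z - z) / (z * cnj z)" using z0 by (simp add: diff_frac_eq)
  also have "z * cnj z = cor ((cmod z)\<^sup>2)" by (simp only: complex_norm_square)
  also have "cnj z - z = cor (- 2 * Im z) * \<i>" by (simp add: complex_eq_iff)
  also have "cor (- 2 * Im z) * \<i> / cor ((cmod z)\<^sup>2) = cor (- 2 * Im z * (1 / (cmod z)\<^sup>2)) * \<i>"
   by simp
  also have "- 2 * Im z * (1 / (cmod z)\<^sup>2) = 2 / s * exp (\<beta> * x) * \<kappa> (exp (x / s))"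
   unfolding Iz kq unfolding z_def by simp
  finally show ?thesis by (simp only: z_def qm(2)[of x])
 qed
 have kc: "continuous_on {0<..} \<kappa>"
 proof -
  have nz: "cor \<alpha> - cor c0 * cor (\<bar>p\<bar> powr (1 - s)) * cis (- (\<beta> * pi)) \<noteq> 0" if p: "p > 0" for p
  proof -
   have "\<bar>p\<bar> powr (1 - s) = exp (\<beta> * (s * ln p))" using s_bounds p by (simp add: powr_def \<beta>_def field_simps)
   thus ?thesis using qnz[of "s * ln p"] by (simp add: qm(1) del: of_real_exp)
  qed
  show ?thesis unfolding \<kappa>_def wt_def by (intro continuous_intros) (use nz in auto)
 qed
 have km: "\<kappa> \<in> borel_measurable borel" unfolding \<kappa>_def[abs_def] by measurable
 have kabs: "\<kappa> \<bar>p\<bar> = \<kappa> p" for p by (simp add: \<kappa>_def wt_def)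
 note K = even_kernel_integral[OF s_bounds(4) \<beta>_def km _ kc jump]
 show "integrable lborel (\<lambda>p. (wt \<alpha> p)\<^sup>2 / ((m p + a) * (m p + b)))"
  using K(1) unfolding kabs by (simp add: m_def \<kappa>_def)
 have q1: "q (cor (ln l)) = cor (\<alpha> - Theta s l)" if "l > 0" for l
  using that by (simp add: q_def Theta_exp)
 let ?S = "\<Sum>z\<in>Z. cor (a - b) * exp z / (deriv q z * (exp z - cor a) * (exp z - cor b))"
 have "R = cor ?R"
 proof (cases "(s - 1) * \<alpha> > 0")
  case True
  have "deriv q (cor (ln ?E)) = cor (- (\<beta> * \<alpha>))"
   using DERIV_imp_deriv[OF dq] Epos(3)[OF True] c0_sign(3) by simp
  moreover have "exp (cor (ln ?E)) = cor ?E" using Epos(1)[OF True] by (simp add: exp_of_real)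
  ultimately have "?S
    = cor ((a - b) * ?E / (- (\<beta> * \<alpha>) * (?E - a) * (?E - b)))"
   using True by (simp add: Z_def)
  moreover have "(a - b) * ?E / (- (\<beta> * \<alpha>) * (?E - a) * (?E - b)) = (b - a) * ?E / (\<beta> * \<alpha> * (?E - a) * (?E - b))"
   by (metis (no_types, opaque_lifting) minus_diff_eq minus_divide_divide minus_mult_left)
  ultimately have sumZ: "?S
    = cor ((b - a) * ?E / (\<beta> * \<alpha> * (?E - a) * (?E - b)))" by (simp only:)
  show ?thesis unfolding R_def sumZ la_def lb_def using True ab by (simp add: q1)
 next
  case False
  hence "Z = {}" by (simp add: Z_def)
  hence "?S = 0" by simp
  thus ?thesis unfolding R_def la_def lb_def using False ab by (simp add: q1)
 qed
 hence "cor ?I = cor (2 * pi / (b - a) * ?R)"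
  using K(2) unfolding kabs by (simp add: m_def \<kappa>_def)
 thus "?I = 2 * pi / (b - a) * ?R" by (simp only: of_real_eq_iff)
qed

end

section \<open>Spectral resolutions\<close>

lemma cinner_eqI: "(\<And>z. cinner x z = cinner y z) \<Longrightarrow> x = y"
 by (metis cinner_diff(1) cinner_self(3) eq_iff_diff_eq_0)

text \<open>\<open>orth_projection\<close> asks only for symmetry and idempotence; an everywhere
  defined symmetric map is linear because inner products determine vectors.\<close>

lemma orth_projection_linear:
 assumes "orth_projection P" shows "clinear_map P"
proof -
 have sym: "cinner (P x) y = cinner x (P y)" for x y using assms by (auto simp: orth_projection_def)
 show ?thesis unfolding clinear_map_def
 proof (intro conjI allI)
  fix x y c
  show "P (x + y) = P x + P y" by (rule cinner_eqI) (simp only: sym cinner_add_left)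
  show "P (c *\<^sub>C x) = c *\<^sub>C P x" by (rule cinner_eqI) (simp only: sym cinner_scaleC_left)
 qed
qed

lemma nn_integral_add_measure:
 assumes sets: "sets M = sets borel" "sets M1 = sets borel" "sets M2 = sets borel"
  and add: "\<And>B. B \<in> sets borel \<Longrightarrow> emeasure M B = emeasure M1 B + emeasure M2 B"
  and g: "g \<in> borel_measurable borel"
 shows "(\<integral>\<^sup>+x. g x \<partial>M) = (\<integral>\<^sup>+x. g x \<partial>M1) + (\<integral>\<^sup>+x. g x \<partial>M2)"
 using g
proof (induction g rule: borel_measurable_induct)
 case (cong f g)
 hence "f = g" by auto
 thus ?case using cong by simp
next
 case (set A)
 thus ?case using sets add by simp
next
 case (mult u c)
 have "u \<in> borel_measurable M" "u \<in> borel_measurable M1" "u \<in> borel_measurable M2"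
  using mult sets by (simp_all cong: measurable_cong_sets)
 thus ?case using mult by (simp add: nn_integral_cmult distrib_left)
next
 case (add u v)
 have "u \<in> borel_measurable M" "u \<in> borel_measurable M1" "u \<in> borel_measurable M2"
  "v \<in> borel_measurable M" "v \<in> borel_measurable M1" "v \<in> borel_measurable M2"
  using add sets by (simp_all cong: measurable_cong_sets)
 thus ?case using add by (simp add: nn_integral_add add_ac)
next
 case (seq U)
 have m: "U i \<in> borel_measurable M" "U i \<in> borel_measurable M1" "U i \<in> borel_measurable M2" for i
  using seq sets by (simp_all cong: measurable_cong_sets)
 have inc: "incseq (\<lambda>i. integral\<^sup>N N (U i))" for N
  using seq(3) by (auto simp: incseq_def le_fun_def intro!: nn_integral_mono)
 have SUP: "(SUP i. U i) x = (SUP i. U i x)" for x by (simp add: image_comp)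
 show ?case unfolding SUP nn_integral_monotone_convergence_SUP[OF seq(3) m(1)]
   nn_integral_monotone_convergence_SUP[OF seq(3) m(2)] nn_integral_monotone_convergence_SUP[OF seq(3) m(3)]
   ennreal_SUP_add[OF inc inc, symmetric] seq.IH ..
qed

lemma integral_add_measure:
 fixes g :: "real \<Rightarrow> real"
 assumes sets: "sets M = sets borel" "sets M1 = sets borel" "sets M2 = sets borel"
  and add: "\<And>B. B \<in> sets borel \<Longrightarrow> emeasure M B = emeasure M1 B + emeasure M2 B"
  and g: "g \<in> borel_measurable borel"
 shows "integrable M g \<longleftrightarrow> integrable M1 g \<and> integrable M2 g"
  "integrable M g \<Longrightarrow> integral\<^sup>L M g = integral\<^sup>L M1 g + integral\<^sup>L M2 g"
proof -
 have m: "g \<in> borel_measurable M" "g \<in> borel_measurable M1" "g \<in> borel_measurable M2"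
  using g sets by (simp_all cong: measurable_cong_sets)
 have nn: "(\<integral>\<^sup>+x. ennreal (h x) \<partial>M) = (\<integral>\<^sup>+x. ennreal (h x) \<partial>M1) + (\<integral>\<^sup>+x. ennreal (h x) \<partial>M2)"
  if "h \<in> borel_measurable borel" for h
  by (rule nn_integral_add_measure[OF sets add]) (use that in auto)
 have "(\<lambda>x. norm (g x)) \<in> borel_measurable borel" using g by simp
 from nn[OF this] show i: "integrable M g \<longleftrightarrow> integrable M1 g \<and> integrable M2 g"
  unfolding integrable_iff_bounded using m by (simp add: ennreal_add_less_top) 
 assume I: "integrable M g"
 hence I12: "integrable M1 g" "integrable M2 g" using i by auto
 have fin: "(\<integral>\<^sup>+x. ennreal (g x) \<partial>N) < \<top>" "(\<integral>\<^sup>+x. ennreal (- g x) \<partial>N) < \<top>" if "integrable N g" for N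
  using that unfolding real_integrable_def by (auto simp: less_top)
 have "(\<lambda>x. - g x) \<in> borel_measurable borel" using g by simp
 from nn[OF this] nn[OF g] show "integral\<^sup>L M g = integral\<^sup>L M1 g + integral\<^sup>L M2 g"
  unfolding real_lebesgue_integral_def[OF I] real_lebesgue_integral_def[OF I12(1)] real_lebesgue_integral_def[OF I12(2)]
  using fin[OF I12(1)] fin[OF I12(2)] by (simp add: enn2real_plus)
qed

section \<open>Projection-valued measures\<close>

locale projection_family =
 fixes E :: "real set \<Rightarrow> L2 \<Rightarrow> L2"
 assumes projection: "\<And>B. B \<in> sets borel \<Longrightarrow> orth_projection (E B)"
  and E_UNIV: "E UNIV = id"
  and inter': "\<And>B C. B \<in> sets borel \<Longrightarrow> C \<in> sets borel \<Longrightarrow> E (B \<inter> C) = E B \<circ> E C"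
  and sums: "\<And>B x. range B \<subseteq> sets borel \<Longrightarrow> disjoint_family B \<Longrightarrow> (\<lambda>i::nat. E (B i) x) sums E (\<Union>i. B i) x"
begin

lemma sym: "B \<in> sets borel \<Longrightarrow> cinner (E B x) y = cinner x (E B y)"
 using projection by (auto simp: orth_projection_def)

lemma lin: "B \<in> sets borel \<Longrightarrow> clinear_map (E B)"
 by (intro orth_projection_linear projection)

lemma UNIV [simp]: "E UNIV x = x"
 by (simp add: E_UNIV)

lemma inter: "B \<in> sets borel \<Longrightarrow> C \<in> sets borel \<Longrightarrow> E B (E C x) = E (B \<inter> C) x"
 by (simp add: inter')

lemma idem: "B \<in> sets borel \<Longrightarrow> E B (E B x) = E B x"
 using inter[of B B] by simp

lemma norm_sq: "B \<in> sets borel \<Longrightarrow> (norm (E B x))\<^sup>2 = Re (cinner x (E B x))"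
 by (simp add: Re_cinner_norm[symmetric] sym idem)

lemma empty [simp]: "E {} x = 0"
proof -
 have "(\<lambda>i::nat. E {} x) sums E (\<Union>i::nat. {}) x" by (rule sums) (auto simp: disjoint_family_on_def)
 hence "(\<lambda>i::nat. E {} x) \<longlonglongrightarrow> 0" by (intro summable_LIMSEQ_zero sums_summable)
 thus ?thesis using LIMSEQ_unique[OF tendsto_const] by blast
qed

definition "\<mu> x = scalar_spectral_measure E x"

lemma sets_mu [simp, measurable_cong]: "sets (\<mu> x) = sets borel"
 unfolding \<mu>_def scalar_spectral_measure_def by (simp add: sets.sigma_sets_eq[of borel, simplified])

lemma space_mu [simp]: "space (\<mu> x) = UNIV"
 using sets_eq_imp_space_eq[OF sets_mu] by simp

text \<open>By \<open>norm_sq\<close> the squared norm of \<open>E B x\<close> is the value of one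
  continuous real-linear functional at \<open>E B x\<close>, so norm convergence of the series gives
  countable additivity.\<close>

lemma mu: "B \<in> sets borel \<Longrightarrow> emeasure (\<mu> x) B = ennreal ((norm (E B x))\<^sup>2)"
 unfolding \<mu>_def scalar_spectral_measure_def
proof (rule emeasure_measure_of_sigma)
 show "sigma_algebra UNIV (sets (borel :: real measure))" using sets.sigma_algebra_axioms[of "borel :: real measure"] by simp
 show "positive (sets borel) (\<lambda>B. ennreal ((norm (E B x))\<^sup>2))" by (simp add: positive_def)
 show "countably_additive (sets borel) (\<lambda>B. ennreal ((norm (E B x))\<^sup>2))"
 proof (rule countably_additiveI)
  fix B :: "nat \<Rightarrow> real set" assume B: "range B \<subseteq> sets borel" "disjoint_family B" "(\<Union>i. B i) \<in> sets borel"
  have "bounded_linear (\<lambda>y. Re (cinner x y))"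
  proof (rule bounded_linear_intro[where K = "norm x"])
   show "Re (cinner x (r *\<^sub>R y)) = r *\<^sub>R Re (cinner x y)" for r y
    by (simp add: scaleR_L2_def cinner_scaleC_right)
   show "norm (Re (cinner x y)) \<le> norm y * norm x" for y
    using abs_Re_le_cmod[of "cinner x y"] cinner_bound[of x y] by (simp add: mult.commute)
  qed (simp add: cinner_add_right)
  from bounded_linear.sums[OF this sums[OF B(1,2)]]
  have s: "(\<lambda>i. (norm (E (B i) x))\<^sup>2) sums (norm (E (\<Union>i. B i) x))\<^sup>2"
   using B by (simp add: norm_sq range_subsetD)
  have "(\<Sum>i. ennreal ((norm (E (B i) x))\<^sup>2)) = ennreal (\<Sum>i. (norm (E (B i) x))\<^sup>2)"
   by (rule suminf_ennreal2) (auto intro: sums_summable[OF s])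
  thus "(\<Sum>i. ennreal ((norm (E (B i) x))\<^sup>2)) = ennreal ((norm (E (\<Union>i. B i) x))\<^sup>2)"
   using sums_unique[OF s] by simp
 qed
qed

lemma finite_mu: "finite_measure (\<mu> x)"
 by (rule finite_measureI) (simp add: mu)

lemma measure_mu: "B \<in> sets borel \<Longrightarrow> measure (\<mu> x) B = (norm (E B x))\<^sup>2"
 by (simp add: measure_def mu)

lemma compl: "B \<in> sets borel \<Longrightarrow> E B x + E (- B) x = x"
proof -
 assume B: "B \<in> sets borel"
 define C where "C i = (case i of 0 \<Rightarrow> B | Suc 0 \<Rightarrow> - B | _ \<Rightarrow> {})" for i :: nat
 have "(\<lambda>i. E (C i) x) sums E (\<Union>i. C i) x"
  using B by (intro sums) (auto simp: C_def disjoint_family_on_def split: nat.splits)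
 moreover have "(\<Union>i. C i) = UNIV"
 proof -
  have "C 0 \<union> C (Suc 0) = UNIV" by (simp add: C_def)
  thus ?thesis by blast
 qed
 moreover have "(\<lambda>i. E (C i) x) sums (\<Sum>i\<in>{0, Suc 0}. E (C i) x)"
  by (rule sums_finite) (auto simp: C_def split: nat.splits)
 ultimately show "E B x + E (- B) x = x" using sums_unique2 by (fastforce simp: C_def)
qed

lemma supported:
 assumes "B \<in> sets borel" "E B x = x"
 shows "AE t in \<mu> x. t \<in> B"
proof -
 have "E (- B) x = 0" using compl[OF assms(1), of x] assms(2) by simp
 hence "- B \<in> null_sets (\<mu> x)" using assms by (simp add: null_sets_def mu)
 thus ?thesis by (rule AE_I') auto
qed

end

locale spectral_family =
 fixes A :: L2_op and E :: "real set \<Rightarrow> L2 \<Rightarrow> L2"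
 assumes res: "spectral_resolution A E"

sublocale spectral_family \<subseteq> projection_family E
proof
 show "E (B \<inter> C) = E B \<circ> E C" if "B \<in> sets borel" "C \<in> sets borel" for B C
  using res that by (simp add: spectral_resolution_def)
 show "(\<lambda>i::nat. E (B i) x) sums E (\<Union>i. B i) x" if "range B \<subseteq> sets borel" "disjoint_family B" for B x
  using res that by (simp add: spectral_resolution_def)
qed (use res in \<open>simp_all add: spectral_resolution_def\<close>)

context spectral_family begin

lemma in_domain: "x \<in> Domain A \<longleftrightarrow> integrable (\<mu> x) (\<lambda>t. t\<^sup>2)"
 using res unfolding spectral_resolution_def \<mu>_def by blast

lemma quad: "(x, y) \<in> A \<Longrightarrow> cinner x y = cor (integral\<^sup>L (\<mu> x) (\<lambda>t. t))"
 using res by (auto simp: spectral_resolution_def \<mu>_def)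

lemma integrable_supported:
 assumes B: "B \<in> sets borel" "E B x = x" "B \<subseteq> {a..b}"
 shows "integrable (\<mu> x) (\<lambda>t. t\<^sup>2)" "integrable (\<mu> x) (\<lambda>t. t)"
proof -
 interpret finite_measure "\<mu> x" by (rule finite_mu)
 define K where "K = max \<bar>a\<bar> \<bar>b\<bar>"
 have k: "\<bar>t\<bar> \<le> K" if "t \<in> B" for t
 proof -
  have "a \<le> t" "t \<le> b" using that B(3) by auto
  thus ?thesis unfolding K_def by linarith
 qed
 show "integrable (\<mu> x) (\<lambda>t. t)"
  by (rule integrable_const_bound[where B = K]) (use supported[OF B(1,2)] k in auto)
 have "AE t in \<mu> x. norm (t\<^sup>2) \<le> K\<^sup>2"
  using supported[OF B(1,2)] by eventually_elim (use k in \<open>auto simp: abs_le_square_iff[symmetric] intro: order_trans[OF k abs_ge_self]\<close>)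
 thus "integrable (\<mu> x) (\<lambda>t. t\<^sup>2)" by (intro integrable_const_bound[where B = "K\<^sup>2"]) auto
qed

lemma domain_supported: "B \<in> sets borel \<Longrightarrow> E B x = x \<Longrightarrow> B \<subseteq> {a..b} \<Longrightarrow> x \<in> Domain A"
 using in_domain integrable_supported by blast

lemma form_bounds:
 assumes B: "B \<in> sets borel" "E B x = x" "B \<subseteq> {a..b}" and A: "(x, y) \<in> A"
 shows "a * (norm x)\<^sup>2 \<le> Re (cinner x y)" "Re (cinner x y) \<le> b * (norm x)\<^sup>2" "Im (cinner x y) = 0"
proof -
 interpret finite_measure "\<mu> x" by (rule finite_mu)
 have m: "measure (\<mu> x) (space (\<mu> x)) = (norm x)\<^sup>2" by (simp add: measure_mu)
 have q: "Re (cinner x y) = integral\<^sup>L (\<mu> x) (\<lambda>t. t)" using quad[OF A] by simp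
 note i = integrable_supported(2)[OF B]
 have ae: "AE t in \<mu> x. a \<le> t" "AE t in \<mu> x. t \<le> b"
  by (rule eventually_mono[OF supported[OF B(1,2)]], use B(3) in auto)+
 have "integral\<^sup>L (\<mu> x) (\<lambda>t. a) \<le> integral\<^sup>L (\<mu> x) (\<lambda>t. t)"
  by (rule integral_mono_AE[OF _ i ae(1)]) simp
 thus "a * (norm x)\<^sup>2 \<le> Re (cinner x y)" unfolding q by (simp add: m[simplified] mult.commute)
 have "integral\<^sup>L (\<mu> x) (\<lambda>t. t) \<le> integral\<^sup>L (\<mu> x) (\<lambda>t. b)"
  by (rule integral_mono_AE[OF i _ ae(2)]) simp
 thus "Re (cinner x y) \<le> b * (norm x)\<^sup>2" unfolding q by (simp add: m[simplified] mult.commute)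
 show "Im (cinner x y) = 0" using quad[OF A] by simp
qed

end

section \<open>Recovering the operator from its quadratic spectral representation\<close>

locale selfadjoint_spectral_family = spectral_family +
 assumes sa: "self_adjoint A"
begin

lemma symmetric: "(x, y) \<in> A \<Longrightarrow> (u, v) \<in> A \<Longrightarrow> cinner x v = cinner y u"
proof -
 assume A: "(x, y) \<in> A" "(u, v) \<in> A"
 have "(x, y) \<in> adjoint_op A" using A(1) sa by (simp add: self_adjoint_def)
 thus ?thesis using A(2) by (auto simp: adjoint_op_def)
qed

lemma linA: "(x, y) \<in> A \<Longrightarrow> (u, v) \<in> A \<Longrightarrow> (x + u, y + v) \<in> A" "(x, y) \<in> A \<Longrightarrow> (c *\<^sub>C x, c *\<^sub>C y) \<in> A"
 "(x, y) \<in> A \<Longrightarrow> (u, v) \<in> A \<Longrightarrow> (x - u, y - v) \<in> A" "(x, y) \<in> A \<Longrightarrow> (x, y') \<in> A \<Longrightarrow> y = y'"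
proof -
 have L: "linear_operator A" using sa by (auto simp: self_adjoint_def)
 show a: "(x, y) \<in> A \<Longrightarrow> (u, v) \<in> A \<Longrightarrow> (x + u, y + v) \<in> A" for x y u v
  using L by (fastforce simp: linear_operator_def)
 show s: "(x, y) \<in> A \<Longrightarrow> (c *\<^sub>C x, c *\<^sub>C y) \<in> A" for x y c
  using L by (fastforce simp: linear_operator_def)
 show "(x, y) \<in> A \<Longrightarrow> (u, v) \<in> A \<Longrightarrow> (x - u, y - v) \<in> A"
  using a[OF _ s[of u v "-1"]] by (simp add: uminus_L2_eq[symmetric])
 show "(x, y) \<in> A \<Longrightarrow> (x, y') \<in> A \<Longrightarrow> y = y'"
  using L by (auto simp: linear_operator_def dest: single_valuedD)
qed

text \<open>A spectral resolution is only known to represent the quadratic form. For x in the range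
  and w in the kernel of \<open>E B\<close> the scalar measures of x and w add up to that of x + w,
  so the mixed terms of the form cancel; replacing w by \<i> w settles the imaginary part.\<close>

lemma orthogonal_pieces:
 assumes B: "B \<in> sets borel" "E B x = x" "E B w = 0" and A: "(x, y) \<in> A" "(w, v) \<in> A"
 shows "cinner w y = 0"
proof -
 have ii: "integrable (\<mu> u) (\<lambda>t. t)" if "u \<in> Domain A" for u
 proof -
  interpret finite_measure "\<mu> u" by (rule finite_mu)
  have "integrable (\<mu> u) (\<lambda>t. t\<^sup>2)" using that in_domain by blast
  hence "integrable (\<mu> u) (\<lambda>t. 1 + t\<^sup>2)" by simp
  thus ?thesis
  proof (rule Bochner_Integration.integrable_bound)
   have "\<bar>t\<bar> \<le> 1 + t\<^sup>2" for t :: real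
    using sum_squares_bound[of 1 "\<bar>t\<bar>"] by (simp add: power2_eq_square)
   thus "AE t in \<mu> u. norm t \<le> norm (1 + t\<^sup>2)" by (intro AE_I2) (simp add: abs_of_nonneg)
  qed simp
 qed
 have re: "Re (cinner w y) = 0" if w: "E B w = 0" "(w, v) \<in> A" for w v
 proof -
  have add: "emeasure (\<mu> (x + w)) C = emeasure (\<mu> x) C + emeasure (\<mu> w) C" if C: "C \<in> sets borel" for C
  proof -
   have "cinner (E C x) (E C w) = cinner (E C (E B x)) (E C w)" by (simp add: B)
   also have "... = cinner x (E B (E C (E C w)))" by (simp only: sym[OF C] sym[OF B(1)])
   also have "... = cinner x (E C (E B w))" using B C by (simp add: inter idem Int_commute)
   also have "... = 0" using w C by (simp add: clinear_mapD[OF lin[OF C]])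
   finally have o: "cinner (E C x) (E C w) = 0" .
   hence "cinner (E C w) (E C x) = 0" by (subst cinner_commute) simp
   hence "(norm (E C (x + w)))\<^sup>2 = (norm (E C x))\<^sup>2 + (norm (E C w))\<^sup>2"
    using o by (simp add: Re_cinner_norm[symmetric] clinear_mapD[OF lin[OF C]] cinner_add_left cinner_add_right)
   thus ?thesis using C by (simp add: mu)
  qed
  have xw: "(x + w, y + v) \<in> A" by (rule linA(1)[OF A(1) w(2)])
  hence "integral\<^sup>L (\<mu> (x + w)) (\<lambda>t. t) = integral\<^sup>L (\<mu> x) (\<lambda>t. t) + integral\<^sup>L (\<mu> w) (\<lambda>t. t)"
   by (intro integral_add_measure(2)[OF _ _ _ add]) (auto intro!: ii)
  hence "cinner (x + w) (y + v) = cinner x y + cinner w v"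
   using quad[OF xw] quad[OF A(1)] quad[OF w(2)] by simp
  hence "cinner x v + cinner w y = 0" by (simp add: cinner_add_left cinner_add_right add.commute)
  moreover have "cinner x v = cnj (cinner w y)" using symmetric[OF A(1) w(2)] by (simp add: cinner_commute[of w])
  ultimately have "cnj (cinner w y) + cinner w y = 0" by simp
  thus ?thesis by (simp add: complex_eq_iff)
 qed
 have "E B (\<i> *\<^sub>C w) = 0" using B by (simp add: clinear_mapD[OF lin[OF B(1)]])
 from re[OF this linA(2)[OF A(2)]] have "Im (cinner w y) = 0" by (simp add: cinner_scaleC_left)
 with re[OF B(3) A(2)] show ?thesis by (simp add: complex_eq_iff)
qed

text \<open>The component z of y outside the range of \<open>E B\<close> may fail to lie in the
  domain. It is cut by bounded spectral sets into pieces that do, and each piece is orthogonal to y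
  by \<open>orthogonal_pieces\<close>.\<close>

lemma range_invariant:
 assumes B: "B \<in> sets borel" "E B x = x" and A: "(x, y) \<in> A"
 shows "E B y = y"
proof -
 define z where "z = y - E B y"
 have Bz: "E B z = 0" using B by (simp add: z_def clinear_mapD[OF lin[OF B(1)]] idem)
 define C where "C i = {t::real. real i \<le> \<bar>t\<bar> \<and> \<bar>t\<bar> < real (Suc i)}" for i
 have Cm: "C i \<in> sets borel" for i unfolding C_def by measurable
 have dis: "disjoint_family C" unfolding disjoint_family_on_def
 proof (intro ballI impI)
  fix i j :: nat assume "i \<noteq> j"
  then consider "Suc i \<le> j" | "Suc j \<le> i" by linarith
  thus "C i \<inter> C j = {}" by cases (auto simp: C_def)
 qed
 have un: "(\<Union>i. C i) = UNIV"
 proof -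
  have "t \<in> C (nat \<lfloor>\<bar>t\<bar>\<rfloor>)" for t by (simp add: C_def) linarith
  thus ?thesis by blast
 qed
 have s: "(\<lambda>i. E (C i) z) sums z" using sums[OF _ dis, of z] Cm un by auto
 have "cinner (E (C i) z) y = 0" for i
 proof -
  have "C i \<subseteq> {- real (Suc i)..real (Suc i)}" by (auto simp: C_def)
  then obtain v where v: "(E (C i) z, v) \<in> A" using domain_supported[OF Cm idem[OF Cm]] by blast
  have "E B (E (C i) z) = E (C i) (E B z)" using B Cm by (simp add: inter Int_commute)
  hence "E B (E (C i) z) = 0" using Bz by (simp add: clinear_mapD[OF lin[OF Cm]])
  from orthogonal_pieces[OF B this A v] show ?thesis .
 qed
 hence "cinner (\<Sum>i<n. E (C i) z) y = 0" for n
  by (induction n) (simp_all add: cinner_add_left)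
 moreover have "(\<lambda>n. cinner (\<Sum>i<n. E (C i) z) y) \<longlonglongrightarrow> cinner z y"
  using s unfolding sums_def by (intro tendsto_intros)
 ultimately have "cinner z y = 0" by (simp add: LIMSEQ_const_iff)
 moreover have "cinner z (E B y) = 0" using Bz B by (simp add: sym[symmetric])
 moreover have "cinner z z = cinner z y - cinner z (E B y)" by (subst (2) z_def) (rule cinner_diff(2))
 ultimately have "cinner z z = 0" by simp
 hence "z = 0" using cinner_self(3) by blast
 thus ?thesis by (simp add: z_def)
qed

text \<open>A symmetric operator whose quadratic form is bounded by r has norm at most r. The form
  of A - c is polarised at g + t x and g - t x, where g = (A - c) x.\<close>

lemma norm_bound:
 assumes x: "E {c - r..c + r} x = x" and r: "r \<ge> 0" and A: "(x, y) \<in> A"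
 shows "norm (y - cor c *\<^sub>C x) \<le> r * norm x"
proof (cases "x = 0")
 case True
 have "(0, 0) \<in> A" using linA(2)[OF A, of 0] by simp
 hence "y = 0" using A True linA(4) by blast
 thus ?thesis using True by simp
next
 case x0: False
 let ?I = "{c - r..c + r}"
 have I: "?I \<in> sets borel" by simp
 define g where "g = y - cor c *\<^sub>C x"
 have gI: "E ?I g = g" using x range_invariant[OF I x A] by (simp add: g_def clinear_mapD[OF lin[OF I]])
 obtain v where v: "(g, v) \<in> A" using domain_supported[OF I gI] by blast
 have bound: "Re (cinner u (w - cor c *\<^sub>C u)) \<le> r * (norm u)\<^sup>2" "- r * (norm u)\<^sup>2 \<le> Re (cinner u (w - cor c *\<^sub>C u))"
  if u: "E ?I u = u" "(u, w) \<in> A" for u w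
  using form_bounds[OF I u(1) subset_refl u(2)]
  by (simp_all add: cinner_diff cinner_scaleC_right cinner_norm algebra_simps flip: of_real_mult)
 define b where "b u w = w - cor c *\<^sub>C u" for u w :: L2
 have main: "4 * t * (norm g)\<^sup>2 \<le> 2 * r * ((norm g)\<^sup>2 + t\<^sup>2 * (norm x)\<^sup>2)" for t
 proof -
  define X where "X = cor t *\<^sub>C x"
  define Yv where "Yv = cor t *\<^sub>C y"
  have XA: "(X, Yv) \<in> A" unfolding X_def Yv_def by (rule linA(2)[OF A])
  have XI: "E ?I X = X" using x by (simp add: X_def clinear_mapD[OF lin[OF I]])
  have bX: "b X Yv = cor t *\<^sub>C g"
   by (simp add: b_def X_def Yv_def g_def L2C.scale_right_diff_distrib mult.commute)
  have "Re (cinner (g + X) (b (g + X) (v + Yv))) \<le> r * (norm (g + X))\<^sup>2"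
   unfolding b_def by (rule bound(1)) (use gI XI linA(1)[OF v XA] in \<open>simp_all add: clinear_mapD[OF lin[OF I]]\<close>)
  moreover have "- r * (norm (g - X))\<^sup>2 \<le> Re (cinner (g - X) (b (g - X) (v - Yv)))"
   unfolding b_def by (rule bound(2)) (use gI XI linA(3)[OF v XA] in \<open>simp_all add: clinear_mapD[OF lin[OF I]]\<close>)
  moreover have "b (g + X) (v + Yv) = b g v + b X Yv" "b (g - X) (v - Yv) = b g v - b X Yv"
   by (simp_all add: b_def L2C.scale_right_distrib L2C.scale_right_diff_distrib)
  moreover have "cinner X (b g v) = cinner (b X Yv) g"
   using symmetric[OF XA v] by (simp add: b_def cinner_diff cinner_scaleC_left cinner_scaleC_right)
  moreover have "(norm (g + X))\<^sup>2 + (norm (g - X))\<^sup>2 = 2 * ((norm g)\<^sup>2 + (norm X)\<^sup>2)"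
   by (simp add: power2_norm_eq_inner inner_add_left inner_add_right inner_diff_left inner_diff_right inner_commute)
  moreover from this have "r * (norm (g + X))\<^sup>2 + r * (norm (g - X))\<^sup>2 = 2 * (r * ((norm g)\<^sup>2 + (norm X)\<^sup>2))"
   unfolding distrib_left[symmetric] by simp
  ultimately have "Re (cinner g (b X Yv)) + Re (cinner (b X Yv) g) \<le> r * ((norm g)\<^sup>2 + (norm X)\<^sup>2)"
   by (simp only: cinner_add_left cinner_add_right cinner_diff plus_complex.sel minus_complex.sel)
  hence "2 * t * (norm g)\<^sup>2 \<le> r * ((norm g)\<^sup>2 + (norm X)\<^sup>2)"
   unfolding bX by (simp add: cinner_scaleC_left cinner_scaleC_right cinner_norm flip: of_real_mult)
  moreover have "(norm X)\<^sup>2 = t\<^sup>2 * (norm x)\<^sup>2" by (simp add: X_def norm_scaleC power_mult_distrib)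
  ultimately show ?thesis by simp
 qed
 have nx: "norm x > 0" using x0 by simp
 show ?thesis
 proof (cases "g = 0")
  case True
  thus ?thesis using r by (simp add: g_def)
 next
  case False
  \<comment> \<open>This t balances the two terms on the right: t^2 |x|^2 = |g|^2.\<close>
  define t where "t = norm g / norm x"
  have t: "t > 0" using False nx by (simp add: t_def)
  have "t\<^sup>2 * (norm x)\<^sup>2 = (norm g)\<^sup>2" using nx by (simp add: t_def power_divide)
  with main[of t] have "t * (norm g)\<^sup>2 \<le> r * (norm g)\<^sup>2" by simp
  hence "t \<le> r" using False by simp
  thus ?thesis using nx by (simp add: t_def g_def divide_le_eq)
 qed
qed

text \<open>The difference of A (E B x) and E B (A x) lies in the range of \<open>E B\<close>, hence
  in the domain because B is bounded. Symmetry of A, tested against this difference, shows that it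
  is orthogonal to itself.\<close>

lemma commutes:
 assumes B: "B \<in> sets borel" "B \<subseteq> {a..b}" and A: "(x, y) \<in> A"
 shows "(E B x, E B y) \<in> A"
proof -
 obtain y' where y': "(E B x, y') \<in> A" using domain_supported[OF B(1) idem[OF B(1)] B(2)] by blast
 have r: "E B y' = y'" by (rule range_invariant[OF B(1) idem[OF B(1)] y'])
 define d where "d = y' - E B y"
 have d: "E B d = d" using B r by (simp add: d_def clinear_mapD[OF lin[OF B(1)]] idem)
 obtain v where v: "(d, v) \<in> A" using domain_supported[OF B(1) d B(2)] by blast
 have vB: "E B v = v" by (rule range_invariant[OF B(1) d v])
 have "cinner d y' = cinner v (E B x)" by (rule symmetric[OF v y'])
 also have "... = cinner v x" using B vB by (simp add: sym[symmetric])
 also have "... = cinner d y" using symmetric[OF v A] by simp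
 also have "... = cinner d (E B y)" using B d by (metis sym)
 finally have "cinner d y' = cinner d (E B y)" .
 moreover have "cinner d d = cinner d y' - cinner d (E B y)" by (subst (2) d_def) (rule cinner_diff(2))
 ultimately have "cinner d d = 0" by simp
 hence "d = 0" using cinner_self(3) by blast
 thus ?thesis using y' by (simp add: d_def)
qed

lemma form_lower_norm:
 assumes B: "B \<in> sets borel" "E B x = x" "B \<subseteq> {c + \<rho>..d} \<or> B \<subseteq> {d..c - \<rho>}" and A: "(x, y) \<in> A"
 shows "\<rho> * norm x \<le> norm (y - cor c *\<^sub>C x)"
proof -
 define g where "g = y - cor c *\<^sub>C x"
 have re: "Re (cinner x g) = Re (cinner x y) - c * (norm x)\<^sup>2"
  by (simp add: g_def cinner_diff cinner_scaleC_right cinner_norm flip: of_real_mult)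
 have "\<rho> * (norm x)\<^sup>2 \<le> \<bar>Re (cinner x g)\<bar>"
  using B(3)
 proof
  assume "B \<subseteq> {c + \<rho>..d}"
  from form_bounds(1)[OF B(1,2) this A] show ?thesis unfolding re by (simp add: distrib_right)
 next
  assume "B \<subseteq> {d..c - \<rho>}"
  from form_bounds(2)[OF B(1,2) this A] show ?thesis unfolding re by (simp add: left_diff_distrib)
 qed
 also have "... \<le> norm x * norm g" using abs_Re_le_cmod[of "cinner x g"] cinner_bound[of x g] by linarith
 finally have "norm x * (\<rho> * norm x) \<le> norm x * norm g" by (simp add: power2_eq_square mult_ac)
 thus ?thesis unfolding g_def[symmetric] by (cases "x = 0") auto
qed

end

text \<open>The range of \<open>E {c - r..c + r}\<close> consists of the \<open>x\<close> with \<open>\<parallel>(A - c)\<^sup>n x\<parallel> \<le> r\<^sup>n \<parallel>x\<parallel>\<close> for all \<open>n\<close>, so it does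
 not depend on \<open>E\<close>.\<close>

lemma spectral_range_inclusion:
 assumes "selfadjoint_spectral_family A E" "selfadjoint_spectral_family A E'"
  and x: "E {a..b} x = x"
 shows "E' {a..b} x = x"
proof (cases "a \<le> b")
 case False
 interpret E: selfadjoint_spectral_family A E by fact
 interpret E': selfadjoint_spectral_family A E' by fact
 show ?thesis using x False by simp
next
 case True
 interpret E: selfadjoint_spectral_family A E by fact
 interpret E': selfadjoint_spectral_family A E' by fact
 define c where "c = (a + b) / 2"
 define r where "r = (b - a) / 2"
 have r: "r \<ge> 0" and ab: "a = c - r" "b = c + r" using True by (auto simp: c_def r_def field_simps)
 let ?I = "{c - r..c + r}"
 have I: "?I \<in> sets borel" by simp
 have xI: "E ?I x = x" using x by (simp add: ab)
 define Aop where "Aop u = (SOME v. (u, v) \<in> A)" for u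
 have Aop: "(u, Aop u) \<in> A" if "E ?I u = u" for u
  unfolding Aop_def using E.domain_supported[OF I that subset_refl] by (auto intro: someI)
 define X where "X n = ((\<lambda>u. Aop u - cor c *\<^sub>C u) ^^ n) x" for n
 have XS: "X (Suc n) = Aop (X n) - cor c *\<^sub>C X n" for n by (simp add: X_def)
 have XI: "E ?I (X n) = X n" for n
 proof (induction n)
  case 0
  show ?case using xI by (simp add: X_def)
 next
  case (Suc n)
  thus ?case using E.range_invariant[OF I Suc Aop[OF Suc]]
   by (simp add: XS clinear_mapD[OF E.lin[OF I]])
 qed
 have XA: "(X n, X (Suc n) + cor c *\<^sub>C X n) \<in> A" for n
  using Aop[OF XI[of n]] by (simp add: XS)
 have Xn: "norm (X n) \<le> r ^ n * norm x" for n
 proof (induction n)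
  case 0
  show ?case by (simp add: X_def)
 next
  case (Suc n)
  have "norm (X (Suc n)) \<le> r * norm (X n)" using E.norm_bound[OF XI r XA, of n] by simp
  also have "... \<le> r * (r ^ n * norm x)" by (rule mult_left_mono[OF Suc r])
  finally show ?case by (simp add: mult.assoc)
 qed
 \<comment> \<open>On the range of \<open>E' J\<close> the operator A - c expands by at least
   \<rho>, while the iterates on x grow at most like r^n; since r < \<rho>, the component of x in
   this range vanishes.\<close>
 have zero: "E' J x = 0" if J: "J \<in> sets borel" "J \<subseteq> {c + \<rho>..d} \<or> J \<subseteq> {d..c - \<rho>}" and rho: "r < \<rho>" for J \<rho> d
 proof -
  obtain u v where uv: "J \<subseteq> {u..v}" using J(2) by blast
  define z where "z n = E' J (X n)" for n
  have zA: "(z n, z (Suc n) + cor c *\<^sub>C z n) \<in> A" for n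
   using E'.commutes[OF J(1) uv XA[of n]] by (simp add: z_def clinear_mapD[OF E'.lin[OF J(1)]])
  have step: "\<rho> * norm (z n) \<le> norm (z (Suc n))" for n
   using E'.form_lower_norm[OF J(1) _ J(2) zA[of n]] by (simp add: z_def E'.idem[OF J(1)])
  have grow: "\<rho> ^ n * norm (z 0) \<le> norm (z n)" for n
  proof (induction n)
   case (Suc n)
   have "\<rho> ^ Suc n * norm (z 0) = \<rho> * (\<rho> ^ n * norm (z 0))" by simp
   also have "... \<le> \<rho> * norm (z n)" using rho r by (intro mult_left_mono Suc) auto
   finally show ?case using step[of n] by linarith
  qed simp
  have contr: "norm (E' J u) \<le> norm u" for u
  proof -
   have "(norm (E' J u))\<^sup>2 \<le> norm u * norm (E' J u)"
    using E'.norm_sq[OF J(1), of u] abs_Re_le_cmod[of "cinner u (E' J u)"] cinner_bound[of u "E' J u"] by linarith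
   thus ?thesis by (cases "E' J u = 0") (auto simp: power2_eq_square)
  qed
  have "norm (z 0) \<le> (r / \<rho>) ^ n * norm x" for n
  proof -
   have "\<rho> ^ n * norm (z 0) \<le> r ^ n * norm x"
    using grow[of n] contr[of "X n"] Xn[of n] by (simp add: z_def)
   thus ?thesis using rho r by (simp add: power_divide field_simps)
  qed
  moreover have "(\<lambda>n. (r / \<rho>) ^ n * norm x) \<longlonglongrightarrow> 0 * norm x"
   using rho r by (intro tendsto_mult_right LIMSEQ_realpow_zero) auto
  ultimately have "norm (z 0) \<le> 0 * norm x" by (intro LIMSEQ_le_const[where X = "\<lambda>n. (r / \<rho>) ^ n * norm x"]) auto
  thus ?thesis by (simp add: z_def X_def)
 qed
 have null: "J \<in> null_sets (E'.\<mu> x)" if "J \<in> sets borel" "J \<subseteq> {c + \<rho>..d} \<or> J \<subseteq> {d..c - \<rho>}" "r < \<rho>" for J \<rho> d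
  using zero[OF that] that(1) by (simp add: null_sets_def E'.mu)
 \<comment> \<open>Bounded intervals at distance greater than r from c exhaust the complement;
   boundedness puts the corresponding pieces into the domain.\<close>
 let ?U = "(\<Union>n::nat. {c + (r + 1 / Suc n)..c + r + real n}) \<union> (\<Union>n::nat. {c - r - real n..c - (r + 1 / Suc n)})"
 have "- ?I \<subseteq> ?U"
 proof
  fix t assume t: "t \<in> - ?I"
  define \<epsilon> where "\<epsilon> = max (t - (c + r)) (c - r - t)"
  have e: "\<epsilon> > 0" using t by (auto simp: \<epsilon>_def)
  obtain n where n': "1 / \<epsilon> + \<bar>t - c\<bar> + r < real n" using reals_Archimedean2 by blast
  moreover have "0 < 1 / \<epsilon>" using e by simp
  ultimately have n2: "\<bar>t - c\<bar> + r < real n" "1 / \<epsilon> < real (Suc n)" using r by - (linarith, auto)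
  hence n: "1 / real (Suc n) < \<epsilon>" "\<bar>t - c\<bar> + r < real n" using e by (simp_all add: field_simps)
  show "t \<in> ?U"
  proof (cases "t > c + r")
   case True
   hence "t \<in> {c + (r + 1 / Suc n)..c + r + real n}" using n r by (auto simp: \<epsilon>_def max_def split: if_splits)
   thus ?thesis by blast
  next
   case False
   hence "t \<in> {c - r - real n..c - (r + 1 / Suc n)}" using n t r by (auto simp: \<epsilon>_def max_def split: if_splits)
   thus ?thesis by blast
  qed
 qed
 moreover have "?U \<in> null_sets (E'.\<mu> x)"
  by (intro null_sets.Un null_sets_UN null[of _ "r + 1 / Suc n" for n] ) auto
 ultimately have "- ?I \<in> null_sets (E'.\<mu> x)" by (rule null_sets_subset[rotated 2]) auto
 hence "E' (- ?I) x = 0" by (simp add: null_sets_def E'.mu)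
 thus ?thesis using E'.compl[OF I, of x] by (simp add: ab)
qed

lemma orth_projection_eq:
 assumes "orth_projection P" "orth_projection Q" "\<And>x. P x = x \<longleftrightarrow> Q x = x"
 shows "P = Q"
proof
 fix x
 have P: "cinner (P u) v = cinner u (P v)" "P (P u) = P u" for u v using assms(1) by (auto simp: orth_projection_def)
 have Q: "cinner (Q u) v = cinner u (Q v)" "Q (Q u) = Q u" for u v using assms(2) by (auto simp: orth_projection_def)
 show "P x = Q x"
 proof (rule cinner_eqI)
  fix z
  have "Q (P u) = P u" "P (Q u) = Q u" for u using assms(3) P(2) Q(2) by blast+
  thus "cinner (P x) z = cinner (Q x) z"
   by (metis P(1) Q(1))
 qed
qed

text \<open>Projections with the same range agree, so the two resolutions coincide on closed
  intervals, which are stable under intersection and generate the Borel sets. This allows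
  \<open>spectral_measure\<close> to be computed from any resolution at hand.\<close>

theorem spectral_measure_unique:
 assumes "self_adjoint A" "spectral_resolution A E" "spectral_resolution A E'"
 shows "scalar_spectral_measure E x = scalar_spectral_measure E' x"
proof -
 have f: "selfadjoint_spectral_family A E" "selfadjoint_spectral_family A E'"
  using assms by (simp_all add: selfadjoint_spectral_family_def spectral_family_def selfadjoint_spectral_family_axioms_def)
 interpret E: selfadjoint_spectral_family A E by (rule f)
 interpret E': selfadjoint_spectral_family A E' by (rule f)
 have eq: "E {a..b} = E' {a..b}" for a b
  by (rule orth_projection_eq) (use E.projection E'.projection spectral_range_inclusion[OF f] spectral_range_inclusion[OF f(2,1)] in auto)
 let ?G = "range (\<lambda>(a, b). {a..b::real})"
 have "E.\<mu> x = E'.\<mu> x"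
 proof (rule measure_eqI_generator_eq[where E = ?G and \<Omega> = UNIV and A = "\<lambda>n. {- real n..real n}"])
  show "Int_stable ?G" by (auto simp: Int_stable_def)
  show "emeasure (E.\<mu> x) X = emeasure (E'.\<mu> x) X" if "X \<in> ?G" for X
   using that eq by (auto simp: E.mu E'.mu)
  show "sets (E.\<mu> x) = sigma_sets UNIV ?G" "sets (E'.\<mu> x) = sigma_sets UNIV ?G"
   by (simp_all add: borel_eq_atLeastAtMost)
  show "(\<Union>n. {- real n..real n}) = UNIV"
  proof -
   have "\<exists>n. t \<in> {- real n..real n}" for t :: real
   proof -
    obtain n where "\<bar>t\<bar> \<le> real n" using real_arch_simple by blast
    hence "t \<in> {- real n..real n}" by auto
    thus ?thesis ..
   qed
   thus ?thesis by blast
  qed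
  show "emeasure (E.\<mu> x) {- real n..real n} \<noteq> \<infinity>" for n by (simp add: E.mu)
 qed (auto simp: image_def)
 thus ?thesis by (simp add: E.\<mu>_def E'.\<mu>_def)
qed

lemma spectral_measure_eq:
 assumes "self_adjoint A" "spectral_resolution A E"
 shows "spectral_measure A = scalar_spectral_measure E"
proof -
 have "spectral_resolution A (SOME E. spectral_resolution A E)" using assms(2) by (rule someI[of "spectral_resolution A"])
 thus ?thesis unfolding spectral_measure_def using spectral_measure_unique[OF assms(1) _ assms(2)] by blast
qed

section \<open>Multiplication by a power\<close>

lemma borel_measurable_powr_abs [measurable]: "(\<lambda>p::real. \<bar>p\<bar> powr s) \<in> borel_measurable borel"
 by measurable

text \<open>Apart from 0 the preimage consists of the image of N under t^(1/s) and its mirror image,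
  and differentiable maps preserve null sets. It makes the spectral measures of multiplication by
  |p|^s absolutely continuous.\<close>

lemma preimage_powr_null:
 fixes s :: real
 assumes s: "s > 0" and N: "N \<in> null_sets lborel"
 shows "{p. \<bar>p\<bar> powr s \<in> N} \<in> null_sets lborel"
proof -
 have Nm: "N \<in> sets borel" using N by (auto simp: null_sets_def)
 let ?g = "\<lambda>t::real. t powr (1 / s)"
 have neg: "negligible (N \<inter> {0<..})"
 proof (rule negligible_subset)
  show "negligible N" by (rule iffD2[OF negligible_iff_null_sets null_sets_completionI[OF N]])
 qed (rule Int_lower1)
 have "?g differentiable_on (N \<inter> {0<..})"
  unfolding differentiable_on_def
 proof (rule ballI, rule differentiable_at_withinI)
  fix t assume "t \<in> N \<inter> {0<..}"
  hence "(?g has_real_derivative (1 / s) * t powr (1 / s - 1)) (at t)" by (intro has_real_derivative_powr) auto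
  thus "?g differentiable (at t)" by (rule differentiableI[OF has_field_derivative_imp_has_derivative])
 qed
 hence n1: "negligible (?g ` (N \<inter> {0<..}))"
  by (intro negligible_differentiable_image_negligible[OF _ neg]) auto
 have n2: "negligible (uminus ` ?g ` (N \<inter> {0<..}))"
  by (intro negligible_differentiable_image_negligible[OF _ n1]) (auto intro!: derivative_intros)
 have "{p. \<bar>p\<bar> powr s \<in> N} \<subseteq> insert 0 (?g ` (N \<inter> {0<..}) \<union> uminus ` ?g ` (N \<inter> {0<..}))"
 proof
  fix p assume p: "p \<in> {p. \<bar>p\<bar> powr s \<in> N}"
  have inv: "(\<bar>p\<bar> powr s) powr (1 / s) = \<bar>p\<bar>" if "p \<noteq> 0" using s that by (simp add: powr_powr)
  show "p \<in> insert 0 (?g ` (N \<inter> {0<..}) \<union> uminus ` ?g ` (N \<inter> {0<..}))"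
  proof (cases "p = 0")
   case False
   hence "\<bar>p\<bar> \<in> ?g ` (N \<inter> {0<..})" using p inv by (intro image_eqI[of _ _ "\<bar>p\<bar> powr s"]) auto
   moreover have "\<bar>p\<bar> = p \<or> \<bar>p\<bar> = - p" by arith
   ultimately have "p \<in> ?g ` (N \<inter> {0<..}) \<or> - p \<in> ?g ` (N \<inter> {0<..})" by metis
   thus ?thesis using image_eqI[of p uminus "- p"] by auto
  qed simp
 qed
 hence "negligible {p. \<bar>p\<bar> powr s \<in> N}"
  by (rule negligible_subset[rotated]) (simp add: n1 n2)
 moreover have "{p. \<bar>p\<bar> powr s \<in> N} \<in> sets borel"
  using measurable_sets_borel[OF borel_measurable_powr_abs Nm, of s] by (simp add: vimage_def)
 ultimately show ?thesis using null_sets_completion_iff[of "{p. \<bar>p\<bar> powr s \<in> N}" lborel] by (simp only: negligible_iff_null_sets sets_lborel)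
qed

text \<open>Multiplication by |p|^s, transported by Y, plus at most one eigenvector. The case e = 0
  encodes that there is none; Y is then onto and \<open>lam\<close> is an arbitrary negative number,
  so both cases are handled together.\<close>

locale multiplication_model =
 fixes s lam :: real and A :: L2_op and Y :: "L2 \<Rightarrow> L2" and e :: L2
 assumes s0: "s > 0" and lam: "lam < 0"
  and Ylin: "clinear_map Y" and Yiso: "\<And>x y. cinner (Y x) (Y y) = cinner x y"
  and Yrange: "\<And>x. x \<in> range Y \<longleftrightarrow> cinner e x = 0"
  and e: "e = 0 \<or> norm e = 1"
  and A: "A = {(Y f + c *\<^sub>C e, Y g + (lam * c) *\<^sub>C e) | f g (c::complex). AE p in lborel. rep_L2 g p = cor (\<bar>p\<bar> powr s) * rep_L2 f p}"
  and sa: "self_adjoint A"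
begin

definition "m p = \<bar>p\<bar> powr s" for p :: real

lemma m_measurable [measurable]: "m \<in> borel_measurable borel" unfolding m_def[abs_def] by measurable
lemma m_nonneg: "0 \<le> m p" by (simp add: m_def)

definition "co x = cinner e x"
definition "fi x = inv Y (x - co x *\<^sub>C e)"

lemma Yinj: "inj Y"
proof (rule injI)
 fix x y assume "Y x = Y y"
 hence "Y (x - y) = 0" by (simp add: clinear_mapD[OF Ylin])
 hence "cinner (x - y) (x - y) = 0" using Yiso[of "x - y" "x - y"] by simp
 thus "x = y" using cinner_self(3)[of "x - y"] by simp
qed

lemma eY [simp]: "cinner e (Y f) = 0" "cinner (Y f) e = 0"
proof -
 show "cinner e (Y f) = 0" using Yrange[of "Y f"] by simp
 thus "cinner (Y f) e = 0" by (subst cinner_commute) simp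
qed

lemma ee: "cinner e e *\<^sub>C e = e" "cinner e e * cinner e x = cinner e x" "cinner e x * cinner e e = cinner e x"
 using e by (auto simp: cinner_norm)

lemma decomp: "x = Y (fi x) + co x *\<^sub>C e"
proof -
 have "cinner e (x - co x *\<^sub>C e) = 0"
  by (simp add: cinner_diff cinner_scaleC_right co_def ee(3))
 hence "x - co x *\<^sub>C e \<in> range Y" by (simp add: Yrange)
 hence "Y (fi x) = x - co x *\<^sub>C e" unfolding fi_def by (rule f_inv_into_f)
 thus ?thesis by simp
qed

lemma co_Y: "co (Y f + c *\<^sub>C e) *\<^sub>C e = c *\<^sub>C e" "co (Y f + c *\<^sub>C e) = c * cinner e e"
proof -
 show 2: "co (Y f + c *\<^sub>C e) = c * cinner e e" by (simp add: co_def cinner_add_right cinner_scaleC_right)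
 show "co (Y f + c *\<^sub>C e) *\<^sub>C e = c *\<^sub>C e" unfolding 2 L2C.scale_scale[symmetric] ee(1) ..
qed

lemma fi_Y: "fi (Y f + c *\<^sub>C e) = f"
 unfolding fi_def co_Y(1) by (simp add: Yinj)

lemma co_linear: "co (x + y) = co x + co y" "co (c *\<^sub>C x) = c * co x"
 by (simp_all add: co_def cinner_add_right cinner_scaleC_right)

lemma fi_linear: "clinear_map fi"
 unfolding clinear_map_def
proof (intro conjI allI)
 fix x y c
 have "x + y = (Y (fi x) + co x *\<^sub>C e) + (Y (fi y) + co y *\<^sub>C e)" using decomp[of x] decomp[of y] by simp
 also have "... = Y (fi x + fi y) + (co x + co y) *\<^sub>C e" by (simp add: clinear_mapD[OF Ylin] L2C.scale_left_distrib)
 finally have "fi (x + y) = fi (Y (fi x + fi y) + (co x + co y) *\<^sub>C e)" by (rule arg_cong)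
 thus "fi (x + y) = fi x + fi y" by (simp only: fi_Y)
 have "c *\<^sub>C x = c *\<^sub>C (Y (fi x) + co x *\<^sub>C e)" using decomp[of x] by simp
 also have "... = Y (c *\<^sub>C fi x) + (c * co x) *\<^sub>C e" by (simp add: clinear_mapD[OF Ylin] L2C.scale_right_distrib)
 finally have "fi (c *\<^sub>C x) = fi (Y (c *\<^sub>C fi x) + (c * co x) *\<^sub>C e)" by (rule arg_cong)
 thus "fi (c *\<^sub>C x) = c *\<^sub>C fi x" by (simp only: fi_Y)
qed

lemma cinner_decomp: "cinner x y = cinner (fi x) (fi y) + cnj (co x) * co y"
proof -
 have "cinner x y = cinner (Y (fi x) + co x *\<^sub>C e) (Y (fi y) + co y *\<^sub>C e)" using decomp[of x] decomp[of y] by simp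
 also have "... = cinner (fi x) (fi y) + cnj (co x) * (co y * cinner e e)"
  by (simp add: cinner_add_left cinner_add_right cinner_scaleC_left cinner_scaleC_right Yiso)
 also have "co y * cinner e e = co y" by (simp only: co_def ee(3))
 finally show ?thesis .
qed

lemma norm_decomp: "(norm x)\<^sup>2 = (norm (fi x))\<^sup>2 + (cmod (co x))\<^sup>2"
proof -
 have "cor ((norm x)\<^sup>2) = cor ((norm (fi x))\<^sup>2 + (cmod (co x))\<^sup>2)"
  unfolding cinner_norm[symmetric] cinner_decomp[of x x]
  by (simp add: cinner_norm complex_norm_square mult.commute del: of_real_power)
 thus ?thesis by (simp only: of_real_eq_iff)
qed

text \<open>Coefficients are compared only after multiplication by \<open>e\<close>, since a
  coefficient of e = 0 is not determined.\<close>

lemma eq_decomp: "x = y \<longleftrightarrow> fi x = fi y \<and> co x *\<^sub>C e = co y *\<^sub>C e"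
 using decomp[of x] decomp[of y] by auto

lemma in_A: "(x, y) \<in> A \<longleftrightarrow> (AE p in lborel. rep_L2 (fi y) p = cor (m p) * rep_L2 (fi x) p) \<and> co y *\<^sub>C e = (lam * co x) *\<^sub>C e"
 (is "_ \<longleftrightarrow> ?r")
proof
 assume "(x, y) \<in> A"
 then obtain f g and c :: complex where fg: "x = Y f + c *\<^sub>C e" "y = Y g + (lam * c) *\<^sub>C e"
   "AE p in lborel. rep_L2 g p = cor (\<bar>p\<bar> powr s) * rep_L2 f p" unfolding A by blast
 have "co y *\<^sub>C e = (lam * co x) *\<^sub>C e"
  by (simp only: fg(1,2) co_Y(1) L2C.scale_scale[symmetric, of _ "co _"]) simp
 thus ?r
  using fg by (simp add: fi_Y m_def)
next
 assume h: ?r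
 have "y = Y (fi y) + co y *\<^sub>C e" by (rule decomp)
 also have "co y *\<^sub>C e = (lam * co x) *\<^sub>C e" using h by blast
 finally have "y = Y (fi y) + (lam * co x) *\<^sub>C e" .
 thus "(x, y) \<in> A" unfolding A using h[unfolded m_def] decomp[of x] by blast
qed

definition "chi B p = (indicator B (m p) :: complex)" for B p
definition "E0 B x = Y (mulop (chi B) (fi x)) + (indicator B lam * co x) *\<^sub>C e"

lemma chi_bounded: "B \<in> sets borel \<Longrightarrow> bounded_borel (chi B)"
 unfolding chi_def[abs_def] by (rule bounded_borelI[of _ 1]) (auto simp: indicator_def)

lemma E0_parts: "fi (E0 B x) = mulop (chi B) (fi x)" "co (E0 B x) = indicator B lam * co x"
proof -
 show "fi (E0 B x) = mulop (chi B) (fi x)" by (simp add: E0_def fi_Y)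
 have "co (E0 B x) = indicator B lam * (co x * cinner e e)" by (simp add: E0_def co_Y(2))
 also have "co x * cinner e e = co x" by (simp only: co_def ee(3))
 finally show "co (E0 B x) = indicator B lam * co x" .
qed

sublocale projection_family E0
proof
 fix B :: "real set" assume B: "B \<in> sets borel"
 have cc: "(\<lambda>p. cnj (chi B p)) = chi B" by (auto simp: chi_def indicator_def)
 have "mulop (chi B) (mulop (chi B) f) = mulop (chi B) f" for f
  unfolding mulop_mulop[OF chi_bounded[OF B] chi_bounded[OF B]]
  by (rule arg_cong[where f = "\<lambda>\<phi>. mulop \<phi> f"]) (auto simp: chi_def indicator_def)
 moreover have "cinner (mulop (chi B) f) g = cinner f (mulop (chi B) g)" for f g
  using mulop_adjoint[of "chi B" f g] chi_bounded[OF B] unfolding cc by simp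
 ultimately show "orth_projection (E0 B)"
  unfolding orth_projection_def
  by (auto simp: cinner_decomp[of "E0 _ _"] cinner_decomp[of _ "E0 _ _"] E0_parts eq_decomp[of "E0 _ _"] indicator_def)
next
 show "E0 UNIV = id"
 proof
  fix x
  have "mulop (chi UNIV) (fi x) = fi x" by (simp add: mulop_def chi_def)
  thus "E0 UNIV x = id x" by (simp add: E0_def decomp[symmetric])
 qed
next
 fix B C :: "real set" assume BC: "B \<in> sets borel" "C \<in> sets borel"
 show "E0 (B \<inter> C) = E0 B \<circ> E0 C"
 proof
  fix x
  have "mulop (chi (B \<inter> C)) f = mulop (chi B) (mulop (chi C) f)" for f
   unfolding mulop_mulop[OF chi_bounded[OF BC(1)] chi_bounded[OF BC(2)]]
   by (rule arg_cong[where f = "\<lambda>\<phi>. mulop \<phi> f"]) (auto simp: chi_def indicator_def)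
  thus "E0 (B \<inter> C) x = (E0 B \<circ> E0 C) x"
   by (auto simp: eq_decomp[of "E0 _ _"] E0_parts indicator_def)
 qed
next
 fix B :: "nat \<Rightarrow> real set" and x assume B: "range B \<subseteq> sets borel" "disjoint_family B"
 let ?U = "\<Union>i. B i"
 have Bi: "B i \<in> sets borel" for i using B(1) by auto
 have ind: "(\<Sum>i<n. indicator (B i) t) = (indicator (\<Union>i<n. B i) t :: complex)" for n t
  by (rule indicator_UN_disjoint[symmetric, unfolded o_def]) (use B(2) in \<open>auto simp: disjoint_family_on_def\<close>)
 have indlim: "(\<lambda>n. indicator (\<Union>i<n. B i) t :: complex) \<longlonglongrightarrow> indicator ?U t" for t
  by (rule LIMSEQ_indicator_UN)
 have lin: "(\<Sum>i<n. E0 (B i) x) = Y (mulop (chi (\<Union>i<n. B i)) (fi x)) + (indicator (\<Union>i<n. B i) lam * co x) *\<^sub>C e" for n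
 proof -
  have sumM: "(\<Sum>i<n. mulop (chi (B i)) f) = mulop (chi (\<Union>i<n. B i)) f" for f
  proof (induction n)
   case 0
   show ?case by (simp add: mulop_def chi_def to_L2_zero)
  next
   case (Suc n)
   have b: "bounded_borel (chi (\<Union>i<n. B i))" "bounded_borel (chi (B n))" using Bi by (auto intro: chi_bounded)
   have "chi (\<Union>i<Suc n. B i) = (\<lambda>p. chi (\<Union>i<n. B i) p + chi (B n) p)"
    by (rule ext) (simp add: chi_def ind[symmetric])
   hence "mulop (chi (\<Union>i<Suc n. B i)) f = mulop (chi (\<Union>i<n. B i)) f + mulop (chi (B n)) f"
    unfolding mulop_def using b by (simp add: distrib_right to_L2_add square_integrable_mult)
   thus ?case using Suc by simp
  qed
  have "(\<Sum>i<n. E0 (B i) x) = Y (\<Sum>i<n. mulop (chi (B i)) (fi x)) + ((\<Sum>i<n. indicator (B i) lam) * co x) *\<^sub>C e"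
   by (induction n) (simp_all add: E0_def clinear_mapD[OF Ylin] distrib_right L2C.scale_left_distrib)
  thus ?thesis by (simp add: sumM ind)
 qed
 have "(\<lambda>n. mulop (chi (\<Union>i<n. B i)) (fi x)) \<longlonglongrightarrow> mulop (chi ?U) (fi x)"
  unfolding mulop_def
 proof (rule L2_dominated_convergence(3)[OF square_integrable_rep[of "fi x"]])
  show "(\<lambda>p. chi (\<Union>i<n. B i) p * rep_L2 (fi x) p) \<in> borel_measurable borel" for n
   using chi_bounded[of "\<Union>i<n. B i"] Bi by (auto simp: bounded_borel_def)
  show "(\<lambda>p. chi ?U p * rep_L2 (fi x) p) \<in> borel_measurable borel"
   using chi_bounded[of ?U] Bi by (auto simp: bounded_borel_def)
  show "AE t in lborel. (\<lambda>n. chi (\<Union>i<n. B i) t * rep_L2 (fi x) t) \<longlonglongrightarrow> chi ?U t * rep_L2 (fi x) t"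
   unfolding chi_def by (intro AE_I2 tendsto_intros indlim)
 qed (auto simp: chi_def indicator_def)
 from tendsto_add[OF isometry_continuous[OF Ylin Yiso this]
   tendsto_scaleC[OF tendsto_mult[OF indlim[of lam] tendsto_const[of "co x"]] tendsto_const[of e]]]
 show "(\<lambda>i. E0 (B i) x) sums E0 ?U x"
  unfolding sums_def lin by (simp add: E0_def)
qed

definition "M1 x = distr (density lborel (\<lambda>p. ennreal ((cmod (rep_L2 (fi x) p))\<^sup>2))) borel m"
definition "M2 x = density (return borel lam) (\<lambda>t. ennreal ((cmod (co x))\<^sup>2))"

lemma mu_add:
 assumes B: "B \<in> sets borel"
 shows "emeasure (\<mu> x) B = emeasure (M1 x) B + emeasure (M2 x) B"
proof -
 have "emeasure (M1 x) B = (\<integral>\<^sup>+p. ennreal ((cmod (rep_L2 (fi x) p))\<^sup>2) * indicator (m -` B) p \<partial>lborel)"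
  unfolding M1_def using measurable_sets_borel[OF m_measurable B] B by (subst emeasure_distr) (simp_all add: emeasure_density)
 also have "... = (\<integral>\<^sup>+p. ennreal ((cmod (chi B p * rep_L2 (fi x) p))\<^sup>2) \<partial>lborel)"
  by (rule nn_integral_cong) (auto simp: chi_def indicator_def)
 also have "... = ennreal ((norm (mulop (chi B) (fi x)))\<^sup>2)"
  unfolding mulop_def by (rule norm_to_L2_nn[symmetric]) (simp add: square_integrable_mult chi_bounded B)
 finally have 1: "emeasure (M1 x) B = ennreal ((norm (mulop (chi B) (fi x)))\<^sup>2)" .
 have 2: "emeasure (M2 x) B = ennreal ((cmod (indicator B lam * co x))\<^sup>2)"
  unfolding M2_def using B by (subst emeasure_density) (auto simp: nn_integral_return indicator_def)
 show ?thesis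
  unfolding 1 2 using B by (simp add: mu norm_decomp[of "E0 B x"] E0_parts)
qed

lemma sets_M: "sets (M1 x) = sets borel" "sets (M2 x) = sets borel"
 by (simp_all add: M1_def M2_def)

lemma M1_integral:
 fixes g :: "real \<Rightarrow> real"
 assumes [measurable]: "g \<in> borel_measurable borel"
 shows "integrable (M1 x) g \<longleftrightarrow> integrable lborel (\<lambda>p. (cmod (rep_L2 (fi x) p))\<^sup>2 * g (m p))"
  "integral\<^sup>L (M1 x) g = (LBINT p. (cmod (rep_L2 (fi x) p))\<^sup>2 * g (m p))"
 unfolding M1_def by (simp_all add: integrable_distr_eq integral_distr integrable_density integral_density)

lemma M2_integral:
 fixes g :: "real \<Rightarrow> real"
 assumes [measurable]: "g \<in> borel_measurable borel"
 shows "integrable (M2 x) g" "integral\<^sup>L (M2 x) g = (cmod (co x))\<^sup>2 * g lam"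
proof -
 show "integrable (M2 x) g" unfolding M2_def
  by (subst integrable_density) (auto simp: integrable_iff_bounded nn_integral_return)
 show "integral\<^sup>L (M2 x) g = (cmod (co x))\<^sup>2 * g lam"
  unfolding M2_def by (subst integral_density) (auto simp: integral_return)
qed

lemma mu_integral:
 fixes g :: "real \<Rightarrow> real"
 assumes [measurable]: "g \<in> borel_measurable borel"
 shows "integrable (\<mu> x) g \<longleftrightarrow> integrable lborel (\<lambda>p. (cmod (rep_L2 (fi x) p))\<^sup>2 * g (m p))"
  "integrable (\<mu> x) g \<Longrightarrow> integral\<^sup>L (\<mu> x) g = (LBINT p. (cmod (rep_L2 (fi x) p))\<^sup>2 * g (m p)) + (cmod (co x))\<^sup>2 * g lam"
 using integral_add_measure[OF sets_mu sets_M mu_add assms, of x] M1_integral[OF assms, of x] M2_integral[OF assms, of x]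
 by auto

lemma form_A:
 assumes "(x, y) \<in> A"
 shows "cinner x y = cor ((LBINT p. (cmod (rep_L2 (fi x) p))\<^sup>2 * m p) + (cmod (co x))\<^sup>2 * lam)"
proof -
 have a: "AE p in lborel. rep_L2 (fi y) p = cor (m p) * rep_L2 (fi x) p" "co y *\<^sub>C e = (lam * co x) *\<^sub>C e"
  using assms by (simp_all add: in_A)
 have "cinner (fi x) (fi y) = (LBINT p. cor ((cmod (rep_L2 (fi x) p))\<^sup>2 * m p))"
  unfolding cinner_rep
 proof (rule integral_cong_AE)
  show "AE p in lborel. cnj (rep_L2 (fi x) p) * rep_L2 (fi y) p = cor ((cmod (rep_L2 (fi x) p))\<^sup>2 * m p)"
   using a(1) by eventually_elim (simp add: complex_norm_square mult_ac del: of_real_power)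
 qed measurable
 also have "... = cor (LBINT p. (cmod (rep_L2 (fi x) p))\<^sup>2 * m p)" by (rule integral_complex_of_real)
 finally have 1: "cinner (fi x) (fi y) = cor (LBINT p. (cmod (rep_L2 (fi x) p))\<^sup>2 * m p)" .
 have "cnj (co x) * co y = cor ((cmod (co x))\<^sup>2 * lam)"
 proof (cases "e = 0")
  case True
  have "co x = cinner e x" by (rule co_def)
  also have "... = 0" by (simp only: True cinner_zero)
  finally show ?thesis by simp
 next
  case False
  hence "co y = lam * co x" using a(2) by (simp only: L2C.scale_cancel_right) simp
  thus ?thesis by (simp add: complex_norm_square mult_ac del: of_real_power)
 qed
 with 1 show ?thesis by (simp add: cinner_decomp[of x y])
qed

theorem spectral_resolution_E0: "spectral_resolution A E0"
 unfolding spectral_resolution_def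
proof (intro conjI ballI allI impI)
 show "Domain A = {x. integrable (scalar_spectral_measure E0 x) (\<lambda>t. t\<^sup>2)}"
 proof (rule set_eqI)
  fix x
  have eqsq: "(cmod (rep_L2 (fi x) p))\<^sup>2 * (m p)\<^sup>2 = (cmod (cor (m p) * rep_L2 (fi x) p))\<^sup>2" for p
   by (simp add: norm_mult power_mult_distrib mult.commute)
  have "integrable (\<mu> x) (\<lambda>t. t\<^sup>2) \<longleftrightarrow> square_integrable (\<lambda>p. cor (m p) * rep_L2 (fi x) p)"
   by (subst mu_integral(1)) (auto simp: square_integrable_def eqsq)
  also have "... \<longleftrightarrow> x \<in> Domain A"
  proof
   assume sq: "square_integrable (\<lambda>p. cor (m p) * rep_L2 (fi x) p)"
   let ?y = "Y (to_L2 (\<lambda>p. cor (m p) * rep_L2 (fi x) p)) + (lam * co x) *\<^sub>C e"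
   have "(x, ?y) \<in> A" unfolding in_A fi_Y co_Y(1) using rep_to_L2[OF sq] by simp
   thus "x \<in> Domain A" by blast
  next
   assume "x \<in> Domain A"
   then obtain y where "(x, y) \<in> A" by blast
   hence "AE p in lborel. cmod (cor (m p) * rep_L2 (fi x) p) \<le> 1 * cmod (rep_L2 (fi y) p)"
    unfolding in_A by (auto elim: eventually_mono)
   thus "square_integrable (\<lambda>p. cor (m p) * rep_L2 (fi x) p)"
    by (rule square_integrable_bound[OF square_integrable_rep, rotated]) measurable
  qed
  finally show "x \<in> Domain A \<longleftrightarrow> x \<in> {x. integrable (scalar_spectral_measure E0 x) (\<lambda>t. t\<^sup>2)}"
   by (simp add: \<mu>_def)
 qed
next
 fix xy assume xy: "xy \<in> A"
 obtain x y where [simp]: "xy = (x, y)" by force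
 have "integrable lborel (\<lambda>p. (cmod (rep_L2 (fi x) p))\<^sup>2 * m p)"
 proof -
  have "integrable lborel (\<lambda>p. cnj (rep_L2 (fi x) p) * rep_L2 (fi y) p)" by (rule integrable_cnj_mult) simp_all
  from integrable_norm[OF this] show ?thesis
  proof (rule integrable_cong_AE_imp)
   have "AE p in lborel. rep_L2 (fi y) p = cor (m p) * rep_L2 (fi x) p" using xy by (simp add: in_A)
   thus "AE p in lborel. cmod (cnj (rep_L2 (fi x) p) * rep_L2 (fi y) p) = (cmod (rep_L2 (fi x) p))\<^sup>2 * m p"
    by eventually_elim (simp add: norm_mult power2_eq_square m_nonneg mult_ac)
  qed measurable
 qed
 hence "integrable (\<mu> x) (\<lambda>t. t)" by (subst mu_integral(1)) auto
 from mu_integral(2)[OF _ this] form_A[of x y] xy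
 show "case xy of (x, y) \<Rightarrow> cinner x y = cor (integral\<^sup>L (scalar_spectral_measure E0 x) (\<lambda>t. t))"
  by (simp add: \<mu>_def)
qed (auto simp: projection E_UNIV inter' intro: sums)

lemma spectral_measure_A: "spectral_measure A x = \<mu> x"
 unfolding spectral_measure_eq[OF sa spectral_resolution_E0] \<mu>_def ..

lemma semibounded: "semibounded_below A"
 unfolding semibounded_below_def
proof (rule exI[of _ lam], clarify)
 fix x y assume xy: "(x, y) \<in> A"
 have "0 \<le> (LBINT p. (cmod (rep_L2 (fi x) p))\<^sup>2 * m p)"
  by (rule integral_nonneg_AE) (simp add: m_nonneg)
 moreover have "lam * (norm x)\<^sup>2 \<le> lam * (cmod (co x))\<^sup>2"
  using lam by (intro mult_left_mono_neg) (auto simp: norm_decomp[of x])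
 ultimately show "lam * (norm x)\<^sup>2 \<le> Re (cinner x y)"
  unfolding form_A[OF xy] by (simp add: mult.commute)
qed

section \<open>Spectral types of the multiplication model\<close>

lemma mu_null:
 assumes N: "N \<in> null_sets lborel" and x: "co x = 0"
 shows "N \<in> null_sets (\<mu> x)"
proof -
 have Nb: "N \<in> sets borel" using N by (auto simp: null_sets_def)
 have "{p. m p \<in> N} \<in> null_sets lborel" unfolding m_def by (rule preimage_powr_null[OF s0 N])
 hence ae: "AE p in lborel. m p \<notin> N" by (rule AE_I') auto
 have "emeasure (M1 x) N = (\<integral>\<^sup>+p. ennreal ((cmod (rep_L2 (fi x) p))\<^sup>2) * indicator (m -` N) p \<partial>lborel)"
  unfolding M1_def using measurable_sets_borel[OF m_measurable Nb] Nb by (subst emeasure_distr) (simp_all add: emeasure_density)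
 also have "... = (\<integral>\<^sup>+p. 0 \<partial>(lborel :: real measure))"
  by (rule nn_integral_cong_AE, use ae in eventually_elim) (simp add: indicator_def)
 finally have "emeasure (M1 x) N = 0" by simp
 moreover have "emeasure (M2 x) N = 0" using x Nb by (simp add: M2_def emeasure_density)
 ultimately show ?thesis using mu_add[OF Nb, of x] Nb by (simp add: null_sets_def)
qed

lemma mu_atom: "emeasure (\<mu> x) {lam} = 0 \<Longrightarrow> co x = 0"
proof -
 assume "emeasure (\<mu> x) {lam} = 0"
 hence "norm (E0 {lam} x) = 0" by (simp add: mu)
 hence "co (E0 {lam} x) = 0" by (simp add: co_def)
 thus "co x = 0" by (simp add: E0_parts)
qed

lemma ac_subspace_A: "ac_subspace A = {x. co x = 0}"
 unfolding ac_subspace_def spectral_measure_A absolutely_continuous_def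
proof (intro set_eqI iffI; simp)
 fix x assume "null_sets lborel \<subseteq> null_sets (\<mu> x)"
 moreover have "{lam} \<in> null_sets lborel" by (simp add: null_sets_def)
 ultimately have "{lam} \<in> null_sets (\<mu> x)" by blast
 thus "co x = 0" by (intro mu_atom) (simp add: null_sets_def)
next
 fix x assume "co x = 0"
 thus "null_sets lborel \<subseteq> null_sets (\<mu> x)" using mu_null by blast
qed

text \<open>Without an atom at \<open>lam\<close> the coefficient of \<open>e\<close> vanishes and
  the measure is absolutely continuous; if it is singular as well, it is 0.\<close>

lemma sc_subspace_A: "sc_subspace A = {0}"
proof -
 have "x = 0" if x: "\<forall>t. emeasure (\<mu> x) {t} = 0" "N \<in> null_sets lborel" "emeasure (\<mu> x) (- N) = 0" for x N
 proof -
  have Nb: "N \<in> sets borel" using x(2) by (auto simp: null_sets_def)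
  have "co x = 0" using x(1) mu_atom by blast
  hence "emeasure (\<mu> x) N = 0" using mu_null[OF x(2)] by (auto simp: null_sets_def)
  hence "E0 N x = 0" "E0 (- N) x = 0" using x(3) Nb by (simp_all add: mu)
  thus "x = 0" using compl[OF Nb, of x] by simp
 qed
 moreover have "emeasure (\<mu> 0) B = 0" for B
 proof (cases "B \<in> sets borel")
  case True
  thus ?thesis by (simp add: mu clinear_mapD(3)[OF lin])
 qed (simp add: emeasure_notin_sets)
 ultimately show ?thesis
  unfolding sc_subspace_def spectral_measure_A by (auto intro!: bexI[of _ "{}"])
qed

lemma zero_in_A: "(0, 0) \<in> A"
 using sa by (simp add: self_adjoint_def linear_operator_def)

lemma sc_spectrum_A: "sc_spectrum A = {}"
proof -
 have "z \<in> resolvent_set_on {0} (A \<inter> {0} \<times> {0})" for z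
  using zero_in_A by (auto simp: resolvent_set_on_def intro!: ex1I[of _ 0] exI[of _ 1])
 thus ?thesis unfolding sc_spectrum_def sc_subspace_A spectrum_on_def by blast
qed

lemma resolvent_function:
 assumes z: "z \<notin> cor ` {0..}"
 obtains C where "C \<ge> 0" "\<And>p. cmod (1 / (cor (m p) - z)) \<le> C" "bounded_borel (\<lambda>p. 1 / (cor (m p) - z))"
  "\<And>p. cor (m p) - z \<noteq> 0"
proof -
 have nz: "cor (m p) - z \<noteq> 0" for p
  using z m_nonneg[of p] by (metis atLeast_iff eq_iff_diff_eq_0 image_eqI)
 have "\<exists>d>0. \<forall>p. d \<le> cmod (cor (m p) - z)"
 proof (cases "Im z = 0")
  case True
  have "Re z < 0"
  proof (rule ccontr)
   assume "\<not> Re z < 0"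
   hence "z \<in> cor ` {0..}" using True by (intro image_eqI[of _ _ "Re z"]) (auto simp: complex_eq_iff)
   thus False using z by blast
  qed
  moreover have "- Re z \<le> cmod (cor (m p) - z)" for p
   using complex_Re_le_cmod[of "cor (m p) - z"] m_nonneg[of p] by simp
  ultimately show ?thesis by (intro exI[of _ "- Re z"]) auto
 next
  case False
  moreover have "\<bar>Im z\<bar> \<le> cmod (cor (m p) - z)" for p
   using abs_Im_le_cmod[of "cor (m p) - z"] by simp
  ultimately show ?thesis by (intro exI[of _ "\<bar>Im z\<bar>"]) auto
 qed
 then obtain d where d: "d > 0" "\<And>p. d \<le> cmod (cor (m p) - z)" by blast
 have b: "cmod (1 / (cor (m p) - z)) \<le> 1 / d" for p
  using d by (simp add: norm_divide frac_le)
 show ?thesis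
  by (rule that[of "1 / d"]) (use d b nz in \<open>auto intro!: bounded_borelI[of _ "1 / d"]\<close>)
qed

lemma resolvent_equation:
 fixes z :: complex
 shows "(x, y + z *\<^sub>C x) \<in> A \<longleftrightarrow> (AE p in lborel. rep_L2 (fi y) p = (cor (m p) - z) * rep_L2 (fi x) p)
   \<and> co y *\<^sub>C e = ((lam - z) * co x) *\<^sub>C e"
proof -
 have "AE p in lborel. rep_L2 (fi (y + z *\<^sub>C x)) p = rep_L2 (fi y) p + z * rep_L2 (fi x) p"
  using rep_add[of "fi y" "z *\<^sub>C fi x"] rep_scaleC[of z "fi x"]
  by eventually_elim (simp add: clinear_mapD[OF fi_linear])
 hence "(AE p in lborel. rep_L2 (fi (y + z *\<^sub>C x)) p = cor (m p) * rep_L2 (fi x) p)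
   \<longleftrightarrow> (AE p in lborel. rep_L2 (fi y) p = (cor (m p) - z) * rep_L2 (fi x) p)"
  by (intro eventually_subst, elim eventually_mono) (auto simp: algebra_simps)
 moreover have "co (y + z *\<^sub>C x) *\<^sub>C e = (lam * co x) *\<^sub>C e \<longleftrightarrow> co y *\<^sub>C e = ((lam - z) * co x) *\<^sub>C e"
  unfolding co_linear L2C.scale_left_distrib left_diff_distrib L2C.scale_left_diff_distrib by (simp only: eq_diff_eq)
 ultimately show ?thesis by (simp add: in_A)
qed

lemma fi_resolvent:
 assumes b: "bounded_borel (\<lambda>p. 1 / (cor (m p) - z))" and nz: "\<And>p. cor (m p) - z \<noteq> 0"
 shows "(AE p in lborel. rep_L2 g p = (cor (m p) - z) * rep_L2 f p) \<longleftrightarrow> f = mulop (\<lambda>p. 1 / (cor (m p) - z)) g"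
proof -
 have "f = mulop (\<lambda>p. 1 / (cor (m p) - z)) g \<longleftrightarrow> (AE p in lborel. rep_L2 f p = 1 / (cor (m p) - z) * rep_L2 g p)"
  unfolding L2_eq_iff by (rule eventually_subst[OF eventually_mono[OF rep_mulop[OF b, of g]]]) simp
 also have "... \<longleftrightarrow> (AE p in lborel. rep_L2 g p = (cor (m p) - z) * rep_L2 f p)"
  by (rule eventually_subst[OF always_eventually]) (use nz in \<open>auto simp: field_simps\<close>)
 finally show ?thesis by blast
qed

lemma norm_fi: "norm (fi x) \<le> norm x" "cmod (co x) \<le> norm x"
 by (rule power2_le_imp_le; simp add: norm_decomp[of x])+

lemma resolvent_range:
 fixes z :: complex
 assumes M: "M = {x. co x = 0} \<or> (M = UNIV \<and> (e = 0 \<or> z \<noteq> cor lam))" and z: "z \<notin> cor ` {0..}"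
 shows "z \<in> resolvent_set_on M (A \<inter> M \<times> M)"
proof -
 obtain C where C: "C \<ge> 0" "\<And>p. cmod (1 / (cor (m p) - z)) \<le> C" "bounded_borel (\<lambda>p. 1 / (cor (m p) - z))"
  "\<And>p. cor (m p) - z \<noteq> 0" using resolvent_function[OF z] by blast
 \<comment> \<open>On the subspace where \<open>co\<close> vanishes z may equal \<open>lam\<close>;
   the quotient is then 0/0, which is 0, and the formula remains correct.\<close>
 define R where "R y = Y (mulop (\<lambda>p. 1 / (cor (m p) - z)) (fi y)) + (co y / (lam - z)) *\<^sub>C e" for y
 have z': "e = 0 \<or> cor lam - z \<noteq> 0 \<or> M = {x. co x = 0}" using M by auto
 have Mcl: "y + c *\<^sub>C x \<in> M" if "x \<in> M" "y \<in> M" for x y c using that M by (auto simp: co_linear)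
 have coR: "co (R y) = co y / (lam - z)" for y
  unfolding R_def co_Y(2) by (simp add: co_def ee(3))
 have RM: "R y \<in> M" if "y \<in> M" for y using that M by (auto simp: coR)
 have sol: "(x, y + z *\<^sub>C x) \<in> A \<longleftrightarrow> x = R y" if xy: "x \<in> M" "y \<in> M" for x y
 proof -
  have "co y *\<^sub>C e = ((lam - z) * co x) *\<^sub>C e \<longleftrightarrow> co x *\<^sub>C e = co (R y) *\<^sub>C e"
  proof (cases "e = 0")
   case False
   thus ?thesis using z' xy unfolding L2C.scale_cancel_right by (auto simp: coR field_simps)
  qed simp
  thus ?thesis
   unfolding resolvent_equation fi_resolvent[OF C(3,4)] eq_decomp[of x "R y"] by (simp add: R_def fi_Y)
 qed
 have nb: "norm (R y) \<le> (C + cmod (1 / (lam - z))) * norm y" for y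
 proof -
  have "norm (R y) \<le> norm (Y (mulop (\<lambda>p. 1 / (cor (m p) - z)) (fi y))) + norm ((co y / (lam - z)) *\<^sub>C e)"
   unfolding R_def by (rule norm_triangle_ineq)
  also have "norm (Y (mulop (\<lambda>p. 1 / (cor (m p) - z)) (fi y))) \<le> C * norm y"
   unfolding isometry_norm[OF Yiso]
   by (rule order_trans[OF mulop_norm[OF bounded_borel_measurable[OF C(3)] C(2)] mult_left_mono[OF norm_fi(1) C(1)]])
  also have "norm ((co y / (lam - z)) *\<^sub>C e) \<le> cmod (1 / (lam - z)) * norm y"
  proof -
   have "norm ((co y / (lam - z)) *\<^sub>C e) = cmod (1 / (lam - z)) * (cmod (co y) * norm e)"
    by (simp add: norm_scaleC norm_divide)
   also have "cmod (co y) * norm e \<le> norm y * 1" using e by (intro mult_mono norm_fi) auto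
   finally show ?thesis by (simp add: mult_left_mono)
  qed
  finally show ?thesis by (simp add: distrib_right)
 qed
 show ?thesis unfolding resolvent_set_on_def mem_Collect_eq
 proof (intro conjI ballI)
  fix y assume y: "y \<in> M"
  show "\<exists>!x. x \<in> M \<and> (x, y + z *\<^sub>C x) \<in> A \<inter> M \<times> M"
   by (rule ex1I[of _ "R y"]) (use y RM sol Mcl in auto)
 next
  show "\<exists>C. \<forall>x\<in>M. \<forall>y\<in>M. (x, y + z *\<^sub>C x) \<in> A \<inter> M \<times> M \<longrightarrow> norm x \<le> C * norm y"
   using sol nb by (intro exI[of _ "C + cmod (1 / (lam - z))"]) auto
 qed
qed

text \<open>Approximate eigenvectors: the image under Y of the indicator of an interval on which
  |p|^s is within \<epsilon> of t. With \<epsilon> = 1 / (|C| + 1), a resolvent bound C would give 1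
  \<le> |C| \<epsilon> < 1.\<close>

lemma half_line_in_spectrum:
 assumes M: "{x. co x = 0} \<subseteq> M" and t: "t \<ge> 0"
 shows "cor t \<notin> resolvent_set_on M (A \<inter> M \<times> M)"
proof
 assume "cor t \<in> resolvent_set_on M (A \<inter> M \<times> M)"
 then obtain C where C: "\<And>x y. x \<in> M \<Longrightarrow> y \<in> M \<Longrightarrow> (x, y + cor t *\<^sub>C x) \<in> A \<inter> M \<times> M \<Longrightarrow> norm x \<le> C * norm y"
  unfolding resolvent_set_on_def by blast
 define p0 where "p0 = t powr (1 / s)"
 have mp0: "m p0 = t" using t s0 by (cases "t = 0") (auto simp: p0_def m_def powr_powr)
 have "isCont m p0"
 proof -
  have "continuous_on UNIV m" unfolding m_def[abs_def]
   by (rule continuous_on_powr') (use s0 in \<open>auto intro!: continuous_intros\<close>)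
  thus ?thesis by (simp add: continuous_on_eq_continuous_at)
 qed
 define \<epsilon> where "\<epsilon> = 1 / (\<bar>C\<bar> + 1)"
 have e0: "\<epsilon> > 0" by (simp add: \<epsilon>_def add_nonneg_pos)
 obtain d where d: "d > 0" "\<And>p. \<bar>p - p0\<bar> < d \<Longrightarrow> \<bar>m p - t\<bar> < \<epsilon>"
  using \<open>isCont m p0\<close> e0 mp0 unfolding continuous_at_eps_delta by (metis dist_real_def)
 define I where "I = {p0..p0 + d / 2}"
 define f where "f = to_L2 (indicator I)"
 have si: "square_integrable (indicator I)"
 proof -
  have "integrable lborel (\<lambda>x. indicator I x *\<^sub>R (1::real))" unfolding I_def by (rule borel_integrable_compact) auto
  moreover have "(\<lambda>x. indicator I x *\<^sub>R (1::real)) = (\<lambda>x. (cmod (indicator I x))\<^sup>2)" by (auto simp: indicator_def)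
  ultimately show ?thesis by (simp add: square_integrable_def I_def)
 qed
 have "(norm f)\<^sup>2 = (LBINT x. indicator I x)" unfolding f_def norm_to_L2_sq[OF si]
  by (rule Bochner_Integration.integral_cong) (auto simp: indicator_def)
 also have "... = d / 2" using d by (simp add: I_def)
 finally have f0: "norm f > 0" using d by (metis half_gt_zero norm_eq_zero not_less_iff_gr_or_eq norm_ge_zero zero_eq_power2 less_le)
 define \<phi> where "\<phi> p = cor (indicator I p * (m p - t))" for p
 have pb: "\<phi> \<in> borel_measurable borel" "cmod (\<phi> p) \<le> \<epsilon>" for p
 proof -
  show "\<phi> \<in> borel_measurable borel" unfolding \<phi>_def[abs_def] I_def by measurable
  show "cmod (\<phi> p) \<le> \<epsilon>"
   using d e0 by (auto simp: \<phi>_def indicator_def I_def abs_mult intro!: less_imp_le[OF d(2)] simp del: of_real_diff)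
 qed
 have bb: "bounded_borel \<phi>" by (rule bounded_borelI[OF pb])
 define y where "y = Y (mulop \<phi> f)"
 have fiY: "fi (Y u) = u" "co (Y u) = 0" for u using fi_Y[of u 0] by (simp_all add: co_def)
 have "AE p in lborel. rep_L2 (mulop \<phi> f) p = (cor (m p) - cor t) * rep_L2 f p"
  using rep_mulop[OF bb, of f] rep_to_L2[OF si, folded f_def]
  by eventually_elim (auto simp: \<phi>_def indicator_def)
 hence "(Y f, y + cor t *\<^sub>C Y f) \<in> A" unfolding resolvent_equation y_def by (simp add: fiY)
 moreover have "Y f \<in> M" "y \<in> M" "y + cor t *\<^sub>C Y f \<in> M"
  using M by (auto simp: y_def co_linear fiY)
 ultimately have "norm (Y f) \<le> C * norm y" by (intro C) auto
 also have "... \<le> \<bar>C\<bar> * (\<epsilon> * norm f)"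
  unfolding y_def isometry_norm[OF Yiso]
  by (rule mult_mono[OF abs_ge_self mulop_norm[OF pb]]) auto
 finally have "norm f * 1 \<le> norm f * (\<bar>C\<bar> * \<epsilon>)" by (simp add: isometry_norm[OF Yiso] mult_ac)
 hence "1 \<le> \<bar>C\<bar> * \<epsilon>" using f0 by simp
 thus False by (simp add: \<epsilon>_def)
qed

lemma ac_spectrum_A: "ac_spectrum A = cor ` {0..}"
proof -
 have "z \<in> resolvent_set_on {x. co x = 0} (A \<inter> {x. co x = 0} \<times> {x. co x = 0}) \<longleftrightarrow> z \<notin> cor ` {0..}" for z
  using resolvent_range[of "{x. co x = 0}" z] half_line_in_spectrum[of "{x. co x = 0}"] by blast
 thus ?thesis unfolding ac_spectrum_def ac_subspace_A spectrum_on_def by blast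
qed

lemma e_eigenvector: "(e, cor lam *\<^sub>C e) \<in> A"
proof -
 have "AE p in lborel. rep_L2 0 p = cor (\<bar>p\<bar> powr s) * rep_L2 0 p" using rep_zero by eventually_elim simp
 hence "(Y 0 + 1 *\<^sub>C e, Y 0 + (cor lam * 1) *\<^sub>C e) \<in> A" unfolding A by blast
 thus ?thesis by (simp add: clinear_mapD[OF Ylin])
qed

lemma spectrum_A: "spectrum A = cor ` {0..} \<union> (if e = 0 then {} else {cor lam})"
proof -
 have "cor lam \<notin> resolvent_set A" if "e \<noteq> 0"
 proof
  assume "cor lam \<in> resolvent_set A"
  hence "\<exists>!x. x \<in> UNIV \<and> (x, 0 + cor lam *\<^sub>C x) \<in> A" unfolding resolvent_set_on_def by blast
  moreover have "(0, 0 + cor lam *\<^sub>C 0) \<in> A" "(e, 0 + cor lam *\<^sub>C e) \<in> A"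
   using zero_in_A e_eigenvector by simp_all
  ultimately show False using that by blast
 qed
 moreover have "cor t \<notin> resolvent_set A" if "t \<ge> 0" for t
  using half_line_in_spectrum[of UNIV t] that by simp
 moreover have "z \<in> resolvent_set A" if "z \<notin> cor ` {0..}" "e = 0 \<or> z \<noteq> cor lam" for z
  using resolvent_range[of UNIV z] that by simp
 ultimately show ?thesis unfolding spectrum_on_def by (auto split: if_splits)
qed

lemma eigenspace_lam: "eigenspace A (cor lam) = L2C.span {e}"
proof -
 have "x \<in> eigenspace A (cor lam) \<longleftrightarrow> (\<exists>c. x = c *\<^sub>C e)" for x
 proof
  assume "x \<in> eigenspace A (cor lam)"
  hence "(x, 0 + cor lam *\<^sub>C x) \<in> A" by (simp add: eigenspace_def)
  hence "AE p in lborel. rep_L2 (fi 0) p = (cor (m p) - cor lam) * rep_L2 (fi x) p"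
   unfolding resolvent_equation by blast
  hence "AE p in lborel. rep_L2 (fi x) p = rep_L2 0 p"
   using rep_zero
  proof eventually_elim
   case (elim p)
   have "cor (m p) - cor lam \<noteq> 0" using lam m_nonneg[of p] by (simp flip: of_real_diff)
   thus ?case using elim by (simp add: clinear_mapD[OF fi_linear])
  qed
  hence "fi x = 0" by (simp add: L2_eq_iff)
  thus "\<exists>c. x = c *\<^sub>C e" using decomp[of x] by (auto simp: clinear_mapD[OF Ylin])
 next
  assume "\<exists>c. x = c *\<^sub>C e"
  then obtain c where c: "x = c *\<^sub>C e" by blast
  have "\<forall>c. \<forall>(x, y)\<in>A. (c *\<^sub>C x, c *\<^sub>C y) \<in> A" using sa by (simp add: self_adjoint_def linear_operator_def)
  hence "(c *\<^sub>C e, c *\<^sub>C cor lam *\<^sub>C e) \<in> A" using e_eigenvector by blast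
  thus "x \<in> eigenspace A (cor lam)" by (simp add: c eigenspace_def mult.commute)
 qed
 thus ?thesis by (auto simp: L2C.span_singleton)
qed

lemma discrete_spectrum_A: "discrete_spectrum A = (if e = 0 then {} else {cor lam})"
proof -
 have no: "\<not> cor t isolated_in spectrum A" if t: "t \<ge> 0" for t
 proof
  assume "cor t isolated_in spectrum A"
  then obtain T where T: "open T" "T \<inter> spectrum A = {cor t}" by (auto simp: isolated_in_def)
  hence "cor t \<in> T" by blast
  then obtain d where d: "d > 0" "ball (cor t) d \<subseteq> T" using T(1) openE by blast
  have "cor (t + d / 2) \<in> ball (cor t) d" using d by (simp add: dist_norm)
  moreover have "cor (t + d / 2) \<in> spectrum A" using t d by (auto simp: spectrum_A simp del: of_real_add)
  ultimately have "cor (t + d / 2) = cor t" using d(2) T(2) by blast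
  thus False using d by (simp only: of_real_eq_iff)
 qed
 show ?thesis
 proof (cases "e = 0")
  case True
  thus ?thesis using no by (auto simp: discrete_spectrum_def isolated_in_def spectrum_A)
 next
  case False
  have "open {z. Re z < 0}" by (intro open_Collect_less continuous_intros)
  moreover have "{z. Re z < 0} \<inter> spectrum A = {cor lam}" using lam False by (auto simp: spectrum_A)
  ultimately have iso: "cor lam isolated_in spectrum A" using False by (auto simp: isolated_in_def spectrum_A)
  have "eigenspace A (cor lam) \<noteq> {0}" using False unfolding eigenspace_lam
   by (metis L2C.span_base singletonI singletonD)
  moreover have "\<exists>B. finite B \<and> eigenspace A (cor lam) \<subseteq> L2C.span B"
   unfolding eigenspace_lam by (intro exI[of _ "{e}"]) auto
  ultimately have "cor lam \<in> discrete_spectrum A" using iso by (simp add: discrete_spectrum_def)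
  moreover have "discrete_spectrum A \<subseteq> {cor lam}"
   using no False by (auto simp: discrete_spectrum_def isolated_in_def spectrum_A)
  ultimately show ?thesis using False by auto
 qed
qed

lemma essential_spectrum_A: "essential_spectrum A = cor ` {0..}"
 unfolding essential_spectrum_def discrete_spectrum_A spectrum_A using lam by auto

lemma dim_eigenspace: "e \<noteq> 0 \<Longrightarrow> L2C.dim (eigenspace A (cor lam)) = 1"
 unfolding eigenspace_lam by (rule L2C.dim_eq_card[of "{e}", THEN trans]) (auto simp: L2C.dependent_single L2C.span_span)

end

section \<open>Self-adjoint extensions\<close>

lemma const_square_integrable:
 assumes "AE p in lborel. rep_L2 x p = c" shows "c = 0" "x = 0"
proof -
 have "square_integrable (\<lambda>p. c)"
  by (rule square_integrable_bound[OF square_integrable_rep[of x], of _ 1]) (use assms in \<open>auto elim: eventually_mono\<close>)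
 thus c: "c = 0" by (auto simp: square_integrable_nn ennreal_mult_top split: if_splits)
 show "x = 0" unfolding L2_eq_iff using assms rep_zero unfolding c by eventually_elim simp
qed

lemma adjoint_closure: "adjoint_op (closure S) = adjoint_op S"
proof
 show "adjoint_op (closure S) \<subseteq> adjoint_op S"
  unfolding adjoint_op_def using closure_subset[of S] by blast
 show "adjoint_op S \<subseteq> adjoint_op (closure S)"
 proof clarify
  fix x y assume xy: "(x, y) \<in> adjoint_op S"
  have "cinner x v = cinner y u" if uv: "(u, v) \<in> closure S" for u v
  proof -
   obtain X where X: "\<And>n. X n \<in> S" "X \<longlonglongrightarrow> (u, v)" using iffD1[OF closure_sequential uv] by blast
   have e: "cinner x (snd (X n)) = cinner y (fst (X n))" for n using xy X(1)[of n] by (force simp: adjoint_op_def)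
   have "(\<lambda>n. cinner x (snd (X n))) \<longlonglongrightarrow> cinner x v" using tendsto_snd[OF X(2)] by (intro tendsto_cinner tendsto_const) simp
   moreover have "(\<lambda>n. cinner x (snd (X n))) \<longlonglongrightarrow> cinner y u" unfolding e using tendsto_fst[OF X(2)] by (intro tendsto_cinner tendsto_const) simp
   ultimately show ?thesis by (rule LIMSEQ_unique)
  qed
  thus "(x, y) \<in> adjoint_op (closure S)" unfolding adjoint_op_def by blast
 qed
qed

lemma adjoint_antimono: "A \<subseteq> B \<Longrightarrow> adjoint_op B \<subseteq> adjoint_op A"
 unfolding adjoint_op_def by blast

lemma powr_weight_bounds:
 fixes p t :: real assumes "t > 0"
 shows "\<bar>p\<bar> powr t \<le> (1 + p\<^sup>2) powr (t / 2)" "(1 + p\<^sup>2) powr (t / 2) \<le> 2 powr (t / 2) * (1 + \<bar>p\<bar> powr t)"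
proof -
 have sq: "(p\<^sup>2) powr (t / 2) = \<bar>p\<bar> powr t"
 proof -
  have "p\<^sup>2 = \<bar>p\<bar> powr 2" by simp
  thus ?thesis by (simp add: powr_powr del: powr_numeral)
 qed
 show "\<bar>p\<bar> powr t \<le> (1 + p\<^sup>2) powr (t / 2)" unfolding sq[symmetric] using assms by (intro powr_mono2) auto
 have "(1 + p\<^sup>2) powr (t / 2) \<le> (2 * max 1 (p\<^sup>2)) powr (t / 2)" using assms by (intro powr_mono2) auto
 also have "... = 2 powr (t / 2) * max 1 (p\<^sup>2) powr (t / 2)" by (rule powr_mult)
 also have "max 1 (p\<^sup>2) powr (t / 2) \<le> 1 + \<bar>p\<bar> powr t" by (simp add: max_def sq)
 finally show "(1 + p\<^sup>2) powr (t / 2) \<le> 2 powr (t / 2) * (1 + \<bar>p\<bar> powr t)" by simp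
qed

lemma sobolev_iff:
 assumes "t > 0"
 shows "F \<in> sobolev t \<longleftrightarrow> square_integrable (\<lambda>p. cor (\<bar>p\<bar> powr t) * rep_L2 (fourier F) p)"
proof
 assume "F \<in> sobolev t"
 hence "square_integrable (sobolev_weight t F)" by (simp add: sobolev_def)
 thus "square_integrable (\<lambda>p. cor (\<bar>p\<bar> powr t) * rep_L2 (fourier F) p)"
  by (rule square_integrable_bound[of _ _ 1])
    (auto simp: sobolev_weight_def norm_mult intro!: AE_I2 mult_right_mono powr_weight_bounds(1)[OF assms])
next
 assume sq: "square_integrable (\<lambda>p. cor (\<bar>p\<bar> powr t) * rep_L2 (fourier F) p)"
 have "square_integrable (\<lambda>p. cor (1 + \<bar>p\<bar> powr t) * rep_L2 (fourier F) p)"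
  using square_integrable_add[OF square_integrable_rep[of "fourier F"] sq] by (simp add: distrib_right)
 hence "square_integrable (sobolev_weight t F)"
 proof (rule square_integrable_bound[of _ _ "2 powr (t / 2)"])
  have "\<bar>(1 + p\<^sup>2) powr (t / 2)\<bar> \<le> 2 powr (t / 2) * \<bar>1 + \<bar>p\<bar> powr t\<bar>" for p
   using powr_weight_bounds(2)[OF assms, of p] by simp
  thus "AE p in lborel. cmod (sobolev_weight t F p) \<le> 2 powr (t / 2) * cmod (cor (1 + \<bar>p\<bar> powr t) * rep_L2 (fourier F) p)"
   unfolding sobolev_weight_def norm_mult norm_of_real mult.assoc[symmetric] by (intro AE_I2 mult_right_mono) auto
 qed (simp add: sobolev_weight_def[abs_def])
 thus "F \<in> sobolev t" by (simp add: sobolev_def)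
qed

definition "fmul \<phi> y = ifourier (mulop \<phi> (fourier y))"

lemma fmul_linear: "bounded_borel \<phi> \<Longrightarrow> clinear_map (fmul \<phi>)"
 using clinear_mapD[OF fourier_linear] clinear_mapD[OF ifourier_linear] clinear_mapD[OF mulop_linear]
 by (simp add: clinear_map_def fmul_def)

lemma rep_fourier_fmul: "bounded_borel \<phi> \<Longrightarrow> AE p in lborel. rep_L2 (fourier (fmul \<phi> y)) p = \<phi> p * rep_L2 (fourier y) p"
 unfolding fmul_def by (simp add: rep_mulop)

lemma fmul_sym:
 assumes "bounded_borel \<phi>" "\<And>p. cnj (\<phi> p) = \<phi> p"
 shows "cinner (fmul \<phi> x) y = cinner x (fmul \<phi> y)"
 using mulop_adjoint[of \<phi> "fourier x" "fourier y"] fourier_cinner[of x "fmul \<phi> y"] assms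
 by (simp add: fmul_def cinner_ifourier)

lemma fmul_norm: "\<phi> \<in> borel_measurable borel \<Longrightarrow> (\<And>p. cmod (\<phi> p) \<le> C) \<Longrightarrow> norm (fmul \<phi> y) \<le> C * norm y"
 using mulop_norm[of \<phi> C "fourier y"] by (simp add: fmul_def isometry_norm[OF ifourier_cinner] fourier_norm)

section \<open>The free resolvent, the functions G and the boundary values\<close>

context fractional_order
begin

definition "ih l p = cor (1 / (m p + l))" for l p :: real
definition "R0 l = fmul (ih l)" for l
abbreviation "A0 \<equiv> frac_laplacian (s / 2)"
abbreviation "GG \<equiv> G s"

lemma m_meas [measurable]: "m \<in> borel_measurable borel" unfolding m_def[abs_def] by measurable
lemma m_nonneg [simp]: "0 \<le> m p" by (simp add: m_def)
lemma m_pos: "l > 0 \<Longrightarrow> 0 < m p + l" using m_nonneg[of p] by linarith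

lemma ih_nz: "l > 0 \<Longrightarrow> cor (m p) + cor l \<noteq> 0"
 using m_pos[of l p] by (simp flip: of_real_add)

lemma ih_measurable [measurable]: "ih l \<in> borel_measurable borel" unfolding ih_def[abs_def] by measurable

lemma ih_bound: "l > 0 \<Longrightarrow> cmod (ih l p) \<le> 1 / l"
 using m_pos[of l p] m_nonneg[of p] unfolding ih_def norm_of_real by (simp add: frac_le)

lemma ih_bb: "l > 0 \<Longrightarrow> bounded_borel (ih l)"
 by (rule bounded_borelI[OF ih_measurable ih_bound])

text \<open>The contour integral needs two distinct poles, so the square is compared with the kernel
  for the parameters l and 2 l.\<close>

lemma ih_sq: assumes l: "l > 0" shows "square_integrable (ih l)"
proof -
 have "integrable lborel (\<lambda>p. 2 * (1 / ((m p + l) * (m p + 2 * l))))"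
  using Theta_integral(1)[of l "2 * l"] l by (intro integrable_mult_right) auto
 hence "integrable lborel (\<lambda>p. (cmod (ih l p))\<^sup>2)"
 proof (rule Bochner_Integration.integrable_bound)
  show "AE p in lborel. norm ((cmod (ih l p))\<^sup>2) \<le> norm (2 * (1 / ((m p + l) * (m p + 2 * l))))"
  proof (rule AE_I2)
   fix p
   have "1 / (m p + l)\<^sup>2 \<le> 2 * (1 / ((m p + l) * (m p + 2 * l)))"
   proof -
    have "1 / (m p + l)\<^sup>2 = 2 / ((m p + l) * (2 * (m p + l)))" using m_pos[OF l, of p] by (simp add: power2_eq_square divide_simps)
    also have "... \<le> 2 / ((m p + l) * (m p + 2 * l))"
    proof (intro frac_le mult_left_mono mult_pos_pos)
     show "0 < m p + l" "0 \<le> m p + l" "0 < m p + 2 * l" "m p + 2 * l \<le> 2 * (m p + l)"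
      using m_pos[OF l, of p] m_pos[of "2 * l" p] m_nonneg[of p] l by (simp_all del: m_nonneg)
    qed auto
    finally show ?thesis by simp
   qed
   thus "norm ((cmod (ih l p))\<^sup>2) \<le> norm (2 * (1 / ((m p + l) * (m p + 2 * l))))"
    using m_pos[OF l, of p] m_nonneg[of p] l by (simp add: ih_def norm_divide power_divide flip: of_real_add)
  qed
 qed measurable
 thus ?thesis by (simp add: square_integrable_def)
qed

lemma G_eq: "GG l = cor (1 / sqrt (2 * pi)) *\<^sub>C ifourier (to_L2 (ih l))"
 unfolding G_def inv_fourier ih_def[abs_def] m_def ..

lemma fourier_G: "fourier (GG l) = cor (1 / sqrt (2 * pi)) *\<^sub>C to_L2 (ih l)"
 unfolding G_eq by (simp add: clinear_mapD[OF fourier_linear])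

lemma rep_fourier_G:
 assumes "l > 0" shows "AE p in lborel. rep_L2 (fourier (GG l)) p = cor (1 / sqrt (2 * pi)) * ih l p"
 using rep_to_L2[OF ih_sq[OF assms]] rep_scaleC[of "cor (1 / sqrt (2 * pi))" "to_L2 (ih l)"] unfolding fourier_G by eventually_elim simp

lemma R0_linear: "l > 0 \<Longrightarrow> clinear_map (R0 l)"
 unfolding R0_def by (rule fmul_linear[OF ih_bb])

lemma rep_fourier_R0: "l > 0 \<Longrightarrow> AE p in lborel. rep_L2 (fourier (R0 l y)) p = ih l p * rep_L2 (fourier y) p"
 unfolding R0_def by (rule rep_fourier_fmul[OF ih_bb])

lemma R0_sym: "l > 0 \<Longrightarrow> cinner (R0 l x) y = cinner x (R0 l y)"
 unfolding R0_def by (rule fmul_sym[OF ih_bb]) (simp_all add: ih_def)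

lemma R0_norm: "l > 0 \<Longrightarrow> norm (R0 l y) \<le> 1 / l * norm y"
 unfolding R0_def by (rule fmul_norm[OF ih_measurable ih_bound])

lemma A0_iff: "(x, y) \<in> A0 \<longleftrightarrow> (AE p in lborel. rep_L2 (fourier y) p = cor (m p) * rep_L2 (fourier x) p)"
 unfolding frac_laplacian_def fourier_multiplier_def m_def by simp

lemma L2_eq_fourier: "x = y \<longleftrightarrow> (AE p in lborel. rep_L2 (fourier x) p = rep_L2 (fourier y) p)"
 unfolding L2_eq_iff[symmetric] using inj_fourier by (auto dest: injD)

lemma rep_fourier_lin:
 "AE p in lborel. rep_L2 (fourier (x + y)) p = rep_L2 (fourier x) p + rep_L2 (fourier y) p"
 "AE p in lborel. rep_L2 (fourier (c *\<^sub>C x)) p = c * rep_L2 (fourier x) p"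
 using rep_add rep_scaleC by (simp_all add: clinear_mapD[OF fourier_linear])

text \<open>On the Fourier side the decomposition says that |p|^s times the transform of x differs
  from that of y by a constant. The right-hand side is free of l, so the decomposition and its
  coefficient c are the same for all l.\<close>

lemma resolvent_form:
 assumes l: "l > 0"
 shows "x = R0 l (y + cor l *\<^sub>C x) + c *\<^sub>C GG l \<longleftrightarrow>
  (AE p in lborel. cor (m p) * rep_L2 (fourier x) p = rep_L2 (fourier y) p + cor (1 / sqrt (2 * pi)) * c)"
proof -
 have "AE p in lborel. rep_L2 (fourier (R0 l (y + cor l *\<^sub>C x) + c *\<^sub>C GG l)) p
   = ih l p * (rep_L2 (fourier y) p + cor l * rep_L2 (fourier x) p + cor (1 / sqrt (2 * pi)) * c)"
  using rep_fourier_R0[OF l, of "y + cor l *\<^sub>C x"] rep_fourier_lin(1)[of y "cor l *\<^sub>C x"]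
   rep_fourier_lin(2)[of "cor l" x] rep_fourier_lin(1)[of "R0 l (y + cor l *\<^sub>C x)" "c *\<^sub>C GG l"]
   rep_fourier_lin(2)[of c "GG l"] rep_fourier_G[OF l]
 proof eventually_elim
  case (elim p) show ?case unfolding elim(4) elim(1) elim(2) elim(3) elim(5) elim(6) by (simp only: distrib_left mult_ac)
 qed
 moreover have "X = ih l p * (Z + cor l * X + C) \<longleftrightarrow> cor (m p) * X = Z + C" for p X Z C
  using ih_nz[OF l, of p] by (auto simp: ih_def field_simps)
 ultimately show ?thesis
  unfolding L2_eq_fourier[of x] by - (rule eventually_subst, erule eventually_mono, simp only:)
qed

text \<open>\<open>dec x y d c\<close>: \<open>(x, y)\<close> is in the graph of the adjoint of \<^term>\<open>k_ring s\<close>, \<open>c\<close> is the coefficient of \<open>x\<close> at \<open>G\<close>, and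
 \<open>d\<close> the value at \<open>0\<close> of its regular part, shifted by \<open>c \<Theta>\<close> so as not to depend on \<open>\<lambda>\<close>.\<close>

definition "dec x y d c \<longleftrightarrow> x = R0 1 (y + x) + c *\<^sub>C GG 1 \<and> d = cinner (GG 1) (y + x) + cor (Theta s 1) * c"

lemma G_R0: assumes "l > 0" "l' > 0"
 shows "cor (l' - l) *\<^sub>C R0 l (GG l') = GG l - GG l'"
proof -
 have "AE p in lborel. rep_L2 (fourier (cor (l' - l) *\<^sub>C R0 l (GG l') + GG l')) p = rep_L2 (fourier (GG l)) p"
  using rep_fourier_lin(1)[of "cor (l' - l) *\<^sub>C R0 l (GG l')" "GG l'"] rep_fourier_lin(2)[of "cor (l' - l)" "R0 l (GG l')"]
   rep_fourier_R0[OF assms(1), of "GG l'"] rep_fourier_G[OF assms(1)] rep_fourier_G[OF assms(2)]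
 proof eventually_elim
  case (elim p)
  have "(l' - l) * (1 / (m p + l) * (1 / (m p + l'))) + 1 / (m p + l') = 1 / (m p + l)"
   using m_pos[OF assms(1), of p] m_pos[OF assms(2), of p] by (simp add: divide_simps)
  hence "cor (l' - l) * (ih l p * ih l' p) + ih l' p = ih l p"
   by (simp only: ih_def flip: of_real_add of_real_mult)
  hence "cor (1 / sqrt (2 * pi)) * (cor (l' - l) * (ih l p * ih l' p) + ih l' p) = cor (1 / sqrt (2 * pi)) * ih l p" by simp
  thus ?case unfolding elim by (simp only: distrib_left mult_ac)
 qed
 thus ?thesis unfolding L2_eq_fourier[symmetric] by (metis add_diff_cancel_right')
qed

lemma cinner_G:
 assumes "l > 0" "l' > 0" "l \<noteq> l'"
 shows "cinner (GG l) (GG l') = cor ((Theta s l - Theta s l') / (l' - l))"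
proof -
 have "cinner (GG l) (GG l') = cor (1 / sqrt (2 * pi)) * (cor (1 / sqrt (2 * pi)) * cinner (to_L2 (ih l)) (to_L2 (ih l')))"
  unfolding fourier_cinner[symmetric, of "GG l"] fourier_G by (simp add: cinner_scaleC_left cinner_scaleC_right)
 also have "cinner (to_L2 (ih l)) (to_L2 (ih l')) = (LBINT p. cor (1 / ((m p + l) * (m p + l'))))"
  unfolding cinner_to_L2[OF ih_sq[OF assms(1)] ih_sq[OF assms(2)]] by (simp add: ih_def)
 also have "... = cor (2 * pi * (Theta s l - Theta s l') / (l' - l))"
  unfolding integral_complex_of_real Theta_integral(2)[OF assms] ..
 also have "cor (1 / sqrt (2 * pi)) * (cor (1 / sqrt (2 * pi)) * cor (2 * pi * (Theta s l - Theta s l') / (l' - l)))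
   = cor (1 / sqrt (2 * pi) * (1 / sqrt (2 * pi) * (2 * pi * (Theta s l - Theta s l') / (l' - l))))" by (simp only: of_real_mult)
 also have "1 / sqrt (2 * pi) * (1 / sqrt (2 * pi) * (2 * pi * (Theta s l - Theta s l') / (l' - l))) = (Theta s l - Theta s l') / (l' - l)" 
  by (simp flip: times_divide_eq_right mult.assoc)
 finally show ?thesis .
qed

text \<open>Changing the parameter from 1 to l alters the value of the regular part at 0. By the
  identity \<open>G_R0\<close> and by \<open>cinner_G\<close> the change is (\<Theta>(s, 1) -
  \<Theta>(s, l)) c, which the shift of d by c \<Theta> compensates.\<close>

lemma dec_iff:
 assumes l: "l > 0"
 shows "dec x y d c \<longleftrightarrow> x = R0 l (y + cor l *\<^sub>C x) + c *\<^sub>C GG l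
   \<and> d = cinner (GG l) (y + cor l *\<^sub>C x) + cor (Theta s l) * c"
proof -
 have 1: "x = R0 1 (y + x) + c *\<^sub>C GG 1 \<longleftrightarrow> x = R0 l (y + cor l *\<^sub>C x) + c *\<^sub>C GG l"
  using resolvent_form[of 1 x y c] resolvent_form[OF l, of x y c] by simp
 have "cinner (GG 1) (y + x) + cor (Theta s 1) * c = cinner (GG l) (y + cor l *\<^sub>C x) + cor (Theta s l) * c"
  if x: "x = R0 l (y + cor l *\<^sub>C x) + c *\<^sub>C GG l"
 proof (cases "l = 1")
  case False
  let ?z = "y + cor l *\<^sub>C x"
  have "cor (1 - l) * cinner (GG 1) x = cor (1 - l) * cinner (GG 1) (R0 l ?z + c *\<^sub>C GG l)" using x by (rule arg_cong)
  also have "... = cinner (cor (1 - l) *\<^sub>C R0 l (GG 1)) ?z + cor (1 - l) * (c * cinner (GG 1) (GG l))"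
   by (simp only: cinner_add_right[of _ "R0 _ _"] distrib_left cinner_scaleC_left R0_sym[OF l] cinner_scaleC_right complex_cnj_complex_of_real)
  also have "cinner (cor (1 - l) *\<^sub>C R0 l (GG 1)) ?z = cinner (GG l) ?z - cinner (GG 1) ?z"
   unfolding G_R0[OF l zero_less_one] by (rule cinner_diff)
  also have "cor (1 - l) * (c * cinner (GG 1) (GG l)) = cor (Theta s l - Theta s 1) * c"
   unfolding cinner_G[OF zero_less_one l False[symmetric]] using False by (simp add: field_simps)
  finally have "cor (1 - l) * cinner (GG 1) x + cinner (GG 1) ?z + cor (Theta s 1) * c = cinner (GG l) ?z + cor (Theta s l) * c"
   by (simp add: algebra_simps)
  moreover have "cinner (GG 1) ?z = cinner (GG 1) (y + x) - cor (1 - l) * cinner (GG 1) x"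
   by (simp add: cinner_add_right cinner_scaleC_right algebra_simps)
  ultimately show ?thesis by simp
 qed simp
 thus ?thesis unfolding dec_def 1 by auto
qed

text \<open>Two decompositions of x differ by a constant on the Fourier side, and a nonzero constant
  is not square integrable.\<close>

lemma dec_unique:
 assumes "dec x y d c" "dec x y' d' c'" shows "y = y'" "c = c'" "d = d'"
proof -
 have h: "AE p in lborel. cor (m p) * rep_L2 (fourier x) p = rep_L2 (fourier y) p + cor (1 / sqrt (2 * pi)) * c"
  "AE p in lborel. cor (m p) * rep_L2 (fourier x) p = rep_L2 (fourier y') p + cor (1 / sqrt (2 * pi)) * c'"
  using assms resolvent_form[of 1 x y c] resolvent_form[of 1 x y' c'] by (simp_all add: dec_def)
 have "AE p in lborel. rep_L2 (fourier (y - y')) p = cor (1 / sqrt (2 * pi)) * c' - cor (1 / sqrt (2 * pi)) * c"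
  using h rep_diff[of "fourier y" "fourier y'"] unfolding clinear_mapD[OF fourier_linear]
  by eventually_elim (simp add: algebra_simps; metis add.commute add_diff_cancel_left' diff_add_eq)
 note z = const_square_integrable[OF this]
 show c: "c = c'" using z(1) by simp
 show y: "y = y'" using z(2) inj_fourier by (simp add: clinear_mapD[OF fourier_linear] inj_eq)
 show "d = d'" using assms unfolding c y dec_def by simp
qed

lemma dec_add: "dec x y d c \<Longrightarrow> dec x' y' d' c' \<Longrightarrow> dec (x + x') (y + y') (d + d') (c + c')"
proof -
 assume h: "dec x y d c" "dec x' y' d' c'"
 have "x + x' = (R0 1 (y + x) + c *\<^sub>C GG 1) + (R0 1 (y' + x') + c' *\<^sub>C GG 1)" using h unfolding dec_def by (metis)
 also have "... = R0 1 ((y + x) + (y' + x')) + (c + c') *\<^sub>C GG 1"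
  by (simp only: clinear_mapD[OF R0_linear[OF zero_less_one]] L2C.scale_left_distrib ac_simps)
 also have "(y + x) + (y' + x') = y + y' + (x + x')" by simp
 finally have "x + x' = R0 1 (y + y' + (x + x')) + (c + c') *\<^sub>C GG 1" .
 moreover have "d + d' = cinner (GG 1) (y + y' + (x + x')) + cor (Theta s 1) * (c + c')"
  using conjunct2[OF h(1)[unfolded dec_def]] conjunct2[OF h(2)[unfolded dec_def]] by (simp add: cinner_add_right algebra_simps)
 ultimately show ?thesis unfolding dec_def ..
qed

lemma dec_scale: "dec x y d c \<Longrightarrow> dec (k *\<^sub>C x) (k *\<^sub>C y) (k * d) (k * c)"
proof -
 assume h: "dec x y d c"
 have "k *\<^sub>C x = k *\<^sub>C (R0 1 (y + x) + c *\<^sub>C GG 1)" using h unfolding dec_def by metis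
 also have "... = R0 1 (k *\<^sub>C y + k *\<^sub>C x) + (k * c) *\<^sub>C GG 1"
  by (simp add: clinear_mapD[OF R0_linear[OF zero_less_one]] L2C.scale_right_distrib)
 finally show ?thesis using conjunct2[OF h[unfolded dec_def]]
  unfolding dec_def by (simp add: cinner_add_right cinner_scaleC_right algebra_simps)
qed

lemma dec_resolvent:
 assumes l: "l > 0"
 shows "dec (R0 l z + c *\<^sub>C GG l) (z - cor l *\<^sub>C (R0 l z + c *\<^sub>C GG l)) (cinner (GG l) z + cor (Theta s l) * c) c"
 unfolding dec_iff[OF l] by simp

text \<open>After the shift from y to y + x the symmetric operator \<open>R0 1\<close> drops out.
  The terms with \<open>Theta s 1\<close> cancel because it is real.\<close>

lemma green:
 assumes "dec x y d c" "dec x' y' d' c'"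
 shows "cinner x y' - cinner y x' = cnj c * d' - c' * cnj d"
proof -
 have h: "x = R0 1 (y + x) + c *\<^sub>C GG 1" "d = cinner (GG 1) (y + x) + cor (Theta s 1) * c"
  "x' = R0 1 (y' + x') + c' *\<^sub>C GG 1" "d' = cinner (GG 1) (y' + x') + cor (Theta s 1) * c'"
  using assms unfolding dec_def by blast+
 have "cinner x y' - cinner y x' = cinner x (y' + x') - cinner (y + x) x'"
  by (simp add: cinner_add_left cinner_add_right)
 also have "cinner x (y' + x') = cinner (R0 1 (y + x) + c *\<^sub>C GG 1) (y' + x')" using h(1) by simp
 also have "cinner (y + x) x' = cinner (y + x) (R0 1 (y' + x') + c' *\<^sub>C GG 1)" using h(3) by simp
 also have "cinner (R0 1 (y + x) + c *\<^sub>C GG 1) (y' + x') - cinner (y + x) (R0 1 (y' + x') + c' *\<^sub>C GG 1)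
   = cnj c * cinner (GG 1) (y' + x') - c' * cnj (cinner (GG 1) (y + x))"
  by (simp add: cinner_add_left[of "R0 _ _"] cinner_add_right[of _ "R0 _ _"] cinner_scaleC_left cinner_scaleC_right R0_sym cinner_commute[symmetric])
 finally show ?thesis unfolding h(2) h(4) by (simp add: algebra_simps)
qed

end

context fractional_order
begin

lemma A0_resolvent: "l > 0 \<Longrightarrow> (F, y) \<in> A0 \<longleftrightarrow> F = R0 l (y + cor l *\<^sub>C F)"
 using resolvent_form[of l F y 0] by (simp add: A0_iff eq_commute)

lemma A0_R0: "l > 0 \<Longrightarrow> (R0 l z, z - cor l *\<^sub>C R0 l z) \<in> A0"
 by (simp add: A0_resolvent)

lemma sobolev_eq: "sobolev s = Domain A0"
proof (rule set_eqI)
 fix F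
 show "F \<in> sobolev s \<longleftrightarrow> F \<in> Domain A0"
  unfolding sobolev_iff[OF s_bounds(4)] m_def[symmetric]
 proof
  assume sq: "square_integrable (\<lambda>p. cor (m p) * rep_L2 (fourier F) p)"
  have "(F, ifourier (to_L2 (\<lambda>p. cor (m p) * rep_L2 (fourier F) p))) \<in> A0"
   unfolding A0_iff fourier_ifourier by (rule rep_to_L2[OF sq])
  thus "F \<in> Domain A0" by blast
 next
  assume "F \<in> Domain A0"
  then obtain y where "(F, y) \<in> A0" by blast
  hence "AE p in lborel. cmod (cor (m p) * rep_L2 (fourier F) p) \<le> 1 * cmod (rep_L2 (fourier y) p)"
   unfolding A0_iff by (auto elim: eventually_mono)
  thus "square_integrable (\<lambda>p. cor (m p) * rep_L2 (fourier F) p)"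
   by (rule square_integrable_bound[OF square_integrable_rep, rotated]) measurable
 qed
qed

lemma point_value_R0:
 assumes l: "l > 0"
 shows "point_value (R0 l z) 0 = cinner (GG l) z"
  "cinner (GG l) z = cor (1 / sqrt (2 * pi)) * (LBINT p. rep_L2 (fourier (R0 l z)) p)"
proof -
 have i: "integrable lborel (\<lambda>p. ih l p * rep_L2 (fourier z) p)"
  by (rule square_integrable_mult_integrable[OF ih_sq[OF l]]) simp
 have ae: "AE p in lborel. ih l p * rep_L2 (fourier z) p = rep_L2 (fourier (R0 l z)) p"
  using rep_fourier_R0[OF l, of z] by eventually_elim simp
 have "integrable lborel (rep_L2 (fourier (R0 l z)))"
  by (rule integrable_cong_AE_imp[OF i _ ae]) measurable
 hence 1: "point_value (R0 l z) 0 = cor (1 / sqrt (2 * pi)) * (LBINT p. rep_L2 (fourier (R0 l z)) p)"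
  by (simp add: ft_def point_value_eq)
 also have "(LBINT p. rep_L2 (fourier (R0 l z)) p) = (LBINT p. cnj (ih l p) * rep_L2 (fourier z) p)"
  by (rule integral_cong_AE) (use ae in \<open>auto simp: ih_def elim!: eventually_mono\<close>)
 also have "... = cinner (to_L2 (ih l)) (fourier z)"
  using cinner_to_L2[OF ih_sq[OF l] square_integrable_rep[of "fourier z"]] by simp
 also have "cor (1 / sqrt (2 * pi)) * \<dots> = cinner (GG l) z"
  unfolding fourier_cinner[symmetric, of "GG l"] fourier_G by (simp add: cinner_scaleC_left)
 finally show "point_value (R0 l z) 0 = cinner (GG l) z" .
 thus "cinner (GG l) z = cor (1 / sqrt (2 * pi)) * (LBINT p. rep_L2 (fourier (R0 l z)) p)" using 1 by simp
qed

lemma dec_regular: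
 assumes l: "l > 0" and F: "(F, w) \<in> A0"
 shows "dec (F + c *\<^sub>C GG l) (w - (cor l * c) *\<^sub>C GG l) (point_value F 0 + cor (Theta s l) * c) c"
proof -
 have e: "F = R0 l (w + cor l *\<^sub>C F)" using F by (simp add: A0_resolvent[OF l, symmetric])
 have "point_value F 0 = cinner (GG l) (w + cor l *\<^sub>C F)" using point_value_R0(1)[OF l] e by metis
 moreover have "R0 l (w + cor l *\<^sub>C F) + c *\<^sub>C GG l = F + c *\<^sub>C GG l" using e by simp
 moreover have "w + cor l *\<^sub>C F - cor l *\<^sub>C (F + c *\<^sub>C GG l) = w - (cor l * c) *\<^sub>C GG l"
  by (simp add: L2C.scale_right_distrib)
 ultimately show ?thesis using dec_resolvent[OF l, of "w + cor l *\<^sub>C F" c] by metis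
qed

lemma dec_decompose:
 assumes l: "l > 0" and d: "dec x y d c"
 obtains F w where "(F, w) \<in> A0" "x = F + c *\<^sub>C GG l" "y = w - (cor l * c) *\<^sub>C GG l"
  "d = point_value F 0 + cor (Theta s l) * c" "y + cor l *\<^sub>C x = w + cor l *\<^sub>C F"
proof -
 let ?z = "y + cor l *\<^sub>C x"
 let ?F = "R0 l ?z"
 have x: "x = ?F + c *\<^sub>C GG l" and d: "d = cinner (GG l) ?z + cor (Theta s l) * c"
  using d dec_iff[OF l] by blast+
 have "cor l *\<^sub>C x = cor l *\<^sub>C ?F + (cor l * c) *\<^sub>C GG l"
  using arg_cong[OF x, of "\<lambda>x. cor l *\<^sub>C x"] by (simp add: L2C.scale_right_distrib)
 hence "y = (?z - cor l *\<^sub>C ?F) - (cor l * c) *\<^sub>C GG l" by (metis add_diff_cancel_right' diff_diff_add)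
 thus ?thesis
  by (rule that[OF A0_R0[OF l] x]) (simp_all add: d point_value_R0(1)[OF l])
qed

lemma ft_test_L2:
 assumes "test_function \<phi>"
 shows "square_integrable (\<lambda>p. cor (m p) * ft \<phi> p)" "AE p in lborel. rep_L2 (fourier (to_L2 \<phi>)) p = ft \<phi> p"
proof -
 note t = test_function_facts[OF assms]
 have q: "ft \<phi> \<in> borel_measurable borel" by (rule ft_measurable[OF square_integrable_measurable[OF t(2)]])
 have "m p \<le> 1 + p\<^sup>2" for p
 proof -
  have "m p \<le> (1 + p\<^sup>2) powr (s / 2)" using powr_weight_bounds(1)[OF s_bounds(4), of p] by (simp add: m_def)
  also have "... \<le> (1 + p\<^sup>2) powr 1" using s_bounds by (intro powr_mono) auto
  finally show ?thesis by (simp add: add_pos_nonneg)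
 qed
 hence "cmod (cor (m p) * ft \<phi> p) \<le> 1 * cmod (cor (1 + p\<^sup>2) * ft \<phi> p)" for p
  unfolding norm_mult norm_of_real mult_1 by (intro mult_right_mono) (auto simp: add_nonneg_nonneg)
 thus "square_integrable (\<lambda>p. cor (m p) * ft \<phi> p)"
  by (intro square_integrable_bound[OF t(3)] AE_I2) (use q in measurable)
 have "cmod (ft \<phi> p) \<le> 1 * cmod (cor (1 + p\<^sup>2) * ft \<phi> p)" for p
  unfolding norm_mult norm_of_real mult_1 using mult_right_mono[of 1 "\<bar>1 + p\<^sup>2\<bar>" "cmod (ft \<phi> p)"] by simp
 hence "square_integrable (ft \<phi>)" by (intro square_integrable_bound[OF t(3) q] AE_I2)
 thus "AE p in lborel. rep_L2 (fourier (to_L2 \<phi>)) p = ft \<phi> p"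
  unfolding fourier_to_L2[OF t(1,2)] by (rule rep_to_L2)
qed

definition "test_graph = {(f, g) \<in> A0. f \<in> test_functions}"

text \<open>Test functions vanish at 0 and contain no multiple of G.\<close>

lemma test_graph_dec:
 assumes "(f, g) \<in> test_graph" shows "dec f g 0 0"
proof -
 obtain \<phi> where \<phi>: "f = to_L2 \<phi>" "test_function \<phi>" and A: "(f, g) \<in> A0"
  using assms by (auto simp: test_graph_def test_functions_eq)
 note t = test_function_facts[OF \<phi>(2)]
 have "point_value f = \<phi>"
  unfolding point_value_def
 proof (rule the_equality)
  show c: "continuous_on UNIV \<phi> \<and> (AE x in lborel. \<phi> x = rep_L2 f x)"
   using t(4) rep_to_L2[OF t(2)] by (auto simp: \<phi>(1) elim: eventually_mono)
  fix h assume h: "continuous_on UNIV h \<and> (AE x in lborel. h x = rep_L2 f x)"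
  show "h = \<phi>"
  proof (rule continuous_AE_eq)
   have a: "AE x in lborel. h x = rep_L2 f x" "AE x in lborel. \<phi> x = rep_L2 f x" using h c by auto
   show "AE x in lborel. h x = \<phi> x" using a by eventually_elim simp
  qed (use h t(4) in auto)
 qed
 thus ?thesis using dec_regular[OF zero_less_one A, of 0] t(5) by simp
qed

lemma test_function_in_graph:
 assumes "test_function \<phi>" obtains g where "(to_L2 \<phi>, g) \<in> test_graph"
  "AE p in lborel. rep_L2 (fourier g) p = cor (m p) * ft \<phi> p" "AE p in lborel. rep_L2 (fourier (to_L2 \<phi>)) p = ft \<phi> p"
proof -
 let ?g = "ifourier (to_L2 (\<lambda>p. cor (m p) * ft \<phi> p))"
 have g: "AE p in lborel. rep_L2 (fourier ?g) p = cor (m p) * ft \<phi> p"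
  unfolding fourier_ifourier by (rule rep_to_L2[OF ft_test_L2(1)[OF assms]])
 have "(to_L2 \<phi>, ?g) \<in> A0"
  unfolding A0_iff using g ft_test_L2(2)[OF assms] by eventually_elim simp
 thus ?thesis using assms by (intro that[OF _ g ft_test_L2(2)[OF assms]]) (auto simp: test_graph_def test_functions_eq)
qed

lemma k_ring_eq: "k_ring s = closure test_graph"
 unfolding k_ring_def test_graph_def ..

text \<open>Adjointness says that |p|^s times the transform of x minus that of y annihilates all
  test functions away from the origin. With the weight of order s < 3/2 this difference is square
  integrable, so \<open>annihilator_of_test_functions\<close> makes it a constant, namely c / sqrt
  (2 pi).\<close>

lemma adjoint_k_ring: "(x, y) \<in> adjoint_op (k_ring s) \<longleftrightarrow> (\<exists>d c. dec x y d c)"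
proof
 assume "\<exists>d c. dec x y d c"
 then obtain d c where d: "dec x y d c" by blast
 show "(x, y) \<in> adjoint_op (k_ring s)"
  unfolding k_ring_eq adjoint_closure using green[OF d test_graph_dec] by (auto simp: adjoint_op_def)
next
 assume "(x, y) \<in> adjoint_op (k_ring s)"
 hence adj: "\<And>u v. (u, v) \<in> test_graph \<Longrightarrow> cinner x v = cinner y u"
  unfolding k_ring_eq adjoint_closure by (auto simp: adjoint_op_def)
 let ?u = "\<lambda>p. cor (m p) * rep_L2 (fourier x) p - rep_L2 (fourier y) p"
 have "\<exists>c. AE p in lborel. ?u p = c"
 proof (rule annihilator_of_test_functions[of ?u s])
  have "square_integrable (\<lambda>p. rep_L2 (fourier x) p + rep_L2 (fourier y) p)" "square_integrable (\<lambda>p. - rep_L2 (fourier y) p)"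
   using square_integrable_scale[of "rep_L2 (fourier y)" "-1"] by (auto intro: square_integrable_add)
  let ?w = "\<lambda>p::real. (1 + p\<^sup>2) powr (- s / 2)"
  have w: "?w p \<le> 1" "\<bar>p\<bar> powr s * ?w p \<le> 1" for p
  proof -
   show "?w p \<le> 1" using ge_one_powr_ge_zero[of "1 + p\<^sup>2" "s / 2"] s_bounds by (simp add: powr_minus_divide divide_le_eq_1)
   have "\<bar>p\<bar> powr s * ?w p \<le> (1 + p\<^sup>2) powr (s / 2) * ?w p"
    using powr_weight_bounds(1)[OF s_bounds(4), of p] by (rule mult_right_mono) simp
   also have "... = 1" using less_imp_neq[OF add_pos_nonneg[OF zero_less_one zero_le_power2[of p]], symmetric] by (simp flip: powr_add)
   finally show "\<bar>p\<bar> powr s * ?w p \<le> 1" .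
  qed
  have "square_integrable (\<lambda>p. cor (\<bar>p\<bar> powr s * ?w p) * rep_L2 (fourier x) p - cor (?w p) * rep_L2 (fourier y) p)"
   by (intro square_integrable_diff square_integrable_mult square_integrable_rep bounded_borelI[of _ 1])
     (use w in \<open>auto simp: abs_mult norm_mult\<close>)
  thus "square_integrable (\<lambda>p. cor (?w p) * ?u p)" by (simp add: m_def algebra_simps)
 next
  fix \<phi> assume \<phi>: "test_function \<phi>"
  obtain g where g: "(to_L2 \<phi>, g) \<in> test_graph" "AE p in lborel. rep_L2 (fourier g) p = cor (m p) * ft \<phi> p"
   "AE p in lborel. rep_L2 (fourier (to_L2 \<phi>)) p = ft \<phi> p" by (rule test_function_in_graph[OF \<phi>])
  have q [measurable]: "ft \<phi> \<in> borel_measurable borel" by (rule ft_measurable[OF square_integrable_measurable[OF test_function_facts(2)[OF \<phi>]]])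
  have "(LBINT p. cnj (?u p) * ft \<phi> p) = (LBINT p. cnj (rep_L2 (fourier x) p) * rep_L2 (fourier g) p - cnj (rep_L2 (fourier y) p) * rep_L2 (fourier (to_L2 \<phi>)) p)"
  proof (rule integral_cong_AE)
   show "AE p in lborel. cnj (?u p) * ft \<phi> p = cnj (rep_L2 (fourier x) p) * rep_L2 (fourier g) p - cnj (rep_L2 (fourier y) p) * rep_L2 (fourier (to_L2 \<phi>)) p"
    using g(2,3) by eventually_elim (simp add: algebra_simps)
  qed measurable
  also have "... = cinner (fourier x) (fourier g) - cinner (fourier y) (fourier (to_L2 \<phi>))"
   unfolding cinner_rep by (intro Bochner_Integration.integral_diff integrable_cnj_mult) simp_all
  finally show "(LBINT p. cnj (?u p) * ft \<phi> p) = 0" using adj[OF g(1)] by (simp add: fourier_cinner)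
 qed (use s_bounds in \<open>auto intro!: borel_measurable_diff borel_measurable_times\<close>)
 then obtain C where "AE p in lborel. ?u p = C" by blast
 hence "AE p in lborel. cor (m p) * rep_L2 (fourier x) p = rep_L2 (fourier y) p + cor (1 / sqrt (2 * pi)) * (cor (sqrt (2 * pi)) * C)"
  by (rule eventually_mono) (simp add: algebra_simps)
 hence "x = R0 1 (y + cor 1 *\<^sub>C x) + (cor (sqrt (2 * pi)) * C) *\<^sub>C GG 1"
  by (subst resolvent_form) auto
 thus "\<exists>d c. dec x y d c" unfolding dec_def by auto
qed

text \<open>The lines through the origin in the plane of boundary values; \<infinity> stands for the
  line c = 0.\<close>

definition bc :: "ereal \<Rightarrow> complex \<Rightarrow> complex \<Rightarrow> bool" where
 "bc \<alpha> d c = (case \<alpha> of ereal a \<Rightarrow> d = cor a * c | _ \<Rightarrow> c = 0)"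

definition "kk \<alpha> = {(x, y). \<exists>d c. dec x y d c \<and> bc \<alpha> d c}"

lemma bc_lin: "bc \<alpha> d c \<Longrightarrow> bc \<alpha> d' c' \<Longrightarrow> bc \<alpha> (d + d') (c + c')" "bc \<alpha> d c \<Longrightarrow> bc \<alpha> (k * d) (k * c)" "bc \<alpha> 0 0"
 by (auto simp: bc_def algebra_simps split: ereal.splits)

lemma bc_sym: "bc \<alpha> d c \<Longrightarrow> bc \<alpha> d' c' \<Longrightarrow> cnj c * d' = c' * cnj d"
 by (auto simp: bc_def split: ereal.splits)

lemma dec_zero: "dec 0 0 0 0"
 by (simp add: dec_def clinear_mapD(3)[OF R0_linear])

lemma kk_linear: "linear_operator (kk \<alpha>)"
proof -
 have "(0, 0) \<in> kk \<alpha>" unfolding kk_def using dec_zero bc_lin(3) by blast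
 moreover have "single_valued (kk \<alpha>)" unfolding kk_def single_valued_def using dec_unique(1) by blast
 moreover have "(x + x', y + y') \<in> kk \<alpha>" if "(x, y) \<in> kk \<alpha>" "(x', y') \<in> kk \<alpha>" for x y x' y'
  using that unfolding kk_def by (blast intro: dec_add bc_lin(1))
 moreover have "(k *\<^sub>C x, k *\<^sub>C y) \<in> kk \<alpha>" if "(x, y) \<in> kk \<alpha>" for x y k
  using that unfolding kk_def by (blast intro: dec_scale bc_lin(2))
 ultimately show ?thesis unfolding linear_operator_def by blast
qed

lemma test_graph_kk: "test_graph \<subseteq> kk \<alpha>"
 unfolding kk_def using test_graph_dec bc_lin(3) by blast

text \<open>A vector orthogonal to all test functions has a constant Fourier transform, by the
  annihilator lemma with order 0, and so is 0.\<close>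

lemma dense_domain: "closure (Domain (kk \<alpha>)) = UNIV"
proof (rule dense_subspace)
 show "L2C.subspace (Domain (kk \<alpha>))"
  using kk_linear[of \<alpha>] unfolding L2C.subspace_def linear_operator_def by blast
 fix y assume y: "\<And>x. x \<in> Domain (kk \<alpha>) \<Longrightarrow> cinner x y = 0"
 have "\<exists>c. AE p in lborel. rep_L2 (fourier y) p = c"
 proof (rule annihilator_of_test_functions[of _ 0])
  fix \<phi> assume \<phi>: "test_function \<phi>"
  obtain g where g: "(to_L2 \<phi>, g) \<in> test_graph" using test_function_in_graph[OF \<phi>] by metis
  hence "cinner (to_L2 \<phi>) y = 0" using test_graph_kk by (intro y) blast
  hence "cinner y (to_L2 \<phi>) = 0" using cinner_commute[of y] by simp
  hence "cinner (fourier y) (fourier (to_L2 \<phi>)) = 0" by (simp add: fourier_cinner)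
  moreover have [measurable]: "ft \<phi> \<in> borel_measurable borel" by (rule ft_measurable[OF square_integrable_measurable[OF test_function_facts(2)[OF \<phi>]]])
  have "(LBINT p. cnj (rep_L2 (fourier y) p) * ft \<phi> p) = cinner (fourier y) (fourier (to_L2 \<phi>))"
   unfolding cinner_rep by (rule integral_cong_AE) (use ft_test_L2(2)[OF \<phi>] in \<open>auto elim: eventually_mono\<close>)
  ultimately show "(LBINT p. cnj (rep_L2 (fourier y) p) * ft \<phi> p) = 0" by simp
 qed (auto simp: add_nonneg_eq_0_iff)
 then obtain c where "AE p in lborel. rep_L2 (fourier y) p = c" ..
 hence "fourier y = 0" by (rule const_square_integrable(2))
 thus "y = 0" using inj_fourier clinear_mapD(3)[OF fourier_linear] by (metis injD)
qed

lemma G_nz: "l > 0 \<Longrightarrow> GG l \<noteq> 0"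
proof
 assume l: "l > 0" and "GG l = 0"
 hence "AE p in lborel. rep_L2 0 p = cor (1 / sqrt (2 * pi)) * ih l p"
  using rep_fourier_G[OF l] by (simp add: clinear_mapD(3)[OF fourier_linear])
 hence "AE p in (lborel :: real measure). False"
  using rep_zero
 proof eventually_elim
  case (elim p) thus ?case using m_pos[OF l, of p] by (simp add: ih_def flip: of_real_add)
 qed
 thus False by (auto simp: eventually_ae_filter null_sets_def top.extremum_unique)
qed

text \<open>Adding \<open>R0 1\<close> of a multiple of \<open>GG 1\<close> adjusts d freely without
  touching c. It is needed to read a condition on boundary values off adjointness.\<close>

lemma dec_surjective: obtains x y where "dec x y d c"
proof -
 let ?t = "(d - cor (Theta s 1) * c) / cinner (GG 1) (GG 1)"
 have "cinner (GG 1) (?t *\<^sub>C GG 1) + cor (Theta s 1) * c = d"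
  using G_nz[of 1] cinner_self(3)[of "GG 1"] by (simp add: cinner_scaleC_right)
 thus ?thesis using dec_resolvent[OF zero_less_one, of "?t *\<^sub>C GG 1" c] that by metis
qed

text \<open>For real \<alpha> and for \<infinity> the line of boundary values is its own annihilator
  with respect to the boundary form of \<open>green\<close>.\<close>

lemma kk_self_adjoint:
 assumes "\<alpha> > -\<infinity>" shows "self_adjoint (kk \<alpha>)"
proof -
 have "adjoint_op (kk \<alpha>) = kk \<alpha>"
 proof (intro subset_antisym subsetI)
  fix q assume "q \<in> kk \<alpha>"
  thus "q \<in> adjoint_op (kk \<alpha>)"
   unfolding kk_def adjoint_op_def using green bc_sym by fastforce
 next
  fix q assume q: "q \<in> adjoint_op (kk \<alpha>)"
  obtain x y where [simp]: "q = (x, y)" by force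
  have "(x, y) \<in> adjoint_op (k_ring s)"
   using q adjoint_antimono[OF test_graph_kk] unfolding k_ring_eq adjoint_closure by auto
  then obtain d c where dc: "dec x y d c" using adjoint_k_ring by blast
  have z: "cnj c * d' = c' * cnj d" if "bc \<alpha> d' c'" for d' c'
  proof -
   obtain x' y' where xy: "dec x' y' d' c'" by (rule dec_surjective)
   hence "(x', y') \<in> kk \<alpha>" using that by (auto simp: kk_def)
   hence "cinner x y' = cinner y x'" using q by (auto simp: adjoint_op_def)
   thus ?thesis using green[OF dc xy] by simp
  qed
  have "bc \<alpha> d c"
  proof (cases \<alpha>)
   case (real a)
   have "cnj c * cor a = cnj d" using z[of "cor a" 1] by (simp add: bc_def real)
   hence "cnj (cnj c * cor a) = cnj (cnj d)" by simp
   thus ?thesis by (simp add: bc_def real mult.commute)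
  next
   case PInf
   thus ?thesis using z[of 1 0] by (simp add: bc_def)
  qed (use assms in simp)
  thus "q \<in> kk \<alpha>" using dc by (auto simp: kk_def)
 qed
 thus ?thesis using kk_linear dense_domain by (simp add: self_adjoint_def)
qed

lemma k_ring_kk: assumes "\<alpha> > -\<infinity>" shows "k_ring s \<subseteq> kk \<alpha>"
proof -
 have "(x, y) \<in> adjoint_op (kk \<alpha>)" if "(x, y) \<in> k_ring s" for x y
 proof -
  have "cinner u y = cinner v x" if uv: "(u, v) \<in> kk \<alpha>" for u v
  proof -
   have "(u, v) \<in> adjoint_op (k_ring s)" unfolding adjoint_k_ring using uv by (auto simp: kk_def)
   thus ?thesis using \<open>(x, y) \<in> k_ring s\<close> unfolding adjoint_op_def by blast
  qed
  hence "cinner x v = cinner y u" if "(u, v) \<in> kk \<alpha>" for u v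
   using that cinner_commute[of x v] cinner_commute[of y u] by simp
  thus ?thesis unfolding adjoint_op_def by blast
 qed
 thus ?thesis using kk_self_adjoint[OF assms] by (auto simp: self_adjoint_def)
qed

text \<open>The boundary values of an extension are isotropic. If some pair has c0 different from 0,
  then d0 / c0 is real and every other pair lies on the same line. Inclusion between self-adjoint
  operators is equality, as passing to adjoints reverses it.\<close>

theorem self_adjoint_extensions: "{A. self_adjoint_extension (k_ring s) A} = kk ` {-\<infinity><..}"
proof (intro subset_antisym subsetI)
 fix A assume "A \<in> kk ` {-\<infinity><..}"
 then obtain \<alpha> where "A = kk \<alpha>" "\<alpha> > -\<infinity>" by blast
 thus "A \<in> {A. self_adjoint_extension (k_ring s) A}"
  using kk_self_adjoint k_ring_kk unfolding self_adjoint_extension_def by blast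
next
 fix A assume "A \<in> {A. self_adjoint_extension (k_ring s) A}"
 hence A: "adjoint_op A = A" "k_ring s \<subseteq> A" by (auto simp: self_adjoint_extension_def self_adjoint_def)
 hence dec: "\<exists>d c. dec x y d c" if "(x, y) \<in> A" for x y
  using that adjoint_antimono[of "k_ring s" A] adjoint_k_ring[of x y] by auto
 have sym: "cnj c * d' = c' * cnj d" if "dec x y d c" "dec x' y' d' c'" "(x, y) \<in> A" "(x', y') \<in> A" for x y d c x' y' d' c'
 proof -
  have "(x, y) \<in> adjoint_op A" using that A by simp
  hence "cinner x y' = cinner y x'" using that(4) by (auto simp: adjoint_op_def)
  thus ?thesis using green[OF that(1,2)] by simp
 qed
 have sub: "A \<subseteq> kk \<alpha> \<Longrightarrow> \<alpha> > -\<infinity> \<Longrightarrow> A \<in> kk ` {-\<infinity><..}" for \<alpha>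
  using adjoint_antimono[of A "kk \<alpha>"] A(1) kk_self_adjoint[of \<alpha>] by (auto simp: self_adjoint_def)
 show "A \<in> kk ` {-\<infinity><..}"
 proof (cases "\<forall>x y d c. (x, y) \<in> A \<longrightarrow> dec x y d c \<longrightarrow> c = 0")
  case True
  hence "A \<subseteq> kk \<infinity>" using dec by (fastforce simp: kk_def bc_def)
  thus ?thesis by (rule sub) simp
 next
  case False
  then obtain x0 y0 d0 c0 where 0: "(x0, y0) \<in> A" "dec x0 y0 d0 c0" "c0 \<noteq> 0" by blast
  define q where "q = d0 / c0"
  define a where "a = Re q"
  have q: "cnj q = q" using sym[OF 0(2) 0(2) 0(1) 0(1)] 0(3) by (simp add: q_def field_simps)
  hence "cor a = cnj q" by (simp add: a_def complex_eq_iff)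
  hence a: "cor a = cnj (d0 / c0)" by (simp only: q_def)
  have "A \<subseteq> kk (ereal a)"
  proof clarify
   fix x y assume xy: "(x, y) \<in> A"
   then obtain d c where dc: "dec x y d c" using dec by blast
   have "d = cor a * c" using sym[OF 0(2) dc 0(1) xy] 0(3) by (simp add: a field_simps)
   thus "(x, y) \<in> kk (ereal a)" using dc by (auto simp: kk_def bc_def)
  qed
  thus ?thesis by (rule sub) simp
 qed
qed

lemma kk_infinity: "kk \<infinity> = A0"
proof -
 have "(x, y) \<in> kk \<infinity> \<longleftrightarrow> (x, y) \<in> A0" for x y
  unfolding A0_resolvent[OF zero_less_one] by (auto simp: kk_def bc_def dec_def)
 thus ?thesis by auto
qed

text \<open>In terms of the regular part at l the line reads: point value = (a - \<Theta>) c. This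
  can be solved for c unless a = \<Theta>, when the point value is 0 and c is free.\<close>

lemma boundary_pairs_iff:
 assumes "\<alpha> > -\<infinity>"
 shows "(F, c) \<in> boundary_pairs s \<alpha> l \<longleftrightarrow> F \<in> sobolev s \<and> bc \<alpha> (point_value F 0 + cor (Theta s l) * c) c"
proof (cases \<alpha>)
 case (real a)
 have "c = p / cor (a - Theta s l) \<longleftrightarrow> p + cor (Theta s l) * c = cor a * c" if "a \<noteq> Theta s l" for p
 proof -
  have "cor a - cor (Theta s l) \<noteq> 0" using that by simp
  thus ?thesis by (auto simp: field_simps)
 qed
 thus ?thesis by (auto simp: boundary_pairs_def bc_def real)
qed (use assms in \<open>auto simp: boundary_pairs_def bc_def\<close>)

lemma kk_iff:
 assumes "l > 0" "\<alpha> > -\<infinity>"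
 shows "(x, y) \<in> kk \<alpha> \<longleftrightarrow> (\<exists>F w c. (F, w) \<in> A0 \<and> (F, c) \<in> boundary_pairs s \<alpha> l \<and> x = F + c *\<^sub>C GG l \<and> y = w - (cor l * c) *\<^sub>C GG l)"
 (is "_ \<longleftrightarrow> ?r")
proof
 assume "(x, y) \<in> kk \<alpha>"
 then obtain d c where "dec x y d c" "bc \<alpha> d c" by (auto simp: kk_def)
 thus ?r
  unfolding boundary_pairs_iff[OF assms(2)] sobolev_eq by (elim dec_decompose[OF assms(1)]) blast
next
 assume ?r
 thus "(x, y) \<in> kk \<alpha>"
  unfolding boundary_pairs_iff[OF assms(2)] kk_def using dec_regular[OF assms(1)] by blast
qed

lemma app_eq: "single_valued A \<Longrightarrow> (x, y) \<in> A \<Longrightarrow> app A x = y"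
 unfolding app_def single_valued_def by blast

lemma op_shift_iff: "(x, z) \<in> op_shift A l \<longleftrightarrow> (x, z - cor l *\<^sub>C x) \<in> A"
 unfolding op_add_def op_scale_def op_one_def by (auto intro!: exI[of _ "z - cor l *\<^sub>C x"])

lemma op_shift_app: "single_valued A \<Longrightarrow> (x, y) \<in> A \<Longrightarrow> app (op_shift A l) x = y + cor l *\<^sub>C x"
 by (rule app_eq) (auto simp: op_shift_iff single_valued_def, metis diff_add_cancel)

theorem kk_domain_action:
 assumes a: "\<alpha> > -\<infinity>" and l: "l > 0"
 shows "Domain (kk \<alpha>) = {F + c *\<^sub>C GG l | F c. (F, c) \<in> boundary_pairs s \<alpha> l}"
  "(F, c) \<in> boundary_pairs s \<alpha> l \<Longrightarrow> app (op_shift (kk \<alpha>) l) (F + c *\<^sub>C GG l) = app (op_shift A0 l) F"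
proof -
 have ex: "\<exists>w. (F, w) \<in> A0" if "(F, c) \<in> boundary_pairs s \<alpha> l" for F c
  using that unfolding boundary_pairs_iff[OF a] sobolev_eq by blast
 show "Domain (kk \<alpha>) = {F + c *\<^sub>C GG l | F c. (F, c) \<in> boundary_pairs s \<alpha> l}"
  unfolding Domain_unfold kk_iff[OF l a] using ex by blast
 assume F: "(F, c) \<in> boundary_pairs s \<alpha> l"
 then obtain w where w: "(F, w) \<in> A0" using ex by blast
 hence "(F + c *\<^sub>C GG l, w - (cor l * c) *\<^sub>C GG l) \<in> kk \<alpha>" unfolding kk_iff[OF l a] using F by blast
 hence "app (op_shift (kk \<alpha>) l) (F + c *\<^sub>C GG l) = w - (cor l * c) *\<^sub>C GG l + cor l *\<^sub>C (F + c *\<^sub>C GG l)"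
  using kk_linear[of \<alpha>] by (intro op_shift_app) (auto simp: linear_operator_def)
 also have "... = w + cor l *\<^sub>C F" by (simp add: L2C.scale_right_distrib)
 also have "... = app (op_shift A0 l) F"
  using kk_linear[of \<infinity>] w by (intro op_shift_app[symmetric]) (auto simp: linear_operator_def kk_infinity)
 finally show "app (op_shift (kk \<alpha>) l) (F + c *\<^sub>C GG l) = app (op_shift A0 l) F" .
qed

section \<open>Krein's formula for the resolvent\<close>

lemma op_add_iff: "(x, y) \<in> op_add A B \<longleftrightarrow> (\<exists>u v. (x, u) \<in> A \<and> (x, v) \<in> B \<and> y = u + v)"
 unfolding op_add_def by blast

lemma op_scale_ket_bra: "(x, y) \<in> op_scale c (ket_bra g) \<longleftrightarrow> y = c *\<^sub>C (cinner g x *\<^sub>C g)"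
 unfolding op_scale_def ket_bra_def by blast

lemma kk_resolvent:
 assumes l: "l > 0" and a: "a \<noteq> Theta s l"
 shows "(x, z) \<in> op_shift (kk (ereal a)) l \<longleftrightarrow> x = R0 l z + cor (inverse (a - Theta s l)) *\<^sub>C (cinner (GG l) z *\<^sub>C GG l)"
proof -
 have nz: "cor a - cor (Theta s l) \<noteq> 0" using a by simp
 have "(x, z) \<in> op_shift (kk (ereal a)) l \<longleftrightarrow> (\<exists>c. x = R0 l z + c *\<^sub>C GG l \<and> cinner (GG l) z + cor (Theta s l) * c = cor a * c)"
  unfolding op_shift_iff kk_def bc_def dec_iff[OF l] by auto
 also have "... \<longleftrightarrow> (\<exists>c. x = R0 l z + c *\<^sub>C GG l \<and> c = cor (inverse (a - Theta s l)) * cinner (GG l) z)"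
  using nz by (intro ex_cong) (auto simp: field_simps)
 finally show ?thesis by simp
qed

theorem resolvent_formula:
 assumes l: "l > 0" and a: "a \<noteq> Theta s l"
 shows "cor (- l) \<in> resolvent_set (kk (ereal a))"
  "converse (op_shift (kk (ereal a)) l) = op_add (converse (op_shift A0 l)) (op_scale (cor (inverse (a - Theta s l))) (ket_bra (GG l)))"
proof -
 have A0: "(x, z) \<in> op_shift A0 l \<longleftrightarrow> x = R0 l z" for x z
  unfolding op_shift_iff A0_resolvent[OF l] by simp
 show "converse (op_shift (kk (ereal a)) l) = op_add (converse (op_shift A0 l)) (op_scale (cor (inverse (a - Theta s l))) (ket_bra (GG l)))"
 proof (rule set_eqI)
  fix q :: "L2 \<times> L2"
  obtain z x where q: "q = (z, x)" by force
  show "q \<in> converse (op_shift (kk (ereal a)) l) \<longleftrightarrow> q \<in> op_add (converse (op_shift A0 l)) (op_scale (cor (inverse (a - Theta s l))) (ket_bra (GG l)))"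
   unfolding q converse_iff kk_resolvent[OF l a] op_add_iff[of z x "converse _"] A0 op_scale_ket_bra by blast
 qed
 let ?r = "\<bar>inverse (a - Theta s l)\<bar>"
 have eq: "(x, y + cor (- l) *\<^sub>C x) \<in> kk (ereal a) \<longleftrightarrow> x = R0 l y + cor (inverse (a - Theta s l)) *\<^sub>C (cinner (GG l) y *\<^sub>C GG l)" for x y
  unfolding kk_resolvent[OF l a, symmetric] op_shift_iff by simp
 have "norm (R0 l y + cor (inverse (a - Theta s l)) *\<^sub>C (cinner (GG l) y *\<^sub>C GG l)) \<le> (1 / l + ?r * (norm (GG l) * norm (GG l))) * norm y" for y
 proof -
  have "norm (cor (inverse (a - Theta s l)) *\<^sub>C (cinner (GG l) y *\<^sub>C GG l)) = ?r * (cmod (cinner (GG l) y) * norm (GG l))"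
   unfolding norm_scaleC norm_of_real ..
  also have "... \<le> ?r * ((norm (GG l) * norm y) * norm (GG l))"
   by (intro mult_left_mono mult_right_mono cinner_bound) auto
  finally show ?thesis using norm_triangle_mono[OF R0_norm[OF l, of y]] by (fastforce simp: algebra_simps)
 qed
 thus "cor (- l) \<in> resolvent_set (kk (ereal a))"
  unfolding resolvent_set_on_def mem_Collect_eq eq by blast
qed

end

section \<open>Quadratic forms\<close>

text \<open>The operator domain is parametrised by D, and in these coordinates the form plus
  \<open>l\<close> times the squared norm is the diagonal form \<open>q\<close>. Limits of
  coordinates give form limits whatever the sign of C; if C > 0 then conversely form convergence
  forces the coordinates to be Cauchy. Hence values can be computed at every l, while the form
  domain is determined at one good l.\<close>

lemma form_closure:
 fixes J :: "L2 \<Rightarrow> L2" and g :: L2 and C l B :: real and D :: "(L2 \<times> complex) set"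
 defines "j \<equiv> \<lambda>w. J (fst w) + snd w *\<^sub>C g" and "q \<equiv> \<lambda>w. (norm (fst w))\<^sup>2 + C * (cmod (snd w))\<^sup>2"
 assumes J: "clinear_map J" "\<And>y. norm (J y) \<le> B * norm y"
  and D: "\<And>w w'. w \<in> D \<Longrightarrow> w' \<in> D \<Longrightarrow> w - w' \<in> D"
  and dom: "Domain A = j ` D"
  and val: "\<And>w. w \<in> D \<Longrightarrow> cinner (j w) (app A (j w)) = cor (q w - l * (norm (j w))\<^sup>2)"
 shows "w \<in> closure D \<Longrightarrow> \<exists>X. form_approx A (j w) X \<and> (\<lambda>n. Re (cinner (X n) (app A (X n)))) \<longlonglongrightarrow> q w - l * (norm (j w))\<^sup>2"
  and "C > 0 \<Longrightarrow> form_approx A x X \<Longrightarrow> \<exists>w\<in>closure D. x = j w \<and> (\<lambda>n. Re (cinner (X n) (app A (X n)))) \<longlonglongrightarrow> q w - l * (norm (j w))\<^sup>2"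
proof -
 have jd: "j (w - w') = j w - j w'" for w w'
  by (simp add: j_def clinear_mapD[OF J(1)] L2C.scale_left_diff_distrib)
 have jt: "((\<lambda>n. j (W n)) \<longlongrightarrow> j w) F" if "(W \<longlongrightarrow> w) F" for W w and F :: "'i filter"
  unfolding j_def by (intro tendsto_add tendsto_scaleC tendsto_const clinear_map_bounded_continuous[OF J] tendsto_fst tendsto_snd that)
 define \<Phi> where "\<Phi> w = q w - l * (norm (j w))\<^sup>2" for w
 have qt: "((\<lambda>n. \<Phi> (W n)) \<longlongrightarrow> \<Phi> w) F" if "(W \<longlongrightarrow> w) F" for W w and F :: "'i filter"
  unfolding q_def \<Phi>_def by (intro tendsto_intros jt tendsto_fst tendsto_snd that)
 have v: "cinner (j w) (app A (j w)) = cor (\<Phi> w)" if "w \<in> D" for w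
  using val[OF that] by (simp add: \<Phi>_def)
 show "\<exists>X. form_approx A (j w) X \<and> (\<lambda>n. Re (cinner (X n) (app A (X n)))) \<longlonglongrightarrow> q w - l * (norm (j w))\<^sup>2" if w: "w \<in> closure D"
 proof -
  obtain W where W: "\<And>n. W n \<in> D" "W \<longlonglongrightarrow> w" using iffD1[OF closure_sequential w] by blast
  have \<Phi>0: "\<Phi> 0 = 0" by (simp add: \<Phi>_def q_def j_def clinear_mapD[OF J(1)])
  have "\<exists>N. \<forall>m\<ge>N. \<forall>n\<ge>N. cmod (cinner (j (W m) - j (W n)) (app A (j (W m) - j (W n)))) < e" if e: "e > 0" for e
  proof -
   have "\<Phi> \<midarrow>0\<rightarrow> 0" using qt[OF tendsto_ident_at, of 0 UNIV] \<Phi>0 by simp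
   then obtain d where d: "d > 0" "\<And>u. u \<noteq> 0 \<Longrightarrow> norm u < d \<Longrightarrow> \<bar>\<Phi> u\<bar> < e" using e unfolding LIM_eq by auto
   obtain N where N: "\<And>m n. m \<ge> N \<Longrightarrow> n \<ge> N \<Longrightarrow> norm (W m - W n) < d"
    using LIMSEQ_imp_Cauchy[OF W(2)] d(1) unfolding Cauchy_def dist_norm by blast
   have "cmod (cinner (j (W m) - j (W n)) (app A (j (W m) - j (W n)))) < e" if "m \<ge> N" "n \<ge> N" for m n
    unfolding jd[symmetric] v[OF D[OF W(1) W(1)]] norm_of_real using d(2)[OF _ N[OF that]] \<Phi>0 e by (cases "W m - W n = 0") auto
   thus ?thesis by blast
  qed
  hence "form_approx A (j w) (\<lambda>n. j (W n))" unfolding form_approx_def dom using W(1) jt[OF W(2)] by blast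
  moreover have "(\<lambda>n. Re (cinner (j (W n)) (app A (j (W n))))) \<longlonglongrightarrow> \<Phi> w"
   unfolding v[OF W(1)] Re_complex_of_real by (rule qt[OF W(2)])
  ultimately show ?thesis unfolding \<Phi>_def by blast
 qed
 show "\<exists>w\<in>closure D. x = j w \<and> (\<lambda>n. Re (cinner (X n) (app A (X n)))) \<longlonglongrightarrow> q w - l * (norm (j w))\<^sup>2"
  if C: "C > 0" and X: "form_approx A x X"
 proof -
  have "\<forall>n. \<exists>w\<in>D. X n = j w" using X unfolding form_approx_def dom by blast
  then obtain W where W: "\<And>n. W n \<in> D" "\<And>n. X n = j (W n)" by metis
  have Xl: "X \<longlonglongrightarrow> x" using X by (simp add: form_approx_def)
  let ?c = "min 1 C"
  have lower: "?c * (norm u)\<^sup>2 \<le> \<Phi> u + \<bar>l\<bar> * (norm (j u))\<^sup>2" for u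
  proof -
   have "?c * (norm u)\<^sup>2 = ?c * (norm (fst u))\<^sup>2 + ?c * (cmod (snd u))\<^sup>2" by (simp add: norm_prod_def distrib_left)
   also have "... \<le> 1 * (norm (fst u))\<^sup>2 + C * (cmod (snd u))\<^sup>2" by (intro add_mono mult_right_mono) auto
   also have "... = \<Phi> u + l * (norm (j u))\<^sup>2" by (simp add: \<Phi>_def q_def)
   also have "... \<le> \<Phi> u + \<bar>l\<bar> * (norm (j u))\<^sup>2" by (intro add_left_mono mult_right_mono) auto
   finally show ?thesis .
  qed
  have "Cauchy W" unfolding Cauchy_def dist_norm
  proof (intro allI impI)
   fix e :: real assume e: "e > 0"
   let ?e = "?c * e\<^sup>2 / 2"
   have e': "?e > 0" using e C by simp
   obtain N1 where N1: "\<And>m n. m \<ge> N1 \<Longrightarrow> n \<ge> N1 \<Longrightarrow> cmod (cinner (X m - X n) (app A (X m - X n))) < ?e"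
    using X e' unfolding form_approx_def by blast
   \<comment> \<open>Chosen such that |l| times the squared distance stays below half of min 1 C
     times e^2; the summand 1 avoids a zero denominator.\<close>
   let ?d = "sqrt (?e / (\<bar>l\<bar> + 1))"
   have d: "?d > 0" using e' by simp
   obtain N2 where N2: "\<And>m n. m \<ge> N2 \<Longrightarrow> n \<ge> N2 \<Longrightarrow> norm (X m - X n) < ?d"
    using LIMSEQ_imp_Cauchy[OF Xl] d unfolding Cauchy_def dist_norm by blast
   have "norm (W m - W n) < e" if mn: "m \<ge> max N1 N2" "n \<ge> max N1 N2" for m n
   proof -
    have "\<bar>\<Phi> (W m - W n)\<bar> < ?e"
     using N1[of m n] mn unfolding W(2) jd[symmetric] v[OF D[OF W(1) W(1)]] norm_of_real by simp
    moreover have "\<bar>l\<bar> * (norm (j (W m - W n)))\<^sup>2 \<le> ?e"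
    proof -
     have "(norm (X m - X n))\<^sup>2 \<le> ?d\<^sup>2" using N2[of m n] mn by (intro power_mono) auto
     also have "?d\<^sup>2 = ?e / (\<bar>l\<bar> + 1)" using e' by simp
     finally have "(\<bar>l\<bar> + 1) * (norm (X m - X n))\<^sup>2 \<le> ?e" by (simp only: pos_le_divide_eq[OF add_nonneg_pos[OF abs_ge_zero zero_less_one]] mult.commute[of "\<bar>l\<bar> + 1"])
     thus ?thesis unfolding W(2) jd[symmetric] distrib_right mult_1 using zero_le_power2[of "norm (j (W m - W n))"] by linarith
    qed
    ultimately have "?c * (norm (W m - W n))\<^sup>2 < ?c * e\<^sup>2" using lower[of "W m - W n"] by linarith
    hence "(norm (W m - W n))\<^sup>2 < e\<^sup>2" using C by (simp add: mult_less_cancel_left_pos)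
    thus ?thesis using e by (intro power2_less_imp_less[of _ e]) auto
   qed
   thus "\<exists>M. \<forall>m\<ge>M. \<forall>n\<ge>M. norm (W m - W n) < e" by blast
  qed
  then obtain w where w: "W \<longlonglongrightarrow> w" using Cauchy_convergent_iff convergent_def by blast
  hence "w \<in> closure D" using W(1) closure_sequential by blast
  moreover have "x = j w" using LIMSEQ_unique[OF Xl] jt[OF w] unfolding W(2)[symmetric] by simp
  moreover have "(\<lambda>n. Re (cinner (X n) (app A (X n)))) \<longlonglongrightarrow> \<Phi> w"
   unfolding W(2) v[OF W(1)] Re_complex_of_real by (rule qt[OF w])
  ultimately show ?thesis unfolding \<Phi>_def by blast
 qed
qed

lemma test_function_zero: "test_function (\<lambda>x. 0)"
 unfolding test_function_def smooth_def by (auto intro!: exI[of _ "\<lambda>n x. 0"])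

lemma test_function_subset:
 assumes "test_function \<phi>" "test_function \<psi>" "smooth \<eta>" "\<And>x. \<eta> x \<noteq> 0 \<Longrightarrow> \<phi> x \<noteq> 0 \<or> \<psi> x \<noteq> 0"
 shows "test_function \<eta>"
proof -
 let ?T = "closure {x. \<phi> x \<noteq> 0} \<union> closure {x. \<psi> x \<noteq> 0}"
 have "closure {x. \<eta> x \<noteq> 0} \<subseteq> closure ({x. \<phi> x \<noteq> 0} \<union> {x. \<psi> x \<noteq> 0})"
  using assms(4) by (intro closure_mono) auto
 hence sub: "closure {x. \<eta> x \<noteq> 0} \<subseteq> ?T" unfolding closure_Un .
 have "compact ?T" using assms(1,2) by (auto simp: test_function_def)
 hence "compact (?T \<inter> closure {x. \<eta> x \<noteq> 0})" by (intro compact_Int_closed) auto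
 hence "compact (closure {x. \<eta> x \<noteq> 0})" using sub by (simp add: Int_absorb1)
 thus ?thesis using assms sub by (auto simp: test_function_def)
qed

lemma test_function_add:
 assumes "test_function \<phi>" "test_function \<psi>" shows "test_function (\<lambda>x. \<phi> x + \<psi> x)"
proof (rule test_function_subset[OF assms])
 obtain D E where "D 0 = \<phi>" "\<forall>n::nat. \<forall>x. (D n has_vector_derivative D (Suc n) x) (at x)"
  "E 0 = \<psi>" "\<forall>n::nat. \<forall>x. (E n has_vector_derivative E (Suc n) x) (at x)"
  using assms unfolding test_function_def smooth_def by blast
 thus "smooth (\<lambda>x. \<phi> x + \<psi> x)" unfolding smooth_def
  by (intro exI[of _ "\<lambda>n x. D n x + E n x"]) (auto intro!: has_vector_derivative_add)
qed auto

lemma test_function_scale: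
 assumes "test_function \<phi>" shows "test_function (\<lambda>x. c * \<phi> x)"
proof (rule test_function_subset[OF assms assms])
 obtain D where "D 0 = \<phi>" "\<forall>n::nat. \<forall>x. (D n has_vector_derivative D (Suc n) x) (at x)"
  using assms unfolding test_function_def smooth_def by blast
 thus "smooth (\<lambda>x. c * \<phi> x)" unfolding smooth_def
  by (intro exI[of _ "\<lambda>n x. c * D n x"]) (auto intro!: has_vector_derivative_mult_right)
qed auto

section \<open>The square root of the free resolvent\<close>

context fractional_order
begin

text \<open>\<open>J l\<close> is the inverse square root of the free operator plus l and maps onto
  H^(s/2). For s > 1, \<open>gg l\<close> is the preimage of \<open>GG l\<close>; for s < 1 it is 0
  by the default value of \<open>to_L2\<close>.\<close>

definition "jh l p = cor (1 / sqrt (m p + l))" for l p :: real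
definition "J l = fmul (jh l)" for l
definition "gg l = cor (1 / sqrt (2 * pi)) *\<^sub>C ifourier (to_L2 (jh l))" for l

lemma jh_measurable [measurable]: "jh l \<in> borel_measurable borel" unfolding jh_def[abs_def] by measurable

lemma jh_bound: assumes "l > 0" shows "cmod (jh l p) \<le> 1 / sqrt l"
proof -
 have "sqrt l \<le> sqrt (m p + l)" by simp
 thus ?thesis using assms m_pos[OF assms, of p] by (simp add: jh_def norm_divide frac_le)
qed

lemma jh_bb: "l > 0 \<Longrightarrow> bounded_borel (jh l)"
 by (rule bounded_borelI[OF jh_measurable jh_bound])

lemma jh_jh: "l > 0 \<Longrightarrow> jh l p * jh l p = ih l p"
 using m_pos[of l p] by (simp add: jh_def ih_def flip: of_real_mult)

lemma jh_nz: "l > 0 \<Longrightarrow> jh l p \<noteq> 0"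
 using m_pos[of l p] by (simp add: jh_def)

lemma J_linear: "l > 0 \<Longrightarrow> clinear_map (J l)"
 unfolding J_def by (rule fmul_linear[OF jh_bb])

lemma rep_fourier_J: "l > 0 \<Longrightarrow> AE p in lborel. rep_L2 (fourier (J l y)) p = jh l p * rep_L2 (fourier y) p"
 unfolding J_def by (rule rep_fourier_fmul[OF jh_bb])

lemma J_sym: "l > 0 \<Longrightarrow> cinner (J l x) y = cinner x (J l y)"
 unfolding J_def by (rule fmul_sym[OF jh_bb]) (simp_all add: jh_def)

lemma J_norm: "l > 0 \<Longrightarrow> norm (J l y) \<le> 1 / sqrt l * norm y"
 unfolding J_def by (rule fmul_norm[OF jh_measurable jh_bound])

lemma J_J: "l > 0 \<Longrightarrow> J l (J l y) = R0 l y"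
 by (simp add: J_def R0_def fmul_def mulop_mulop[OF jh_bb jh_bb] jh_jh)

lemma J_inj: assumes l: "l > 0" and "J l y = J l y'" shows "y = y'"
proof -
 have "AE p in lborel. rep_L2 (fourier y) p = rep_L2 (fourier y') p"
  using rep_fourier_J[OF l, of y] rep_fourier_J[OF l, of y'] unfolding assms(2)
  by eventually_elim (use jh_nz[OF l] in simp)
 thus ?thesis by (simp add: L2_eq_fourier)
qed

lemma m_sqrt: "\<bar>p\<bar> powr (s / 2) = sqrt (m p)"
 by (simp add: m_def powr_half_sqrt[symmetric] powr_powr)

lemma sobolev_half: assumes l: "l > 0" shows "sobolev (s / 2) = range (J l)"
proof (rule set_eqI)
 fix F
 have s2: "s / 2 > 0" using s_bounds by simp
 show "F \<in> sobolev (s / 2) \<longleftrightarrow> F \<in> range (J l)"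
  unfolding sobolev_iff[OF s2] m_sqrt
 proof
  assume sq: "square_integrable (\<lambda>p. cor (sqrt (m p)) * rep_L2 (fourier F) p)"
  have "square_integrable (\<lambda>p. cor (sqrt l) * rep_L2 (fourier F) p)" by (rule square_integrable_scale) simp
  from square_integrable_add[OF sq this] have "square_integrable (\<lambda>p. cor (sqrt (m p) + sqrt l) * rep_L2 (fourier F) p)"
   by (simp add: distrib_right)
  hence q: "square_integrable (\<lambda>p. cor (sqrt (m p + l)) * rep_L2 (fourier F) p)"
  proof (rule square_integrable_bound[of _ _ 1])
   have "sqrt (m p + l) \<le> sqrt (m p) + sqrt l" for p using l by (intro sqrt_add_le_add_sqrt) auto
   thus "AE p in lborel. cmod (cor (sqrt (m p + l)) * rep_L2 (fourier F) p) \<le> 1 * cmod (cor (sqrt (m p) + sqrt l) * rep_L2 (fourier F) p)"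
    unfolding norm_mult norm_of_real mult_1 using l by (intro AE_I2 mult_right_mono) auto
  qed measurable
  let ?y = "ifourier (to_L2 (\<lambda>p. cor (sqrt (m p + l)) * rep_L2 (fourier F) p))"
  have "AE p in lborel. rep_L2 (fourier F) p = rep_L2 (fourier (J l ?y)) p"
   using rep_fourier_J[OF l, of ?y] rep_to_L2[OF q] unfolding fourier_ifourier
  proof eventually_elim
   case (elim p)
   have "jh l p * cor (sqrt (m p + l)) = 1" using m_pos[OF l, of p] by (simp add: jh_def)
   thus ?case unfolding elim by (simp flip: mult.assoc)
  qed
  hence "F = J l ?y" by (simp add: L2_eq_fourier)
  thus "F \<in> range (J l)" by blast
 next
  assume "F \<in> range (J l)"
  then obtain y where F: "F = J l y" by blast
  have b: "cmod (cor (sqrt (m p)) * jh l p) \<le> 1" for p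
   using m_pos[OF l, of p] l by (simp add: jh_def norm_mult norm_divide)
  show "square_integrable (\<lambda>p. cor (sqrt (m p)) * rep_L2 (fourier F) p)"
  proof (rule square_integrable_bound[OF square_integrable_rep[of "fourier y"], of _ 1])
   show "AE p in lborel. cmod (cor (sqrt (m p)) * rep_L2 (fourier F) p) \<le> 1 * cmod (rep_L2 (fourier y) p)"
    using rep_fourier_J[OF l, of y] unfolding F
   proof eventually_elim
    case (elim p)
    show ?case unfolding elim mult.assoc[symmetric] using b[of p] by (subst norm_mult) (rule mult_right_mono, auto)
   qed
  qed measurable
 qed
qed

text \<open>The kernel b / ((m + l) (m + b)) increases to 1 / (m + l) as b grows, and
  \<open>Theta_integral\<close> gives its integral. For s > 1, \<Theta>(s, b) tends to 0; for s < 1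
  it tends to minus infinity, so the integrals are unbounded.\<close>

lemma Theta_antimono_limit:
 assumes l: "l > 0"
 shows "s > 1 \<Longrightarrow> integrable lborel (\<lambda>p. 1 / (m p + l)) \<and> (LBINT p. 1 / (m p + l)) = 2 * pi * Theta s l"
  "s < 1 \<Longrightarrow> \<not> integrable lborel (\<lambda>p. 1 / (m p + l))"
proof -
 define b where "b n = l + real (Suc n)" for n
 define f where "f n p = b n * (1 / ((m p + l) * (m p + b n)))" for n p
 have b: "b n > 0" "b n \<noteq> l" for n using l by (simp_all add: b_def)
 have fi: "integrable lborel (f n)" for n
  unfolding f_def[abs_def] by (intro integrable_mult_right Theta_integral(1)[OF l b(1) b(2)[symmetric]])
 have fv: "(LBINT p. f n p) = b n * (2 * pi * (Theta s l - Theta s (b n)) / (b n - l))" for n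
  unfolding f_def[abs_def] Theta_integral(2)[OF l b(1) b(2)[symmetric], symmetric] by (rule integral_mult_right_zero)
 have fle: "f n p \<le> 1 / (m p + l)" "0 \<le> f n p" for n p
  using m_pos[OF l, of p] m_pos[OF b(1), of p n] b(1)[of n] by (auto simp: f_def divide_simps)
 have mono: "f n p \<le> f n' p" if "n \<le> n'" for n n' p
 proof -
  have "b n / (m p + b n) \<le> b n' / (m p + b n')"
  proof -
   have e: "b k / (m p + b k) = 1 - m p / (m p + b k)" for k
    using m_pos[OF b(1), of p k] by (simp add: field_simps)
   have "m p / (m p + b n') \<le> m p / (m p + b n)"
    using m_pos[OF b(1), of p n] m_pos[OF b(1), of p n'] that by (intro divide_left_mono) (auto simp: b_def)
   thus ?thesis unfolding e by simp
  qed
  hence "1 / (m p + l) * (b n / (m p + b n)) \<le> 1 / (m p + l) * (b n' / (m p + b n'))"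
   using m_pos[OF l, of p] by (intro mult_left_mono) auto
  thus ?thesis by (simp add: f_def)
 qed
 have lim: "(\<lambda>n. f n p) \<longlonglongrightarrow> 1 / (m p + l)" for p
 proof -
  have "(\<lambda>n. f n p) \<longlonglongrightarrow> inverse (m p + l)" unfolding f_def b_def using m_pos[OF l, of p] by real_asymp
  thus ?thesis by (simp only: inverse_eq_divide)
 qed
 show "integrable lborel (\<lambda>p. 1 / (m p + l)) \<and> (LBINT p. 1 / (m p + l)) = 2 * pi * Theta s l" if s: "s > 1"
 proof -
  have "\<beta> < 0" by (rule beta(4)[OF s])
  hence "(\<lambda>n. b n * (2 * pi * (Theta s l - c0 * b n powr \<beta>) / (b n - l))) \<longlonglongrightarrow> 2 * pi * Theta s l"
   unfolding b_def by real_asymp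
  hence "(\<lambda>n. \<integral>p. f n p \<partial>lborel) \<longlonglongrightarrow> 2 * pi * Theta s l" unfolding fv Theta_eq[OF b(1)] .
  note L = has_bochner_integral_monotone_convergence[OF fi _ _ this, of "\<lambda>p. 1 / (m p + l)"]
  have "has_bochner_integral lborel (\<lambda>p. 1 / (m p + l)) (2 * pi * Theta s l)"
   by (rule L) (use lim mono in \<open>auto simp: mono_def\<close>)
  thus ?thesis by (simp add: has_bochner_integral_iff)
 qed
 show "\<not> integrable lborel (\<lambda>p. 1 / (m p + l))" if s: "s < 1"
 proof
  assume i: "integrable lborel (\<lambda>p. 1 / (m p + l))"
  have "\<beta> > 0" "c0 < 0" using beta(3)[OF s] c0_sign(1)[OF s] by auto
  have "(\<lambda>n. b n / (b n - l) * (2 * pi)) \<longlonglongrightarrow> 2 * pi" unfolding b_def by real_asymp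
  moreover have "filterlim (\<lambda>n. b n powr \<beta>) at_top sequentially" unfolding b_def using \<open>\<beta> > 0\<close> by real_asymp
  hence "filterlim (\<lambda>n. Theta s l + (- c0) * b n powr \<beta>) at_top sequentially"
   using \<open>c0 < 0\<close> by (intro filterlim_tendsto_add_at_top[OF tendsto_const] filterlim_tendsto_pos_mult_at_top[OF tendsto_const]) auto
  ultimately have "filterlim (\<lambda>n. b n / (b n - l) * (2 * pi) * (Theta s l + (- c0) * b n powr \<beta>)) at_top sequentially"
   by - (rule filterlim_tendsto_pos_mult_at_top[where c = "2 * pi"], simp_all)
  hence "filterlim (\<lambda>n. b n * (2 * pi * (Theta s l - c0 * b n powr \<beta>) / (b n - l))) at_top sequentially"
   by (simp add: mult_ac)
  hence "eventually (\<lambda>n. (LBINT p. f n p) > (LBINT p. 1 / (m p + l))) sequentially"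
   unfolding fv Theta_eq[OF b(1)] filterlim_at_top_dense by blast
  then obtain n where n: "(LBINT p. f n p) > (LBINT p. 1 / (m p + l))" by (auto simp: eventually_sequentially)
  have "(LBINT p. f n p) \<le> (LBINT p. 1 / (m p + l))" using fi i fle by (intro integral_mono)
  thus False using n by simp
 qed
qed

text \<open>The source of the dichotomy at s = 1: G lies in H^(s/2) exactly if \<open>jh l\<close>
  is square integrable.\<close>

lemma jh_sq: assumes l: "l > 0" shows "square_integrable (jh l) \<longleftrightarrow> s > 1"
proof -
 have "(\<lambda>p. (cmod (jh l p))\<^sup>2) = (\<lambda>p. 1 / (m p + l))"
  using m_pos[OF l] by (auto simp: jh_def norm_divide power_divide less_imp_le)
 hence "square_integrable (jh l) \<longleftrightarrow> integrable lborel (\<lambda>p. 1 / (m p + l))" by (simp add: square_integrable_def)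
 thus ?thesis using Theta_antimono_limit[OF l] s_bounds(3) by (cases "s > 1") auto
qed

lemma gg_zero: "l > 0 \<Longrightarrow> s < 1 \<Longrightarrow> gg l = 0"
 using jh_sq[of l] by (simp add: gg_def to_L2_def clinear_mapD(3)[OF ifourier_linear])

lemma J_gg: assumes l: "l > 0" and s: "s > 1" shows "J l (gg l) = GG l"
proof -
 have "mulop (jh l) (to_L2 (jh l)) = to_L2 (ih l)"
  using mulop_to_L2[OF jh_bb[OF l]] jh_sq[OF l] s jh_jh[OF l] by simp
 thus ?thesis by (simp add: J_def fmul_def gg_def G_eq clinear_mapD[OF fourier_linear] clinear_mapD[OF ifourier_linear] clinear_mapD[OF mulop_linear[OF jh_bb[OF l]]])
qed

lemma gg_norm: assumes l: "l > 0" and s: "s > 1" shows "cinner (gg l) (gg l) = cor (Theta s l)" "Theta s l > 0"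
proof -
 have "cinner (gg l) (gg l) = cor (1 / sqrt (2 * pi)) * (cor (1 / sqrt (2 * pi)) * cinner (to_L2 (jh l)) (to_L2 (jh l)))"
  unfolding gg_def by (simp add: cinner_scaleC_left cinner_scaleC_right ifourier_cinner)
 also have "cinner (to_L2 (jh l)) (to_L2 (jh l)) = (LBINT p. cor (1 / (m p + l)))"
  using cinner_to_L2[of "jh l" "jh l"] jh_sq[OF l] s jh_jh[OF l] by (simp add: jh_def ih_def)
 also have "... = cor (2 * pi * Theta s l)"
  unfolding integral_complex_of_real using Theta_antimono_limit(1)[OF l s] by simp
 also have "cor (1 / sqrt (2 * pi)) * (cor (1 / sqrt (2 * pi)) * cor (2 * pi * Theta s l))
   = cor (1 / sqrt (2 * pi) * (1 / sqrt (2 * pi) * (2 * pi * Theta s l)))" by (simp only: of_real_mult)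
 also have "1 / sqrt (2 * pi) * (1 / sqrt (2 * pi) * (2 * pi * Theta s l)) = Theta s l" by (simp flip: times_divide_eq_right mult.assoc)
 finally show "cinner (gg l) (gg l) = cor (Theta s l)" .
 show "Theta s l > 0" unfolding Theta_eq[OF l] using c0_sign(2)[OF s] l by simp
qed

lemma gg_R0: assumes l: "l > 0" and s: "s > 1" shows "cinner (gg l) (J l z) = cinner (GG l) z"
 using J_sym[OF l, of "gg l" z] J_gg[OF assms] by simp

text \<open>\<open>J l\<close> maps \<open>V' l\<close> onto the form domain of the Friedrichs extension. For \<open>s < 1\<close> the function
 \<open>jh l\<close> is not square integrable, hence \<open>gg l = 0\<close> and \<open>V' l = UNIV\<close>.\<close>

definition "V' l = {y. cinner (gg l) y = 0}"

lemma V'_iff: assumes l: "l > 0"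
 shows "y \<in> V' l \<longleftrightarrow> s < 1 \<or> (LBINT p. rep_L2 (fourier (J l y)) p) = 0"
proof (cases "s < 1")
 case True
 thus ?thesis using l by (simp add: V'_def gg_zero)
next
 case False
 hence s: "s > 1" using s_bounds(3) by simp
 have "cinner (gg l) y = cnj (cor (1 / sqrt (2 * pi))) * cinner (to_L2 (jh l)) (to_L2 (rep_L2 (fourier y)))"
  unfolding gg_def by (simp add: cinner_scaleC_left cinner_ifourier)
 also have "cinner (to_L2 (jh l)) (to_L2 (rep_L2 (fourier y))) = (LBINT p. rep_L2 (fourier (J l y)) p)"
  using cinner_to_L2[of "jh l" "rep_L2 (fourier y)"] jh_sq[OF l] s
  by (simp del: to_L2_rep) (rule integral_cong_AE, use rep_fourier_J[OF l, of y] in \<open>auto simp: jh_def elim: eventually_mono\<close>)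
 finally show ?thesis using False by (simp add: V'_def)
qed

text \<open>A description of the image of \<open>V' l\<close> without l. For s > 1 the transform of
  F is integrable, and the condition says that F vanishes at 0.\<close>

definition "VV = {F \<in> sobolev (s / 2). s > 1 \<longrightarrow> (LBINT p. rep_L2 (fourier F) p) = 0}"

lemma VV_eq: "l > 0 \<Longrightarrow> VV = J l ` V' l"
 unfolding VV_def sobolev_half[of l] using V'_iff s_bounds(3) by auto

lemma test_in_V':
 assumes l: "l > 0" and "J l y \<in> test_functions" shows "y \<in> V' l"
proof (cases "s < 1")
 case False
 hence s: "s > 1" using s_bounds(3) by simp
 obtain \<phi> where \<phi>: "test_function \<phi>" "J l y = to_L2 \<phi>" using assms(2) by (auto simp: test_functions_eq)
 obtain g where "(J l y, g) \<in> test_graph" using test_function_in_graph[OF \<phi>(1)] \<phi>(2) by metis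
 hence d: "dec (J l y) g 0 0" by (rule test_graph_dec)
 hence e: "J l y = R0 l (g + cor l *\<^sub>C J l y) + 0 *\<^sub>C GG l" "0 = cinner (GG l) (g + cor l *\<^sub>C J l y) + cor (Theta s l) * 0"
  unfolding dec_iff[OF l] by blast+
 have "J l y = J l (J l (g + cor l *\<^sub>C J l y))" unfolding J_J[OF l] by (rule trans[OF e(1)]) simp
 hence "y = J l (g + cor l *\<^sub>C J l y)" by (rule J_inj[OF l])
 hence "cinner (gg l) y = cinner (gg l) (J l (g + cor l *\<^sub>C J l y))" by (rule arg_cong)
 also have "... = 0" unfolding gg_R0[OF l s] using e(2) by simp
 finally show ?thesis by (simp add: V'_def)
qed (use l in \<open>simp add: V'_def gg_zero\<close>)

lemma test_preimage:
 assumes l: "l > 0" and \<phi>: "test_function \<phi>"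
 obtains y where "J l y = to_L2 \<phi>" "AE p in lborel. rep_L2 (fourier y) p = cor (sqrt (m p + l)) * ft \<phi> p"
proof -
 obtain g where g: "(to_L2 \<phi>, g) \<in> test_graph" "AE p in lborel. rep_L2 (fourier (to_L2 \<phi>)) p = ft \<phi> p" using test_function_in_graph[OF \<phi>] by metis
 hence "to_L2 \<phi> = R0 l (g + cor l *\<^sub>C to_L2 \<phi>)" using A0_resolvent[OF l] by (auto simp: test_graph_def)
 hence y: "J l (J l (g + cor l *\<^sub>C to_L2 \<phi>)) = to_L2 \<phi>" unfolding J_J[OF l] by (rule sym)
 have "AE p in lborel. rep_L2 (fourier (J l (g + cor l *\<^sub>C to_L2 \<phi>))) p = cor (sqrt (m p + l)) * ft \<phi> p"
  using rep_fourier_J[OF l, of "J l (g + cor l *\<^sub>C to_L2 \<phi>)"] g(2) unfolding y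
 proof eventually_elim
  case (elim p)
  have "cor (sqrt (m p + l)) * jh l p = 1" using m_pos[OF l, of p] by (simp add: jh_def)
  thus ?case using elim by (simp flip: mult.assoc)
 qed
 with y show ?thesis by (rule that)
qed

text \<open>If z is orthogonal to all preimages of test functions, then sqrt (m + l) times its
  transform is constant, by the annihilator lemma of order s/2. So the transform of z is a multiple
  of \<open>jh l\<close>: this is 0 for s < 1, where \<open>jh l\<close> is not square integrable,
  and makes z a multiple of \<open>gg l\<close> for s > 1.\<close>

lemma closure_tests:
 assumes l: "l > 0" shows "closure {y. J l y \<in> test_functions} = V' l"
proof
 let ?S = "{y. J l y \<in> test_functions}"
 have cl: "closed (V' l)" unfolding V'_def closed_sequential_limits
  using tendsto_cinner[OF tendsto_const[of "gg l"]] by (fastforce simp: LIMSEQ_const_iff)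
 show "closure ?S \<subseteq> V' l" proof (rule closure_minimal[OF _ cl], rule subsetI)
  fix y assume "y \<in> ?S" thus "y \<in> V' l" by (intro test_in_V'[OF l]) simp
 qed
 have tg: "to_L2 \<phi> \<in> test_functions" if "test_function \<phi>" for \<phi> using that by (auto simp: test_functions_eq)
 show "V' l \<subseteq> closure ?S"
 proof (rule ccontr)
  assume "\<not> V' l \<subseteq> closure ?S"
  then obtain y where y: "y \<in> V' l" "y \<notin> closure ?S" by blast
  have "L2C.subspace ?S"
  proof (rule L2C.subspaceI)
   show "0 \<in> ?S" using tg[OF test_function_zero] by (simp add: clinear_mapD(3)[OF J_linear[OF l]] to_L2_zero)
   fix u v c assume u: "u \<in> ?S"
   then obtain \<phi> where \<phi>: "test_function \<phi>" "J l u = to_L2 \<phi>" by (auto simp: test_functions_eq)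
   show "c *\<^sub>C u \<in> ?S" using tg[OF test_function_scale[OF \<phi>(1), of c]] to_L2_scale[OF test_function_facts(2)[OF \<phi>(1)], of c]
    by (simp add: clinear_mapD(2)[OF J_linear[OF l]] \<phi>(2))
   assume "v \<in> ?S"
   then obtain \<psi> where \<psi>: "test_function \<psi>" "J l v = to_L2 \<psi>" by (auto simp: test_functions_eq)
   show "u + v \<in> ?S" using tg[OF test_function_add[OF \<phi>(1) \<psi>(1)]] to_L2_add[OF test_function_facts(2)[OF \<phi>(1)] test_function_facts(2)[OF \<psi>(1)]]
    by (simp add: clinear_mapD(1)[OF J_linear[OF l]] \<phi>(2) \<psi>(2))
  qed
  then obtain z where z: "\<And>x. x \<in> ?S \<Longrightarrow> cinner x z = 0" "cinner z y \<noteq> 0" using orthogonal_separation[OF _ y(2)] by blast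
  let ?u = "\<lambda>p. cor (sqrt (m p + l)) * rep_L2 (fourier z) p"
  have "\<exists>c. AE p in lborel. ?u p = c"
  proof (rule annihilator_of_test_functions[of ?u "s / 2"])
   let ?w = "\<lambda>p::real. (1 + p\<^sup>2) powr (- (s / 2) / 2)"
   have w: "?w p * sqrt (m p + l) \<le> sqrt (1 + l)" for p
   proof -
    have nz: "1 + p\<^sup>2 > 0" by (rule add_pos_nonneg[OF zero_less_one zero_le_power2])
    have "m p + l \<le> (1 + l) * (1 + p\<^sup>2) powr (s / 2)"
     using powr_weight_bounds(1)[OF s_bounds(4), of p] ge_one_powr_ge_zero[of "1 + p\<^sup>2" "s / 2"] s_bounds l
     by (simp add: m_def distrib_right add_mono)
    hence "sqrt (m p + l) \<le> sqrt ((1 + l) * (1 + p\<^sup>2) powr (s / 2))" by (rule real_sqrt_le_mono)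
    also have "... = sqrt (1 + l) * (1 + p\<^sup>2) powr (s / 2 / 2)" by (simp add: real_sqrt_mult powr_half_sqrt[symmetric] powr_powr)
    finally have "?w p * sqrt (m p + l) \<le> ?w p * (sqrt (1 + l) * (1 + p\<^sup>2) powr (s / 2 / 2))" by (rule mult_left_mono) simp
    also have "... = sqrt (1 + l) * (?w p * (1 + p\<^sup>2) powr (s / 2 / 2))" by simp
    also have "?w p * (1 + p\<^sup>2) powr (s / 2 / 2) = 1" using nz by (simp flip: powr_add)
    finally show ?thesis by simp
   qed
   show "square_integrable (\<lambda>p. cor (?w p) * ?u p)"
   proof (rule square_integrable_bound[OF square_integrable_rep[of "fourier z"], of _ "sqrt (1 + l)"])
    have "cmod (cor (?w p * sqrt (m p + l))) \<le> sqrt (1 + l)" for p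
     using w[of p] m_pos[OF l, of p] by (simp only: norm_of_real abs_mult) simp
    thus "AE p in lborel. cmod (cor (?w p) * ?u p) \<le> sqrt (1 + l) * cmod (rep_L2 (fourier z) p)"
     unfolding mult.assoc[symmetric] of_real_mult[symmetric] by (subst norm_mult) (intro AE_I2 mult_right_mono, auto)
   qed measurable
  next
   fix \<phi> assume \<phi>: "test_function \<phi>"
   obtain v where v: "J l v = to_L2 \<phi>" "AE p in lborel. rep_L2 (fourier v) p = cor (sqrt (m p + l)) * ft \<phi> p" by (rule test_preimage[OF l \<phi>])
   have [measurable]: "ft \<phi> \<in> borel_measurable borel" by (rule ft_measurable[OF square_integrable_measurable[OF test_function_facts(2)[OF \<phi>]]])
   have "(LBINT p. cnj (?u p) * ft \<phi> p) = cinner (fourier z) (fourier v)"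
    unfolding cinner_rep by (rule integral_cong_AE) (use v(2) in \<open>auto elim: eventually_mono\<close>)
   also have "... = cnj (cinner v z)" unfolding fourier_cinner by (rule cinner_commute)
   also have "... = 0" using z(1)[of v] tg[OF \<phi>] v(1) by simp
   finally show "(LBINT p. cnj (?u p) * ft \<phi> p) = 0" .
  qed (use s_bounds in auto)
  then obtain c where c: "AE p in lborel. ?u p = c" by blast
  have zc: "AE p in lborel. rep_L2 (fourier z) p = c * jh l p"
   using c
  proof eventually_elim
   case (elim p)
   have "cor (sqrt (m p + l)) * jh l p = 1" using m_pos[OF l, of p] by (simp add: jh_def)
   thus ?case unfolding elim[symmetric] by (simp add: mult_ac)
  qed
  have "cinner z y = 0"
  proof (cases "s < 1")
   case True
   have "c = 0"
   proof (rule ccontr)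
    assume c: "c \<noteq> 0"
    have "square_integrable (jh l)"
     by (rule square_integrable_bound[OF square_integrable_rep[of "fourier z"], of _ "1 / cmod c"])
       (use zc c in \<open>auto simp: norm_mult elim: eventually_mono\<close>)
    thus False using jh_sq[OF l] True by simp
   qed
   hence "fourier z = 0" unfolding L2_eq_iff using zc rep_zero by (auto elim: eventually_elim2)
   hence "cinner (fourier z) (fourier y) = 0" by simp
   thus ?thesis by (simp add: fourier_cinner)
  next
   case False
   hence s: "square_integrable (jh l)" using jh_sq[OF l] s_bounds(3) by simp
   have "fourier z = c *\<^sub>C to_L2 (jh l)" unfolding L2_eq_iff
    using zc rep_to_L2[OF s] rep_scaleC[of c "to_L2 (jh l)"] by eventually_elim simp
   hence "z = c *\<^sub>C ifourier (to_L2 (jh l))" using ifourier_fourier[of z] by (simp add: clinear_mapD(2)[OF ifourier_linear])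
   hence "z = (cor (sqrt (2 * pi)) * c) *\<^sub>C gg l" by (simp add: gg_def)
   thus ?thesis using y(1) by (simp add: V'_def cinner_scaleC_left)
  qed
  thus False using z(2) by simp
 qed
qed

end

section \<open>The Friedrichs extension\<close>

context fractional_order
begin

lemma regular_J: assumes l: "l > 0" and d: "dec x v d c"
 obtains y where "y = J l (v + cor l *\<^sub>C x)" "x = J l y + c *\<^sub>C GG l"
  "s > 1 \<Longrightarrow> cinner (gg l) y = d - cor (Theta s l) * c"
  "cinner x (v + cor l *\<^sub>C x) = cor ((norm y)\<^sup>2) + cnj c * (d - cor (Theta s l) * c)"
proof -
 let ?z = "v + cor l *\<^sub>C x"
 have e: "x = R0 l ?z + c *\<^sub>C GG l" "d = cinner (GG l) ?z + cor (Theta s l) * c" using d unfolding dec_iff[OF l] by blast+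
 have "cinner x ?z = cinner (R0 l ?z + c *\<^sub>C GG l) ?z" using arg_cong[OF e(1), of "\<lambda>x. cinner x ?z"] .
 also have "... = cinner (J l (J l ?z)) ?z + cnj c * cinner (GG l) ?z" by (simp add: J_J[OF l] cinner_add_left[of "R0 _ _"] cinner_scaleC_left)
 also have "cinner (J l (J l ?z)) ?z = cor ((norm (J l ?z))\<^sup>2)" unfolding J_sym[OF l] cinner_norm ..
 finally show ?thesis
  by (intro that[of "J l ?z"]) (simp_all add: J_J[OF l] e(1)[symmetric] gg_R0[OF l] e(2))
qed

lemma gg_real: assumes l: "l > 0" and y: "y \<in> V' l" and c: "s < 1 \<Longrightarrow> t = 0"
 shows "cinner y (t *\<^sub>C gg l) = 0" "cinner (t *\<^sub>C gg l) y = 0"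
 using y cinner_commute[of y "gg l"] by (auto simp: V'_def cinner_scaleC_left cinner_scaleC_right)

lemma G_not_form:
 assumes l: "l > 0" and s: "s < 1" and c: "c *\<^sub>C GG l = J l y" shows "c = 0"
proof (rule ccontr)
 assume c0: "c \<noteq> 0"
 have "AE p in lborel. rep_L2 (fourier y) p = c * cor (1 / sqrt (2 * pi)) * jh l p"
  using rep_fourier_J[OF l, of y] rep_fourier_G[OF l] rep_fourier_lin(2)[of c "GG l"] unfolding c
 proof eventually_elim
  case (elim p)
  have "jh l p * rep_L2 (fourier y) p = jh l p * (c * cor (1 / sqrt (2 * pi)) * jh l p)"
   using elim jh_jh[OF l, of p] by (simp add: mult_ac)
  thus ?case unfolding mult_cancel_left using jh_nz[OF l, of p] by blast
 qed
 hence "square_integrable (jh l)"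
  by (intro square_integrable_bound[OF square_integrable_rep[of "fourier y"], of _ "sqrt (2 * pi) / cmod c"])
    (use c0 in \<open>auto simp: norm_mult norm_divide elim: eventually_mono\<close>)
 thus False using jh_sq[OF l] s by simp
qed

definition "kF = (if s < 1 then kk \<infinity> else kk 0)"

lemma kF_form:
 assumes l: "l > 0" and x: "(x, v) \<in> kF"
 obtains y where "y \<in> V' l" "x = J l y" "cinner x v = cor ((norm y)\<^sup>2 - l * (norm x)\<^sup>2)"
proof -
 have cv: "cinner x v = cinner x (v + cor l *\<^sub>C x) - cor l * cor ((norm x)\<^sup>2)"
  by (simp add: cinner_add_right cinner_scaleC_right cinner_norm)
 obtain d c where d: "dec x v d c" "if s < 1 then c = 0 else d = 0"
  using x by (auto simp: kF_def kk_def bc_def zero_ereal_def split: if_splits)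
 obtain y where y: "x = J l y + c *\<^sub>C GG l" "s > 1 \<Longrightarrow> cinner (gg l) y = d - cor (Theta s l) * c"
  "cinner x (v + cor l *\<^sub>C x) = cor ((norm y)\<^sup>2) + cnj c * (d - cor (Theta s l) * c)"
  using regular_J[OF l d(1)] by metis
 show ?thesis
 proof (cases "s < 1")
  case True
  thus ?thesis using d(2) y cv l by (intro that[of y]) (simp_all add: V'_def gg_zero)
 next
  case False
  hence s: "s > 1" and d0: "d = 0" using s_bounds(3) d(2) by auto
  \<comment> \<open>For d = 0 the product of \<open>gg l\<close> with y is -\<Theta> c, while
    \<open>gg l\<close> has squared norm \<Theta>. The shift thus lands in \<open>V' l\<close>, and
    as \<open>J l\<close> maps \<open>gg l\<close> to \<open>GG l\<close> it absorbs the singular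
    part of x.\<close>
  let ?y = "y + c *\<^sub>C gg l"
  have V: "?y \<in> V' l" using y(2)[OF s] d0 by (simp add: V'_def cinner_add_right cinner_scaleC_right gg_norm(1)[OF l s] mult.commute)
  have "cinner y ?y = cinner ?y ?y" using gg_real(2)[OF l V, of c] s by (simp add: cinner_add_left)
  hence "cor ((norm ?y)\<^sup>2) = cor ((norm y)\<^sup>2) + c * cnj (cinner (gg l) y)"
   unfolding cinner_norm cinner_add_right[of y] cinner_scaleC_right using cinner_commute[of y "gg l"] by simp
  also have "c * cnj (cinner (gg l) y) = cnj c * (d - cor (Theta s l) * c)" unfolding y(2)[OF s] d0 by simp
  finally show ?thesis
   using V y cv s by (intro that[of ?y]) (simp_all add: clinear_mapD[OF J_linear[OF l]] J_gg[OF l])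
 qed
qed

lemma kF_gt: "kF = kk (if s < 1 then \<infinity> else 0)" by (simp add: kF_def)

lemma closure_V': "l > 0 \<Longrightarrow> closure (V' l) = V' l"
 using closure_tests[of l] closure_closure by metis

text \<open>Serves both the minimal operator and its Friedrichs extension: the preimages of test
  functions are already dense in \<open>V' 1\<close>, so nothing in between can change the
  closure.\<close>

lemma form_domain_between:
 assumes A: "linear_operator A" "k_ring s \<subseteq> A" "A \<subseteq> kF"
 shows "form_domain A = VV"
proof -
 have J1: "clinear_map (J 1)" "\<And>y. norm (J 1 y) \<le> 1 * norm y" using J_linear J_norm[of 1] by simp_all
 let ?D0 = "{y. J 1 y \<in> Domain A}"
 have D0: "closure ?D0 = V' 1"
 proof
  have "?D0 \<subseteq> V' 1"
  proof clarify
   fix y v assume "(J 1 y, v) \<in> A"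
   then obtain y' where "y' \<in> V' 1" "J 1 y = J 1 y'" using kF_form[of 1 "J 1 y" v] A(3) by auto
   thus "y \<in> V' 1" using J_inj[of 1 y y'] by simp
  qed
  thus "closure ?D0 \<subseteq> V' 1" using closure_mono[of ?D0 "V' 1"] closure_V'[of 1] by simp
  have "y \<in> ?D0" if ty: "J 1 y \<in> test_functions" for y
  proof -
   obtain \<phi> where \<phi>: "test_function \<phi>" "J 1 y = to_L2 \<phi>" using ty by (auto simp: test_functions_eq)
   obtain g where "(J 1 y, g) \<in> test_graph" using test_function_in_graph[OF \<phi>(1)] \<phi>(2) by metis
   hence "(J 1 y, g) \<in> A" using A(2) closure_subset unfolding k_ring_eq by blast
   thus ?thesis by blast
  qed
  thus "V' 1 \<subseteq> closure ?D0" unfolding closure_tests[OF zero_less_one, symmetric] by (intro closure_mono) blast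
 qed
 let ?D = "?D0 \<times> {0::complex}"
 have cD: "closure ?D = V' 1 \<times> {0}" unfolding closure_Times D0 by simp
 have sv: "single_valued A" and lin: "\<And>x y x' y'. (x, y) \<in> A \<Longrightarrow> (x', y') \<in> A \<Longrightarrow> (x + x', y + y') \<in> A"
  "\<And>c x y. (x, y) \<in> A \<Longrightarrow> (c *\<^sub>C x, c *\<^sub>C y) \<in> A"
  using A(1) unfolding linear_operator_def by blast+
 have diff: "w - w' \<in> ?D" if ww: "w \<in> ?D" "w' \<in> ?D" for w w'
 proof -
  obtain y v y' v' where w: "w = (y, 0)" "w' = (y', 0)" "(J 1 y, v) \<in> A" "(J 1 y', v') \<in> A" using ww by auto
  have "(J 1 y + (-1) *\<^sub>C J 1 y', v + (-1) *\<^sub>C v') \<in> A" by (intro lin w)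
  hence "J 1 (y - y') \<in> Domain A" by (auto simp: clinear_mapD[OF J1(1)])
  thus ?thesis by (simp add: w)
 qed
 have dom: "Domain A = (\<lambda>w. J 1 (fst w) + snd w *\<^sub>C 0) ` ?D"
 proof (intro subset_antisym subsetI)
  fix x assume x: "x \<in> Domain A"
  then obtain v where "(x, v) \<in> kF" using A(3) by blast
  then obtain y where "x = J 1 y" using kF_form[of 1 x v] by auto
  thus "x \<in> (\<lambda>w. J 1 (fst w) + snd w *\<^sub>C 0) ` ?D" using x by (intro image_eqI[of _ _ "(y, 0)"]) auto
 qed auto
 have val: "cinner (J 1 (fst w) + snd w *\<^sub>C 0) (app A (J 1 (fst w) + snd w *\<^sub>C 0))
   = cor ((norm (fst w))\<^sup>2 + 1 * (cmod (snd w))\<^sup>2 - 1 * (norm (J 1 (fst w) + snd w *\<^sub>C 0))\<^sup>2)" if ww: "w \<in> ?D" for w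
 proof -
  obtain y v where w: "w = (y, 0)" "(J 1 y, v) \<in> A" using ww by auto
  obtain y' where y': "J 1 y = J 1 y'" "cinner (J 1 y) v = cor ((norm y')\<^sup>2 - 1 * (norm (J 1 y))\<^sup>2)"
   using kF_form[of 1 "J 1 y" v] w(2) A(3) by auto
  thus ?thesis using J_inj[of 1 y y'] app_eq[OF sv w(2)] by (simp add: w(1))
 qed
 have eq: "x \<in> form_domain A \<longleftrightarrow> x \<in> VV" for x
 proof
  assume "x \<in> form_domain A"
  then obtain X where X: "form_approx A x X" by (auto simp: form_domain_def)
  obtain w where "w \<in> closure ?D" "x = J 1 (fst w) + snd w *\<^sub>C 0"
   using form_closure(2)[OF J1 diff dom val _ X] by auto
  thus "x \<in> VV" unfolding cD VV_eq[OF zero_less_one] by auto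
 next
  assume "x \<in> VV"
  then obtain y where y: "x = J 1 y" "y \<in> V' 1" unfolding VV_eq[OF zero_less_one] by blast
  thus "x \<in> form_domain A"
   using form_closure(1)[OF J1 diff dom val, of "(y, 0)"] unfolding cD form_domain_def by auto
 qed
 thus ?thesis by blast
qed

lemma k_ring_kF: "k_ring s \<subseteq> kF" unfolding kF_gt by (rule k_ring_kk) simp

lemma k_ring_linear: "linear_operator (k_ring s)"
proof -
 have zero: "(0, 0) \<in> test_graph"
  using test_function_zero to_L2_zero A0_resolvent[OF zero_less_one, of 0 0]
  by (auto simp: test_graph_def test_functions_eq clinear_mapD[OF R0_linear] intro!: image_eqI[of _ _ "\<lambda>x. 0"])
 have A0l: "\<And>x y x' y'. (x, y) \<in> A0 \<Longrightarrow> (x', y') \<in> A0 \<Longrightarrow> (x + x', y + y') \<in> A0" "\<And>c x y. (x, y) \<in> A0 \<Longrightarrow> (c *\<^sub>C x, c *\<^sub>C y) \<in> A0"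
  using kk_linear[of \<infinity>] unfolding kk_infinity linear_operator_def by blast+
 have tg: "(x + x', y + y') \<in> test_graph" "(c *\<^sub>C x, c *\<^sub>C y) \<in> test_graph" if xy: "(x, y) \<in> test_graph" "(x', y') \<in> test_graph" for x y x' y' c
 proof -
  obtain \<phi> \<psi> where p: "test_function \<phi>" "test_function \<psi>" "x = to_L2 \<phi>" "x' = to_L2 \<psi>" using xy by (auto simp: test_graph_def test_functions_eq)
  show "(x + x', y + y') \<in> test_graph"
   using xy A0l(1)[of x y x' y'] test_function_add[OF p(1,2)] to_L2_add[OF test_function_facts(2)[OF p(1)] test_function_facts(2)[OF p(2)]]
   by (auto simp: test_graph_def test_functions_eq p(3,4) intro!: image_eqI[of _ _ "\<lambda>x. \<phi> x + \<psi> x"])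
  show "(c *\<^sub>C x, c *\<^sub>C y) \<in> test_graph"
   using xy A0l(2)[of x y c] test_function_scale[OF p(1), of c] to_L2_scale[OF test_function_facts(2)[OF p(1)], of c]
   by (auto simp: test_graph_def test_functions_eq p(3,4) intro!: image_eqI[of _ _ "\<lambda>x. c * \<phi> x"])
 qed
 have cl: "P \<in> closure test_graph" if "\<And>n. X n \<in> test_graph" "X \<longlonglongrightarrow> P" for X P using that closure_sequential by blast
 have "(x + x', y + y') \<in> k_ring s" if k: "(x, y) \<in> k_ring s" "(x', y') \<in> k_ring s" for x y x' y'
 proof -
  obtain X X' where X: "\<And>n. X n \<in> test_graph" "X \<longlonglongrightarrow> (x, y)" "\<And>n. X' n \<in> test_graph" "X' \<longlonglongrightarrow> (x', y')"
   using k unfolding k_ring_eq closure_sequential by blast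
  have "(\<lambda>n. X n + X' n) \<longlonglongrightarrow> (x, y) + (x', y')" by (intro tendsto_add X)
  thus ?thesis unfolding k_ring_eq
   by (intro cl[of "\<lambda>n. X n + X' n"]) (use tg(1) X(1,3) in \<open>auto simp: plus_prod_def split_beta\<close>)
 qed
 moreover have "(c *\<^sub>C x, c *\<^sub>C y) \<in> k_ring s" if "(x, y) \<in> k_ring s" for x y c
 proof -
  obtain X where X: "\<And>n. X n \<in> test_graph" "X \<longlonglongrightarrow> (x, y)" using \<open>(x, y) \<in> k_ring s\<close> unfolding k_ring_eq closure_sequential by blast
  have "(\<lambda>n. (c *\<^sub>C fst (X n), c *\<^sub>C snd (X n))) \<longlonglongrightarrow> (c *\<^sub>C x, c *\<^sub>C y)"
   using tendsto_fst[OF X(2)] tendsto_snd[OF X(2)] by (intro tendsto_Pair tendsto_scaleC tendsto_const) simp_all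
  thus ?thesis unfolding k_ring_eq
   by (rule cl[rotated]) (use tg(2)[OF _ zero] X(1) in auto)
 qed
 moreover have "(0, 0) \<in> k_ring s" using zero closure_subset unfolding k_ring_eq by blast
 moreover have "single_valued (k_ring s)"
  using k_ring_kF kk_linear unfolding kF_gt linear_operator_def by (blast intro: single_valued_subset)
 ultimately show ?thesis unfolding linear_operator_def by blast
qed

text \<open>For s < 1 the function G is not in the form domain, which forces c = 0. For s > 1 it is
  in H^(s/2), and the condition that x vanishes at 0 amounts to d = 0.\<close>

theorem friedrichs: "friedrichs_extension (k_ring s) = kF"
proof -
 have fd: "form_domain (k_ring s) = VV" by (rule form_domain_between[OF k_ring_linear order_refl k_ring_kF])
 have "(x, v) \<in> friedrichs_extension (k_ring s) \<longleftrightarrow> (x, v) \<in> kF" for x v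
 proof
  assume "(x, v) \<in> friedrichs_extension (k_ring s)"
  then obtain d c where d: "dec x v d c" and x: "x \<in> VV" unfolding friedrichs_extension_def fd using adjoint_k_ring by blast
  obtain y' where y': "x = J 1 y'" "y' \<in> V' 1" using x unfolding VV_eq[OF zero_less_one] by blast
  obtain y where y: "x = J 1 y + c *\<^sub>C GG 1" "s > 1 \<Longrightarrow> cinner (gg 1) y = d - cor (Theta s 1) * c"
   using regular_J[OF zero_less_one d] by metis
  have c: "c *\<^sub>C GG 1 = J 1 (y' - y)" using y y' by (simp add: clinear_mapD[OF J_linear])
  show "(x, v) \<in> kF"
  proof (cases "s < 1")
   case True
   have "c = 0" using G_not_form[OF zero_less_one True c] .
   thus ?thesis using d True by (auto simp: kF_def kk_def bc_def)
  next
   case False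
   hence s: "s > 1" using s_bounds(3) by simp
   have "J 1 (c *\<^sub>C gg 1) = J 1 (y' - y)" using c by (simp add: clinear_mapD[OF J_linear] J_gg s)
   hence "c *\<^sub>C gg 1 = y' - y" by (rule J_inj[OF zero_less_one])
   hence "cinner (gg 1) (c *\<^sub>C gg 1) = cinner (gg 1) (y' - y)" by simp
   hence "d = 0" using y(2)[OF s] y'(2) by (simp add: V'_def cinner_diff cinner_scaleC_right gg_norm(1)[OF zero_less_one s] mult.commute)
   thus ?thesis using d s by (auto simp: kF_def kk_def bc_def zero_ereal_def)
  qed
 next
  assume k: "(x, v) \<in> kF"
  hence "(x, v) \<in> adjoint_op (k_ring s)" unfolding adjoint_k_ring by (auto simp: kF_gt kk_def)
  moreover have "x \<in> VV" using kF_form[OF zero_less_one k] unfolding VV_eq[OF zero_less_one] by blast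
  ultimately show "(x, v) \<in> friedrichs_extension (k_ring s)" unfolding friedrichs_extension_def fd by blast
 qed
 thus ?thesis by auto
qed

lemma form_domain_kF: "form_domain kF = VV"
 by (rule form_domain_between[OF _ k_ring_kF order_refl]) (simp add: kF_gt kk_linear)

end

section \<open>The forms of the other extensions\<close>

context fractional_order
begin

lemma Theta_inverse:
 assumes "t / c0 > 0"
 shows "Theta s ((t / c0) powr (1 / \<beta>)) = t"
proof -
 have "((t / c0) powr (1 / \<beta>)) powr \<beta> = t / c0" using assms beta(2) unfolding powr_powr by (simp only: divide_self_if nonzero_divide_eq_eq times_divide_eq_left mult_1 powr_one if_False)
 moreover have "(t / c0) powr (1 / \<beta>) > 0" using assms by (metis powr_gt_zero less_irrefl)
 ultimately show ?thesis using c0_sign(3) by (simp add: Theta_eq)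
qed

text \<open>The parameter l is found by prescribing \<Theta>. For s < 1 the coefficient is a -
  \<Theta>, and \<Theta> = -(|a| + 1) makes it positive. For s > 1 it is \<Theta> (a - \<Theta>) /
  a, which is positive at \<Theta> = |a| / 2 for either sign of a.\<close>

lemma form_coeff_pos:
 assumes "s > 1 \<longrightarrow> a \<noteq> 0" obtains l where "l > 0" "form_coeff s a l > 0"
proof (cases "s < 1")
 case True
 let ?l = "(- (\<bar>a\<bar> + 1) / c0) powr (1 / \<beta>)"
 have p: "- (\<bar>a\<bar> + 1) / c0 > 0" using c0_sign(1)[OF True] by (intro divide_neg_neg) auto
 have "form_coeff s a ?l > 0" using True unfolding form_coeff_def Theta_inverse[OF p] theta_def by (auto simp: abs_if)
 moreover have "?l > 0" using p by (metis powr_gt_zero less_irrefl)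
 ultimately show ?thesis using that by blast
next
 case False
 hence s: "s > 1" using s_bounds(3) by simp
 let ?l = "(\<bar>a\<bar> / 2 / c0) powr (1 / \<beta>)"
 have p: "\<bar>a\<bar> / 2 / c0 > 0" using c0_sign(2)[OF s] mp[OF assms s] by simp
 have "form_coeff s a ?l > 0" using s mp[OF assms s] unfolding form_coeff_def Theta_inverse[OF p] theta_def
  by (auto simp: abs_if field_simps)
 moreover have "?l > 0" using p by (metis powr_gt_zero less_irrefl)
 ultimately show ?thesis using that by blast
qed

lemma V'_subspace: assumes "y \<in> V' l" "y' \<in> V' l" shows "y + t *\<^sub>C y' \<in> V' l"
 using assms by (simp add: V'_def cinner_add_right cinner_scaleC_right)

text \<open>For s > 1 the regular part at l need not vanish at 0. Moving t \<open>gg l\<close> with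
  t = (a - \<Theta>) c / \<Theta> from y to the singular part puts y into \<open>V' l\<close> and
  changes the coefficient of G from c to c + t = (a / \<Theta>) c. This is where the summand 1 /
  \<Theta> of \<open>form_coeff\<close> comes from.\<close>

lemma kk_form:
 assumes l: "l > 0" and a: "s > 1 \<longrightarrow> a \<noteq> 0" and d: "dec x v (cor a * c) c"
 obtains y where "y \<in> V' l" "x = J l y + (if s < 1 then c else cor (a / Theta s l) * c) *\<^sub>C GG l"
  "cinner x v = cor ((norm y)\<^sup>2 + form_coeff s a l * (cmod (if s < 1 then c else cor (a / Theta s l) * c))\<^sup>2 - l * (norm x)\<^sup>2)"
proof -
 have cv: "cinner x v = cinner x (v + cor l *\<^sub>C x) - cor l * cor ((norm x)\<^sup>2)"
  by (simp add: cinner_add_right cinner_scaleC_right cinner_norm)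
 let ?T = "Theta s l"
 obtain y where y: "x = J l y + c *\<^sub>C GG l" "s > 1 \<Longrightarrow> cinner (gg l) y = cor a * c - cor ?T * c"
  "cinner x (v + cor l *\<^sub>C x) = cor ((norm y)\<^sup>2) + cnj c * (cor a * c - cor ?T * c)"
  using regular_J[OF l d] by metis
 have "cnj c * (cor a * c - cor ?T * c) = cor (a - ?T) * (c * cnj c)" by (simp add: algebra_simps)
 also have "... = cor ((a - ?T) * (cmod c)\<^sup>2)" by (simp only: complex_norm_square[symmetric] of_real_mult[symmetric])
 finally have yc: "cinner x (v + cor l *\<^sub>C x) = cor ((norm y)\<^sup>2 + (a - ?T) * (cmod c)\<^sup>2)" using y(3) by simp
 show ?thesis
 proof (cases "s < 1")
  case True
  have "form_coeff s a l = a - ?T" using True by (simp add: form_coeff_def theta_def)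
  thus ?thesis using True y(1) cv yc l by (intro that[of y]) (simp_all add: V'_def gg_zero)
 next
  case False
  hence s: "s > 1" using s_bounds(3) by simp
  have T: "?T > 0" by (rule gg_norm(2)[OF l s])
  have a0: "a \<noteq> 0" by (rule mp[OF a s])
  define t where "t = cor ((a - ?T) / ?T) * c"
  have gy: "cinner (gg l) y = cor ?T * t" unfolding y(2)[OF s] t_def using T by (simp add: field_simps)
  let ?y = "y + (- t) *\<^sub>C gg l"
  have V: "?y \<in> V' l" unfolding V'_def mem_Collect_eq cinner_add_right cinner_scaleC_right gy gg_norm(1)[OF l s] by simp
  have "y = ?y + t *\<^sub>C gg l" by simp
  hence "cinner y y = cinner (?y + t *\<^sub>C gg l) (?y + t *\<^sub>C gg l)" by simp
  also have "... = cinner ?y ?y + t * (cnj t * cor ?T)"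
   using gg_real[OF l V, of t] s gg_norm(1)[OF l s]
   by (simp only: cinner_add_left[of ?y] cinner_add_right[of _ ?y] cinner_scaleC_left cinner_scaleC_right) simp
  also have "t * (cnj t * cor ?T) = cor (?T * (cmod t)\<^sup>2)"
   by (simp only: of_real_mult complex_norm_square mult_ac)
  finally have ny: "(norm y)\<^sup>2 = (norm ?y)\<^sup>2 + ?T * (cmod t)\<^sup>2" unfolding cinner_norm of_real_add[symmetric] of_real_eq_iff .
  have x: "x = J l ?y + (cor (a / ?T) * c) *\<^sub>C GG l"
  proof -
   have "cor (a / ?T) * c = t + c" unfolding t_def using T by (simp add: field_simps)
   thus ?thesis unfolding y(1) by (simp add: clinear_mapD[OF J_linear[OF l]] J_gg[OF l s] L2C.scale_left_distrib)
  qed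
  have "?T * (cmod t)\<^sup>2 + (a - ?T) * (cmod c)\<^sup>2 = form_coeff s a l * (cmod (cor (a / ?T) * c))\<^sup>2"
  proof -
   \<comment> \<open>Both sides equal a (a - \<Theta>) / \<Theta>, since \<open>form_coeff\<close>
     is \<Theta> (a - \<Theta>) / a; for a = \<Theta> both are 0.\<close>
   have "?T * ((a - ?T) / ?T)\<^sup>2 + (a - ?T) = form_coeff s a l * (a / ?T)\<^sup>2"
    using T s a0 by (auto simp: form_coeff_def theta_def field_simps power2_eq_square)
   hence "(?T * ((a - ?T) / ?T)\<^sup>2 + (a - ?T)) * (cmod c)\<^sup>2 = form_coeff s a l * (a / ?T)\<^sup>2 * (cmod c)\<^sup>2" by simp
   thus ?thesis unfolding t_def norm_mult norm_of_real power_mult_distrib power2_abs distrib_right mult.assoc .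
  qed
  hence E: "(norm y)\<^sup>2 + (a - ?T) * (cmod c)\<^sup>2 = (norm ?y)\<^sup>2 + form_coeff s a l * (cmod (cor (a / ?T) * c))\<^sup>2" using ny by linarith
  have "cinner x v = cor ((norm ?y)\<^sup>2 + form_coeff s a l * (cmod (cor (a / ?T) * c))\<^sup>2 - l * (norm x)\<^sup>2)"
   unfolding cv yc E of_real_diff of_real_mult[of l] ..
  thus ?thesis using that[of ?y] V x unfolding if_not_P[OF False] by blast
 qed
qed

lemma G_V:
 assumes l: "l > 0" and y: "y \<in> V' l" and e: "k *\<^sub>C GG l = J l y" shows "k = 0"
proof (cases "s < 1")
 case True
 thus ?thesis using G_not_form[OF l True e] by simp
next
 case False
 hence s: "s > 1" using s_bounds(3) by simp
 have "J l (k *\<^sub>C gg l) = J l y" using e by (simp add: clinear_mapD[OF J_linear[OF l]] J_gg[OF l s])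
 hence "k *\<^sub>C gg l = y" by (rule J_inj[OF l])
 thus ?thesis using y gg_norm[OF l s] by (auto simp: V'_def cinner_scaleC_right)
qed

text \<open>The multipliers satisfy m / (m + l) + l / (m + l) = 1.\<close>

lemma nabla_norm:
 assumes l: "l > 0"
 shows "(norm (app (abs_nabla (s / 2)) (J l y)))\<^sup>2 = (norm y)\<^sup>2 - l * (norm (J l y))\<^sup>2"
proof -
 let ?r = "\<lambda>p. cor (sqrt (m p)) * jh l p"
 have mm: "?r p = cor (sqrt (m p) / sqrt (m p + l))" for p by (simp add: jh_def)
 have b: "bounded_borel ?r"
  by (rule bounded_borelI[of _ 1]) (use m_pos[OF l] l in \<open>auto simp: jh_def norm_mult norm_divide\<close>)
 let ?h = "ifourier (mulop ?r (fourier y))"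
 have h: "AE p in lborel. rep_L2 (fourier ?h) p = ?r p * rep_L2 (fourier y) p"
  unfolding fourier_ifourier by (rule rep_mulop[OF b])
 have "AE p in lborel. rep_L2 (fourier ?h) p = cor (sqrt (m p)) * rep_L2 (fourier (J l y)) p"
  using h rep_fourier_J[OF l, of y] by eventually_elim simp
 hence in_h: "(J l y, ?h) \<in> abs_nabla (s / 2)" unfolding abs_nabla_def fourier_multiplier_def m_sqrt by blast
 have "single_valued (abs_nabla (s / 2))"
  unfolding single_valued_def abs_nabla_def fourier_multiplier_def
  by (auto simp: L2_eq_fourier elim: eventually_elim2)
 hence app: "app (abs_nabla (s / 2)) (J l y) = ?h" using in_h by (rule app_eq)
 have sq: "(norm x)\<^sup>2 = (LBINT p. (cmod (rep_L2 (fourier x) p))\<^sup>2)" "integrable lborel (\<lambda>p. (cmod (rep_L2 (fourier x) p))\<^sup>2)" for x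
  using norm_L2_sq[of "fourier x"] square_integrable_rep[of "fourier x"] by (simp_all add: fourier_norm square_integrable_def)
 have "(norm ?h)\<^sup>2 + l * (norm (J l y))\<^sup>2 = (LBINT p. (cmod (rep_L2 (fourier ?h) p))\<^sup>2 + l * (cmod (rep_L2 (fourier (J l y)) p))\<^sup>2)"
  unfolding sq(1)[of ?h] sq(1)[of "J l y"] using sq(2)[of ?h] sq(2)[of "J l y"] by simp
 also have "... = (LBINT p. (cmod (rep_L2 (fourier y) p))\<^sup>2)"
 proof (rule integral_cong_AE)
  show "AE p in lborel. (cmod (rep_L2 (fourier ?h) p))\<^sup>2 + l * (cmod (rep_L2 (fourier (J l y)) p))\<^sup>2 = (cmod (rep_L2 (fourier y) p))\<^sup>2"
   using h rep_fourier_J[OF l, of y]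
  proof eventually_elim
   case (elim p)
   have "(cmod (?r p))\<^sup>2 + l * (cmod (jh l p))\<^sup>2 = 1"
    using m_pos[OF l, of p] unfolding mm by (simp add: jh_def norm_divide power_divide flip: add_divide_distrib)
   hence "((cmod (?r p))\<^sup>2 + l * (cmod (jh l p))\<^sup>2) * (cmod (rep_L2 (fourier y) p))\<^sup>2 = (cmod (rep_L2 (fourier y) p))\<^sup>2" by simp
   thus ?case unfolding elim norm_mult[of _ "rep_L2 _ _"] power_mult_distrib by (simp only: distrib_right mult.assoc)
  qed
 qed measurable
 finally show ?thesis unfolding app sq(1)[of y] by simp
qed

text \<open>Turns closure in the Sobolev norm into closure in L2. The constant 2 is the root of a
  crude 4 in the comparison of (1 + p^2)^(s/2) with 1 + |p|^s.\<close>

lemma sobolev_norm_J: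
 shows "sobolev_norm (s / 2) (J 1 y) \<le> 2 * norm y" "norm y \<le> 2 * sobolev_norm (s / 2) (J 1 y)"
proof -
 define w where "w p = cor ((1 + p\<^sup>2) powr (s / 2 / 2) / sqrt (m p + 1))" for p :: real
 have rt: "(1 + p\<^sup>2) powr (s / 2 / 2) = sqrt ((1 + p\<^sup>2) powr (s / 2))" for p :: real
  by (simp add: powr_half_sqrt[symmetric] powr_powr)
 have nz: "1 + p\<^sup>2 > (0::real)" for p by (rule add_pos_nonneg[OF zero_less_one zero_le_power2])
 have up: "cmod (w p) \<le> 2" for p
 proof -
  have "(1 + p\<^sup>2) powr (s / 2) \<le> 2 powr (s / 2) * (1 + m p)" using powr_weight_bounds(2)[OF s_bounds(4), of p] by (simp add: m_def)
  also have "... \<le> 2 powr 2 * (1 + m p)" using s_bounds by (intro mult_right_mono powr_mono) auto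
  finally have "(1 + p\<^sup>2) powr (s / 2) \<le> 2\<^sup>2 * (m p + 1)" by (simp add: powr_numeral)
  hence "sqrt ((1 + p\<^sup>2) powr (s / 2)) \<le> sqrt (2\<^sup>2) * sqrt (m p + 1)" unfolding real_sqrt_mult[symmetric] by (rule real_sqrt_le_mono)
  hence "(1 + p\<^sup>2) powr (s / 2 / 2) \<le> 2 * sqrt (m p + 1)" unfolding rt by (simp only: real_sqrt_abs abs_numeral)
  thus ?thesis using m_pos[of 1 p] unfolding w_def norm_of_real by (simp add: divide_le_eq)
 qed
 have lo: "1 \<le> 2 * cmod (w p)" for p
 proof -
  have "m p + 1 \<le> 2\<^sup>2 * (1 + p\<^sup>2) powr (s / 2)"
   using powr_weight_bounds(1)[OF s_bounds(4), of p] ge_one_powr_ge_zero[of "1 + p\<^sup>2" "s / 2"] s_bounds by (simp add: m_def)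
  hence "sqrt (m p + 1) \<le> sqrt (2\<^sup>2) * sqrt ((1 + p\<^sup>2) powr (s / 2))" unfolding real_sqrt_mult[symmetric] by (rule real_sqrt_le_mono)
  hence "sqrt (m p + 1) \<le> 2 * (1 + p\<^sup>2) powr (s / 2 / 2)" unfolding rt by (simp only: real_sqrt_abs abs_numeral)
  thus ?thesis using m_pos[of 1 p] unfolding w_def norm_of_real by (simp add: le_divide_eq)
 qed
 have b: "bounded_borel w" by (rule bounded_borelI[OF _ up]) (simp add: w_def[abs_def])
 have sq: "square_integrable (\<lambda>p. w p * rep_L2 (fourier y) p)" by (rule square_integrable_mult[OF b]) simp
 have "to_L2 (sobolev_weight (s / 2) (J 1 y)) = to_L2 (\<lambda>p. w p * rep_L2 (fourier y) p)"
 proof (rule to_L2_cong)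
  show "AE p in lborel. sobolev_weight (s / 2) (J 1 y) p = w p * rep_L2 (fourier y) p"
   using rep_fourier_J[OF zero_less_one, of y] by eventually_elim (simp add: sobolev_weight_def w_def jh_def)
  show "(\<lambda>p. w p * rep_L2 (fourier y) p) \<in> borel_measurable borel" by (rule square_integrable_measurable[OF sq])
 qed (simp add: sobolev_weight_def[abs_def])
 hence n: "sobolev_norm (s / 2) (J 1 y) = norm (to_L2 (\<lambda>p. w p * rep_L2 (fourier y) p))" by (simp add: sobolev_norm_def)
 have y: "norm y = norm (to_L2 (rep_L2 (fourier y)))" by (simp add: fourier_norm)
 show "sobolev_norm (s / 2) (J 1 y) \<le> 2 * norm y" unfolding n y
  by (rule norm_to_L2_le[OF sq]) (use up in \<open>auto simp: norm_mult intro!: mult_right_mono\<close>)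
 have "cmod (rep_L2 (fourier y) p) \<le> 2 * cmod (w p * rep_L2 (fourier y) p)" for p
  using mult_right_mono[OF lo[of p] norm_ge_zero[of "rep_L2 (fourier y) p"]] by (simp add: norm_mult)
 thus "norm y \<le> 2 * sobolev_norm (s / 2) (J 1 y)" unfolding n y
  by (intro norm_to_L2_le[OF _ sq]) auto
qed

lemma VV_sobolev: "VV = (if s < 1 then sobolev (s / 2) else sobolev0 (s / 2))"
proof (cases "s < 1")
 case True
 thus ?thesis by (simp add: VV_def)
next
 case False
 have rng: "test_functions \<subseteq> range (J 1)"
 proof
  fix x assume "x \<in> test_functions"
  then obtain \<phi> where \<phi>: "test_function \<phi>" "x = to_L2 \<phi>" by (auto simp: test_functions_eq)
  obtain y where "J 1 y = to_L2 \<phi>" by (rule test_preimage[OF zero_less_one \<phi>(1)])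
  thus "x \<in> range (J 1)" unfolding \<phi>(2) by (metis rangeI)
 qed
 have "J 1 y \<in> sobolev0 (s / 2) \<longleftrightarrow> y \<in> V' 1" for y
 proof -
  let ?S = "\<lambda>e. \<exists>u. J 1 u \<in> test_functions \<and> sobolev_norm (s / 2) (J 1 (y - u)) < e" and ?N = "\<lambda>e. \<exists>u. J 1 u \<in> test_functions \<and> norm (y - u) < e"
  have "J 1 y \<in> sobolev0 (s / 2) \<longleftrightarrow> (\<forall>e>0. ?S e)"
  proof -
   have "(\<exists>\<phi>\<in>test_functions. sobolev_norm (s / 2) (J 1 y - \<phi>) < e) \<longleftrightarrow> ?S e" for e
    unfolding clinear_mapD[OF J_linear[OF zero_less_one]] using rng by blast
   thus ?thesis unfolding sobolev0_def sobolev_half[OF zero_less_one] by blast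
  qed
  also have "... \<longleftrightarrow> (\<forall>e>0. ?N e)"
  proof (intro iffI allI impI)
   fix e :: real assume h: "\<forall>e>0. ?S e" "e > 0"
   then obtain u where "J 1 u \<in> test_functions" "sobolev_norm (s / 2) (J 1 (y - u)) < e / 2" using half_gt_zero by blast
   thus "?N e" using sobolev_norm_J(2)[of "y - u"] by (intro exI[of _ u]) auto
  next
   fix e :: real assume h: "\<forall>e>0. ?N e" "e > 0"
   then obtain u where "J 1 u \<in> test_functions" "norm (y - u) < e / 2" using half_gt_zero by blast
   thus "?S e" using sobolev_norm_J(1)[of "y - u"] by (intro exI[of _ u]) auto
  qed
  also have "... \<longleftrightarrow> y \<in> V' 1" unfolding closure_tests[OF zero_less_one, symmetric] closure_approachable by (simp add: dist_norm norm_minus_commute)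
  finally show ?thesis .
 qed
 moreover have "sobolev0 (s / 2) \<subseteq> range (J 1)" by (auto simp: sobolev0_def sobolev_half[OF zero_less_one])
 ultimately show ?thesis using False unfolding VV_eq[OF zero_less_one] by auto
qed

definition "jj l w = J l (fst w) + snd w *\<^sub>C GG l" for l w
definition "D_form a l = {w \<in> V' l \<times> UNIV. jj l w \<in> Domain (kk (ereal a))}" for a l

lemma jj_inj: assumes l: "l > 0" "w \<in> V' l \<times> UNIV" "w' \<in> V' l \<times> UNIV" "jj l w = jj l w'" shows "w = w'"
proof -
 have V: "fst w' - fst w \<in> V' l" using l(2,3) by (auto simp: V'_def cinner_diff)
 have e: "(snd w - snd w') *\<^sub>C GG l = J l (fst w' - fst w)"
  using l(4) by (simp add: jj_def clinear_mapD[OF J_linear[OF l(1)]] L2C.scale_left_diff_distrib algebra_simps)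
 hence s: "snd w = snd w'" using G_V[OF l(1) V e] by simp
 hence "fst w = fst w'" using l(4) J_inj[OF l(1)] by (simp add: jj_def)
 thus ?thesis using s by (simp add: prod_eq_iff)
qed

lemma kk_member: "(x, v) \<in> kk (ereal a) \<longleftrightarrow> (\<exists>c. dec x v (cor a * c) c)"
 by (simp add: kk_def bc_def)

lemma jj_linear: "l > 0 \<Longrightarrow> jj l (w - w') = jj l w - jj l w'"
 by (simp add: jj_def clinear_mapD[OF J_linear] L2C.scale_left_diff_distrib)

lemma kk_comb: assumes "x \<in> Domain (kk \<alpha>)" "x' \<in> Domain (kk \<alpha>)" shows "x + t *\<^sub>C x' \<in> Domain (kk \<alpha>)"
 using assms kk_linear[of \<alpha>] unfolding linear_operator_def by blast

lemma D_form:
 assumes l: "l > 0" and a: "s > 1 \<longrightarrow> a \<noteq> 0"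
 shows "w \<in> D_form a l \<Longrightarrow> w' \<in> D_form a l \<Longrightarrow> w - w' \<in> D_form a l"
  "Domain (kk (ereal a)) = jj l ` D_form a l"
  "w \<in> D_form a l \<Longrightarrow> cinner (jj l w) (app (kk (ereal a)) (jj l w)) = cor ((norm (fst w))\<^sup>2 + form_coeff s a l * (cmod (snd w))\<^sup>2 - l * (norm (jj l w))\<^sup>2)"
  "closure (D_form a l) = V' l \<times> UNIV"
proof -
 have dec: "\<exists>w\<in>V' l \<times> UNIV. x = jj l w \<and> cinner x v = cor ((norm (fst w))\<^sup>2 + form_coeff s a l * (cmod (snd w))\<^sup>2 - l * (norm x)\<^sup>2)"
  if xv: "(x, v) \<in> kk (ereal a)" for x v
 proof -
  obtain c where "dec x v (cor a * c) c" using xv kk_member by blast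
  thus ?thesis by (rule kk_form[OF l a]) (auto simp: jj_def)
 qed
 show 1: "w - w' \<in> D_form a l" if "w \<in> D_form a l" "w' \<in> D_form a l" for w w'
  using that kk_comb[of "jj l w" "ereal a" "jj l w'" "-1"] V'_subspace[of "fst w" l "fst w'" "-1"]
  by (auto simp: D_form_def jj_linear[OF l] mem_Times_iff)
 show "Domain (kk (ereal a)) = jj l ` D_form a l"
  using dec unfolding D_form_def by blast
 show "cinner (jj l w) (app (kk (ereal a)) (jj l w)) = cor ((norm (fst w))\<^sup>2 + form_coeff s a l * (cmod (snd w))\<^sup>2 - l * (norm (jj l w))\<^sup>2)"
  if w: "w \<in> D_form a l" for w
 proof -
  obtain v where v: "(jj l w, v) \<in> kk (ereal a)" using w by (auto simp: D_form_def)
  obtain w' where w': "w' \<in> V' l \<times> UNIV" "jj l w = jj l w'"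
   "cinner (jj l w) v = cor ((norm (fst w'))\<^sup>2 + form_coeff s a l * (cmod (snd w'))\<^sup>2 - l * (norm (jj l w))\<^sup>2)" using dec[OF v] by blast
  have "w = w'" using w w'(1,2) by (intro jj_inj[OF l]) (auto simp: D_form_def)
  moreover have "app (kk (ereal a)) (jj l w) = v" using kk_linear v by (intro app_eq) (auto simp: linear_operator_def)
  ultimately show ?thesis using w'(3) by simp
 qed
 show "closure (D_form a l) = V' l \<times> UNIV"
 proof
  have "closure (V' l \<times> (UNIV::complex set)) = V' l \<times> UNIV" by (simp add: closure_Times closure_V'[OF l])
  thus "closure (D_form a l) \<subseteq> V' l \<times> UNIV" using closure_mono[of "D_form a l" "V' l \<times> UNIV"] by (auto simp: D_form_def)
  \<comment> \<open>One element of the domain with c = 1 suffices: its coefficient k1 at G is not 0,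
    so its multiples, corrected by preimages of test functions, reach every coefficient.\<close>
  obtain x v where d: "dec x v (cor a * 1) 1" by (rule dec_surjective)
  define k1 where "k1 = (if s < 1 then 1 else cor (a / Theta s l) * 1)"
  have "k1 \<noteq> 0" using a gg_norm(2)[OF l] s_bounds(3) by (auto simp: k1_def)
  moreover have "x \<in> Domain (kk (ereal a))" using d kk_member by blast
  ultimately obtain y1 where y1: "y1 \<in> V' l" "J l y1 + k1 *\<^sub>C GG l \<in> Domain (kk (ereal a))" "k1 \<noteq> 0"
   using kk_form[OF l a d] unfolding k1_def by metis
  show "V' l \<times> UNIV \<subseteq> closure (D_form a l)"
  proof (clarify)
   fix y k assume y: "y \<in> V' l"
   let ?t = "k / k1"
   have "y + (- ?t) *\<^sub>C y1 \<in> closure {y. J l y \<in> test_functions}"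
    unfolding closure_tests[OF l] by (rule V'_subspace[OF y y1(1)])
   then obtain Y where Y: "\<And>n. J l (Y n) \<in> test_functions" "Y \<longlonglongrightarrow> y + (- ?t) *\<^sub>C y1" unfolding closure_sequential by blast
   have "(Y n + ?t *\<^sub>C y1, k) \<in> D_form a l" for n
   proof -
    obtain \<phi> where \<phi>: "test_function \<phi>" "J l (Y n) = to_L2 \<phi>" using Y(1)[of n] by (auto simp: test_functions_eq)
    obtain g where "(J l (Y n), g) \<in> test_graph" using test_function_in_graph[OF \<phi>(1)] \<phi>(2) by metis
    hence "J l (Y n) \<in> Domain (kk (ereal a))" using test_graph_kk by blast
    hence "J l (Y n) + ?t *\<^sub>C (J l y1 + k1 *\<^sub>C GG l) \<in> Domain (kk (ereal a))" by (rule kk_comb[OF _ y1(2)])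
    moreover have "J l (Y n) + ?t *\<^sub>C (J l y1 + k1 *\<^sub>C GG l) = jj l (Y n + ?t *\<^sub>C y1, k)"
     using y1(3) by (simp add: jj_def clinear_mapD[OF J_linear[OF l]] L2C.scale_right_distrib)
    ultimately show ?thesis using V'_subspace[OF test_in_V'[OF l Y(1)] y1(1)] by (simp add: D_form_def)
   qed
   moreover have "(\<lambda>n. (Y n + ?t *\<^sub>C y1, k)) \<longlonglongrightarrow> (y + (- ?t) *\<^sub>C y1 + ?t *\<^sub>C y1, k)" by (intro tendsto_intros Y(2))
   hence "(\<lambda>n. (Y n + ?t *\<^sub>C y1, k)) \<longlonglongrightarrow> (y, k)" by simp
   ultimately show "(y, k) \<in> closure (D_form a l)" unfolding closure_sequential by (intro exI[of _ "\<lambda>n. (Y n + ?t *\<^sub>C y1, k)"]) simp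
  qed
 qed
qed

text \<open>Approximating sequences with the stated form value exist for every l. That all such
  sequences have the same limit, and what the form domain is, comes from one k with positive
  coefficient.\<close>

theorem form_kk:
 assumes a: "s > 1 \<longrightarrow> a \<noteq> 0" and l: "l > 0"
 shows "direct_sum (form_domain (kk (ereal a))) VV (L2C.span {GG l})"
  "F \<in> VV \<Longrightarrow> form_value (kk (ereal a)) (F + \<kappa> *\<^sub>C GG l) =
    (norm (app (abs_nabla (s / 2)) F))\<^sup>2 - l * (norm (F + \<kappa> *\<^sub>C GG l))\<^sup>2 + l * (norm F)\<^sup>2 + form_coeff s a l * (cmod \<kappa>)\<^sup>2"
proof -
 let ?A = "kk (ereal a)"
 have approx: "\<exists>X. form_approx ?A (jj k w) X \<and> (\<lambda>n. Re (cinner (X n) (app ?A (X n)))) \<longlonglongrightarrow> (norm (fst w))\<^sup>2 + form_coeff s a k * (cmod (snd w))\<^sup>2 - k * (norm (jj k w))\<^sup>2"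
  if k: "k > 0" and w: "fst w \<in> V' k" for k w
 proof -
  note D = D_form[OF k a]
  show ?thesis
   using form_closure(1)[OF J_linear[OF k] J_norm[OF k] D(1) D(2)[unfolded jj_def[abs_def]] D(3)[unfolded jj_def[abs_def]], of w] w
   unfolding D(4) jj_def by (simp add: mem_Times_iff)
 qed
 obtain k where k: "k > 0" "form_coeff s a k > 0" using form_coeff_pos[OF a] by blast
 have conv: "\<exists>w\<in>V' k \<times> UNIV. x = jj k w \<and> (\<lambda>n. Re (cinner (X n) (app ?A (X n)))) \<longlonglongrightarrow> (norm (fst w))\<^sup>2 + form_coeff s a k * (cmod (snd w))\<^sup>2 - k * (norm x)\<^sup>2"
  if X: "form_approx ?A x X" for x X
 proof -
  note D = D_form[OF k(1) a]
  show ?thesis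
   using form_closure(2)[OF J_linear[OF k(1)] J_norm[OF k(1)] D(1) D(2)[unfolded jj_def[abs_def]] D(3)[unfolded jj_def[abs_def]] k(2) X]
   unfolding D(4) jj_def by auto
 qed
 have fv: "form_value ?A x = r" if X: "form_approx ?A x X" "(\<lambda>n. Re (cinner (X n) (app ?A (X n)))) \<longlonglongrightarrow> r" for x X r
 proof -
  have lim: "(\<lambda>n. Re (cinner (X' n) (app ?A (X' n)))) \<longlonglongrightarrow> r" if X': "form_approx ?A x X'" for X'
  proof -
   obtain w w' where w: "w \<in> V' k \<times> UNIV" "x = jj k w" "(\<lambda>n. Re (cinner (X n) (app ?A (X n)))) \<longlonglongrightarrow> (norm (fst w))\<^sup>2 + form_coeff s a k * (cmod (snd w))\<^sup>2 - k * (norm x)\<^sup>2"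
    "w' \<in> V' k \<times> UNIV" "x = jj k w'" "(\<lambda>n. Re (cinner (X' n) (app ?A (X' n)))) \<longlonglongrightarrow> (norm (fst w'))\<^sup>2 + form_coeff s a k * (cmod (snd w'))\<^sup>2 - k * (norm x)\<^sup>2"
    using conv[OF X(1)] conv[OF X'] by blast
   have "w = w'" using w(2,5) by (intro jj_inj[OF k(1) w(1,4)]) simp
   thus ?thesis using w(6) LIMSEQ_unique[OF X(2) w(3)] by simp
  qed
  show ?thesis unfolding form_value_def
   by (rule the_equality) (use lim X LIMSEQ_unique in blast)+
 qed
 show "form_value ?A (F + \<kappa> *\<^sub>C GG l) =
    (norm (app (abs_nabla (s / 2)) F))\<^sup>2 - l * (norm (F + \<kappa> *\<^sub>C GG l))\<^sup>2 + l * (norm F)\<^sup>2 + form_coeff s a l * (cmod \<kappa>)\<^sup>2" if FV: "F \<in> VV"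
 proof -
  obtain y where y: "F = J l y" "y \<in> V' l" using FV unfolding VV_eq[OF l] by blast
  obtain X where X: "form_approx ?A (jj l (y, \<kappa>)) X"
   "(\<lambda>n. Re (cinner (X n) (app ?A (X n)))) \<longlonglongrightarrow> (norm y)\<^sup>2 + form_coeff s a l * (cmod \<kappa>)\<^sup>2 - l * (norm (jj l (y, \<kappa>)))\<^sup>2"
   using approx[OF l, of "(y, \<kappa>)"] y(2) by auto
  show ?thesis using fv[OF X] unfolding y(1) nabla_norm[OF l] by (simp add: jj_def)
 qed
 have dom: "form_domain ?A = jj k ` (V' k \<times> UNIV)"
  using approx[OF k(1)] conv unfolding form_domain_def by fastforce
 have sub: "F + \<kappa> *\<^sub>C GG h \<in> form_domain ?A" if h: "h > 0" and FV: "F \<in> VV" for F \<kappa> h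
 proof -
  obtain y where "F = J h y" "y \<in> V' h" using FV unfolding VV_eq[OF h] by blast
  thus ?thesis using approx[OF h, of "(y, \<kappa>)"] unfolding form_domain_def jj_def by auto
 qed
 have VVc: "u + t *\<^sub>C v \<in> VV" if uv: "u \<in> VV" "v \<in> VV" for u v t
 proof -
  obtain y y' where "u = J 1 y" "y \<in> V' 1" "v = J 1 y'" "y' \<in> V' 1" using uv unfolding VV_eq[OF zero_less_one] by blast
  thus ?thesis unfolding VV_eq[OF zero_less_one]
   by (intro image_eqI[of _ _ "y + t *\<^sub>C y'"] V'_subspace) (simp_all add: clinear_mapD[OF J_linear])
 qed
 have V0: "0 \<in> VV" unfolding VV_eq[OF zero_less_one] by (intro image_eqI[of _ _ 0]) (simp_all add: V'_def clinear_mapD[OF J_linear])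
 have Gn: "t = 0" if "t *\<^sub>C GG l \<in> VV" for t
 proof -
  obtain y where "t *\<^sub>C GG l = J l y" "y \<in> V' l" using \<open>t *\<^sub>C GG l \<in> VV\<close> unfolding VV_eq[OF l] by blast
  thus ?thesis by (intro G_V[OF l])
 qed
 \<comment> \<open>Modulo \<open>VV\<close>, \<open>GG l\<close> is a nonzero multiple of
   \<open>GG k\<close>, which transfers the decomposition from k to l.\<close>
 have "GG l \<in> jj k ` (V' k \<times> UNIV)" using sub[OF l V0, of 1] unfolding dom by simp
 then obtain y1 k1 where g: "y1 \<in> V' k" "GG l = J k y1 + k1 *\<^sub>C GG k" unfolding jj_def by fastforce
 have Jy1: "J k y1 \<in> VV" using g(1) VV_eq[OF k(1)] by blast
 have k1: "k1 \<noteq> 0" using Gn[of 1] g(2) Jy1 by auto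
 have Gk: "GG k = (1 / k1) *\<^sub>C GG l + (- 1 / k1) *\<^sub>C J k y1"
  unfolding g(2) using k1 by (simp add: L2C.scale_right_distrib)
 have sup: "\<exists>F t. F \<in> VV \<and> x = F + t *\<^sub>C GG l" if x: "x \<in> form_domain ?A" for x
 proof -
  obtain y t where y: "y \<in> V' k" "x = J k y + t *\<^sub>C GG k" using x unfolding dom jj_def by fastforce
  have "x = (J k y + (t * (- 1 / k1)) *\<^sub>C J k y1) + (t / k1) *\<^sub>C GG l"
   unfolding y(2) Gk by (simp add: L2C.scale_right_distrib L2C.scale_right_diff_distrib)
  moreover have "J k y \<in> VV" using y(1) VV_eq[OF k(1)] by blast
  ultimately show ?thesis using VVc[OF _ Jy1] by blast
 qed
 have "form_domain ?A = {v + w |v w. v \<in> VV \<and> w \<in> L2C.span {GG l}}"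
  unfolding L2C.span_singleton
 proof (intro subset_antisym subsetI)
  fix x assume "x \<in> form_domain ?A"
  thus "x \<in> {v + w |v w. v \<in> VV \<and> w \<in> range (\<lambda>k. k *\<^sub>C GG l)}" using sup by blast
 qed (use sub[OF l] in blast)
 moreover have "VV \<inter> L2C.span {GG l} = {0}"
  using Gn V0 unfolding L2C.span_singleton by (auto intro: image_eqI[of _ _ 0])
 ultimately show "direct_sum (form_domain ?A) VV (L2C.span {GG l})" unfolding direct_sum_def by blast
qed

end

section \<open>Spectra\<close>

lemma resolvent_limit_zero:
 fixes K :: "real \<Rightarrow> complex" and y :: "real \<Rightarrow> real"
 assumes K: "integrable lborel K" and y [measurable]: "y \<in> borel_measurable borel" and y0: "\<And>p. y p \<ge> 0"
  and z: "\<And>\<tau>. \<tau> > 0 \<Longrightarrow> (LBINT p. K p / cor (1 + \<tau> * y p)) = 0"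
 shows "(LBINT p. K p) = 0"
proof -
 have [measurable]: "K \<in> borel_measurable borel" using K by auto
 have "(\<lambda>n. \<integral>p. K p / cor (1 + 1 / real (Suc n) * y p) \<partial>lborel) \<longlonglongrightarrow> (LBINT p. K p)"
 proof (rule integral_dominated_convergence[where w = "\<lambda>p. cmod (K p)"])
  show "AE p in lborel. (\<lambda>n. K p / cor (1 + 1 / real (Suc n) * y p)) \<longlonglongrightarrow> K p"
  proof (rule AE_I2)
   fix p
   have "(\<lambda>n. 1 + 1 / real (Suc n) * y p) \<longlonglongrightarrow> 1 + 0 * y p" by (intro tendsto_intros LIMSEQ_inverse_real_of_nat[unfolded inverse_eq_divide])
   from tendsto_divide[OF tendsto_const[of "K p"] tendsto_of_real[OF this, where 'a = complex]]
   show "(\<lambda>n. K p / cor (1 + 1 / real (Suc n) * y p)) \<longlonglongrightarrow> K p" by simp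
  qed
  show "AE p in lborel. norm (K p / cor (1 + 1 / real (Suc n) * y p)) \<le> cmod (K p)" for n
  proof (rule AE_I2)
   fix p
   have "1 \<le> 1 + 1 / real (Suc n) * y p" using y0[of p] by simp
   hence "cmod (K p) / (1 + 1 / real (Suc n) * y p) \<le> cmod (K p) / 1" by (intro divide_left_mono) auto
   moreover have "\<bar>1 + 1 / real (Suc n) * y p\<bar> = 1 + 1 / real (Suc n) * y p" using \<open>1 \<le> 1 + 1 / real (Suc n) * y p\<close> by linarith
   ultimately show "norm (K p / cor (1 + 1 / real (Suc n) * y p)) \<le> cmod (K p)" by (simp only: norm_divide norm_of_real div_by_1)
  qed
 qed (use K in auto)
 moreover have "(LBINT p. K p / cor (1 + 1 / real (Suc n) * y p)) = 0" for n by (rule z) simp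
 ultimately show ?thesis by (simp add: LIMSEQ_const_iff)
qed

text \<open>The identity K y / (1 + \<tau> y) = (K - K / (1 + \<tau> y)) / \<tau> passes the
  hypothesis on from K to K y; at every stage the limit \<tau> -> 0 yields a vanishing
  moment.\<close>

lemma resolvent_moments:
 fixes K :: "real \<Rightarrow> complex" and y :: "real \<Rightarrow> real"
 assumes K: "integrable lborel K" and y [measurable]: "y \<in> borel_measurable borel" and y0: "\<And>p. 0 \<le> y p" "\<And>p. y p \<le> C"
  and z: "\<And>\<tau>. \<tau> > 0 \<Longrightarrow> (LBINT p. K p / cor (1 + \<tau> * y p)) = 0"
 shows "integrable lborel (\<lambda>p. K p * cor (y p ^ n)) \<and> (LBINT p. K p * cor (y p ^ n)) = 0"
 using K z
proof (induction n arbitrary: K)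
 case 0
 thus ?case using resolvent_limit_zero[OF 0(1) y y0(1) 0(2)] by simp
next
 case (Suc n)
 have [measurable]: "K \<in> borel_measurable borel" using Suc(2) by auto
 let ?K = "\<lambda>p. K p * cor (y p)"
 have iK: "integrable lborel ?K"
  by (rule Bochner_Integration.integrable_bound[OF integrable_mult_left[OF Suc(2), of "cor C"]])
    (use y0 order_trans[OF y0] in \<open>auto simp: norm_mult intro!: AE_I2 mult_left_mono\<close>)
 have "(LBINT p. ?K p / cor (1 + \<tau> * y p)) = 0" if \<tau>: "\<tau> > 0" for \<tau>
 proof -
  let ?q = "\<lambda>p. cor (1 + \<tau> * y p)"
  have q: "1 \<le> cmod (?q p)" for p using y0(1)[of p] \<tau> unfolding norm_of_real by simp
  have i2: "integrable lborel (\<lambda>p. K p / ?q p)"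
  proof (rule Bochner_Integration.integrable_bound[OF Suc(2)])
   show "AE p in lborel. norm (K p / ?q p) \<le> norm (K p)"
    unfolding norm_divide using frac_le[OF norm_ge_zero order_refl zero_less_one q] by (intro AE_I2) simp
  qed measurable
  have "?K p / ?q p = (K p - K p / ?q p) / cor \<tau>" for p
  proof -
   have "?q p \<noteq> 0" using q[of p] by (metis norm_zero not_one_le_zero)
   thus ?thesis using \<tau> by (simp add: divide_simps) (simp add: algebra_simps)
  qed
  thus ?thesis using resolvent_limit_zero[OF Suc(2) y y0(1) Suc(3)] Suc(2,3) i2 \<tau> by simp
 qed
 from Suc(1)[OF iK this] show ?case by (simp add: mult_ac)
qed

text \<open>The range of y is compact, so Weierstrass approximation extends the vanishing from
  polynomials to continuous functions of y.\<close>

lemma continuous_function_moments: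
 fixes K :: "real \<Rightarrow> complex" and y :: "real \<Rightarrow> real"
 assumes K: "integrable lborel K" and y [measurable]: "y \<in> borel_measurable borel" and y0: "\<And>p. y p \<in> {0..C}"
  and z: "\<And>n. integrable lborel (\<lambda>p. K p * cor (y p ^ n))" "\<And>n. (LBINT p. K p * cor (y p ^ n)) = 0"
  and \<phi>: "continuous_on {0..C} \<phi>" and \<phi>m [measurable]: "(\<lambda>p. \<phi> (y p)) \<in> borel_measurable borel"
 shows "(LBINT p. K p * cor (\<phi> (y p))) = 0"
proof -
 have [measurable]: "K \<in> borel_measurable borel" using K by auto
 let ?N = "\<integral>p. cmod (K p) \<partial>lborel"
 have bnd: "cmod (LBINT p. K p * cor (\<phi> (y p))) \<le> 0 + e * (?N + 1)" if e: "e > 0" for e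
 proof -
  obtain g where g: "real_polynomial_function g" "\<And>x. x \<in> {0..C} \<Longrightarrow> \<bar>\<phi> x - g x\<bar> < e"
   using Stone_Weierstrass_real_polynomial_function[OF compact_Icc \<phi> e] by blast
  obtain c N where gs: "g = (\<lambda>x. \<Sum>i\<le>N::nat. c i * x ^ i)" using g(1) unfolding real_polynomial_function_iff_sum by blast
  have gy: "K p * cor (g (y p)) = (\<Sum>i\<le>N. cor (c i) * (K p * cor (y p ^ i)))" for p
   unfolding gs by (simp add: sum_distrib_left mult_ac)
  have gi: "integrable lborel (\<lambda>p. K p * cor (g (y p)))" unfolding gy by (intro Bochner_Integration.integrable_sum integrable_mult_right z(1))
  have g0: "(LBINT p. K p * cor (g (y p))) = 0"
   unfolding gy using z by (subst Bochner_Integration.integral_sum) auto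
  have [measurable]: "(\<lambda>p. g (y p)) \<in> borel_measurable borel" unfolding gs by measurable
  let ?d = "\<lambda>p. K p * cor (\<phi> (y p) - g (y p))"
  have b: "cmod (?d p) \<le> e * cmod (K p)" for p
   using less_imp_le[OF g(2)[OF y0[of p]]] by (simp only: norm_mult norm_of_real mult.commute[of e]) (rule mult_left_mono, auto)
  have di: "integrable lborel ?d"
   by (rule Bochner_Integration.integrable_bound[OF integrable_mult_right[OF integrable_norm[OF K], of e]]) (use b e in \<open>auto intro!: AE_I2\<close>)
  have "(LBINT p. K p * cor (\<phi> (y p))) = (LBINT p. ?d p + K p * cor (g (y p)))" by (simp add: right_diff_distrib)
  also have "... = (LBINT p. ?d p)" using g0 by (subst Bochner_Integration.integral_add[OF di gi]) simp
  also have "cmod \<dots> \<le> (LBINT p. e * cmod (K p))"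
   by (rule Bochner_Integration.integral_norm_bound_integral[OF di integrable_mult_right[OF integrable_norm[OF K]] b])
  also have "... \<le> e * (?N + 1)" using e by (simp add: distrib_left)
  finally show ?thesis by simp
 qed
 have N: "?N + 1 > 0" by (simp add: add_nonneg_pos)
 have "cmod (LBINT p. K p * cor (\<phi> (y p))) \<le> 0"
 proof (rule field_le_epsilon)
  fix e :: real assume "e > 0"
  thus "cmod (LBINT p. K p * cor (\<phi> (y p))) \<le> 0 + e" using bnd[of "e / (?N + 1)"] N by simp
 qed
 thus ?thesis by simp
qed

text \<open>As functions of y = 1 / (|p|^s + b) the kernels give all moments of y, these all
  continuous functions of y, and among them y cos (t p). Together with evenness, Fourier uniqueness
  applies.\<close>

lemma resolvent_total:
 fixes h :: "real \<Rightarrow> complex"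
 assumes s: "s > 0" and b: "b > 0" and even: "\<And>p. h (- p) = h p"
  and i: "integrable lborel (\<lambda>p. h p / cor (\<bar>p\<bar> powr s + b))"
  and z: "\<And>a. a > b \<Longrightarrow> (LBINT p. h p / cor (\<bar>p\<bar> powr s + a)) = 0"
 shows "AE p in lborel. h p = 0"
proof -
 let ?K = "\<lambda>p. h p / cor (\<bar>p\<bar> powr s + b)"
 define y where "y p = 1 / (\<bar>p\<bar> powr s + b)" for p
 have pos: "\<bar>p\<bar> powr s + a > 0" if "a > 0" for a p using that by (simp add: add_nonneg_pos)
 have [measurable]: "y \<in> borel_measurable borel" unfolding y_def[abs_def] by measurable
 have y0: "0 < y p" "y p \<le> 1 / b" for p using pos[OF b, of p] b by (auto simp: y_def intro!: divide_left_mono mult_pos_pos)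
 have "(LBINT p. ?K p / cor (1 + \<tau> * y p)) = 0" if \<tau>: "\<tau> > 0" for \<tau>
 proof -
  have "?K p / cor (1 + \<tau> * y p) = h p / cor (\<bar>p\<bar> powr s + (b + \<tau>))" for p
  proof -
   have "(\<bar>p\<bar> powr s + b) * (1 + \<tau> * y p) = \<bar>p\<bar> powr s + (b + \<tau>)" using pos[OF b, of p] by (simp add: y_def field_simps)
   thus ?thesis unfolding divide_divide_eq_left of_real_mult[symmetric] by simp
  qed
  hence "(LBINT p. ?K p / cor (1 + \<tau> * y p)) = (LBINT p. h p / cor (\<bar>p\<bar> powr s + (b + \<tau>)))" by (rule Bochner_Integration.integral_cong[OF refl])
  also have "... = 0" by (rule z) (use \<tau> in simp)
  finally show ?thesis .
 qed
 note mom = this[THEN resolvent_moments[OF i \<open>y \<in> borel_measurable borel\<close> less_imp_le[OF y0(1)] y0(2)]]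
 have inv: "(1 / y p - b) powr (1 / s) = \<bar>p\<bar>" for p using s b by (simp add: y_def powr_powr)
 have cos0: "(LBINT p. (?K p * cor (y p)) * cor (cos (t * p))) = 0" for t
 proof -
  \<comment> \<open>The factor x makes \<open>\<phi>\<close> continuous at 0, which corresponds to p
    at infinity; the maximum keeps the base of the power nonnegative on both sides of 1/b.\<close>
  define \<phi> where "\<phi> x = x * cos (t * (max 0 (1 / x - b)) powr (1 / s))" for x
  have \<phi>y: "\<phi> (y p) = y p * cos (t * p)" for p
  proof -
   have "1 / y p - b \<ge> 0" by (simp add: y_def)
   hence "\<phi> (y p) = y p * cos (t * \<bar>p\<bar>)" by (simp add: \<phi>_def inv)
   also have "cos (t * \<bar>p\<bar>) = cos (t * p)" by (cases "p \<ge> 0") auto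
   finally show ?thesis .
  qed
  have "continuous_on {0..1 / b} \<phi>"
   unfolding continuous_on_def
  proof
   fix x assume x: "x \<in> {0..1 / b}"
   show "(\<phi> \<longlongrightarrow> \<phi> x) (at x within {0..1 / b})"
   proof (cases "x = 0")
    case True
    have "((\<lambda>x. \<bar>x\<bar>) \<longlongrightarrow> \<bar>0 :: real\<bar>) (at 0 within {0..1 / b})" by (intro tendsto_intros)
    hence "(\<phi> \<longlongrightarrow> 0) (at 0 within {0..1 / b})"
     by (intro Lim_null_comparison[of \<phi> "\<lambda>x. \<bar>x\<bar>"]) (auto simp: \<phi>_def abs_mult intro!: mult_left_le always_eventually)
    thus ?thesis using True by (simp add: \<phi>_def)
   next
    case False
    have "isCont (\<lambda>x. max 0 (1 / x - b)) x" using False by (intro continuous_intros) auto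
    hence "((\<lambda>x. (max 0 (1 / x - b)) powr (1 / s)) \<longlongrightarrow> (max 0 (1 / x - b)) powr (1 / s)) (at x)"
     using s by (intro tendsto_powr') (auto simp: isCont_def)
    hence "(\<phi> \<longlongrightarrow> \<phi> x) (at x)" unfolding \<phi>_def by (intro tendsto_mult tendsto_cos tendsto_const tendsto_ident_at)
    thus ?thesis by (rule tendsto_within_subset[OF _ subset_UNIV])
   qed
  qed
  moreover have "(\<lambda>p. \<phi> (y p)) \<in> borel_measurable borel" unfolding \<phi>y by measurable
  ultimately have "(LBINT p. ?K p * cor (\<phi> (y p))) = 0"
   using continuous_function_moments[OF i _ _ mom[THEN conjunct1] mom[THEN conjunct2], of "1 / b" \<phi>] y0 by (auto simp: less_imp_le)
  thus ?thesis unfolding \<phi>y by (simp add: mult.assoc)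
 qed
 let ?L = "\<lambda>p. ?K p * cor (y p)"
 have Li: "integrable lborel ?L" using mom[of 1] by simp
 have Le: "?L (- p) = ?L p" for p by (simp add: even y_def)
 have "(LBINT p. exp (\<i> * cor (t * p)) * ?L p) = 0" for t
 proof -
  let ?e = "\<lambda>t p. exp (\<i> * cor (t * p))"
  have ei: "integrable lborel (\<lambda>p. ?e t p * ?L p)" for t using integrable_exp_mult[OF Li, of "- t"] by simp
  have "(LBINT p. ?e (- t) p * ?L p) = (LBINT p. ?e t p * ?L p)"
   using integral_lborel_uminus[of "\<lambda>p. ?e t p * ?L p"] unfolding Le by simp
  moreover have "?e t p + ?e (- t) p = 2 * cor (cos (t * p))" for p
   by (simp add: cos_of_real[symmetric] cos_exp_eq del: of_real_mult)
  hence "?e t p * ?L p + ?e (- t) p * ?L p = 2 * (?L p * cor (cos (t * p)))" for p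
   unfolding distrib_right[symmetric] by (simp only: mult_ac)
  hence "(LBINT p. ?e t p * ?L p) + (LBINT p. ?e (- t) p * ?L p) = 0"
   unfolding Bochner_Integration.integral_add[OF ei ei, symmetric] using cos0[of t] by (simp only: integral_mult_right_zero mult_zero_right)
  ultimately show ?thesis by simp
 qed
 hence "AE p in lborel. ?L p = 0" by (rule L1_Fourier_uniqueness[OF Li])
 thus ?thesis
 proof eventually_elim
  case (elim p)
  thus ?case using y0(1)[of p] pos[OF b, of p] by (auto simp flip: of_real_add)
 qed
qed

lemma even_odd_orthogonal: assumes "refl_L2 x = x" "refl_L2 y = - y" shows "cinner x y = 0"
proof -
 have "cinner x y = cinner x (- y)" using refl_cinner[of x y] assms by simp
 thus ?thesis by simp
qed

context fractional_order
begin

lemma G_continuous: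
 assumes X: "X \<longlonglongrightarrow> l" "\<And>n. X n > 0" and l: "l > 0"
 shows "(\<lambda>n. GG (X n)) \<longlonglongrightarrow> GG l"
proof -
 have "norm (GG (X n) - GG l) \<le> \<bar>l - X n\<bar> * (1 / X n * norm (GG l))" for n
  unfolding G_R0[OF X(2) l, symmetric] norm_scaleC norm_of_real by (intro mult_left_mono R0_norm X(2)) auto
 moreover have "(\<lambda>n. \<bar>l - X n\<bar> * (1 / X n * norm (GG l))) \<longlonglongrightarrow> \<bar>l - l\<bar> * (1 / l * norm (GG l))"
  by (intro tendsto_mult tendsto_rabs tendsto_diff tendsto_divide tendsto_const X(1)) (use l in simp)
 hence "(\<lambda>n. \<bar>l - X n\<bar> * (1 / X n * norm (GG l))) \<longlonglongrightarrow> 0" by simp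
 ultimately have "(\<lambda>n. GG (X n) - GG l) \<longlonglongrightarrow> 0" by (rule Lim_null_comparison[OF always_eventually[OF allI]])
 thus ?thesis by (simp add: LIM_zero_cancel)
qed

lemma Theta_continuous:
 assumes X: "X \<longlonglongrightarrow> l" "\<And>n. X n > 0" and l: "l > 0"
 shows "(\<lambda>n. Theta s (X n)) \<longlonglongrightarrow> Theta s l"
proof -
 have "(\<lambda>n. c0 * X n powr \<beta>) \<longlonglongrightarrow> c0 * l powr \<beta>" using l by (intro tendsto_mult tendsto_powr tendsto_const X(1)) simp
 thus ?thesis by (simp add: Theta_eq X(2) l)
qed

lemma refl_G: assumes "l > 0" shows "refl_L2 (fourier (GG l)) = fourier (GG l)"
proof -
 have "(\<lambda>p. ih l (- p)) = ih l" by (rule ext) (simp add: ih_def m_def)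
 thus ?thesis unfolding fourier_G clinear_mapD[OF refl_linear] refl_to_L2[OF ih_sq[OF assms]] by simp
qed

lemma wt_even: "wt \<alpha> (- p) = wt \<alpha> p" by (simp add: wt_def)

lemma wt_pos: assumes "p \<noteq> 0" shows "wt \<alpha> p > 0"
proof -
 let ?z = "cor \<alpha> - cor c0 * cor (\<bar>p\<bar> powr (1 - s)) * cis (- (\<beta> * pi))"
 have "Im ?z = c0 * (\<bar>p\<bar> powr (1 - s)) * sin (\<beta> * pi)" by simp
 hence "Im ?z \<noteq> 0" using assms c0_sign(3,4) sin_beta by simp
 hence "?z \<noteq> 0" by (metis zero_complex.simps(2))
 thus ?thesis unfolding wt_def by simp
qed

end

section \<open>The bound state and the Gram matrix of the spectral model\<close>

locale point_perturbation = fractional_order +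
 fixes \<alpha> :: real
begin

definition "bound \<longleftrightarrow> (s - 1) * \<alpha> > 0"
definition "E = eigenvalue_E s \<alpha>"
text \<open>The normalised eigenvector, or 0 without a bound state, with -1 as dummy eigenvalue;
  this is the convention of \<open>multiplication_model\<close>.\<close>

definition "eg = (if bound then cor (1 / norm (GG E)) *\<^sub>C GG E else 0)"
definition "lam = (if bound then - E else - 1)"

lemma bound_sign: "bound \<longleftrightarrow> \<alpha> / c0 > 0"
 unfolding bound_def using c0_sign s_bounds(3)
 by (cases "s < 1") (auto simp: zero_less_mult_iff zero_less_divide_iff)

lemma E_eq: "E = (\<alpha> / c0) powr (1 / \<beta>)"
proof -
 have "s / (1 - s) = 1 / \<beta>" using s_bounds by (simp add: \<beta>_def field_simps)
 moreover have "\<alpha> * s * sin (pi / s) = \<alpha> / c0" by (simp add: c0_def)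
 ultimately show ?thesis by (simp only: E_def eigenvalue_E_def)
qed

lemma E_pos: "bound \<Longrightarrow> E > 0" unfolding E_eq bound_sign by (metis powr_gt_zero less_irrefl)

lemma Theta_E: "bound \<Longrightarrow> Theta s E = \<alpha>" unfolding E_eq bound_sign by (rule Theta_inverse)

lemma lam_neg: "lam < 0" using E_pos by (simp add: lam_def)

lemma Theta_ne: assumes "a > 0" "Theta s a = \<alpha>" shows "bound" "a = E"
proof -
 have q: "\<alpha> / c0 = a powr \<beta>" using assms Theta_eq[of a] c0_sign(3) by (auto simp: field_simps)
 thus "bound" using assms(1) by (simp add: bound_sign)
 show "a = E" unfolding E_eq q powr_powr using assms(1) beta(2) by simp
qed

text \<open>Above E, so that parameters from \<open>b0\<close> on avoid the zero of \<alpha> -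
  \<Theta>, and larger than -\<open>lam\<close> in both cases.\<close>

definition "b0 = 2 + (if bound then E else 0)"

lemma b0: "b0 > 0" "bound \<Longrightarrow> b0 > E" using E_pos by (auto simp: b0_def add_pos_pos)

lemma ge_b0: assumes "a \<ge> b0" shows "a > 0" "Theta s a \<noteq> \<alpha>" "bound \<Longrightarrow> a > E" "bound \<Longrightarrow> a \<noteq> E" "a + lam > 0" "\<alpha> - Theta s a \<noteq> 0"
proof -
 show a: "a > 0" and aE: "bound \<Longrightarrow> a > E" using b0 assms by linarith+
 thus "bound \<Longrightarrow> a \<noteq> E" by blast
 show T: "Theta s a \<noteq> \<alpha>"
 proof
  assume "Theta s a = \<alpha>"
  thus False using Theta_ne[OF a] aE by auto
 qed
 thus "\<alpha> - Theta s a \<noteq> 0" by simp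
 show "a + lam > 0"
 proof (cases "bound")
  case False
  thus ?thesis using assms by (simp add: b0_def lam_def)
 qed (use aE in \<open>simp add: lam_def\<close>)
qed

definition "rr a = 1 / (\<alpha> - Theta s a)" for a
text \<open>With the factor \<open>rr a\<close> these multiples of \<open>GG a\<close> satisfy, for
  the perturbed resolvent, the same identity as 1 / (m + a) under multiplication. In
  \<open>vv\<close> the bound state is removed, and sqrt (2 pi) makes the Gram matrix equal to that
  of \<open>uf\<close>.\<close>

definition "ee a = cor (rr a) *\<^sub>C GG a" for a
definition "uf a p = cor (wt \<alpha> p / (m p + a))" for a p :: real
definition "vv a = cor (sqrt (2 * pi)) *\<^sub>C (ee a - cinner eg (ee a) *\<^sub>C eg)" for a

lemma uf_measurable [measurable]: "uf a \<in> borel_measurable borel" unfolding uf_def[abs_def] by measurable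

lemma uf_sq: assumes "a \<ge> b0" shows "square_integrable (uf a)"
proof -
 note a = ge_b0[OF assms]
 have "a \<noteq> 2 * a" "2 * a > 0" "bound \<Longrightarrow> E \<noteq> a \<and> E \<noteq> 2 * a" using a(1,3) by auto
 hence "integrable lborel (\<lambda>p. 2 * ((wt \<alpha> p)\<^sup>2 / ((m p + a) * (m p + 2 * a))))"
  using reciprocal_integral(1)[OF a(1), of "2 * a" \<alpha>] unfolding bound_def E_def by (intro integrable_mult_right) blast
 hence "integrable lborel (\<lambda>p. (cmod (uf a p))\<^sup>2)"
 proof (rule Bochner_Integration.integrable_bound)
  show "AE p in lborel. norm ((cmod (uf a p))\<^sup>2) \<le> norm (2 * ((wt \<alpha> p)\<^sup>2 / ((m p + a) * (m p + 2 * a))))"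
  proof (rule AE_I2)
   fix p
   have q: "0 < m p + a" "0 < m p + 2 * a" "m p + 2 * a \<le> 2 * (m p + a)" using m_pos[OF a(1), of p] m_nonneg[of p] a(1) by (simp_all del: m_nonneg)
   have "(wt \<alpha> p)\<^sup>2 / (m p + a)\<^sup>2 = 2 * (wt \<alpha> p)\<^sup>2 / ((m p + a) * (2 * (m p + a)))"
    using q(1) by (simp add: power2_eq_square divide_simps)
   also have "... \<le> 2 * (wt \<alpha> p)\<^sup>2 / ((m p + a) * (m p + 2 * a))"
    using q by (intro divide_left_mono mult_left_mono mult_pos_pos) auto
   finally have "(wt \<alpha> p)\<^sup>2 / (m p + a)\<^sup>2 \<le> 2 * ((wt \<alpha> p)\<^sup>2 / ((m p + a) * (m p + 2 * a)))" by simp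
   moreover have "(cmod (uf a p))\<^sup>2 = (wt \<alpha> p)\<^sup>2 / (m p + a)\<^sup>2" unfolding uf_def norm_of_real by (simp add: power_divide)
   ultimately show "norm ((cmod (uf a p))\<^sup>2) \<le> norm (2 * ((wt \<alpha> p)\<^sup>2 / ((m p + a) * (m p + 2 * a))))" using q by simp
  qed
 qed measurable
 thus ?thesis by (simp add: square_integrable_def)
qed

lemma eg_norm: "cinner eg eg = (if bound then 1 else 0)"
proof (cases bound)
 case True
 have "norm eg = 1" using True G_nz[OF E_pos[OF True]] by (simp add: eg_def norm_scaleC norm_divide)
 thus ?thesis using True by (simp add: cinner_norm)
qed (simp add: eg_def)

lemma ee_ee:
 assumes "a \<ge> b0" "a' \<ge> b0" "a \<noteq> a'"
 shows "cinner (ee a) (ee a') = cor ((rr a - rr a') / (a' - a))"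
proof -
 have "cinner (ee a) (ee a') = cor (rr a * (rr a' * ((Theta s a - Theta s a') / (a' - a))))"
  unfolding ee_def cinner_scaleC_left cinner_scaleC_right cinner_G[OF ge_b0(1)[OF assms(1)] ge_b0(1)[OF assms(2)] assms(3)]
  by (simp only: complex_cnj_complex_of_real of_real_mult mult_ac)
 also have "rr a * (rr a' * ((Theta s a - Theta s a') / (a' - a))) = (rr a - rr a') / (a' - a)"
  using ge_b0(6)[OF assms(1)] ge_b0(6)[OF assms(2)] assms(3) by (simp add: rr_def divide_simps)
 finally show ?thesis .
qed

lemma eg_ee:
 assumes "a \<ge> b0" "bound"
 shows "cinner eg (ee a) = cor (1 / (norm (GG E) * (a - E)))"
proof -
 have "cinner eg (ee a) = cor (1 / norm (GG E) * (rr a * ((Theta s E - Theta s a) / (a - E))))"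
  using assms(2) unfolding eg_def ee_def if_P[OF assms(2)] cinner_scaleC_left cinner_scaleC_right cinner_G[OF E_pos[OF assms(2)] ge_b0(1)[OF assms(1)] ge_b0(4)[OF assms, symmetric]]
  by (simp only: complex_cnj_complex_of_real of_real_mult mult_ac)
 also have "1 / norm (GG E) * (rr a * ((Theta s E - Theta s a) / (a - E))) = 1 / (norm (GG E) * (a - E))"
  using ge_b0(6)[OF assms(1)] by (simp add: rr_def Theta_E[OF assms(2)])
 finally show ?thesis .
qed

lemma vv_vv: "cinner (vv a) (vv a') = cor (2 * pi) * (cinner (ee a) (ee a') - cnj (cinner eg (ee a)) * cinner eg (ee a'))"
proof -
 let ?p = "cinner eg (ee a)" and ?p' = "cinner eg (ee a')"
 have g: "cnj ?p * (?p' * cinner eg eg) = cnj ?p * ?p'" using eg_norm by (cases bound) (simp_all add: eg_def)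
 have "cinner (ee a - ?p *\<^sub>C eg) (ee a' - ?p' *\<^sub>C eg) = cinner (ee a) (ee a') - ?p' * cinner (ee a) eg - (cnj ?p * ?p' - cnj ?p * (?p' * cinner eg eg))"
  by (simp add: cinner_diff cinner_scaleC_left cinner_scaleC_right algebra_simps)
 also have "... = cinner (ee a) (ee a') - cnj ?p * ?p'" unfolding g using cinner_commute[of "ee a" eg] by simp
 finally have "cinner (ee a - ?p *\<^sub>C eg) (ee a' - ?p' *\<^sub>C eg) = cinner (ee a) (ee a') - cnj ?p * ?p'" .
 thus ?thesis unfolding vv_def cinner_scaleC_left cinner_scaleC_right
  by (simp only: complex_cnj_complex_of_real mult.assoc[symmetric] of_real_mult[symmetric] real_sqrt_mult_self) simp
qed

text \<open>\<open>cinner_G\<close> needs distinct parameters, so the norm is obtained as a limit of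
  divided differences, that is as minus the derivative of \<Theta> at E; there \<Theta> =
  \<alpha>.\<close>

lemma G_E_norm: assumes "bound" shows "(norm (GG E))\<^sup>2 = - \<beta> * \<alpha> / E"
proof -
 note E = E_pos[OF assms]
 define X where "X n = E + 1 / real (Suc n)" for n
 have Xp: "X n > 0" "X n \<noteq> E" for n using E by (simp_all add: X_def add_pos_pos)
 have h: "(\<lambda>n. 1 / real (Suc n)) \<longlonglongrightarrow> 0" using LIMSEQ_inverse_real_of_nat by (simp add: inverse_eq_divide)
 have X: "X \<longlonglongrightarrow> E" unfolding X_def using tendsto_add[OF tendsto_const[of E] h] by simp
 have "((\<lambda>l. c0 * l powr \<beta>) has_real_derivative c0 * (\<beta> * E powr (\<beta> - 1))) (at E)"
  by (intro DERIV_cmult has_real_derivative_powr E)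
 hence "(\<lambda>h. (c0 * (E + h) powr \<beta> - c0 * E powr \<beta>) / h) \<midarrow>0\<rightarrow> c0 * (\<beta> * E powr (\<beta> - 1))" by (simp add: DERIV_def)
 hence "(\<lambda>n. (c0 * (E + 1 / real (Suc n)) powr \<beta> - c0 * E powr \<beta>) / (1 / real (Suc n))) \<longlonglongrightarrow> c0 * (\<beta> * E powr (\<beta> - 1))"
  by (rule LIMSEQ_SEQ_conv[THEN iffD2, rule_format, OF _ conjI]) (use h in auto)
 hence "(\<lambda>n. - ((c0 * (E + 1 / real (Suc n)) powr \<beta> - c0 * E powr \<beta>) / (1 / real (Suc n)))) \<longlonglongrightarrow> - (c0 * (\<beta> * E powr (\<beta> - 1)))" by (rule tendsto_minus)
 moreover have "- ((c0 * (E + 1 / real (Suc n)) powr \<beta> - c0 * E powr \<beta>) / (1 / real (Suc n))) = Re (cinner (GG E) (GG (X n)))" for n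
  unfolding cinner_G[OF E Xp(1) Xp(2)[symmetric]] Re_complex_of_real Theta_eq[OF E] Theta_eq[OF Xp(1)] by (simp add: X_def field_simps)
 ultimately have "(\<lambda>n. Re (cinner (GG E) (GG (X n)))) \<longlonglongrightarrow> - (c0 * (\<beta> * E powr (\<beta> - 1)))" by simp
 moreover have "(\<lambda>n. Re (cinner (GG E) (GG (X n)))) \<longlonglongrightarrow> Re (cinner (GG E) (GG E))"
  by (intro tendsto_Re tendsto_cinner tendsto_const G_continuous[OF X Xp(1) E])
 ultimately have "Re (cinner (GG E) (GG E)) = - (c0 * (\<beta> * E powr (\<beta> - 1)))" by (metis LIMSEQ_unique)
 moreover have "c0 * E powr \<beta> = \<alpha>" using Theta_E[OF assms] Theta_eq[OF E] by simp
 ultimately show ?thesis using E by (simp add: Re_cinner_norm powr_diff)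
qed

text \<open>The residue at ln E in \<open>reciprocal_integral\<close> is exactly the rank-one term
  that projecting away the bound state subtracts; \<open>G_E_norm\<close> matches the
  constants.\<close>

lemma gram_off:
 assumes "a \<ge> b0" "a' \<ge> b0" "a \<noteq> a'"
 shows "cinner (to_L2 (uf a)) (to_L2 (uf a')) = cinner (vv a) (vv a')"
proof -
 note A = ge_b0[OF assms(1)] and A' = ge_b0[OF assms(2)]
 have "cinner (to_L2 (uf a)) (to_L2 (uf a')) = (LBINT p. cor ((wt \<alpha> p)\<^sup>2 / ((m p + a) * (m p + a'))))"
  unfolding cinner_to_L2[OF uf_sq[OF assms(1)] uf_sq[OF assms(2)]] by (simp add: uf_def power2_eq_square)
 also have "... = cor (2 * pi / (a' - a) * (rr a - rr a' + (if bound then (a' - a) * E / (\<beta> * \<alpha> * (E - a) * (E - a')) else 0)))"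
  unfolding integral_complex_of_real rr_def bound_def E_def
  by (subst reciprocal_integral(2)[OF A(1) A'(1) assms(3)]) (use A(4) A'(4) in \<open>auto simp: bound_def E_def\<close>)
 also have "... = cinner (vv a) (vv a')"
 proof (cases bound)
  case True
  have N: "norm (GG E) * norm (GG E) = - \<beta> * \<alpha> / E" using G_E_norm[OF True] by (simp add: power2_eq_square)
  have fr: "2 * pi / D * (x + K) = 2 * pi * (x / D - Q)" if "K / D = - Q" for D x K Q :: real
  proof -
   have Q: "Q = - (K / D)" using that by simp
   show ?thesis unfolding Q by (simp add: distrib_left add_divide_distrib)
  qed
  have nz: "\<alpha> \<noteq> 0" "\<beta> \<noteq> 0" "E > 0" using True beta(2) E_pos[OF True] by (auto simp: bound_def)
  have "(a' - a) * E / (\<beta> * \<alpha> * (E - a) * (E - a')) / (a' - a) = - (1 / (norm (GG E) * (a - E)) * (1 / (norm (GG E) * (a' - E))))"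
  proof -
   have "1 / (norm (GG E) * (a - E)) * (1 / (norm (GG E) * (a' - E))) = 1 / ((norm (GG E) * norm (GG E)) * ((a - E) * (a' - E)))" by simp
   also have "... = - (E / (\<beta> * \<alpha> * ((a - E) * (a' - E))))" unfolding N using nz by (simp add: divide_simps)
   also have "(a - E) * (a' - E) = (E - a) * (E - a')" by (simp add: algebra_simps)
   finally show ?thesis using assms(3) by simp
  qed
  hence "2 * pi / (a' - a) * (rr a - rr a' + (a' - a) * E / (\<beta> * \<alpha> * (E - a) * (E - a')))
    = 2 * pi * ((rr a - rr a') / (a' - a) - 1 / (norm (GG E) * (a - E)) * (1 / (norm (GG E) * (a' - E))))"
   by (rule fr)
  thus ?thesis unfolding vv_vv ee_ee[OF assms] eg_ee[OF assms(1) True] eg_ee[OF assms(2) True] if_P[OF True]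
   by (simp only: complex_cnj_complex_of_real of_real_mult of_real_diff)
 next
  case False
  thus ?thesis unfolding vv_vv ee_ee[OF assms] by (simp add: eg_def)
 qed
 finally show ?thesis .
qed

text \<open>The diagonal, where the two poles would coincide, follows by continuity in the second
  parameter.\<close>

lemma gram_even:
 assumes "a \<ge> b0" "a' \<ge> b0"
 shows "cinner (to_L2 (uf a)) (to_L2 (uf a')) = cinner (vv a) (vv a')"
proof (cases "a = a'")
 case True
 note A = ge_b0[OF assms(1)]
 define X where "X n = a + 1 / real (Suc n)" for n
 have h: "(\<lambda>n. 1 / real (Suc n)) \<longlonglongrightarrow> 0" using LIMSEQ_inverse_real_of_nat by (simp add: inverse_eq_divide)
 have X: "X \<longlonglongrightarrow> a" unfolding X_def using tendsto_add[OF tendsto_const[of a] h] by simp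
 have Xa: "X n \<ge> b0" "a \<noteq> X n" "a \<le> X n" for n using assms(1) by (simp_all add: X_def add_increasing2)
 have "(\<lambda>n. to_L2 (uf (X n))) \<longlonglongrightarrow> to_L2 (uf a)"
 proof (rule L2_dominated_convergence(3)[OF uf_sq[OF assms(1)]])
  show "AE p in lborel. (\<lambda>n. uf (X n) p) \<longlonglongrightarrow> uf a p"
   unfolding uf_def using m_pos[OF A(1)] by (intro AE_I2 tendsto_of_real tendsto_divide tendsto_add tendsto_const X) (simp add: less_imp_neq[symmetric])
  show "AE p in lborel. cmod (uf (X n) p) \<le> cmod (uf a p)" for n
   unfolding uf_def norm_of_real abs_divide
   by (intro AE_I2 divide_left_mono) (use m_pos[OF A(1)] m_pos[OF ge_b0(1)[OF Xa(1)]] Xa(3) in \<open>auto simp: abs_of_pos\<close>)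
 qed measurable
 hence L: "(\<lambda>n. cinner (to_L2 (uf a)) (to_L2 (uf (X n)))) \<longlonglongrightarrow> cinner (to_L2 (uf a)) (to_L2 (uf a))" by (intro tendsto_cinner tendsto_const)
 have "(\<lambda>n. ee (X n)) \<longlonglongrightarrow> ee a" unfolding ee_def rr_def
  using A(6) by (intro tendsto_scaleC tendsto_of_real tendsto_divide tendsto_const tendsto_diff G_continuous[OF X ge_b0(1)[OF Xa(1)] A(1)] Theta_continuous[OF X ge_b0(1)[OF Xa(1)] A(1)])
 hence "(\<lambda>n. vv (X n)) \<longlonglongrightarrow> vv a" unfolding vv_def by (intro tendsto_scaleC tendsto_const tendsto_diff tendsto_cinner)
 hence "(\<lambda>n. cinner (vv a) (vv (X n))) \<longlonglongrightarrow> cinner (vv a) (vv a)" by (intro tendsto_cinner tendsto_const)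
 hence "(\<lambda>n. cinner (to_L2 (uf a)) (to_L2 (uf (X n)))) \<longlonglongrightarrow> cinner (vv a) (vv a)" unfolding gram_off[OF assms(1) Xa(1,2)] .
 with L show ?thesis unfolding True[symmetric] by (rule LIMSEQ_unique)
qed (rule gram_off[OF assms])

end

section \<open>The unitary equivalence with multiplication\<close>

context point_perturbation
begin

text \<open>Even functions are generated by \<open>uf\<close>. On odd ones the perturbation is
  invisible, because G is even, and the inverse Fourier transform already diagonalises.\<close>

definition "gens = {(to_L2 (uf a), vv a) | a. a \<ge> b0} \<union> {(x, ifourier x) | x. refl_L2 x = - x}"

lemma refl_uf: "a \<ge> b0 \<Longrightarrow> refl_L2 (to_L2 (uf a)) = to_L2 (uf a)"
 by (simp add: refl_to_L2[OF uf_sq]) (simp add: uf_def[abs_def] wt_even m_def)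

lemma refl_eg: "refl_L2 (fourier eg) = fourier eg"
 using refl_G[OF E_pos] by (simp add: eg_def clinear_mapD[OF fourier_linear] clinear_mapD[OF refl_linear])

lemma cinner_even_ifourier:
 assumes "refl_L2 (fourier x) = fourier x" "refl_L2 y = - y" shows "cinner x (ifourier y) = 0"
 using fourier_cinner[of x "ifourier y"] even_odd_orthogonal[OF assms] by simp

lemma refl_vv: "a \<ge> b0 \<Longrightarrow> refl_L2 (fourier (vv a)) = fourier (vv a)"
 using refl_G[OF ge_b0(1), of a]
 by (simp add: vv_def ee_def clinear_mapD[OF fourier_linear] clinear_mapD[OF refl_linear] refl_eg)

lemma cinner_sym_zero: "cinner x y = 0 \<longleftrightarrow> cinner y x = 0"
 using cinner_commute[of x y] by simp

lemma gram_gens: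
 assumes "(u, v) \<in> gens" "(u', v') \<in> gens" shows "cinner u u' = cinner v v'"
proof -
 have eo0: "cinner u u' = 0 \<and> cinner v v' = 0" if "a \<ge> b0" "u = to_L2 (uf a)" "v = vv a" "refl_L2 u' = - u'" "v' = ifourier u'" for a u v u' v'
  using even_odd_orthogonal[OF refl_uf[OF that(1)] that(4)] cinner_even_ifourier[OF refl_vv[OF that(1)] that(4)] that(2,3,5) by simp
 consider (ee) a a' where "a \<ge> b0" "a' \<ge> b0" "u = to_L2 (uf a)" "v = vv a" "u' = to_L2 (uf a')" "v' = vv a'"
  | (eo) a where "a \<ge> b0" "u = to_L2 (uf a)" "v = vv a" "refl_L2 u' = - u'" "v' = ifourier u'"
  | (oe) a where "a \<ge> b0" "u' = to_L2 (uf a)" "v' = vv a" "refl_L2 u = - u" "v = ifourier u"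
  | (oo) "v = ifourier u" "v' = ifourier u'"
  using assms unfolding gens_def by blast
 thus ?thesis
 proof cases
  case ee
  thus ?thesis using gram_even by simp
 next
  case eo
  thus ?thesis using eo0[OF eo] by simp
 next
  case oe
  hence "cinner u' u = 0 \<and> cinner v' v = 0" by (intro eo0)
  thus ?thesis using cinner_sym_zero[of u u'] cinner_sym_zero[of v v'] by simp
 next
  case oo
  thus ?thesis by (simp add: ifourier_cinner)
 qed
qed

text \<open>Used with the weight \<open>wt \<alpha>\<close> for the totality of the
  \<open>uf\<close> and with weight 1 for that of the G. The representative is symmetrised because
  \<open>resolvent_total\<close> asks for evenness at every point.\<close>

lemma even_total:
 assumes even: "refl_L2 y = y" and g [measurable]: "g \<in> borel_measurable borel" and g0: "\<And>p. p \<noteq> 0 \<Longrightarrow> g p \<noteq> 0" "\<And>p. g (- p) = g p"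
  and sq: "\<And>a. a \<ge> b0 \<Longrightarrow> square_integrable (\<lambda>p. cor (g p / (m p + a)))"
  and z: "\<And>a. a > b0 \<Longrightarrow> cinner (to_L2 (\<lambda>p. cor (g p / (m p + a)))) y = 0"
 shows "y = 0"
proof -
 define Y where "Y p = (rep_L2 y p + rep_L2 y (- p)) / 2" for p
 have Ym [measurable]: "Y \<in> borel_measurable borel" unfolding Y_def[abs_def] by measurable
 have "AE p in lborel. rep_L2 y (- p) = rep_L2 y p" using rep_refl[of y] unfolding even by eventually_elim simp
 hence Yy: "AE p in lborel. Y p = rep_L2 y p" by eventually_elim (simp add: Y_def)
 let ?h = "\<lambda>p. cor (g p) * Y p"
 have int: "(LBINT p. ?h p / cor (\<bar>p\<bar> powr s + a)) = cinner (to_L2 (\<lambda>p. cor (g p / (m p + a)))) y"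
  "integrable lborel (\<lambda>p. ?h p / cor (\<bar>p\<bar> powr s + a))" if a: "a \<ge> b0" for a
 proof -
  have ae: "AE p in lborel. cnj (cor (g p / (m p + a))) * rep_L2 y p = ?h p / cor (\<bar>p\<bar> powr s + a)"
   using Yy by eventually_elim (simp add: m_def)
  have c: "cinner (to_L2 (\<lambda>p. cor (g p / (m p + a)))) (to_L2 (rep_L2 y)) = (LBINT p. cnj (cor (g p / (m p + a))) * rep_L2 y p)"
   by (rule cinner_to_L2[OF sq[OF a] square_integrable_rep])
  also have "... = (LBINT p. ?h p / cor (\<bar>p\<bar> powr s + a))"
   by (rule integral_cong_AE[OF _ _ ae]) measurable
  finally show "(LBINT p. ?h p / cor (\<bar>p\<bar> powr s + a)) = cinner (to_L2 (\<lambda>p. cor (g p / (m p + a)))) y" by simp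
  have "integrable lborel (\<lambda>p. cnj (cor (g p / (m p + a))) * rep_L2 y p)" by (rule integrable_cnj_mult[OF sq[OF a] square_integrable_rep])
  thus "integrable lborel (\<lambda>p. ?h p / cor (\<bar>p\<bar> powr s + a))" by (rule integrable_cong_AE_imp[OF _ _ ae]) measurable
 qed
 have "AE p in lborel. ?h p = 0"
  by (rule resolvent_total[OF s_bounds(4) b0(1)]) (use int z in \<open>auto simp: g0(2) Y_def add.commute\<close>)
 moreover have "AE p in (lborel :: real measure). p \<noteq> 0" by (rule AE_lborel_singleton)
 ultimately have "AE p in lborel. rep_L2 y p = rep_L2 0 p" using Yy rep_zero
  by eventually_elim (use g0(1) in auto)
 thus "y = 0" by (simp add: L2_eq_iff)
qed

lemma odd_part_zero: assumes "\<And>x. refl_L2 x = - x \<Longrightarrow> cinner x y = 0" shows "refl_L2 y = y"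
proof -
 let ?f = "y - refl_L2 y"
 have o: "refl_L2 ?f = - ?f" by (simp add: clinear_mapD[OF refl_linear])
 have "cinner ?f (refl_L2 y) = cinner (refl_L2 ?f) (refl_L2 (refl_L2 y))" by (simp only: refl_cinner)
 hence "cinner ?f (refl_L2 y) = - cinner ?f y" unfolding o by (simp only: cinner_minus refl_refl)
 hence "cinner ?f ?f = 0" using assms[OF o] by (simp only: cinner_diff(2)[of ?f]) simp
 thus ?thesis using cinner_self(3)[of ?f] by simp
qed

lemma gens_total:
 assumes "\<And>a. a > b0 \<Longrightarrow> cinner (to_L2 (uf a)) y = 0" "\<And>x. refl_L2 x = - x \<Longrightarrow> cinner x y = 0"
 shows "y = 0"
proof (rule even_total[OF odd_part_zero, of y "wt \<alpha>"])
 show "p \<noteq> 0 \<Longrightarrow> wt \<alpha> p \<noteq> 0" for p using wt_pos[of p \<alpha>] by simp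
qed (use assms uf_sq in \<open>auto simp: wt_even uf_def[abs_def]\<close>)

definition "rho = cor (inverse (\<alpha> - Theta s b0))"
text \<open>The resolvent at -\<open>b0\<close> given by Krein's formula. By \<open>kk_R\<close>
  this one bounded operator determines the extension, so it is enough to intertwine it.\<close>

definition "R z = R0 b0 z + rho *\<^sub>C (cinner (GG b0) z *\<^sub>C GG b0)" for z

lemma R_linear: "clinear_map R"
 using clinear_mapD[OF R0_linear[OF b0(1)]]
 by (simp add: clinear_map_def R_def cinner_add_right cinner_scaleC_right L2C.scale_left_distrib L2C.scale_right_distrib mult_ac)

lemma kk_R: "(x, v) \<in> kk (ereal \<alpha>) \<longleftrightarrow> x = R (v + cor b0 *\<^sub>C x)"
 using kk_resolvent[OF b0(1) ge_b0(2)[OF order_refl, symmetric], of x "v + cor b0 *\<^sub>C x"]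
 unfolding op_shift_iff R_def rho_def by simp

lemma R_sym: "cinner (R x) y = cinner x (R y)"
 unfolding R_def rho_def by (simp add: cinner_add_left cinner_add_right cinner_scaleC_left cinner_scaleC_right R0_sym[OF b0(1)])
  (simp add: cinner_commute[of x "GG b0"] mult_ac)

lemma R_continuous: "X \<longlonglongrightarrow> x \<Longrightarrow> (\<lambda>n. R (X n)) \<longlonglongrightarrow> R x"
 unfolding R_def by (intro tendsto_add tendsto_scaleC tendsto_const tendsto_cinner clinear_map_bounded_continuous[OF R0_linear[OF b0(1)] R0_norm[OF b0(1)]])

lemma R_G:
 assumes "l > 0" "l \<noteq> b0"
 shows "cor (l - b0) *\<^sub>C R (GG l) = cor ((\<alpha> - Theta s l) * rr b0) *\<^sub>C GG b0 - GG l"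
proof -
 have nz: "\<alpha> - Theta s b0 \<noteq> 0" by (rule ge_b0(6)) simp
 have "cor (l - b0) *\<^sub>C R (GG l) = cor (l - b0) *\<^sub>C R0 b0 (GG l) + (cor (l - b0) * (rho * cinner (GG b0) (GG l))) *\<^sub>C GG b0"
  by (simp add: R_def L2C.scale_right_distrib)
 also have "cor (l - b0) * (rho * cinner (GG b0) (GG l)) = cor ((l - b0) * (inverse (\<alpha> - Theta s b0) * ((Theta s b0 - Theta s l) / (l - b0))))"
  unfolding cinner_G[OF b0(1) assms(1) assms(2)[symmetric]] rho_def by (simp only: of_real_mult)
 also have "(l - b0) * (inverse (\<alpha> - Theta s b0) * ((Theta s b0 - Theta s l) / (l - b0))) = (\<alpha> - Theta s l) * rr b0 - 1"
 proof -
  have "l - b0 \<noteq> 0" using assms(2) by simp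
  hence "(l - b0) * (inverse (\<alpha> - Theta s b0) * ((Theta s b0 - Theta s l) / (l - b0))) = (Theta s b0 - Theta s l) / (\<alpha> - Theta s b0)" by (simp add: divide_inverse)
  also have "... = (\<alpha> - Theta s l) * rr b0 - 1" using nz by (simp add: rr_def divide_simps)
  finally show ?thesis .
 qed
 finally show ?thesis unfolding G_R0[OF b0(1) assms(1)] by (simp add: L2C.scale_left_diff_distrib)
qed

lemma R_eg: "R eg = cor (1 / (b0 + lam)) *\<^sub>C eg"
proof (cases bound)
 case True
 have "cor (E - b0) *\<^sub>C R (GG E) = - GG E"
  using R_G[OF E_pos[OF True]] b0(2)[OF True] Theta_E[OF True] by simp
 hence "cor (1 / (E - b0)) *\<^sub>C cor (E - b0) *\<^sub>C R (GG E) = cor (1 / (E - b0)) *\<^sub>C (- GG E)" by simp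
 moreover have "cor (1 / (E - b0)) * cor (E - b0) = 1" using b0(2)[OF True] by (simp flip: of_real_diff)
 ultimately have "R (GG E) = - (cor (1 / (E - b0)) *\<^sub>C GG E)" by simp
 also have "... = cor (1 / (b0 + lam)) *\<^sub>C GG E"
 proof -
  have "1 / (b0 + lam) = - (1 / (E - b0))" using True b0(2)[OF True] by (simp add: lam_def divide_simps)
  thus ?thesis by (simp only: of_real_minus L2C.scale_minus_left)
 qed
 finally show ?thesis using True by (simp add: eg_def clinear_mapD[OF R_linear] mult.commute)
qed (simp add: eg_def clinear_mapD[OF R_linear])

text \<open>The counterpart of \<open>mulop_uf\<close>: R acts on \<open>ee a\<close> as
  multiplication by 1 / (m + b0) acts on \<open>uf a\<close>.\<close>

lemma R_ee: assumes "a > b0" shows "cor (a - b0) *\<^sub>C R (ee a) = ee b0 - ee a"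
proof -
 have a: "a > 0" "a \<noteq> b0" using assms b0(1) by auto
 have nz: "\<alpha> - Theta s a \<noteq> 0" by (rule ge_b0(6)) (use assms in simp)
 have "cor (a - b0) *\<^sub>C R (ee a) = cor (rr a) *\<^sub>C (cor (a - b0) *\<^sub>C R (GG a))"
  by (simp add: ee_def clinear_mapD[OF R_linear] mult.commute)
 also have "... = cor (rr a * ((\<alpha> - Theta s a) * rr b0)) *\<^sub>C GG b0 - ee a"
  unfolding R_G[OF a] by (simp add: L2C.scale_right_diff_distrib ee_def)
 also have "rr a * ((\<alpha> - Theta s a) * rr b0) = rr b0" using nz by (simp add: rr_def)
 finally show ?thesis by (simp add: ee_def)
qed

lemma R_vv: assumes "a > b0" shows "cor (a - b0) *\<^sub>C R (vv a) = vv b0 - vv a"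
proof -
 let ?k = "cor (1 / (b0 + lam))"
 have "cinner eg (ee b0) - cinner eg (ee a) = cinner eg (cor (a - b0) *\<^sub>C R (ee a))" unfolding R_ee[OF assms] cinner_diff ..
 also have "... = cor (a - b0) * (?k * cinner eg (ee a))"
  unfolding cinner_scaleC_right R_sym[symmetric] R_eg by (simp add: cinner_scaleC_left)
 finally have p: "cor (a - b0) * (cinner eg (ee a) * ?k) = cinner eg (ee b0) - cinner eg (ee a)" by (simp only: mult.commute[of ?k])
 have "cor (a - b0) *\<^sub>C R (vv a) = cor (sqrt (2 * pi)) *\<^sub>C (cor (a - b0) *\<^sub>C R (ee a) - (cor (a - b0) * (cinner eg (ee a) * ?k)) *\<^sub>C eg)"
  unfolding vv_def clinear_mapD[OF R_linear] R_eg by (simp add: L2C.scale_right_diff_distrib mult_ac)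
 also have "... = vv b0 - vv a" unfolding R_ee[OF assms] p vv_def
  by (simp add: L2C.scale_right_diff_distrib L2C.scale_left_diff_distrib algebra_simps)
 finally show ?thesis .
qed

lemma mulop_uf: assumes "a > b0" shows "cor (a - b0) *\<^sub>C mulop (ih b0) (to_L2 (uf a)) = to_L2 (uf b0) - to_L2 (uf a)"
proof -
 have sq: "square_integrable (uf a)" "square_integrable (uf b0)" using uf_sq assms by simp_all
 have "cor (a - b0) * (ih b0 p * uf a p) = uf b0 p - uf a p" for p
 proof -
  have "(a - b0) * (1 / (m p + b0) * (wt \<alpha> p / (m p + a))) = wt \<alpha> p / (m p + b0) - wt \<alpha> p / (m p + a)"
   using m_pos[OF b0(1), of p] m_pos[of a p] assms b0(1) by (simp add: divide_simps) (simp add: algebra_simps)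
  thus ?thesis unfolding ih_def uf_def by (simp only: of_real_mult[symmetric] of_real_diff[symmetric])
 qed
 hence "to_L2 (\<lambda>p. cor (a - b0) * (ih b0 p * uf a p)) = to_L2 (uf b0) - to_L2 (uf a)"
  by (simp only: to_L2_diff[OF sq(2,1)])
 thus ?thesis unfolding mulop_to_L2[OF ih_bb[OF b0(1)] sq(1)] by (simp only: to_L2_scale[OF square_integrable_mult[OF ih_bb[OF b0(1)] sq(1)]])
qed

lemma eg_vv: "cinner eg (vv a) = 0"
 unfolding vv_def cinner_scaleC_right cinner_diff using eg_norm by (cases bound) (simp_all add: eg_def)

text \<open>The intertwining relation and orthogonality to \<open>eg\<close> are checked on
  generators. For the range, a vector orthogonal to all values of Y, freed from its
  \<open>eg\<close> component, is orthogonal to all G with large parameter and has an even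
  transform, so \<open>even_total\<close> makes it 0.\<close>

lemma model_exists:
 obtains Y where "clinear_map Y" "\<And>x y. cinner (Y x) (Y y) = cinner x y" "\<And>x. x \<in> range Y \<longleftrightarrow> cinner eg x = 0"
  "\<And>f. R (Y f) = Y (mulop (ih b0) f)"
proof -
 have total0: "y = 0" if h: "\<And>u v. (u, v) \<in> gens \<Longrightarrow> cinner u y = 0" for y
 proof (rule gens_total)
  show "cinner (to_L2 (uf a)) y = 0" if "a > b0" for a by (rule h[of _ "vv a"]) (use that in \<open>auto simp: gens_def\<close>)
  show "cinner x y = 0" if "refl_L2 x = - x" for x by (rule h[of _ "ifourier x"]) (use that in \<open>auto simp: gens_def\<close>)
 qed
 obtain Y where Y: "clinear_map Y" "\<And>x y. cinner (Y x) (Y y) = cinner x y" "\<And>u v. (u, v) \<in> gens \<Longrightarrow> Y u = v"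
  by (rule gram_extension[OF gram_gens total0]) auto
 have Yu: "Y (to_L2 (uf a)) = vv a" if "a \<ge> b0" for a using that by (intro Y(3)) (auto simp: gens_def)
 have Yo: "Y x = ifourier x" if "refl_L2 x = - x" for x using that by (intro Y(3)) (auto simp: gens_def)
 let ?T = "{to_L2 (uf a) | a. a > b0} \<union> {x. refl_L2 x = - x}"
 have total: "y = 0" if "\<And>x. x \<in> ?T \<Longrightarrow> cinner x y = 0" for y by (rule gens_total) (use that in auto)
 note Mlin = mulop_linear[OF ih_bb[OF b0(1)]]
 have eY: "cinner eg (Y f) = 0" for f
 proof -
  have "f \<in> {f. cinner eg (Y f) = 0}"
  proof (rule closed_subspace_dense_UNIV[OF _ _ _ total])
   show "L2C.subspace {f. cinner eg (Y f) = 0}" by (rule L2C.subspaceI) (simp_all add: clinear_mapD[OF Y(1)] cinner_add_right cinner_scaleC_right)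
   show "?T \<subseteq> {f. cinner eg (Y f) = 0}" using Yu Yo eg_vv cinner_even_ifourier[OF refl_eg] by (auto simp: less_imp_le)
   fix X x assume "\<And>n. X n \<in> {f. cinner eg (Y f) = 0}" and X: "X \<longlonglongrightarrow> x"
   hence "(\<lambda>n. cinner eg (Y (X n))) = (\<lambda>n. 0)" by simp
   moreover have "(\<lambda>n. cinner eg (Y (X n))) \<longlonglongrightarrow> cinner eg (Y x)" by (intro tendsto_cinner tendsto_const isometry_continuous[OF Y(1,2) X])
   ultimately show "x \<in> {f. cinner eg (Y f) = 0}" by (simp add: LIMSEQ_const_iff)
  qed
  thus ?thesis by simp
 qed
 have RY: "R (Y f) = Y (mulop (ih b0) f)" for f
 proof -
  have "f \<in> {f. R (Y f) = Y (mulop (ih b0) f)}"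
  proof (rule closed_subspace_dense_UNIV[OF _ _ _ total])
   show "L2C.subspace {f. R (Y f) = Y (mulop (ih b0) f)}" by (rule L2C.subspaceI) (simp_all add: clinear_mapD[OF Y(1)] clinear_mapD[OF R_linear] clinear_mapD[OF Mlin])
   show "?T \<subseteq> {f. R (Y f) = Y (mulop (ih b0) f)}"
   proof (intro Un_least subsetI)
    fix x assume "x \<in> {to_L2 (uf a) | a. a > b0}"
    then obtain a where a: "x = to_L2 (uf a)" "a > b0" by blast
    have "cor (a - b0) *\<^sub>C R (Y x) = cor (a - b0) *\<^sub>C Y (mulop (ih b0) x)"
     unfolding clinear_mapD(2)[OF Y(1), symmetric] a(1) mulop_uf[OF a(2)] clinear_mapD(5)[OF Y(1)] Yu[OF less_imp_le[OF a(2)]] Yu[OF order_refl] by (rule R_vv[OF a(2)])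
    thus "x \<in> {f. R (Y f) = Y (mulop (ih b0) f)}" using a(2) unfolding L2C.scale_cancel_left by simp
   next
    fix x assume "x \<in> {x. refl_L2 x = - x}"
    hence x: "refl_L2 x = - x" by simp
    have "refl_L2 (mulop (ih b0) x) = - mulop (ih b0) x"
    proof -
     have "AE p in lborel. rep_L2 (refl_L2 (mulop (ih b0) x)) p = rep_L2 (mulop (ih b0) (refl_L2 x)) p"
      using rep_refl[of "mulop (ih b0) x"] AE_lborel_uminus[OF rep_mulop[OF ih_bb[OF b0(1)], of x]] rep_mulop[OF ih_bb[OF b0(1)], of "refl_L2 x"] rep_refl[of x]
      by eventually_elim (simp add: ih_def m_def)
     hence "refl_L2 (mulop (ih b0) x) = mulop (ih b0) (refl_L2 x)" by (simp only: L2_eq_iff)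
     thus ?thesis unfolding x clinear_mapD(4)[OF Mlin] .
    qed
    hence "Y (mulop (ih b0) x) = ifourier (mulop (ih b0) x)" by (rule Yo)
    moreover have "R (ifourier x) = ifourier (mulop (ih b0) x)"
     using cinner_even_ifourier[OF refl_G[OF b0(1)] x] by (simp add: R_def R0_def fmul_def)
    ultimately show "x \<in> {f. R (Y f) = Y (mulop (ih b0) f)}" by (simp add: Yo[OF x])
   qed
   fix X x assume X: "\<And>n. X n \<in> {f. R (Y f) = Y (mulop (ih b0) f)}" "X \<longlonglongrightarrow> x"
   have "(\<lambda>n. R (Y (X n))) \<longlonglongrightarrow> R (Y x)" by (intro R_continuous isometry_continuous[OF Y(1,2) X(2)])
   moreover have "(\<lambda>n. Y (mulop (ih b0) (X n))) \<longlonglongrightarrow> Y (mulop (ih b0) x)"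
    by (intro isometry_continuous[OF Y(1,2)] clinear_map_bounded_continuous[OF Mlin mulop_norm[OF ih_measurable ih_bound[OF b0(1)]] X(2)])
   ultimately have "R (Y x) = Y (mulop (ih b0) x)" using X(1) by (simp add: LIMSEQ_unique)
   thus "x \<in> {f. R (Y f) = Y (mulop (ih b0) f)}" by simp
  qed
  thus ?thesis by simp
 qed
 have "x \<in> range Y \<longleftrightarrow> cinner eg x = 0" for x
 proof
  assume x: "cinner eg x = 0"
  show "x \<in> range Y"
  proof (rule isometry_range[OF Y(1,2)])
   fix z assume z: "\<And>f. cinner (Y f) z = 0"
   let ?z = "z - cinner eg z *\<^sub>C eg"
   have z0: "cinner (vv a) ?z = 0" if "a \<ge> b0" for a
    using z[of "to_L2 (uf a)"] eg_vv[of a] cinner_sym_zero[of eg "vv a"] unfolding Yu[OF that] by (simp add: cinner_diff cinner_scaleC_right)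
   have ez: "cinner eg ?z = 0" using eg_norm by (cases bound) (simp_all add: cinner_diff cinner_scaleC_right eg_def)
   have gz: "cinner (GG a) ?z = 0" if "a \<ge> b0" for a
   proof -
    have "cinner (vv a) ?z = cor (sqrt (2 * pi) * rr a) * cinner (GG a) ?z"
     unfolding vv_def cinner_scaleC_left cinner_diff(1) ez by (simp add: ee_def cinner_scaleC_left)
    thus ?thesis using z0[OF that] ge_b0(6)[OF that] by (simp add: rr_def)
   qed
   have "fourier ?z = 0"
   proof (rule even_total[of _ "\<lambda>p. 1"])
    show "refl_L2 (fourier ?z) = fourier ?z"
    proof (rule odd_part_zero)
     fix w assume w: "refl_L2 w = - w"
     have "cinner (ifourier w) ?z = 0"
      using z[of w] cinner_even_ifourier[OF refl_eg w] cinner_sym_zero[of eg "ifourier w"] unfolding Yo[OF w] by (simp add: cinner_diff cinner_scaleC_right)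
     thus "cinner w (fourier ?z) = 0" by (simp only: cinner_ifourier)
    qed
    show "square_integrable (\<lambda>p. cor (1 / (m p + a)))" if "a \<ge> b0" for a using ih_sq[OF ge_b0(1)[OF that]] by (simp add: ih_def[abs_def])
    show "cinner (to_L2 (\<lambda>p. cor (1 / (m p + a)))) (fourier ?z) = 0" if "a > b0" for a
     using gz[of a] that fourier_cinner[of "GG a" ?z] unfolding fourier_G by (simp add: cinner_scaleC_left ih_def[abs_def])
   qed simp_all
   hence "?z = 0" using inj_fourier clinear_mapD(3)[OF fourier_linear] by (metis injD)
   hence "z = cinner eg z *\<^sub>C eg" by simp
   hence "cinner z x = cinner (cinner eg z *\<^sub>C eg) x" by (rule arg_cong)
   thus "cinner z x = 0" using x by (simp add: cinner_scaleC_left)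
  qed
 qed (use eY in auto)
 thus ?thesis using that[of Y] Y(1,2) RY by blast
qed

end

section \<open>From the resolvent back to the operator\<close>

context point_perturbation
begin

lemma mulop_resolvent:
 "mulop (ih b0) (g + cor b0 *\<^sub>C f) = f \<longleftrightarrow> (AE p in lborel. rep_L2 g p = cor (\<bar>p\<bar> powr s) * rep_L2 f p)"
proof -
 have "AE p in lborel. rep_L2 (mulop (ih b0) (g + cor b0 *\<^sub>C f)) p = ih b0 p * (rep_L2 g p + cor b0 * rep_L2 f p)"
  using rep_mulop[OF ih_bb[OF b0(1)], of "g + cor b0 *\<^sub>C f"] rep_add[of g "cor b0 *\<^sub>C f"] rep_scaleC[of "cor b0" f]
  by eventually_elim simp
 moreover have "ih b0 p * (Z + cor b0 * X) = X \<longleftrightarrow> Z = cor (\<bar>p\<bar> powr s) * X" for p X Z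
  using ih_nz[OF b0(1), of p] by (auto simp: ih_def m_def field_simps)
 ultimately show ?thesis
  unfolding L2_eq_iff by - (rule eventually_subst, erule eventually_mono, simp only:)
qed

text \<open>Membership of (x, v) means x = R (v + b0 x). In the coordinates of Y and
  \<open>eg\<close> this splits into the equation f = (g + b0 f) / (m + b0) and its analogue with
  \<open>lam\<close> in place of m.\<close>

lemma model_form:
 assumes Y: "clinear_map Y" "\<And>x y. cinner (Y x) (Y y) = cinner x y" "\<And>x. x \<in> range Y \<longleftrightarrow> cinner eg x = 0"
  and RY: "\<And>f. R (Y f) = Y (mulop (ih b0) f)"
 shows "kk (ereal \<alpha>) = {(Y f + c *\<^sub>C eg, Y g + (cor lam * c) *\<^sub>C eg) | f g (c::complex).
   AE p in lborel. rep_L2 g p = cor (\<bar>p\<bar> powr s) * rep_L2 f p}" (is "_ = ?M")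
proof -
 have bl: "cor b0 + cor lam \<noteq> 0" using ge_b0(5)[OF order_refl] by (simp flip: of_real_add)
 have Rform: "R ((Y g + d *\<^sub>C eg) + cor b0 *\<^sub>C (Y f + c *\<^sub>C eg))
  = Y (mulop (ih b0) (g + cor b0 *\<^sub>C f)) + ((d + cor b0 * c) / cor (b0 + lam)) *\<^sub>C eg" for f g c d
 proof -
  have "(Y g + d *\<^sub>C eg) + cor b0 *\<^sub>C (Y f + c *\<^sub>C eg) = Y (g + cor b0 *\<^sub>C f) + (d + cor b0 * c) *\<^sub>C eg"
   by (simp add: clinear_mapD[OF Y(1)] L2C.scale_right_distrib L2C.scale_left_distrib)
  thus ?thesis by (simp add: clinear_mapD[OF R_linear] RY R_eg)
 qed
 have "(x, v) \<in> kk (ereal \<alpha>) \<longleftrightarrow> (x, v) \<in> ?M" for x v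
 proof
  assume "(x, v) \<in> ?M"
  then obtain f g and c :: complex where fg: "x = Y f + c *\<^sub>C eg" "v = Y g + (cor lam * c) *\<^sub>C eg"
   "AE p in lborel. rep_L2 g p = cor (\<bar>p\<bar> powr s) * rep_L2 f p" by blast
  have "(cor lam * c + cor b0 * c) / cor (b0 + lam) = c" using bl by (simp add: field_simps)
  thus "(x, v) \<in> kk (ereal \<alpha>)" unfolding kk_R fg(1,2) Rform using iffD2[OF mulop_resolvent fg(3)] by simp
 next
  assume k: "(x, v) \<in> kk (ereal \<alpha>)"
  have dec: "\<exists>f. x = Y f + cinner eg x *\<^sub>C eg" for x
  proof -
   have "cinner eg (x - cinner eg x *\<^sub>C eg) = 0" using eg_norm by (cases bound) (simp_all add: cinner_diff cinner_scaleC_right eg_def)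
   hence "x - cinner eg x *\<^sub>C eg \<in> range Y" by (simp add: Y(3))
   thus ?thesis by (metis diff_add_cancel imageE)
  qed
  obtain f where f: "x = Y f + cinner eg x *\<^sub>C eg" using dec by blast
  obtain g where g: "v = Y g + cinner eg v *\<^sub>C eg" using dec by blast
  let ?c = "cinner eg x" and ?d = "cinner eg v" and ?F = "mulop (ih b0) (g + cor b0 *\<^sub>C f)"
  let ?q = "(?d + cor b0 * ?c) / cor (b0 + lam)"
  have eq: "Y f + ?c *\<^sub>C eg = Y ?F + ?q *\<^sub>C eg"
   using k[unfolded kk_R] Rform[of g ?d f ?c] unfolding f[symmetric] g[symmetric] by simp
  have eY: "cinner eg (Y h) = 0" for h using Y(3)[of "Y h"] by simp
  have "?c * cinner eg eg = ?q * cinner eg eg" using arg_cong[OF eq, of "cinner eg"] by (simp add: cinner_add_right cinner_scaleC_right eY)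
  hence ce: "?c *\<^sub>C eg = ?q *\<^sub>C eg" using eg_norm by (cases bound) (simp_all add: eg_def)
  have "Y f = Y ?F" using eq unfolding ce by (simp only: add_right_cancel)
  hence "Y (f - ?F) = 0" by (simp only: clinear_mapD(5)[OF Y(1)] diff_self)
  hence "cinner (f - ?F) (f - ?F) = 0" using Y(2)[of "f - ?F" "f - ?F"] by simp
  hence F: "?F = f" using cinner_self(3)[of "f - ?F"] by simp
  have "cor (b0 + lam) *\<^sub>C (?c *\<^sub>C eg) = cor (b0 + lam) *\<^sub>C (?q *\<^sub>C eg)" by (rule arg_cong[OF ce])
  moreover have "cor (b0 + lam) * ?q = ?d + cor b0 * ?c" using bl by simp
  ultimately have "(cor (b0 + lam) * ?c) *\<^sub>C eg = (?d + cor b0 * ?c) *\<^sub>C eg" by (simp only: L2C.scale_scale)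
  hence "?d *\<^sub>C eg = (cor lam * ?c) *\<^sub>C eg"
   by (auto simp add: L2C.scale_left_distrib distrib_right)
  hence "v = Y g + (cor lam * ?c) *\<^sub>C eg" using g by metis
  thus "(x, v) \<in> ?M" using f F[unfolded mulop_resolvent] by blast
 qed
 thus ?thesis by (intro equalityI subrelI) (simp_all only:)
qed

lemma spectral_properties:
 shows "semibounded_below (kk (ereal \<alpha>))" "essential_spectrum (kk (ereal \<alpha>)) = cor ` {0..}"
  "ac_spectrum (kk (ereal \<alpha>)) = cor ` {0..}" "sc_spectrum (kk (ereal \<alpha>)) = {}"
  "discrete_spectrum (kk (ereal \<alpha>)) = (if bound then {cor (- E)} else {})"
  "bound \<Longrightarrow> L2C.dim (eigenspace (kk (ereal \<alpha>)) (cor (- E))) = 1"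
  "bound \<Longrightarrow> GG E \<in> eigenspace (kk (ereal \<alpha>)) (cor (- E))"
proof -
 obtain Y where Y: "clinear_map Y" "\<And>x y. cinner (Y x) (Y y) = cinner x y" "\<And>x. x \<in> range Y \<longleftrightarrow> cinner eg x = 0"
  "\<And>f. R (Y f) = Y (mulop (ih b0) f)" by (rule model_exists) auto
 have e0: "eg = 0 \<longleftrightarrow> \<not> bound" using eg_norm cinner_self(3)[of eg] by (auto split: if_splits)
 have "norm eg = 1" if bound using eg_norm that norm_ge_zero[of eg] by (simp add: cinner_norm power2_eq_1_iff flip: of_real_power)
 then interpret M: multiplication_model s lam "kk (ereal \<alpha>)" Y eg
  using s_bounds lam_neg Y(1,2,3) e0 model_form[OF Y] kk_self_adjoint[of "ereal \<alpha>"]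
  by unfold_locales auto
 show "semibounded_below (kk (ereal \<alpha>))" by (rule M.semibounded)
 show "essential_spectrum (kk (ereal \<alpha>)) = cor ` {0..}" by (rule M.essential_spectrum_A)
 show "ac_spectrum (kk (ereal \<alpha>)) = cor ` {0..}" by (rule M.ac_spectrum_A)
 show "sc_spectrum (kk (ereal \<alpha>)) = {}" by (rule M.sc_spectrum_A)
 show "discrete_spectrum (kk (ereal \<alpha>)) = (if bound then {cor (- E)} else {})"
  unfolding M.discrete_spectrum_A e0 by (simp add: lam_def)
 assume b: bound
 hence l: "lam = - E" by (simp add: lam_def)
 show "L2C.dim (eigenspace (kk (ereal \<alpha>)) (cor (- E))) = 1" using M.dim_eigenspace b e0 unfolding l by blast
 have "GG E = cor (norm (GG E)) *\<^sub>C eg" using b G_nz[OF E_pos[OF b]] by (simp add: eg_def flip: of_real_mult)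
 hence "GG E \<in> L2C.span {eg}" unfolding L2C.span_singleton by blast
 thus "GG E \<in> eigenspace (kk (ereal \<alpha>)) (cor (- E))" using M.eigenspace_lam unfolding l by simp
qed

end

theorem theorem5p3:
  fixes s :: real
  assumes "s \<in> {1/2<..<1} \<union> {1<..<3/2}"
  shows "\<exists>k :: ereal \<Rightarrow> L2_op.
    \<comment> \<open>(i)\<close>
    {A. self_adjoint_extension (k_ring s) A} = k ` {-\<infinity><..} \<and>
    (\<forall>\<alpha>>-\<infinity>. \<forall>l>0.
       Domain (k \<alpha>) = {F + c *\<^sub>C G s l | F c. (F, c) \<in> boundary_pairs s \<alpha> l} \<and>
       (\<forall>(F, c)\<in>boundary_pairs s \<alpha> l.
          app (op_shift (k \<alpha>) l) (F + c *\<^sub>C G s l) = app (op_shift (frac_laplacian (s / 2)) l) F)) \<and>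
    (s < 1 \<longrightarrow> friedrichs_extension (k_ring s) = k \<infinity>) \<and>
    (s > 1 \<longrightarrow> friedrichs_extension (k_ring s) = k 0) \<and>
    k \<infinity> = frac_laplacian (s / 2) \<and>
    \<comment> \<open>(ii)\<close>
    (\<forall>a::real. (s > 1 \<longrightarrow> a \<noteq> 0) \<longrightarrow> (\<forall>l>0.
       direct_sum (form_domain (k (ereal a)))
         (if s < 1 then sobolev (s / 2) else sobolev0 (s / 2)) (L2C.span {G s l}) \<and>
       (\<forall>F\<in>form_domain (friedrichs_extension (k_ring s)). \<forall>\<kappa>::complex.
          form_value (k (ereal a)) (F + \<kappa> *\<^sub>C G s l) =
            (norm (app (abs_nabla (s / 2)) F))\<^sup>2 - l * (norm (F + \<kappa> *\<^sub>C G s l))\<^sup>2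
            + l * (norm F)\<^sup>2 + form_coeff s a l * (cmod \<kappa>)\<^sup>2))) \<and>
    \<comment> \<open>(iii)\<close>
    (\<forall>a::real. \<forall>l>0. a \<noteq> Theta s l \<longrightarrow>
       complex_of_real (- l) \<in> resolvent_set (k (ereal a)) \<and>
       converse (op_shift (k (ereal a)) l) =
         op_add (converse (op_shift (frac_laplacian (s / 2)) l))
           (op_scale (complex_of_real (inverse (a - Theta s l))) (ket_bra (G s l)))) \<and>
    \<comment> \<open>(iv)\<close>
    (\<forall>a::real.
       semibounded_below (k (ereal a)) \<and>
       essential_spectrum (k (ereal a)) = complex_of_real ` {0..} \<and>
       ac_spectrum (k (ereal a)) = complex_of_real ` {0..} \<and>
       sc_spectrum (k (ereal a)) = {} \<and>
       ((s - 1) * a \<le> 0 \<longrightarrow> discrete_spectrum (k (ereal a)) = {}) \<and>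
       ((s - 1) * a > 0 \<longrightarrow>
          discrete_spectrum (k (ereal a)) = {complex_of_real (- eigenvalue_E s a)} \<and>
          L2C.dim (eigenspace (k (ereal a)) (complex_of_real (- eigenvalue_E s a))) = 1 \<and>
          G s \<bar>eigenvalue_E s a\<bar> \<noteq> 0 \<and>
          G s \<bar>eigenvalue_E s a\<bar> \<in> eigenspace (k (ereal a)) (complex_of_real (- eigenvalue_E s a))))"
proof -
 interpret fractional_order s by unfold_locales (rule assms)
 have spec: "semibounded_below (kk (ereal a)) \<and>
    essential_spectrum (kk (ereal a)) = cor ` {0..} \<and>
    ac_spectrum (kk (ereal a)) = cor ` {0..} \<and>
    sc_spectrum (kk (ereal a)) = {} \<and>
    ((s - 1) * a \<le> 0 \<longrightarrow> discrete_spectrum (kk (ereal a)) = {}) \<and>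
    ((s - 1) * a > 0 \<longrightarrow>
     discrete_spectrum (kk (ereal a)) = {cor (- eigenvalue_E s a)} \<and>
     L2C.dim (eigenspace (kk (ereal a)) (cor (- eigenvalue_E s a))) = 1 \<and>
     G s \<bar>eigenvalue_E s a\<bar> \<noteq> 0 \<and>
     G s \<bar>eigenvalue_E s a\<bar> \<in> eigenspace (kk (ereal a)) (cor (- eigenvalue_E s a)))" for a
 proof -
  interpret P: point_perturbation s a ..
  have E: "P.E = eigenvalue_E s a" by (rule P.E_def)
  have b: "P.bound \<longleftrightarrow> (s - 1) * a > 0" by (rule P.bound_def)
  note S = P.spectral_properties[unfolded E]
  have pos: "\<bar>eigenvalue_E s a\<bar> = eigenvalue_E s a" "eigenvalue_E s a > 0" if "(s - 1) * a > 0" using P.E_pos that unfolding b E by auto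
  show ?thesis using S b pos G_nz[of "eigenvalue_E s a"] by auto
 qed
 have fr: "friedrichs_extension (k_ring s) = kF" by (rule friedrichs)
 show ?thesis
  apply (rule exI[of _ kk])
  apply (intro conjI)
  subgoal by (rule self_adjoint_extensions)
  subgoal using kk_domain_action by blast
  subgoal using fr by (simp add: kF_def)
  subgoal using fr by (simp add: kF_def)
  subgoal by (rule kk_infinity)
  subgoal using form_kk unfolding VV_sobolev[symmetric] fr form_domain_kF by blast
  subgoal using resolvent_formula by blast
  subgoal using spec by blast
  done
qed

end
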